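(* There exists an $\epsilon_0>0$ sufficiently small such that, for $0<\epsilon\le\epsilon_0$ and for any $\mathcal{O}(1)$ value of $c\in(0,2)$, the system $$u_\zeta=v,\qquad v_\zeta=cv-\mu u+u^3,\qquad \mu_\zeta=\epsilon(1-\mu^2)$$ has a heteroclinic orbit $\Gamma_\epsilon$ which lies in the transverse intersection of the unstable manifold $W^{\mathrm u}(0,0,-1)$ of the equilibrium $(u,v,\mu)=(0,0,-1)$ and the stable manifold $W^{\mathrm s}(1,0,1)$ of the equilibrium $(u,v,\mu)=(1,0,1)$. Furthermore, $\Gamma_\epsilon$ is monotone increasing in $u$, and there exists a small $\tilde\delta>0$, independent of $\epsilon$, such that $\Gamma_\epsilon$ is close to $(u,v)=(0,0)$ for $\mu\in[-1,\tfrac{c^2}{4}-\tilde\delta)$ and $\Gamma_\epsilon$ is close to $(u,v)=(\sqrt{\mu},0)$ for $\mu\in(\tfrac{c^2}{4}+\tilde\delta,1]$. The front location $\mu_{\mathrm{fr}}$ is given by $$\mu_{\mathrm{fr}}=\frac{c^2}{4}+\Omega_0\Bigl(1-\frac{c^4}{16}\Bigr)^{2/3}\epsilon^{2/3}+\mathcal O(\epsilon\ln(\epsilon)).$$ Here $\Omega_0$ is the smallest positive zero of the combination $J_{-1/3}(2z^{3/2}/3)+J_{1/3}(2z^{3/2}/3)$ of Bessel functions of the first kind.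
   Context: The system is the traveling-wave system, in the reversed co-moving variable $\zeta=-(x-ct)$, for the Allen-Cahn equation $u_t=u_{xx}+\mu(x-ct)u-u^3$ with slowly varying ramp $\mu(\xi)=-\tanh(\epsilon\xi)$, where $c$ is the ramp speed; "$\mathcal{O}(1)$ value of $c$" means of order one with respect to the small parameter $\epsilon$. The manifolds $W^{\mathrm u}(0,0,-1)$ and $W^{\mathrm s}(1,0,1)$ are both two-dimensional in the three-dimensional $(u,v,\mu)$ phase space, and the heteroclinic orbit runs from $(0,0,-1)$ as $\zeta\to-\infty$ to $(1,0,1)$ as $\zeta\to+\infty$. Along it $\mu$ is strictly increasing in $\zeta$ from $-1$ to $1$, so the orbit can be parametrized by $\mu$. With $\mu_c:=c^2/4$, the front location is defined as $$\mu_{\mathrm{fr}}:=\inf\{\mu : u>\sqrt{\mu_c}/2\},$$ with $u$ evaluated along $\Gamma_\epsilon$. The word "close" is used informally, with no rate specified. *)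

theory Defs
  imports "HOL-Analysis.Analysis" "HOL-Library.Landau_Symbols"
begin

definition ramp_field :: "real \<Rightarrow> real \<Rightarrow> real \<times> real \<times> real \<Rightarrow> real \<times> real \<times> real" where
  "ramp_field \<epsilon> c = (\<lambda>(u, v, \<mu>). (v, c * v - \<mu> * u + u ^ 3, \<epsilon> * (1 - \<mu>\<^sup>2)))"

definition heteroclinic ::
  "('a::real_normed_vector \<Rightarrow> 'a) \<Rightarrow> 'a \<Rightarrow> 'a \<Rightarrow> (real \<Rightarrow> 'a) \<Rightarrow> bool" where
  "heteroclinic f p q \<gamma> \<longleftrightarrow>
     f p = 0 \<and> f q = 0 \<and>
     (\<forall>t. (\<gamma> has_vector_derivative f (\<gamma> t)) (at t)) \<and>
     (\<gamma> \<longlongrightarrow> p) at_bot \<and> (\<gamma> \<longlongrightarrow> q) at_top"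

text \<open>The global invariant manifolds of an equilibrium. Vector fields need not be complete, so
  only the half-orbit that converges to the equilibrium is required to exist.\<close>

definition unstable_manifold :: "('a::real_normed_vector \<Rightarrow> 'a) \<Rightarrow> 'a \<Rightarrow> 'a set" where
  "unstable_manifold f p = {q. \<exists>\<gamma>. \<gamma> 0 = q \<and>
     (\<forall>t\<le>0. (\<gamma> has_vector_derivative f (\<gamma> t)) (at t within {..0})) \<and> (\<gamma> \<longlongrightarrow> p) at_bot}"

definition stable_manifold :: "('a::real_normed_vector \<Rightarrow> 'a) \<Rightarrow> 'a \<Rightarrow> 'a set" where
  "stable_manifold f p = {q. \<exists>\<gamma>. \<gamma> 0 = q \<and>
     (\<forall>t\<ge>0. (\<gamma> has_vector_derivative f (\<gamma> t)) (at t within {0..})) \<and> (\<gamma> \<longlongrightarrow> p) at_top}"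

text \<open>Near \<open>q\<close> the set \<open>S\<close> is an embedded two-dimensional \<open>C\<^sup>1\<close> submanifold (with local
  parametrization \<open>\<phi>\<close>) whose tangent space at \<open>q\<close> is \<open>P\<close>.\<close>

definition surface_with_tangent_plane ::
  "'a::real_normed_vector set \<Rightarrow> 'a \<Rightarrow> 'a set \<Rightarrow> bool" where
  "surface_with_tangent_plane S q P \<longleftrightarrow>
     (\<exists>(U :: (real \<times> real) set) W \<phi> \<psi> (D :: real \<times> real \<Rightarrow> (real \<times> real) \<Rightarrow>\<^sub>L 'a).
        open U \<and> 0 \<in> U \<and> open W \<and> q \<in> W \<and>
        homeomorphism U (S \<inter> W) \<phi> \<psi> \<and> \<phi> 0 = q \<and>
        (\<forall>x\<in>U. (\<phi> has_derivative blinfun_apply (D x)) (at x) \<and> inj (blinfun_apply (D x))) \<and>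
        continuous_on U D \<and>
        P = range (blinfun_apply (D 0)))"

definition transverse_at :: "'a::real_normed_vector set \<Rightarrow> 'a set \<Rightarrow> 'a \<Rightarrow> bool" where
  "transverse_at S T q \<longleftrightarrow>
     (\<exists>P Q. surface_with_tangent_plane S q P \<and> surface_with_tangent_plane T q Q \<and>
        {x + y |x y. x \<in> P \<and> y \<in> Q} = UNIV)"

definition front_location :: "real \<Rightarrow> (real \<times> real \<times> real) set \<Rightarrow> real" where
  "front_location c \<Gamma> = Inf {\<mu>. \<exists>u v. (u, v, \<mu>) \<in> \<Gamma> \<and> u > sqrt (c\<^sup>2 / 4) / 2}"

text \<open>Bessel function of the first kind for real order and positive argument; \<^const>\<open>rGamma\<close> is
  the reciprocal Gamma function.\<close>

definition bessel_J :: "real \<Rightarrow> real \<Rightarrow> real" where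
  "bessel_J \<nu> x =
     (\<Sum>k. (-1) ^ k / fact k * rGamma (real k + \<nu> + 1) * (x / 2) powr (2 * real k + \<nu>))"

definition \<Omega>\<^sub>0 :: real where
  "\<Omega>\<^sub>0 = (LEAST z. z > 0 \<and>
     bessel_J (-1/3) (2 * z powr (3/2) / 3) + bessel_J (1/3) (2 * z powr (3/2) / 3) = 0)"

end

theory Submission
 imports Defs
begin

text \<open>The substitution \<open>u = exp (c \<zeta> / 2) f\<close> turns the linearization at \<open>u = 0\<close> into
 \<open>f'' = (c\<^sup>2/4 - \<mu>) f\<close>, whose solutions change from growing to oscillating when \<open>\<mu>\<close> passes
 \<open>c\<^sup>2/4\<close>. There the ramp is nearly linear, so in the variable
 \<open>(\<epsilon> (1 - c\<^sup>4/16))^(1/3) (\<zeta> - \<zeta>\<^sub>c)\<close> the equation is Airy's equation up to small errors. Sturm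
 comparison with slightly perturbed Airy functions shows that the front is small until, and no
 longer small soon after, the first zero \<open>\<Omega>\<^sub>0\<close> of \<open>Ai (- x)\<close>; on both sides \<open>u\<close> changes
 exponentially fast, so it needs only the time \<open>O (ln \<epsilon>)\<close>, in which \<open>\<mu>\<close> moves by
 \<open>O (\<epsilon> ln \<epsilon>)\<close>, to pass between these sizes.

 The front itself is found by shooting. Each invariant manifold is a monotone one-parameter family
 of solutions, swept along the flow, whose difference quotients in the parameter are Lipschitz;
 hence it is a \<open>C\<^sup>1\<close> surface. The logarithmic slope of its tangent vector transverse to the flow lies above
 \<open>v / u\<close> for the unstable manifold and below \<open>- v / u\<close>, read in reversed time, for the stable one;
 this separation is the transversality.\<close>

text \<open>Orbits with |\<mu>| < 1 have \<mu> = tanh (\<epsilon> \<zeta>) up to a time shift, so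
  they are the solutions of one scalar non-autonomous equation, and reversing time only changes the
  signs of c and \<epsilon>. One analysis therefore serves both manifolds. Two obstacles shape it.
  The cubic lets solutions blow up, so the nonlinearity is cut off beyond |u| = 2 and the orbits in
  use are shown to stay below the cut. And the manifolds are global sets, so besides a smooth piece
  it must be shown that no other sheet of them comes near the front. The separation of logarithmic
  slopes has a single source: in a weighted Wronskian of two solutions everything linear cancels,
  and the cubic leaves a term of fixed sign. Existence, monotonicity and transversality hold for
  every \<epsilon> > 0; smallness enters with the closeness and the front location. There the
  estimates are organised in powers of \<theta> = \<epsilon>^(1/6): shifting the Airy variable by a
  multiple of \<theta>^2 is a tolerable error, because it moves \<mu> by a multiple of \<theta>^6 =
  \<epsilon>.\<close>

section \<open>Global solutions of Lipschitz equations\<close>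

lemma continuous_antiderivative_exists:
 fixes f :: "real \<Rightarrow> 'a::banach"
 assumes "continuous_on UNIV f"
 obtains F where "F t0 = 0" "\<And>t. (F has_vector_derivative f t) (at t)"
proof -
 define F where "F t = (if t0 \<le> t then integral {t0..t} f else - integral {t..t0} f)" for t
 have "(F has_vector_derivative f t) (at t)" for t
 proof -
  define a where "a = min t t0 - 1"
  define b where "b = max t t0 + 1"
  have cont: "continuous_on {a..b} f" using assms continuous_on_subset by blast
  have int: "f integrable_on {x..y}" for x y
   using assms continuous_on_subset integrable_continuous_interval by blast
  have "((\<lambda>x. integral {a..x} f) has_vector_derivative f t) (at t within {a..b})"
   by (rule integral_has_vector_derivative[OF cont]) (auto simp: a_def b_def)
  then have "((\<lambda>x. integral {a..x} f) has_vector_derivative f t) (at t)"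
   using at_within_interior[of t "{a..b}"] unfolding a_def b_def interior_atLeastAtMost_real
   by (metis greaterThanLessThan_iff less_add_one less_le_trans max.cobounded1 min.cobounded1 diff_less_eq le_less_trans)
  then have "((\<lambda>x. integral {a..x} f - integral {a..t0} f) has_vector_derivative f t) (at t)"
   by (auto intro!: derivative_eq_intros)
  then show ?thesis
  proof (rule has_vector_derivative_transform_within_open[where S="{a<..<b}"])
   fix x assume x: "x \<in> {a<..<b}"
   show "integral {a..x} f - integral {a..t0} f = F x"
   proof (cases "t0 \<le> x")
    case True
    then show ?thesis
     using Henstock_Kurzweil_Integration.integral_combine[of a t0 x f] int
     by (simp add: F_def a_def algebra_simps)
   next
    case False
    then show ?thesis
     using Henstock_Kurzweil_Integration.integral_combine[of a x t0 f] int x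
     by (simp add: F_def algebra_simps)
   qed
  qed (auto simp: a_def b_def)
 qed
 moreover have "F t0 = 0" by (simp add: F_def)
 ultimately show ?thesis using that by blast
qed

text \<open>Integrating \<open>K * L * exp (2 * L * r)\<close> gives at most
  \<open>K / 2 * exp (2 * L * r)\<close>: in the norm with this weight a Picard step halves
  distances, on the whole line at once.\<close>

lemma norm_le_exp_of_derivative_bound:
 fixes g :: "real \<Rightarrow> 'a::real_inner"
 assumes "L > 0" and "g t0 = 0"
  and der: "\<And>t. (g has_vector_derivative g' t) (at t)"
  and bnd: "\<And>t. norm (g' t) \<le> K * L * exp (2 * L * \<bar>t - t0\<bar>)"
 shows "norm (g t) \<le> K / 2 * exp (2 * L * \<bar>t - t0\<bar>)"
proof -
 have K: "0 \<le> K" using bnd[of t0] \<open>L > 0\<close> norm_ge_zero[of "g' t0"]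
  by (smt (verit, best) exp_gt_zero mult_pos_pos mult_minus_left zero_less_mult_iff)
 have "norm (g t - g t0) \<le> K / 2 * exp (2 * L * \<bar>t - t0\<bar>) - K / 2"
 proof (cases "t0 \<le> t")
  case True
  have "norm (g t - g t0) \<le> (K / 2 * exp (2 * L * (t - t0))) - (K / 2 * exp (2 * L * (t0 - t0)))"
  proof (cases "t0 = t")
   case False
   show ?thesis
   proof (rule differentiable_bound_general[where f'=g' and \<phi>'="\<lambda>t. K * L * exp (2 * L * (t - t0))"])
    show "t0 < t" using True False by simp
    show "continuous_on {t0..t} g"
     using der by (meson continuous_at_imp_continuous_on has_vector_derivative_continuous)
    show "continuous_on {t0..t} (\<lambda>t. K / 2 * exp (2 * L * (t - t0)))"
     by (intro continuous_intros)
    show "((\<lambda>t. K / 2 * exp (2 * L * (t - t0))) has_vector_derivative K * L * exp (2 * L * (x - t0))) (at x)" for x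
     unfolding has_real_derivative_iff_has_vector_derivative[symmetric]
     by (auto intro!: derivative_eq_intros)
   qed (use der bnd in \<open>auto, metis abs_of_pos diff_gt_0_iff_gt\<close>)
  qed simp
  then show ?thesis using True by simp
 next
  case False
  \<comment> \<open>Times before \<open>t0\<close> are reflected, because the mean value estimate
    runs forward.\<close>
  define G where "G s = g (- s)" for s
  have "norm (G (-t) - G (-t0)) \<le> (K / 2 * exp (2 * L * (- t + t0))) - (K / 2 * exp (2 * L * (- t0 + t0)))"
  proof (rule differentiable_bound_general[where f'="\<lambda>s. - g' (- s)" and \<phi>'="\<lambda>t. K * L * exp (2 * L * (t + t0))"])
   show "- t0 < - t" using False by simp
   have dG: "(G has_vector_derivative - g' (- s)) (at s)" for s
   proof -
    have "(uminus has_vector_derivative - (1::real)) (at s)"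
     using has_vector_derivative_minus[OF has_vector_derivative_id, of "at s"] by simp
    from vector_diff_chain_at[OF this, of g "g' (-s)"] der show ?thesis
     by (simp add: o_def G_def[abs_def])
   qed
   then show "continuous_on {-t0..-t} G"
    by (meson continuous_at_imp_continuous_on has_vector_derivative_continuous)
   show "continuous_on {-t0..-t} (\<lambda>t. K / 2 * exp (2 * L * (t + t0)))"
    by (intro continuous_intros)
   show "((\<lambda>t. K / 2 * exp (2 * L * (t + t0))) has_vector_derivative K * L * exp (2 * L * (x + t0))) (at x)" for x
    unfolding has_real_derivative_iff_has_vector_derivative[symmetric]
    by (auto intro!: derivative_eq_intros)
   show "(G has_vector_derivative - g' (- s)) (at s)" for s by (rule dG)
   show "norm (- g' (- x)) \<le> K * L * exp (2 * L * (x + t0))" if "- t0 < x" for x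
    using bnd[of "-x"] that by (simp add: abs_if algebra_simps)
  qed
  then show ?thesis using False by (simp add: G_def)
 qed
 then show ?thesis using K assms(2) by simp
qed

text \<open>In the norm weighted by \<open>exp (2 * L * |t - t0|)\<close> the Picard iterates
  converge geometrically on the whole line, so the solution is global from the outset. The bound
  \<open>B\<close> along the constant function \<open>x0\<close> controls the first step.\<close>

lemma picard_lindeloef_global:
 fixes F :: "real \<Rightarrow> 'a::euclidean_space \<Rightarrow> 'a"
 assumes cont: "continuous_on UNIV (\<lambda>(t, x). F t x)"
  and lip: "\<And>t x y. norm (F t x - F t y) \<le> L * norm (x - y)" and "L > 0"
  and bdd: "\<And>t. norm (F t x0) \<le> B"
 obtains x where "x t0 = x0" "\<And>t. (x has_vector_derivative F t (x t)) (at t)"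
proof -
 have contF: "continuous_on UNIV (\<lambda>t. F t (y t))" if "continuous_on UNIV y" for y
 proof -
  have "continuous_on UNIV (\<lambda>t. (t, y t))" using that by (intro continuous_intros)
  from continuous_on_compose2[OF cont this] show ?thesis by simp
 qed
 define step where "step y = (SOME z. z t0 = x0 \<and> (\<forall>t. (z has_vector_derivative F t (y t)) (at t)))" for y
 have step: "step y t0 = x0 \<and> (\<forall>t. (step y has_vector_derivative F t (y t)) (at t))"
  if "continuous_on UNIV y" for y
 proof -
  note c = contF[OF that]
  obtain G where "G t0 = 0" "\<And>t. (G has_vector_derivative F t (y t)) (at t)"
   using continuous_antiderivative_exists[OF c] by blast
  then have "\<exists>z. z t0 = x0 \<and> (\<forall>t. (z has_vector_derivative F t (y t)) (at t))"
   by (intro exI[of _ "\<lambda>t. x0 + G t"]) (auto intro!: derivative_eq_intros)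
  from someI_ex[OF this] show ?thesis unfolding step_def .
 qed
 define X where "X n = (step ^^ n) (\<lambda>_. x0)" for n
 have X0: "X 0 = (\<lambda>_. x0)" and XS: "X (Suc n) = step (X n)" for n by (auto simp: X_def)
 have contX: "continuous_on UNIV (X n)" for n
 proof (induction n)
  case (Suc n)
  then show ?case using step[OF Suc] unfolding XS
   by (meson continuous_at_imp_continuous_on has_vector_derivative_continuous)
 qed (simp add: X0)
 have dX: "(X (Suc n) has_vector_derivative F t (X n t)) (at t)" for n t
  using step[OF contX] XS by auto
 have Xt0: "X n t0 = x0" for n using step[OF contX] by (cases n) (auto simp: X0 XS)
 have B0: "B \<ge> 0" using bdd[of 0] norm_ge_zero order_trans by blast
 define K where "K = B / L"
 have diff: "norm (X (Suc n) t - X n t) \<le> K * (1/2) ^ Suc n * exp (2 * L * \<bar>t - t0\<bar>)" for n t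
 proof (induction n arbitrary: t)
  case 0
  have "norm (X (Suc 0) t - x0) \<le> K / 2 * exp (2 * L * \<bar>t - t0\<bar>)"
  proof (rule norm_le_exp_of_derivative_bound[OF \<open>L > 0\<close>])
   show "((\<lambda>t. X (Suc 0) t - x0) has_vector_derivative F t x0) (at t)" for t
    using dX[of 0 t] X0 by (auto intro!: derivative_eq_intros)
   show "norm (F t x0) \<le> K * L * exp (2 * L * \<bar>t - t0\<bar>)" for t
   proof -
    have "norm (F t x0) \<le> B" by (rule bdd)
    also have "B = K * L" using \<open>L > 0\<close> by (simp add: K_def)
    also have "\<dots> \<le> K * L * exp (2 * L * \<bar>t - t0\<bar>)"
     using B0 \<open>L > 0\<close> by (simp add: K_def mult_left_le[of _ "B"] mult_le_cancel_left1)
    finally show ?thesis .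
   qed
  qed (simp add: Xt0)
  then show ?case by (simp add: X0)
 next
  case (Suc n)
  have "norm (X (Suc (Suc n)) t - X (Suc n) t) \<le> (K * (1/2) ^ Suc n) / 2 * exp (2 * L * \<bar>t - t0\<bar>)"
  proof (rule norm_le_exp_of_derivative_bound[OF \<open>L > 0\<close>])
   show "((\<lambda>t. X (Suc (Suc n)) t - X (Suc n) t) has_vector_derivative (F t (X (Suc n) t) - F t (X n t))) (at t)" for t
    using dX[of "Suc n" t] dX[of n t] by (auto intro!: derivative_eq_intros)
   show "norm (F t (X (Suc n) t) - F t (X n t)) \<le> K * (1/2) ^ Suc n * L * exp (2 * L * \<bar>t - t0\<bar>)" for t
   proof -
    have "norm (F t (X (Suc n) t) - F t (X n t)) \<le> L * norm (X (Suc n) t - X n t)" by (rule lip)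
    also have "\<dots> \<le> L * (K * (1/2) ^ Suc n * exp (2 * L * \<bar>t - t0\<bar>))"
     using Suc[of t] \<open>L > 0\<close> by (intro mult_left_mono) auto
    finally show ?thesis by (simp add: mult_ac)
   qed
  qed (simp add: Xt0)
  then show ?case by simp
 qed
 define M where "M R = K * exp (2 * L * R)" for R :: real
 have tail: "norm (X (n + j) t - X n t) \<le> M R * (1/2) ^ n" if "\<bar>t - t0\<bar> \<le> R" for n j t R
 proof -
  have "norm (X (n + j) t - X n t) \<le> M R * ((1/2) ^ n - (1/2) ^ (n + j))"
  proof (induction j)
   case (Suc j)
   have "norm (X (Suc (n + j)) t - X (n + j) t) \<le> M R * (1/2) ^ Suc (n + j)"
   proof -
    have "K * exp (2 * L * \<bar>t - t0\<bar>) \<le> M R" unfolding M_def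
     using that \<open>L > 0\<close> B0 by (intro mult_left_mono) (auto simp: K_def)
    then have "K * exp (2 * L * \<bar>t - t0\<bar>) * (1/2) ^ Suc (n + j) \<le> M R * (1/2) ^ Suc (n + j)"
     by (rule mult_right_mono) simp
    moreover have "norm (X (Suc (n + j)) t - X (n + j) t) \<le> K * exp (2 * L * \<bar>t - t0\<bar>) * (1/2) ^ Suc (n + j)"
     using diff[of "n + j" t] by (simp add: mult_ac)
    ultimately show ?thesis by linarith
   qed
   moreover have "norm (X (n + Suc j) t - X n t) \<le> norm (X (Suc (n + j)) t - X (n + j) t) + norm (X (n + j) t - X n t)"
    by (metis add_Suc_right norm_triangle_ineq diff_add_cancel add_diff_eq)
   ultimately show ?case using Suc by (simp add: algebra_simps)
  qed simp
  also have "\<dots> \<le> M R * (1/2) ^ n"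
   using B0 \<open>L > 0\<close> by (intro mult_left_mono) (auto simp: M_def K_def)
  finally show ?thesis .
 qed
 have M0: "0 \<le> M R" for R using B0 \<open>L > 0\<close> by (simp add: M_def K_def)
 have "Cauchy (\<lambda>n. X n t)" for t
 proof (rule CauchyI)
  fix e :: real assume "e > 0"
  define m where "m = M \<bar>t - t0\<bar>"
  have "(\<lambda>n. m * (1/2) ^ n) \<longlonglongrightarrow> m * 0"
   by (intro tendsto_mult tendsto_const LIMSEQ_power_zero) simp
  then have "eventually (\<lambda>n. m * (1/2) ^ n < e / 2) sequentially"
   using order_tendstoD(2)[of _ "m*0" sequentially "e/2"] \<open>e > 0\<close> by simp
  then obtain N where N: "\<And>n. n \<ge> N \<Longrightarrow> m * (1/2) ^ n < e / 2"
   using eventually_sequentially by auto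
  have *: "norm (X n t - X N t) < e / 2" if "n \<ge> N" for n
   using tail[of t "\<bar>t-t0\<bar>" N "n - N"] N[of N] that by (simp add: m_def)
  show "\<exists>N. \<forall>m\<ge>N. \<forall>n\<ge>N. norm (X m t - X n t) < e"
   using * by (metis dist_norm dist_triangle_half_l)
 qed
 then have "\<exists>l. (\<lambda>n. X n t) \<longlonglongrightarrow> l" for t using Cauchy_convergent_iff convergent_def by blast
 then obtain x where x: "\<And>t. (\<lambda>n. X n t) \<longlonglongrightarrow> x t" by metis
 have xt: "norm (X n t - x t) \<le> M R * (1/2) ^ n" if "\<bar>t - t0\<bar> \<le> R" for n t R
 proof -
  have "(\<lambda>j. norm (X (n + j) t - X n t)) \<longlonglongrightarrow> norm (x t - X n t)"
   using LIMSEQ_ignore_initial_segment[OF x[of t], of n] by (intro tendsto_intros) (simp add: add.commute)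
  then have "norm (x t - X n t) \<le> M R * (1/2) ^ n"
   by (rule Lim_bounded) (use tail[OF that] in auto)
  then show ?thesis by (simp add: norm_minus_commute)
 qed
 have "(x has_vector_derivative F t (x t)) (at t)" for t
 proof -
  define R where "R = \<bar>t - t0\<bar> + 1"
  \<comment> \<open>The derivatives converge uniformly only on bounded sets; a neighbourhood of
    \<open>t\<close> is enough to differentiate the limit.\<close>
  define S where "S = {t - 1<..<t + 1}"
  have "\<exists>g. \<forall>s\<in>S. (\<lambda>n. X (Suc n) s) \<longlonglongrightarrow> g s \<and> (g has_derivative (\<lambda>h. h *\<^sub>R F s (x s))) (at s within S)"
  proof (rule has_derivative_sequence)
   show "convex S" by (simp add: S_def)
   show "t \<in> S" by (simp add: S_def)
   show "(\<lambda>n. X (Suc n) t) \<longlonglongrightarrow> x t" by (rule LIMSEQ_Suc[OF x])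
   show "(X (Suc n) has_derivative (\<lambda>h. h *\<^sub>R F s (X n s))) (at s within S)" for n s
    using dX[of n s] by (simp add: has_vector_derivative_def has_derivative_at_withinI)
   fix e :: real assume "e > 0"
   have "(\<lambda>n. L * (M R * (1/2) ^ n)) \<longlonglongrightarrow> L * (M R * 0)"
    by (intro tendsto_mult tendsto_const LIMSEQ_power_zero) simp
   then have ev: "eventually (\<lambda>n. L * (M R * (1/2) ^ n) < e) sequentially"
    using order_tendstoD(2)[of _ "L * (M R * 0)" sequentially e] \<open>e > 0\<close> by simp
   show "\<forall>\<^sub>F n in sequentially. \<forall>s\<in>S. \<forall>h. norm (h *\<^sub>R F s (X n s) - h *\<^sub>R F s (x s)) \<le> e * norm h"
    using ev
   proof eventually_elim
    case (elim n)
    show ?case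
    proof (intro ballI allI)
     fix s h :: real assume "s \<in> S"
     then have "\<bar>s - t0\<bar> \<le> R" by (auto simp: S_def R_def)
     then have "norm (F s (X n s) - F s (x s)) \<le> L * (M R * (1/2) ^ n)"
      using lip[of s "X n s" "x s"] xt[of s R n] \<open>L > 0\<close>
      by (meson mult_left_mono order_less_imp_le order_trans)
     then have "norm (F s (X n s) - F s (x s)) \<le> e" using elim by simp
     then have "norm h * norm (F s (X n s) - F s (x s)) \<le> norm h * e"
      by (rule mult_left_mono) simp
     then show "norm (h *\<^sub>R F s (X n s) - h *\<^sub>R F s (x s)) \<le> e * norm h"
      by (simp flip: scaleR_diff_right add: mult.commute)
    qed
   qed
  qed
  then obtain g where g: "\<And>s. s \<in> S \<Longrightarrow> (\<lambda>n. X (Suc n) s) \<longlonglongrightarrow> g s"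
   and dg: "\<And>s. s \<in> S \<Longrightarrow> (g has_derivative (\<lambda>h. h *\<^sub>R F s (x s))) (at s within S)" by blast
  have "g s = x s" if "s \<in> S" for s
   using LIMSEQ_unique[OF g[OF that]] LIMSEQ_Suc[OF x[of s]] by simp
  moreover have tS: "t \<in> S" and "open S" by (auto simp: S_def)
  moreover have "(g has_vector_derivative F t (x t)) (at t)"
   using dg[OF tS] at_within_open[OF tS \<open>open S\<close>] by (simp add: has_vector_derivative_def)
  ultimately show ?thesis
   using has_vector_derivative_transform_within_open by blast
 qed
 moreover have "x t0 = x0" using x[of t0] Xt0 by (simp add: LIMSEQ_const_iff)
 ultimately show ?thesis using that by blast
qed

section \<open>The layer equation with truncated nonlinearity\<close>

text \<open>The squared norm N satisfies |N'| \<le> 2 K N, so it changes by at most the factor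
  \<open>exp (2 * K * (b - a))\<close> in either direction of time. Scalar equations are covered by
  setting one component to zero.\<close>

lemma gronwall_two:
 fixes d e d' e' :: "real \<Rightarrow> real"
 assumes "a \<le> b" and cont: "continuous_on {a..b} d" "continuous_on {a..b} e"
  and der: "\<And>t. a < t \<Longrightarrow> t < b \<Longrightarrow> DERIV d t :> d' t"
   "\<And>t. a < t \<Longrightarrow> t < b \<Longrightarrow> DERIV e t :> e' t"
  and bnd: "\<And>t. a < t \<Longrightarrow> t < b \<Longrightarrow> \<bar>d t * d' t + e t * e' t\<bar> \<le> K * ((d t)\<^sup>2 + (e t)\<^sup>2)"
 shows "(d b)\<^sup>2 + (e b)\<^sup>2 \<le> ((d a)\<^sup>2 + (e a)\<^sup>2) * exp (2 * K * (b - a))"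
  and "(d a)\<^sup>2 + (e a)\<^sup>2 \<le> ((d b)\<^sup>2 + (e b)\<^sup>2) * exp (2 * K * (b - a))"
proof -
 define N where "N t = (d t)\<^sup>2 + (e t)\<^sup>2" for t
 have dN: "DERIV N t :> 2 * (d t * d' t + e t * e' t)" if "a < t" "t < b" for t
  unfolding N_def[abs_def] using der[OF that]
  by (auto intro!: derivative_eq_intros simp: algebra_simps)
 have cN: "continuous_on {a..b} N" unfolding N_def[abs_def] by (intro continuous_intros cont)
 have "N b * exp (- 2 * K * (b - a)) \<le> N a * exp (- 2 * K * (a - a))"
 proof (rule DERIV_nonpos_imp_decreasing_open[OF \<open>a \<le> b\<close>])
  fix t assume t: "a < t" "t < b"
  have "((\<lambda>t. N t * exp (- 2 * K * (t - a))) has_real_derivative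
    (2 * (d t * d' t + e t * e' t) - 2 * K * N t) * exp (- 2 * K * (t - a))) (at t)"
   by (rule derivative_eq_intros dN[OF t] refl | simp)+ (simp add: algebra_simps)
  moreover have "2 * (d t * d' t + e t * e' t) - 2 * K * N t \<le> 0"
   using bnd[OF t] unfolding N_def by (simp add: abs_le_iff mult.assoc)
  ultimately show "\<exists>y. DERIV (\<lambda>t. N t * exp (- 2 * K * (t - a))) t :> y \<and> y \<le> 0"
   by (blast intro: mult_nonpos_nonneg exp_ge_zero)
 qed (intro continuous_intros cN)
 then have "N b \<le> N a * exp (2 * K * (b - a))"
 proof -
  assume *: "N b * exp (- 2 * K * (b - a)) \<le> N a * exp (- 2 * K * (a - a))"
  have "N b = N b * exp (- 2 * K * (b - a)) * exp (2 * K * (b - a))"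
   by (simp add: mult.assoc mult_exp_exp)
  also have "\<dots> \<le> N a * exp (2 * K * (b - a))"
   using mult_right_mono[OF *, of "exp (2 * K * (b - a))"] by simp
  finally show ?thesis .
 qed
 then show "(d b)\<^sup>2 + (e b)\<^sup>2 \<le> ((d a)\<^sup>2 + (e a)\<^sup>2) * exp (2 * K * (b - a))"
  by (simp only: N_def)
 have "N a * exp (2 * K * (a - a)) \<le> N b * exp (2 * K * (b - a))"
 proof (rule DERIV_nonneg_imp_increasing_open[OF \<open>a \<le> b\<close>])
  fix t assume t: "a < t" "t < b"
  have "((\<lambda>t. N t * exp (2 * K * (t - a))) has_real_derivative
    (2 * (d t * d' t + e t * e' t) + 2 * K * N t) * exp (2 * K * (t - a))) (at t)"
   by (rule derivative_eq_intros dN[OF t] refl | simp)+ (simp add: algebra_simps)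
  moreover have "2 * (d t * d' t + e t * e' t) + 2 * K * N t \<ge> 0"
   using bnd[OF t] unfolding N_def by (simp add: abs_le_iff mult.assoc)
  ultimately show "\<exists>y. DERIV (\<lambda>t. N t * exp (2 * K * (t - a))) t :> y \<and> y \<ge> 0"
   by (blast intro: mult_nonneg_nonneg exp_ge_zero)
 qed (intro continuous_intros cN)
 then show "(d a)\<^sup>2 + (e a)\<^sup>2 \<le> ((d b)\<^sup>2 + (e b)\<^sup>2) * exp (2 * K * (b - a))"
  by (simp add: N_def)
qed

lemma sum_squares_le_imp_abs_le:
 fixes x y :: real
 assumes "x\<^sup>2 + y\<^sup>2 \<le> M\<^sup>2" "0 \<le> M"
 shows "\<bar>x\<bar> \<le> M" "\<bar>y\<bar> \<le> M"
proof -
 have "x\<^sup>2 \<le> M\<^sup>2" "y\<^sup>2 \<le> M\<^sup>2" using assms(1) zero_le_power2[of x] zero_le_power2[of y] by linarith+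
 then show "\<bar>x\<bar> \<le> M" "\<bar>y\<bar> \<le> M" using assms(2) by (auto simp: power2_le_iff_abs_le)
qed

text \<open>The cut at 2 makes the cubic globally Lipschitz, so that all solutions exist for all
  times. The front lies in 0 < u < 1 and its neighbours in |u| \<le> 2, where the cut changes
  nothing.\<close>

definition cub :: "real \<Rightarrow> real" where
 "cub x = (max (-2) (min 2 x)) ^ 3"

lemma cub_eq: assumes "\<bar>x\<bar> \<le> 2" shows "cub x = x ^ 3"
proof -
 have "max (-2) (min 2 x) = x" using assms by auto
 then show ?thesis by (simp add: cub_def)
qed

lemma cub_minus: "cub (- x) = - cub x"
proof -
 have "max (-2) (min 2 (- x)) = - max (-2) (min 2 x)" by (simp add: max_def min_def)
 then show ?thesis by (simp add: cub_def)
qed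

lemma cub_0 [simp]: "cub 0 = 0" by (simp add: cub_def)

lemma cube_diff: "(x::real) ^ 3 - y ^ 3 = (x - y) * (x\<^sup>2 + x * y + y\<^sup>2)"
 by (simp add: power2_eq_square power3_eq_cube algebra_simps)

lemma abs_square_sum_le:
 assumes "\<bar>x\<bar> \<le> (M::real)" "\<bar>y\<bar> \<le> M"
 shows "\<bar>x\<^sup>2 + x * y + y\<^sup>2\<bar> \<le> 3 * M\<^sup>2"
proof -
 have "x\<^sup>2 \<le> M\<^sup>2" "y\<^sup>2 \<le> M\<^sup>2"
  using power_mono[OF assms(1), of 2] power_mono[OF assms(2), of 2] by auto
 moreover have "\<bar>x * y\<bar> \<le> M\<^sup>2"
  using mult_mono'[OF assms] by (simp add: abs_mult power2_eq_square)
 moreover have "0 \<le> x\<^sup>2" "0 \<le> y\<^sup>2" by auto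
 ultimately show ?thesis by linarith
qed

lemma cub_lipschitz: "\<bar>cub x - cub y\<bar> \<le> 12 * \<bar>x - y\<bar>"
proof -
 define a b where "a = max (-2) (min 2 x)" and "b = max (-2) (min 2 y)"
 have "\<bar>a\<bar> \<le> 2" "\<bar>b\<bar> \<le> 2" "\<bar>a - b\<bar> \<le> \<bar>x - y\<bar>" by (auto simp: a_def b_def max_def min_def)
 have "\<bar>cub x - cub y\<bar> = \<bar>a - b\<bar> * \<bar>a\<^sup>2 + a * b + b\<^sup>2\<bar>"
  unfolding cub_def a_def[symmetric] b_def[symmetric] cube_diff abs_mult ..
 also have "\<dots> \<le> \<bar>x - y\<bar> * (3 * 2\<^sup>2)"
  using \<open>\<bar>a - b\<bar> \<le> \<bar>x - y\<bar>\<close> abs_square_sum_le[OF \<open>\<bar>a\<bar> \<le> 2\<close> \<open>\<bar>b\<bar> \<le> 2\<close>] by (intro mult_mono) auto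
 finally show ?thesis by simp
qed

lemma continuous_cub: "continuous_on S cub"
 unfolding cub_def[abs_def] by (intro continuous_intros)

text \<open>The front equation has \<open>k = c\<close> and the increasing ramp; in reversed time it
  has \<open>k = - c\<close> and the reversed ramp. Only continuity and |m| \<le> 1 are assumed, so
  that both are instances.\<close>

locale ramp_eq =
 fixes k :: real and m :: "real \<Rightarrow> real"
 assumes k_le: "\<bar>k\<bar> \<le> 2" and m_cont: "continuous_on UNIV m" and m_le: "\<And>t. \<bar>m t\<bar> \<le> 1"
begin

definition tsol :: "(real \<Rightarrow> real) \<Rightarrow> (real \<Rightarrow> real) \<Rightarrow> bool" where
 "tsol u v \<longleftrightarrow> (\<forall>t. DERIV u t :> v t \<and>
   DERIV v t :> k * v t + cub (u t) - m t * u t)"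

lemma tsolD: "tsol u v \<Longrightarrow> DERIV u t :> v t"
  "tsol u v \<Longrightarrow> DERIV v t :> k * v t + cub (u t) - m t * u t"
 by (auto simp: tsol_def)

lemma tsol_cont: assumes "tsol u v" shows "continuous_on S u" "continuous_on S v"
 by (rule DERIV_continuous_on, rule has_field_derivative_at_within, rule tsolD[OF assms])+

lemma tsol_isCont: assumes "tsol u v" shows "isCont u t" "isCont v t"
 by (rule DERIV_isCont, rule tsolD[OF assms])+

lemma tsol_zero: "tsol (\<lambda>_. 0) (\<lambda>_. 0)" by (simp add: tsol_def)

lemma tsol_minus: assumes "tsol u v" shows "tsol (\<lambda>t. - u t) (\<lambda>t. - v t)"
 using assms by (auto simp: tsol_def cub_minus intro!: derivative_eq_intros)

lemma tsol_exists: "\<exists>u v. tsol u v \<and> u t0 = a \<and> v t0 = b"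
proof -
 define F where "F t p = (snd p, k * snd p + cub (fst p) - m t * fst p)" for t :: real and p :: "real \<times> real"
 have lip: "norm (F t p - F t q) \<le> 16 * norm (p - q)" for t p q
 proof -
  define d e where "d = fst p - fst q" and "e = snd p - snd q"
  have d: "\<bar>d\<bar> \<le> norm (p - q)" and e: "\<bar>e\<bar> \<le> norm (p - q)"
   using norm_fst_le[of "fst (p - q)" "snd (p - q)"] norm_snd_le[of "snd (p - q)" "fst (p - q)"]
   unfolding prod.collapse by (auto simp: d_def e_def)
  have "F t p - F t q = (e, k * e + (cub (fst p) - cub (fst q)) - m t * d)"
   by (simp add: F_def d_def e_def algebra_simps)
  then have "norm (F t p - F t q) \<le> \<bar>e\<bar> + \<bar>k * e + (cub (fst p) - cub (fst q)) - m t * d\<bar>"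
   using norm_Pair_le[of e "k * e + (cub (fst p) - cub (fst q)) - m t * d"] by (simp only: real_norm_def)
  also have "\<dots> \<le> \<bar>e\<bar> + (\<bar>k * e\<bar> + \<bar>cub (fst p) - cub (fst q)\<bar> + \<bar>m t * d\<bar>)"
   by linarith
  also have "\<dots> \<le> \<bar>e\<bar> + (2 * \<bar>e\<bar> + 12 * \<bar>d\<bar> + 1 * \<bar>d\<bar>)"
   unfolding abs_mult using k_le m_le[of t] cub_lipschitz[of "fst p" "fst q"] d_def
   by (intro add_mono mult_right_mono) auto
  also have "\<dots> \<le> 16 * norm (p - q)" using d e by linarith
  finally show ?thesis .
 qed
 have bdd: "norm (F t (a, b)) \<le> \<bar>b\<bar> + (\<bar>k * b\<bar> + \<bar>cub a\<bar> + \<bar>a\<bar>)" for t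
 proof -
  have "\<bar>m t * a\<bar> \<le> \<bar>a\<bar>" using m_le[of t] by (simp add: abs_mult mult_left_le_one_le)
  then show ?thesis using norm_Pair_le[of b "k * b + cub a - m t * a"] unfolding F_def by simp
 qed
 have "continuous_on UNIV (\<lambda>x::real \<times> (real \<times> real). cub (fst (snd x)))"
  by (rule continuous_on_compose2[OF continuous_cub[of UNIV]]) (auto intro!: continuous_intros)
 moreover have "continuous_on UNIV (\<lambda>x::real \<times> (real \<times> real). m (fst x))"
  by (rule continuous_on_compose2[OF m_cont]) (auto intro!: continuous_intros)
 ultimately have "continuous_on UNIV (\<lambda>(t, x). F t x)"
  unfolding F_def case_prod_unfold by (intro continuous_intros)
 from picard_lindeloef_global[OF this lip _ bdd] obtain x where
  x: "x t0 = (a, b)" "\<And>t. (x has_vector_derivative F t (x t)) (at t)" by auto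
 have "tsol (\<lambda>t. fst (x t)) (\<lambda>t. snd (x t))"
  unfolding tsol_def has_real_derivative_iff_has_vector_derivative
 proof (intro allI conjI)
  fix t
  show "((\<lambda>t. fst (x t)) has_vector_derivative snd (x t)) (at t)"
   using bounded_linear.has_vector_derivative[OF bounded_linear_fst x(2)[of t]] by (simp add: F_def)
  show "((\<lambda>t. snd (x t)) has_vector_derivative k * snd (x t) + cub (fst (x t)) - m t * fst (x t)) (at t)"
   using bounded_linear.has_vector_derivative[OF bounded_linear_snd x(2)[of t]] by (simp add: F_def)
 qed
 then show ?thesis using x(1) by (metis fst_conv snd_conv)
qed

lemma tsol_diff:
 assumes "tsol u v" "tsol u' v'"
 shows "DERIV (\<lambda>t. u t - u' t) t :> v t - v' t"
  "((\<lambda>t. v t - v' t) has_real_derivative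
    k * (v t - v' t) + (cub (u t) - cub (u' t)) - m t * (u t - u' t)) (at t)"
 by (rule DERIV_diff[OF tsolD(1)[OF assms(1)] tsolD(1)[OF assms(2)]])
   (rule DERIV_cong[OF DERIV_diff[OF tsolD(2)[OF assms(1)] tsolD(2)[OF assms(2)]]], simp add: algebra_simps)

text \<open>The constant collects |k| \<le> 2, the Lipschitz constant 12 of \<open>cub\<close> and
  |m| \<le> 1: the mixed terms are at most 14 |d| |e| \<le> 7 (d^2 + e^2), and 2 e^2 comes on
  top.\<close>

lemma growth_bound:
 assumes "\<bar>w\<bar> \<le> 12 * \<bar>d\<bar>"
 shows "\<bar>d * e + e * (k * e + w - m t * d)\<bar> \<le> 9 * (d\<^sup>2 + e\<^sup>2)"
proof -
 have "\<bar>k * e + w - m t * d\<bar> \<le> 2 * \<bar>e\<bar> + 13 * \<bar>d\<bar>"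
 proof -
  have "\<bar>k * e\<bar> \<le> 2 * \<bar>e\<bar>" "\<bar>m t * d\<bar> \<le> 1 * \<bar>d\<bar>"
   unfolding abs_mult using k_le m_le[of t] by (intro mult_right_mono; simp)+
  then show ?thesis using assms by linarith
 qed
 then have "\<bar>e\<bar> * \<bar>k * e + w - m t * d\<bar> \<le> \<bar>e\<bar> * (2 * \<bar>e\<bar> + 13 * \<bar>d\<bar>)" by (rule mult_left_mono) simp
 then have "\<bar>d * e + e * (k * e + w - m t * d)\<bar> \<le> \<bar>d\<bar> * \<bar>e\<bar> + \<bar>e\<bar> * (2 * \<bar>e\<bar> + 13 * \<bar>d\<bar>)"
  using abs_triangle_ineq[of "d * e" "e * (k * e + w - m t * d)"] unfolding abs_mult by linarith
 also have "\<dots> = 14 * (\<bar>d\<bar> * \<bar>e\<bar>) + 2 * e\<^sup>2" by (simp add: algebra_simps power2_eq_square)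
 also have "\<dots> \<le> 7 * (d\<^sup>2 + e\<^sup>2) + 2 * e\<^sup>2"
  using sum_squares_bound[of "\<bar>d\<bar>" "\<bar>e\<bar>"] by simp
 also have "\<dots> \<le> 9 * (d\<^sup>2 + e\<^sup>2)" by simp
 finally show ?thesis .
qed

lemma tsol_dependence:
 assumes "tsol u v" "tsol u' v'"
 shows "(u t - u' t)\<^sup>2 + (v t - v' t)\<^sup>2 \<le> ((u s - u' s)\<^sup>2 + (v s - v' s)\<^sup>2) * exp (18 * \<bar>t - s\<bar>)"
proof -
 have c: "continuous_on S (\<lambda>t. u t - u' t)" "continuous_on S (\<lambda>t. v t - v' t)" for S
  by (intro continuous_intros tsol_cont[OF assms(1)] tsol_cont[OF assms(2)])+
 note g = gronwall_two[where d="\<lambda>t. u t - u' t" and e="\<lambda>t. v t - v' t" and K=9,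
   OF _ c tsol_diff[OF assms] growth_bound[OF cub_lipschitz]]
 show ?thesis
 proof (cases "s \<le> t")
  case True
  then show ?thesis using g(1)[OF True] by simp
 next
  case False
  then have "t \<le> s" by simp
  then show ?thesis using g(2)[OF \<open>t \<le> s\<close>] by simp
 qed
qed

lemma tsol_unique:
 assumes "tsol u v" "tsol u' v'" "u s = u' s" "v s = v' s"
 shows "u = u'" "v = v'"
proof -
 have "u t = u' t \<and> v t = v' t" for t
  using tsol_dependence[OF assms(1,2), of t s] assms(3,4) sum_power2_le_zero_iff[of "u t - u' t" "v t - v' t"]
  by simp
 then show "u = u'" "v = v'" by auto
qed

lemma tsol_dependence_abs:
 assumes "tsol u v" "tsol u' v'" "\<bar>u s - u' s\<bar> \<le> \<rho>" "\<bar>v s - v' s\<bar> \<le> \<rho>" "\<bar>t - s\<bar> \<le> R"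
 shows "\<bar>u t - u' t\<bar> \<le> 2 * \<rho> * exp (9 * R)" "\<bar>v t - v' t\<bar> \<le> 2 * \<rho> * exp (9 * R)"
proof -
 have \<rho>: "\<rho> \<ge> 0" using assms(3) by linarith
 have "(u s - u' s)\<^sup>2 \<le> \<rho>\<^sup>2" "(v s - v' s)\<^sup>2 \<le> \<rho>\<^sup>2"
  using assms(3,4) power2_le_iff_abs_le[OF \<rho>] by auto
 then have "(u s - u' s)\<^sup>2 + (v s - v' s)\<^sup>2 \<le> (2 * \<rho>)\<^sup>2" by (simp add: power_mult_distrib) (use zero_le_power2[of \<rho>] in linarith)
 then have "((u s - u' s)\<^sup>2 + (v s - v' s)\<^sup>2) * exp (18 * \<bar>t - s\<bar>) \<le> (2 * \<rho>)\<^sup>2 * exp (18 * R)"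
  using assms(5) by (intro mult_mono) auto
 also have "\<dots> = (2 * \<rho> * exp (9 * R))\<^sup>2"
  by (simp add: power_mult_distrib flip: exp_of_nat_mult)
 finally have N: "(u t - u' t)\<^sup>2 + (v t - v' t)\<^sup>2 \<le> (2 * \<rho> * exp (9 * R))\<^sup>2"
  using tsol_dependence[OF assms(1,2), of t s] by linarith
 have "0 \<le> 2 * \<rho> * exp (9 * R)" using \<rho> by simp
 from sum_squares_le_imp_abs_le[OF N this]
 show "\<bar>u t - u' t\<bar> \<le> 2 * \<rho> * exp (9 * R)" "\<bar>v t - v' t\<bar> \<le> 2 * \<rho> * exp (9 * R)" .
qed

text \<open>A steep crossing cannot have come from afar with the same sign: this bounds logarithmic
 derivatives of positive differences of solutions.\<close>

lemma steep_crossing: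
 assumes "tsol u v" "tsol u' v'" and d: "u t - u' t > 0" and e: "v t - v' t \<ge> 200 * (u t - u' t)"
 shows "u (t - 1/100) - u' (t - 1/100) < 0" "\<forall>s\<in>{t - 1/100..t}. v s - v' s > 0"
proof -
 define E where "E = v t - v' t"
 define D where "D = u t - u' t"
 have E0: "E > 0" and DE: "200 * D \<le> E" using d e by (auto simp: E_def D_def)
 \<comment> \<open>Over the time 1/100 the Gronwall factor is below 3/2, so both components stay
   below 5/4 E.\<close>
 have small: "\<bar>u s - u' s\<bar> \<le> 5/4 * E \<and> \<bar>v s - v' s\<bar> \<le> 5/4 * E" if s: "s \<in> {t - 1/100..t}" for s
 proof -
  have "D\<^sup>2 \<le> (E / 200)\<^sup>2" using d DE by (intro power_mono) (auto simp: D_def)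
  then have "D\<^sup>2 + E\<^sup>2 \<le> (1 + 1/40000) * E\<^sup>2" by (simp add: power_divide)
  moreover have "exp (18 * \<bar>s - t\<bar>) \<le> 3/2"
  proof -
   have "exp (18 * \<bar>s - t\<bar>) \<le> exp (18/100)" using s by auto
   also have "\<dots> \<le> 1 + 18/100 + (18/100)\<^sup>2" by (rule exp_bound) auto
   finally show ?thesis by (simp add: power2_eq_square)
  qed
  ultimately have "(D\<^sup>2 + E\<^sup>2) * exp (18 * \<bar>s - t\<bar>) \<le> ((1 + 1/40000) * E\<^sup>2) * (3/2)"
   by (intro mult_mono) auto
  also have "\<dots> \<le> (5/4 * E)\<^sup>2" by (simp add: power_mult_distrib power2_eq_square)
  finally have N: "(u s - u' s)\<^sup>2 + (v s - v' s)\<^sup>2 \<le> (5/4 * E)\<^sup>2"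
   using tsol_dependence[OF assms(1,2), of s t] unfolding D_def E_def by linarith
  have "0 \<le> 5/4 * E" using E0 by simp
  from sum_squares_le_imp_abs_le[OF N this] show ?thesis by simp
 qed
 \<comment> \<open>The slope changes at a rate of at most 20 E and hence stays above 3/4 E. The
   difference then falls by at least 3/400 E, which is more than its final value of at most E /
   200.\<close>
 have slope: "v s - v' s \<ge> 3/4 * E" if s: "s \<in> {t - 1/100..t}" for s
 proof -
  have "v t - v' t - 20 * E * t \<le> v s - v' s - 20 * E * s"
  proof (rule DERIV_nonpos_imp_nonincreasing[where f="\<lambda>x. v x - v' x - 20 * E * x"])
   fix x assume x: "s \<le> x" "x \<le> t"
   have "\<bar>k * (v x - v' x)\<bar> \<le> 2 * (5/4 * E)" "\<bar>m x * (u x - u' x)\<bar> \<le> 1 * (5/4 * E)"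
    unfolding abs_mult using small[of x] s x k_le m_le[of x] by (intro mult_mono; simp)+
   then have "k * (v x - v' x) + (cub (u x) - cub (u' x)) - m x * (u x - u' x) - 20 * E \<le> 0"
    using cub_lipschitz[of "u x" "u' x"] small[of x] s x E0 by auto
   moreover have "((\<lambda>x. v x - v' x - 20 * E * x) has_real_derivative
     k * (v x - v' x) + (cub (u x) - cub (u' x)) - m x * (u x - u' x) - 20 * E) (at x)"
    using DERIV_diff[OF tsol_diff(2)[OF assms(1,2), of x] DERIV_cmult[OF DERIV_ident, of "20 * E"]]
    by simp
   ultimately show "\<exists>y. DERIV (\<lambda>x. v x - v' x - 20 * E * x) x :> y \<and> y \<le> 0" by blast
  qed (use s in auto)
  moreover have "20 * E * (t - s) \<le> 20 * E * (1/100)" using s E0 by (intro mult_left_mono) auto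
  ultimately show ?thesis unfolding E_def[symmetric] using E0 by (simp add: algebra_simps)
 qed
 then show "\<forall>s\<in>{t - 1/100..t}. v s - v' s > 0" using E0 by fastforce
 have "u (t - 1/100) - u' (t - 1/100) - 3/4 * E * (t - 1/100) \<le> u t - u' t - 3/4 * E * t"
 proof (rule DERIV_nonneg_imp_nondecreasing[where f="\<lambda>x. u x - u' x - 3/4 * E * x"])
  fix x assume x: "t - 1/100 \<le> x" "x \<le> t"
  have "DERIV (\<lambda>x. u x - u' x - 3/4 * E * x) x :> (v x - v' x - 3/4 * E)"
   using DERIV_diff[OF tsol_diff(1)[OF assms(1,2), of x] DERIV_cmult[OF DERIV_ident, of "3/4 * E"]]
   by simp
  then show "\<exists>y. DERIV (\<lambda>x. u x - u' x - 3/4 * E * x) x :> y \<and> y \<ge> 0"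
   using slope[of x] x by force
 qed simp
 then show "u (t - 1/100) - u' (t - 1/100) < 0"
  using DE E0 unfolding D_def[symmetric] by (simp add: algebra_simps)
qed

lemma log_slope_bound:
 assumes "tsol u v" "tsol u' v'" and "\<And>s. s \<le> t \<Longrightarrow> u s - u' s > 0"
 shows "v t - v' t \<le> 200 * (u t - u' t)"
 using steep_crossing(1)[OF assms(1,2), of t] assms(3)[of t] assms(3)[of "t - 1/100"] by force

end

section \<open>Monotonicity, zeros and a maximum principle\<close>

lemma deriv_nonneg_mono:
 fixes f f' :: "real \<Rightarrow> real"
 assumes "a \<le> b" "\<And>t. a \<le> t \<Longrightarrow> t \<le> b \<Longrightarrow> DERIV f t :> f' t"
  and "\<And>t. a \<le> t \<Longrightarrow> t \<le> b \<Longrightarrow> 0 \<le> f' t"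
 shows "f a \<le> f b"
 by (rule DERIV_nonneg_imp_nondecreasing[OF assms(1)]) (use assms in blast)

lemma deriv_nonpos_mono:
 fixes f f' :: "real \<Rightarrow> real"
 assumes "a \<le> b" "\<And>t. a \<le> t \<Longrightarrow> t \<le> b \<Longrightarrow> DERIV f t :> f' t"
  and "\<And>t. a \<le> t \<Longrightarrow> t \<le> b \<Longrightarrow> f' t \<le> 0"
 shows "f b \<le> f a"
 by (rule DERIV_nonpos_imp_nonincreasing[OF assms(1)]) (use assms in blast)

lemma last_zero:
 fixes f :: "real \<Rightarrow> real"
 assumes "continuous_on {a..b} f" "f a \<le> 0" "0 < f b" "a \<le> b"
 obtains c where "a \<le> c" "c < b" "f c = 0" "\<And>t. c < t \<Longrightarrow> t \<le> b \<Longrightarrow> 0 < f t"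
proof -
 define Z where "Z = {t \<in> {a..b}. f t \<le> 0}"
 have "closed ({a..b} \<inter> f -` {..0})" by (rule continuous_closed_preimage[OF assms(1)]) auto
 moreover have "Z = {a..b} \<inter> f -` {..0}" by (auto simp: Z_def)
 ultimately have "closed Z" by simp
 have Z: "a \<in> Z" "bdd_above Z" using assms by (auto simp: Z_def)
 then have c: "Sup Z \<in> Z" using closed_contains_Sup[of Z] \<open>closed Z\<close> by blast
 have pos: "0 < f t" if "Sup Z < t" "t \<le> b" for t
 proof (rule ccontr)
  assume "\<not> 0 < f t"
  then have "t \<in> Z" using that c by (auto simp: Z_def)
  then show False using cSup_upper[OF _ Z(2), of t] that by simp
 qed
 have lt: "Sup Z < b" using c assms by (auto simp: Z_def less_le)
 have "f (Sup Z) = 0"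
 proof (rule ccontr)
  assume "f (Sup Z) \<noteq> 0"
  then have "f (Sup Z) \<le> 0" "0 \<le> f b" using c assms by (auto simp: Z_def)
  moreover have "continuous_on {Sup Z..b} f" using assms(1) c by (auto intro: continuous_on_subset simp: Z_def)
  ultimately obtain x where "Sup Z \<le> x" "x \<le> b" "f x = 0" using IVT'[of f "Sup Z" 0 b] lt by auto
  then show False using pos[of x] \<open>f (Sup Z) \<noteq> 0\<close> by (cases "x = Sup Z") auto
 qed
 then show ?thesis using that[of "Sup Z"] c pos lt by (auto simp: Z_def)
qed

lemma first_zero:
 fixes f :: "real \<Rightarrow> real"
 assumes "continuous_on {a..b} f" "0 < f a" "f b \<le> 0" "a \<le> b"
 obtains c where "a < c" "c \<le> b" "f c = 0" "\<And>t. a \<le> t \<Longrightarrow> t < c \<Longrightarrow> 0 < f t"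
proof -
 have "continuous_on {-b..-a} (\<lambda>t. f (- t))"
  by (rule continuous_on_compose2[OF assms(1)]) (auto intro!: continuous_intros)
 then obtain c where c: "-b \<le> c" "c < -a" "f (-c) = 0" "\<And>t. c < t \<Longrightarrow> t \<le> -a \<Longrightarrow> 0 < f (-t)"
  using last_zero[of "-b" "-a" "\<lambda>t. f (-t)"] assms by auto
 have "0 < f t" if "a \<le> t" "t < -c" for t using c(4)[of "-t"] that by simp
 with c show ?thesis using that[of "-c"] by auto
qed

text \<open>On a compact interval positivity has a margin, and Lipschitz dependence on the parameter
  cannot use it up within a distance \<open>\<rho>\<close>. This yields the openness in the shooting
  arguments.\<close>

lemma uniform_perturbation_positive:
 fixes f :: "real \<Rightarrow> real \<Rightarrow> real"
 assumes "continuous_on {a..b} (f \<sigma>0)" "\<And>t. t \<in> {a..b} \<Longrightarrow> 0 < f \<sigma>0 t"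
  and "0 \<le> C" "\<And>\<sigma> t. \<sigma> \<in> S \<Longrightarrow> t \<in> {a..b} \<Longrightarrow> \<bar>f \<sigma> t - f \<sigma>0 t\<bar> \<le> C * \<bar>\<sigma> - \<sigma>0\<bar>"
 obtains \<rho> where "\<rho> > 0" "\<And>\<sigma> t. \<sigma> \<in> S \<Longrightarrow> \<bar>\<sigma> - \<sigma>0\<bar> < \<rho> \<Longrightarrow> t \<in> {a..b} \<Longrightarrow> 0 < f \<sigma> t"
proof (cases "a \<le> b")
 case True
 then obtain t0 where t0: "t0 \<in> {a..b}" "\<And>t. t \<in> {a..b} \<Longrightarrow> f \<sigma>0 t0 \<le> f \<sigma>0 t"
  using continuous_attains_inf[of "{a..b}" "f \<sigma>0"] assms(1) by auto
 define \<rho> where "\<rho> = f \<sigma>0 t0 / (C + 1)"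
 have "\<rho> > 0" using assms(2)[OF t0(1)] assms(3) by (simp add: \<rho>_def)
 moreover have "0 < f \<sigma> t" if "\<sigma> \<in> S" "\<bar>\<sigma> - \<sigma>0\<bar> < \<rho>" "t \<in> {a..b}" for \<sigma> t
 proof -
  have "C * \<bar>\<sigma> - \<sigma>0\<bar> \<le> C * \<rho>" using that assms(3) by (intro mult_left_mono) auto
  also have "\<dots> < (C + 1) * \<rho>" using \<open>\<rho> > 0\<close> by simp
  also have "\<dots> = f \<sigma>0 t0" using assms(3) by (simp add: \<rho>_def)
  finally show ?thesis using assms(4)[OF that(1,3)] t0(2)[OF that(3)] by linarith
 qed
 ultimately show ?thesis using that by blast
next
 case False
 then show ?thesis using that[of 1] by auto
qed

text \<open>Second-order maximum principle on a half line: a solution of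
 \<open>d'' = k d' + Q d\<close>, \<open>Q \<ge> 0\<close>, that vanishes at \<open>-\<infinity>\<close> moves away from zero.\<close>

context
 fixes d e Q :: "real \<Rightarrow> real" and k T :: real
 assumes dd: "\<And>t. t \<le> T \<Longrightarrow> DERIV d t :> e t"
  and de: "\<And>t. t \<le> T \<Longrightarrow> DERIV e t :> k * e t + Q t * d t"
  and Q: "\<And>t. t \<le> T \<Longrightarrow> 0 \<le> Q t"
  and lim: "(d \<longlongrightarrow> 0) at_bot"
begin

text \<open>The product \<open>exp (- k * s) * (d s * e s)\<close> has derivative
  \<open>exp (- k * s) * (e s ^ 2 + Q s * d s ^ 2)\<close> and is nondecreasing. If it were negative
  at \<open>t\<close> it would be negative before, and d^2 would grow backwards in time instead of
  vanishing.\<close>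

lemma vanishing_moves_away:
 assumes "t \<le> T" shows "0 \<le> d t * e t"
proof (rule ccontr)
 assume neg: "\<not> 0 \<le> d t * e t"
 have h: "exp (- k * s) * (d s * e s) \<le> exp (- k * t) * (d t * e t)" if "s \<le> t" for s
 proof (rule deriv_nonneg_mono[OF that, where f'="\<lambda>s. exp (- k * s) * (e s ^ 2 + Q s * d s ^ 2)"])
  fix x assume "s \<le> x" "x \<le> t"
  then have x: "x \<le> T" using assms by simp
  show "DERIV (\<lambda>s. exp (- k * s) * (d s * e s)) x :> exp (- k * x) * (e x ^ 2 + Q x * d x ^ 2)"
   by (rule derivative_eq_intros dd[OF x] de[OF x] refl | simp)+
     (simp add: algebra_simps power2_eq_square)
  show "0 \<le> exp (- k * x) * (e x ^ 2 + Q x * d x ^ 2)" using Q[OF x] by simp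
 qed
 have neg': "d s * e s < 0" if "s \<le> t" for s
 proof -
  have "exp (- k * t) * (d t * e t) < 0" using neg by (simp add: mult_pos_neg)
  with h[OF that] have "exp (- k * s) * (d s * e s) < 0" by linarith
  then show ?thesis by (simp add: mult_less_0_iff)
 qed
 have N: "(d t)\<^sup>2 \<le> (d s)\<^sup>2" if "s \<le> t" for s
 proof (rule deriv_nonpos_mono[OF that, where f'="\<lambda>s. 2 * (d s * e s)"])
  fix x assume x: "s \<le> x" "x \<le> t"
  then have xT: "x \<le> T" using assms by simp
  show "DERIV (\<lambda>s. (d s)\<^sup>2) x :> 2 * (d x * e x)"
   by (rule derivative_eq_intros dd[OF xT] refl | simp)+
  show "2 * (d x * e x) \<le> 0" using neg'[of x] x by simp
 qed
 have "((\<lambda>s. (d s)\<^sup>2) \<longlongrightarrow> 0\<^sup>2) at_bot" by (intro tendsto_intros lim)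
 then have "(d t)\<^sup>2 \<le> 0\<^sup>2"
  by (rule tendsto_lowerbound) (auto intro!: eventually_at_bot_linorderI[of t] N)
 then show False using neg by simp
qed

lemma vanishing_abs_mono:
 assumes "s \<le> t" "t \<le> T" shows "\<bar>d s\<bar> \<le> \<bar>d t\<bar>"
proof -
 have "(d s)\<^sup>2 \<le> (d t)\<^sup>2"
 proof (rule deriv_nonneg_mono[OF assms(1), where f'="\<lambda>s. 2 * (d s * e s)"])
  fix x assume x: "s \<le> x" "x \<le> t"
  then have xT: "x \<le> T" using assms by simp
  show "DERIV (\<lambda>s. (d s)\<^sup>2) x :> 2 * (d x * e x)"
   by (rule derivative_eq_intros dd[OF xT] refl | simp)+
  show "0 \<le> 2 * (d x * e x)" using vanishing_moves_away[OF xT] by simp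
 qed
 then show ?thesis by (simp add: abs_le_square_iff)
qed

text \<open>The derivative of \<open>e - k * d\<close> is \<open>Q * d\<close>, so this quantity is
  nondecreasing; if it were negative at \<open>t\<close>, then \<open>k * d\<close> would stay above
  a positive constant towards minus infinity. The bound reflects that the positive root of
  \<lambda>^2 = k \<lambda> + Q is at least k.\<close>

lemma vanishing_slope_bound:
 assumes pos: "\<And>t. t \<le> T \<Longrightarrow> 0 < d t" and "t \<le> T"
 shows "0 \<le> e t" "k * d t \<le> e t"
proof -
 have e: "0 \<le> e s" if "s \<le> T" for s
  using vanishing_moves_away[OF that] pos[OF that] by (simp add: zero_le_mult_iff)
 show "0 \<le> e t" using e assms by simp
 show "k * d t \<le> e t"
 proof (rule ccontr)
  assume neg: "\<not> k * d t \<le> e t"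
  have g: "e s - k * d s \<le> e t - k * d t" if "s \<le> t" for s
  proof (rule deriv_nonneg_mono[OF that, where f'="\<lambda>s. Q s * d s"])
   fix x assume "s \<le> x" "x \<le> t"
   then have x: "x \<le> T" using assms by simp
   show "DERIV (\<lambda>s. e s - k * d s) x :> Q x * d x"
    by (rule derivative_eq_intros dd[OF x] de[OF x] refl | simp)+
   show "0 \<le> Q x * d x" using Q[OF x] pos[OF x] by simp
  qed
  have "((\<lambda>s. k * d s) \<longlongrightarrow> k * 0) at_bot" by (intro tendsto_intros lim)
  then have "k * d t - e t \<le> k * 0"
  proof (rule tendsto_lowerbound)
   show "\<forall>\<^sub>F s in at_bot. k * d t - e t \<le> k * d s"
   proof (rule eventually_at_bot_linorderI[of t])
    fix s assume "s \<le> t"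
    then show "k * d t - e t \<le> k * d s" using g[of s] e[of s] assms(2) by linarith
   qed
  qed simp
  then show False using neg by simp
 qed
qed

end

section \<open>Solutions asymptotic to a given one, by shooting in the slope\<close>

context ramp_eq
begin

lemma tsol_diff_quotient:
 assumes "tsol u v" "tsol u' v'" "\<bar>u t\<bar> \<le> 2" "\<bar>u' t\<bar> \<le> 2"
 shows "((\<lambda>t. v t - v' t) has_real_derivative
    k * (v t - v' t) + ((u t)\<^sup>2 + u t * u' t + (u' t)\<^sup>2 - m t) * (u t - u' t)) (at t)"
 by (rule DERIV_cong[OF tsol_diff(2)[OF assms(1,2)]])
   (simp add: cub_eq assms cube_diff algebra_simps)

text \<open>Shooting in the slope \<sigma> at time \<open>T\<close>. Seen backwards in time, too
  small a slope lets the difference turn round and grow, too large a slope drives it through zero.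
  Both happen for open sets of slopes, so connectedness of the line leaves a slope with neither, and
  that solution is squeezed towards \<open>U\<close>.\<close>

lemma decaying_solution_exists_pos:
 assumes UV: "tsol U V" and "0 < s" and le2: "\<And>t. t \<le> T \<Longrightarrow> \<bar>U t\<bar> + s \<le> 2" and "0 < q"
  and Q: "\<And>t x. t \<le> T \<Longrightarrow> U t \<le> x \<Longrightarrow> x \<le> U t + s \<Longrightarrow> q \<le> x\<^sup>2 + x * U t + (U t)\<^sup>2 - m t"
 shows "\<exists>u v. tsol u v \<and> u T = U T + s \<and> (\<forall>t\<le>T. U t < u t \<and> u t \<le> U t + s) \<and>
  ((\<lambda>t. u t - U t) \<longlongrightarrow> 0) at_bot \<and> ((\<lambda>t. v t - V t) \<longlongrightarrow> 0) at_bot"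
proof -
 have "\<forall>\<sigma>. \<exists>u v. tsol u v \<and> u T = U T + s \<and> v T = V T + \<sigma>" using tsol_exists by blast
 then obtain u v where uv: "\<And>\<sigma>. tsol (u \<sigma>) (v \<sigma>)" and uT: "\<And>\<sigma>. u \<sigma> T = U T + s" and vT: "\<And>\<sigma>. v \<sigma> T = V T + \<sigma>"
  by metis
 define d e where "d \<sigma> t = u \<sigma> t - U t" and "e \<sigma> t = v \<sigma> t - V t" for \<sigma> t
 have dT: "d \<sigma> T = s" and eT: "e \<sigma> T = \<sigma>" for \<sigma> by (auto simp: d_def e_def uT vT)
 have contd: "continuous_on S (d \<sigma>)" and conte: "continuous_on S (e \<sigma>)" for S \<sigma>
  unfolding d_def[abs_def] e_def[abs_def] by (intro continuous_intros tsol_cont[OF uv] tsol_cont[OF UV])+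
 have dd: "DERIV (d \<sigma>) t :> e \<sigma> t" for \<sigma> t
  unfolding d_def[abs_def] e_def by (rule tsol_diff(1)[OF uv UV])
 define Qf where "Qf \<sigma> t = (u \<sigma> t)\<^sup>2 + u \<sigma> t * U t + (U t)\<^sup>2 - m t" for \<sigma> t
 have de: "DERIV (e \<sigma>) t :> k * e \<sigma> t + Qf \<sigma> t * d \<sigma> t"
  and Qd: "q * d \<sigma> t \<le> Qf \<sigma> t * d \<sigma> t" if "t \<le> T" "0 \<le> d \<sigma> t" "d \<sigma> t \<le> s" for \<sigma> t
 proof -
  have *: "\<bar>u \<sigma> t\<bar> \<le> 2" "\<bar>U t\<bar> \<le> 2" using le2[OF that(1)] that \<open>0 < s\<close> by (auto simp: d_def)
  show "DERIV (e \<sigma>) t :> k * e \<sigma> t + Qf \<sigma> t * d \<sigma> t"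
   unfolding d_def[abs_def] e_def[abs_def] Qf_def by (rule tsol_diff_quotient[OF uv UV *])
  show "q * d \<sigma> t \<le> Qf \<sigma> t * d \<sigma> t"
   unfolding Qf_def by (intro mult_right_mono Q that) (use that in \<open>auto simp: d_def\<close>)
 qed
 have near: "\<bar>d \<sigma> t - d \<sigma>0 t\<bar> \<le> 2 * exp (9 * (T - a)) * \<bar>\<sigma> - \<sigma>0\<bar>"
   "\<bar>e \<sigma> t - e \<sigma>0 t\<bar> \<le> 2 * exp (9 * (T - a)) * \<bar>\<sigma> - \<sigma>0\<bar>" if "t \<in> {a..T}" for \<sigma> \<sigma>0 t a
  using tsol_dependence_abs[OF uv[of \<sigma>] uv[of \<sigma>0], of T "\<bar>\<sigma> - \<sigma>0\<bar>" t "T - a"] that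
  by (auto simp: uT vT d_def e_def mult_ac)
 \<comment> \<open>Demanding that the other quantity keep its sign up to \<open>T\<close> makes the
   two sets disjoint: whichever event lies closer to \<open>T\<close> excludes the other.\<close>
 define A1 where "A1 = {\<sigma>. \<exists>t\<le>T. e \<sigma> t < 0 \<and> (\<forall>t'\<in>{t..T}. 0 < d \<sigma> t')}"
 define A2 where "A2 = {\<sigma>. \<exists>t\<le>T. d \<sigma> t < 0 \<and> (\<forall>t'\<in>{t..T}. 0 < e \<sigma> t')}"
 have "open A1" unfolding open_dist
 proof
  fix \<sigma>0 assume "\<sigma>0 \<in> A1"
  then obtain t where t: "t \<le> T" "e \<sigma>0 t < 0" "\<And>t'. t' \<in> {t..T} \<Longrightarrow> 0 < d \<sigma>0 t'" by (auto simp: A1_def)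
  obtain \<rho> where \<rho>: "\<rho> > 0" "\<And>\<sigma> t'. \<bar>\<sigma> - \<sigma>0\<bar> < \<rho> \<Longrightarrow> t' \<in> {t..T} \<Longrightarrow> 0 < d \<sigma> t'"
   using uniform_perturbation_positive[of t T d \<sigma>0, OF contd t(3), of "2 * exp (9 * (T - t))" UNIV] near(1) by auto
  obtain \<rho>' where \<rho>': "\<rho>' > 0" "\<And>\<sigma> t'. \<bar>\<sigma> - \<sigma>0\<bar> < \<rho>' \<Longrightarrow> t' \<in> {t..t} \<Longrightarrow> 0 < - e \<sigma> t'"
   using uniform_perturbation_positive[of t t "\<lambda>\<sigma> t. - e \<sigma> t" \<sigma>0 "2 * exp (9 * (T - t))" UNIV] near(2)[of t t _ \<sigma>0] t(1,2)
   by (auto simp: abs_minus_commute)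
  show "\<exists>\<epsilon>>0. \<forall>\<sigma>. dist \<sigma> \<sigma>0 < \<epsilon> \<longrightarrow> \<sigma> \<in> A1"
   using \<rho> \<rho>' t(1) by (intro exI[of _ "min \<rho> \<rho>'"]) (force simp: A1_def dist_real_def)
 qed
 have "open A2" unfolding open_dist
 proof
  fix \<sigma>0 assume "\<sigma>0 \<in> A2"
  then obtain t where t: "t \<le> T" "d \<sigma>0 t < 0" "\<And>t'. t' \<in> {t..T} \<Longrightarrow> 0 < e \<sigma>0 t'" by (auto simp: A2_def)
  obtain \<rho> where \<rho>: "\<rho> > 0" "\<And>\<sigma> t'. \<bar>\<sigma> - \<sigma>0\<bar> < \<rho> \<Longrightarrow> t' \<in> {t..T} \<Longrightarrow> 0 < e \<sigma> t'"
   using uniform_perturbation_positive[of t T e \<sigma>0, OF conte t(3), of "2 * exp (9 * (T - t))" UNIV] near(2) by auto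
  obtain \<rho>' where \<rho>': "\<rho>' > 0" "\<And>\<sigma> t'. \<bar>\<sigma> - \<sigma>0\<bar> < \<rho>' \<Longrightarrow> t' \<in> {t..t} \<Longrightarrow> 0 < - d \<sigma> t'"
   using uniform_perturbation_positive[of t t "\<lambda>\<sigma> t. - d \<sigma> t" \<sigma>0 "2 * exp (9 * (T - t))" UNIV] near(1)[of t t _ \<sigma>0] t(1,2)
   by (auto simp: abs_minus_commute)
  show "\<exists>\<epsilon>>0. \<forall>\<sigma>. dist \<sigma> \<sigma>0 < \<epsilon> \<longrightarrow> \<sigma> \<in> A2"
   using \<rho> \<rho>' t(1) by (intro exI[of _ "min \<rho> \<rho>'"]) (force simp: A2_def dist_real_def)
 qed
 have "A1 \<inter> A2 = {}"
 proof (rule ccontr)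
  assume "A1 \<inter> A2 \<noteq> {}"
  then obtain \<sigma> t1 t2 where "t1 \<le> T" "e \<sigma> t1 < 0" "\<forall>t'\<in>{t1..T}. 0 < d \<sigma> t'"
   "t2 \<le> T" "d \<sigma> t2 < 0" "\<forall>t'\<in>{t2..T}. 0 < e \<sigma> t'" by (auto simp: A1_def A2_def)
  then show False by (metis atLeastAtMost_iff linear not_less_iff_gr_or_eq)
 qed
 moreover have "-1 \<in> A1" unfolding A1_def
  by (auto intro!: exI[of _ T] simp: dT eT \<open>0 < s\<close>)
 \<comment> \<open>A slope of 200 times the difference is the steepness treated by
   \<open>steep_crossing\<close>.\<close>
 moreover have "200 * s \<in> A2"
 proof -
  have "d (200 * s) (T - 1/100) < 0" "\<forall>t\<in>{T - 1/100..T}. 0 < e (200 * s) t"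
   using steep_crossing[OF uv[of "200 * s"] UV, of T] \<open>0 < s\<close> by (auto simp: d_def e_def uT vT)
  then show ?thesis by (auto simp: A2_def intro!: exI[of _ "T - 1/100"])
 qed
 ultimately have "\<not> UNIV \<subseteq> A1 \<union> A2"
  using connectedD[OF connected_UNIV \<open>open A1\<close> \<open>open A2\<close>] by auto
 then obtain \<sigma> where n1: "\<sigma> \<notin> A1" and n2: "\<sigma> \<notin> A2" by auto
 \<comment> \<open>At the zero closest to \<open>T\<close> the slope is nonnegative, and nonzero by
   uniqueness. Between there and \<open>T\<close> it has no zero, since e' = Q d > 0 at one would
   make it negative just before. So slightly earlier d < 0 with positive slopes up to
   \<open>T\<close>, which means membership in \<open>A2\<close>.\<close>
 have pos: "0 < d \<sigma> t" if "t \<le> T" for t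
 proof (rule ccontr)
  assume "\<not> 0 < d \<sigma> t"
  with \<open>t \<le> T\<close> obtain t1 where t1: "t \<le> t1" "t1 < T" "d \<sigma> t1 = 0" "\<And>t'. t1 < t' \<Longrightarrow> t' \<le> T \<Longrightarrow> 0 < d \<sigma> t'"
   using last_zero[of t T "d \<sigma>", OF contd] dT \<open>0 < s\<close> by (metis linorder_not_less)
  have e0: "0 \<le> e \<sigma> t'" if "t1 < t'" "t' \<le> T" for t'
   using n1 t1(4) that unfolding A1_def by force
  have d_le: "d \<sigma> t' \<le> s" if "t1 < t'" "t' \<le> T" for t'
   unfolding dT[of \<sigma>, symmetric] by (rule deriv_nonneg_mono[OF that(2) dd]) (use e0 that in auto)
  have e1: "0 < e \<sigma> t'" if t': "t1 < t'" "t' \<le> T" for t'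
  proof (rule ccontr)
   assume "\<not> 0 < e \<sigma> t'"
   then have "e \<sigma> t' = 0" using e0[OF t'] by simp
   then have "DERIV (e \<sigma>) t' :> Qf \<sigma> t' * d \<sigma> t'"
    using de[of t' \<sigma>] t1(4)[OF t'] d_le[OF t'] t' by simp
   moreover have "0 < Qf \<sigma> t' * d \<sigma> t'"
    using Qd[of t' \<sigma>] t1(4)[OF t'] d_le[OF t'] t' mult_pos_pos[OF \<open>0 < q\<close> t1(4)[OF t']] by linarith
   ultimately obtain h where h: "h > 0" "\<And>x. 0 < x \<Longrightarrow> x < h \<Longrightarrow> e \<sigma> (t' - x) < e \<sigma> t'"
    using DERIV_pos_inc_left by blast
   define x where "x = min h (t' - t1) / 2"
   have "0 < x" "x < h" "t1 < t' - x" using h t' by (auto simp: x_def min_def field_simps)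
   then show False using h(2)[of x] e0[of "t' - x"] t' \<open>e \<sigma> t' = 0\<close> by simp
  qed
  have "0 \<le> e \<sigma> t1"
  proof (rule ccontr)
   assume neg: "\<not> 0 \<le> e \<sigma> t1"
   have "isCont (e \<sigma>) t1" using conte[of UNIV] by (simp add: continuous_on_eq_continuous_at)
   then have "\<forall>\<^sub>F x in at t1. e \<sigma> x < 0" using neg order_tendstoD(2)[of "e \<sigma>" "e \<sigma> t1" "at t1" 0] by (simp add: isCont_def)
   then obtain h where h: "h > 0" "\<And>x. x \<noteq> t1 \<Longrightarrow> dist x t1 < h \<Longrightarrow> e \<sigma> x < 0" by (auto simp: eventually_at)
   define x where "x = t1 + min h (T - t1) / 2"
   have "t1 < x" "x \<le> T" "dist x t1 < h" using h t1 by (auto simp: x_def dist_real_def min_def field_simps)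
   then show False using h(2)[of x] e1[of x] by simp
  qed
  moreover have "e \<sigma> t1 \<noteq> 0"
  proof
   assume "e \<sigma> t1 = 0"
   then have "u \<sigma> = U" using tsol_unique(1)[OF uv UV, of \<sigma> t1] t1(3) by (simp add: d_def e_def)
   then show False using dT[of \<sigma>] \<open>0 < s\<close> by (simp add: d_def)
  qed
  ultimately have et1: "0 < e \<sigma> t1" by simp
  obtain h where h: "h > 0" "\<And>x. 0 < x \<Longrightarrow> x < h \<Longrightarrow> d \<sigma> (t1 - x) < d \<sigma> t1"
   using DERIV_pos_inc_left[OF dd et1] by blast
  have "isCont (e \<sigma>) t1" using conte[of UNIV] by (simp add: continuous_on_eq_continuous_at)
  then have "\<forall>\<^sub>F x in at t1. 0 < e \<sigma> x" using et1 order_tendstoD(1)[of "e \<sigma>" "e \<sigma> t1" "at t1" 0] by (simp add: isCont_def)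
  then obtain h' where h': "h' > 0" "\<And>x. x \<noteq> t1 \<Longrightarrow> dist x t1 < h' \<Longrightarrow> 0 < e \<sigma> x" by (auto simp: eventually_at)
  define x where "x = min h h' / 2"
  have x: "0 < x" "x < h" "x < h'" using h h' by (auto simp: x_def)
  have "0 < e \<sigma> y" if "y \<in> {t1 - x..T}" for y
   using that e1[of y] et1 h'(2)[of y] x by (cases "y < t1"; cases "y = t1") (auto simp: dist_real_def)
  moreover have "d \<sigma> (t1 - x) < 0" using h(2) x t1(3) by simp
  ultimately have "\<sigma> \<in> A2" using x t1(2) by (auto simp: A2_def intro!: exI[of _ "t1 - x"])
  then show False using n2 by simp
 qed
 have e0: "0 \<le> e \<sigma> t" if "t \<le> T" for t using n1 pos that unfolding A1_def by force
 have dmono: "d \<sigma> t \<le> d \<sigma> t'" if "t \<le> t'" "t' \<le> T" for t t'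
  by (rule deriv_nonneg_mono[OF that(1) dd]) (use e0 that in auto)
 then have ds: "d \<sigma> t \<le> s" if "t \<le> T" for t using dT[of \<sigma>] that by force
 \<comment> \<open>This combination is monotone, its derivative being Q d. If d stayed above \<eta>,
   it would fall without bound backwards in time, against e \<ge> 0 and the bound on k d.\<close>
 define g where "g t = e \<sigma> t - k * d \<sigma> t" for t
 have dg: "DERIV g t :> Qf \<sigma> t * d \<sigma> t" if "t \<le> T" for t
  unfolding g_def[abs_def]
  by (rule derivative_eq_intros dd de[OF that] pos[OF that, THEN less_imp_le] ds[OF that] refl | simp)+
 have gmono: "g t \<le> g t'" if "t \<le> t'" "t' \<le> T" for t t'
 proof (rule deriv_nonneg_mono[OF that(1) dg])
  fix x assume "t \<le> x" "x \<le> t'"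
  then have x: "x \<le> T" using that by simp
  show "0 \<le> Qf \<sigma> x * d \<sigma> x"
   using Qd[OF x, of \<sigma>] pos[OF x] ds[OF x] mult_pos_pos[OF \<open>0 < q\<close> pos[OF x]] by linarith
 qed (use that in auto)
 have kd: "- (2 * s) \<le> k * d \<sigma> t \<and> k * d \<sigma> t \<le> 2 * s" if "t \<le> T" for t
 proof -
  have "\<bar>k * d \<sigma> t\<bar> \<le> 2 * s" unfolding abs_mult using k_le pos[OF that] ds[OF that] by (intro mult_mono) auto
  then show ?thesis by linarith
 qed
 have limd: "(d \<sigma> \<longlongrightarrow> 0) at_bot"
 proof (rule tendstoI)
  fix \<eta> :: real assume "\<eta> > 0"
  have "\<exists>t\<le>T. d \<sigma> t < \<eta>"
  proof (rule ccontr)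
   assume "\<not> (\<exists>t\<le>T. d \<sigma> t < \<eta>)"
   then have big: "\<eta> \<le> d \<sigma> t" if "t \<le> T" for t using that by force
   define t where "t = T - (4 * s + g T + 1) / (q * \<eta>)"
   have gT: "- (2 * s) \<le> g T" using e0[of T] kd[of T] by (simp add: g_def)
   have pos': "0 < q * \<eta>" using \<open>0 < q\<close> \<open>\<eta> > 0\<close> by simp
   then have t: "t \<le> T" using gT \<open>0 < s\<close> by (simp add: t_def)
   have "g t - q * \<eta> * t \<le> g T - q * \<eta> * T"
   proof (rule deriv_nonneg_mono[OF t, where f'="\<lambda>x. Qf \<sigma> x * d \<sigma> x - q * \<eta>"])
    fix x assume "t \<le> x" "x \<le> T"
    then show "DERIV (\<lambda>t. g t - q * \<eta> * t) x :> Qf \<sigma> x * d \<sigma> x - q * \<eta>"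
     using DERIV_diff[OF dg DERIV_cmult[OF DERIV_ident, of "q * \<eta>"]] by simp
    show "0 \<le> Qf \<sigma> x * d \<sigma> x - q * \<eta>"
     using Qd[OF \<open>x \<le> T\<close>, of \<sigma>] pos[OF \<open>x \<le> T\<close>] ds[OF \<open>x \<le> T\<close>]
      mult_left_mono[OF big[OF \<open>x \<le> T\<close>] less_imp_le[OF \<open>0 < q\<close>]] by linarith
   qed
   moreover have "q * \<eta> * (T - t) = 4 * s + g T + 1" using \<open>0 < q\<close> \<open>\<eta> > 0\<close> by (simp add: t_def)
   ultimately have "g t \<le> - 4 * s - 1" by (simp add: algebra_simps)
   then show False using e0[OF t] kd[OF t] \<open>0 < s\<close> by (simp add: g_def)
  qed
  then obtain t where "t \<le> T" "d \<sigma> t < \<eta>" by blast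
  then have "\<bar>d \<sigma> t'\<bar> < \<eta>" if "t' \<le> t" for t' using dmono[of t' t] pos[of t'] that by simp
  then show "\<forall>\<^sub>F t in at_bot. dist (d \<sigma> t) 0 < \<eta>"
   by (auto intro!: eventually_at_bot_linorderI[of t] simp: dist_real_def)
 qed
 have g0: "0 \<le> g t" if "t \<le> T" for t
 proof -
  have "((\<lambda>t. k * d \<sigma> t) \<longlongrightarrow> k * 0) at_bot" by (intro tendsto_intros limd)
  then have "- g t \<le> k * 0"
  proof (rule tendsto_lowerbound)
   show "\<forall>\<^sub>F x in at_bot. - g t \<le> k * d \<sigma> x"
   proof (rule eventually_at_bot_linorderI[of t])
    fix x assume "x \<le> t"
    then show "- g t \<le> k * d \<sigma> x" using gmono[of x t] e0[of x] that by (simp add: g_def)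
   qed
  qed simp
  then show ?thesis by simp
 qed
 \<comment> \<open>If g stayed above \<eta> while k d tends to 0, the slope e would stay above
   \<eta> / 2 and d would become negative.\<close>
 have limg: "(g \<longlongrightarrow> 0) at_bot"
 proof (rule tendstoI)
  fix \<eta> :: real assume "\<eta> > 0"
  have "\<exists>t\<le>T. g t < \<eta>"
  proof (rule ccontr)
   assume "\<not> (\<exists>t\<le>T. g t < \<eta>)"
   then have big: "\<eta> \<le> g t" if "t \<le> T" for t using that by force
   have "((\<lambda>t. k * d \<sigma> t) \<longlongrightarrow> k * 0) at_bot" by (intro tendsto_intros limd)
   then have "\<forall>\<^sub>F t in at_bot. - (\<eta> / 2) < k * d \<sigma> t" by (rule order_tendstoD) (use \<open>\<eta> > 0\<close> in simp)
   then obtain t0 where t0: "\<And>t. t \<le> t0 \<Longrightarrow> - (\<eta> / 2) < k * d \<sigma> t" by (auto simp: eventually_at_bot_linorder)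
   define t1 where "t1 = min t0 T"
   define t where "t = t1 - 2 * (s + 1) / \<eta>"
   have t: "t \<le> t1" using \<open>\<eta> > 0\<close> \<open>0 < s\<close> by (simp add: t_def)
   have "d \<sigma> t - \<eta> / 2 * t \<le> d \<sigma> t1 - \<eta> / 2 * t1"
   proof (rule deriv_nonneg_mono[OF t, where f'="\<lambda>x. e \<sigma> x - \<eta> / 2"])
    fix x assume x: "t \<le> x" "x \<le> t1"
    show "DERIV (\<lambda>t. d \<sigma> t - \<eta> / 2 * t) x :> e \<sigma> x - \<eta> / 2"
     using DERIV_diff[OF dd DERIV_cmult[OF DERIV_ident, of "\<eta> / 2"]] by simp
    show "0 \<le> e \<sigma> x - \<eta> / 2" using t0[of x] big[of x] x by (simp add: g_def t1_def)
   qed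
   moreover have "\<eta> / 2 * (t1 - t) = s + 1" using \<open>\<eta> > 0\<close> by (simp add: t_def)
   moreover have "d \<sigma> t1 \<le> s" using ds[of t1] by (simp add: t1_def)
   moreover have "\<eta> / 2 * (t1 - t) = \<eta> / 2 * t1 - \<eta> / 2 * t" by (rule right_diff_distrib)
   ultimately have "d \<sigma> t < 0" by linarith
   then show False using pos[of t] t by (simp add: t1_def)
  qed
  then obtain t where "t \<le> T" "g t < \<eta>" by blast
  then have "\<bar>g t'\<bar> < \<eta>" if "t' \<le> t" for t' using gmono[of t' t] g0[of t'] that by simp
  then show "\<forall>\<^sub>F t in at_bot. dist (g t) 0 < \<eta>"
   by (auto intro!: eventually_at_bot_linorderI[of t] simp: dist_real_def)
 qed
 have "((\<lambda>t. g t + k * d \<sigma> t) \<longlongrightarrow> 0 + k * 0) at_bot" by (intro tendsto_intros limg limd)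
 then have lime: "(e \<sigma> \<longlongrightarrow> 0) at_bot" by (simp add: g_def)
 show ?thesis
  using uv[of \<sigma>] uT[of \<sigma>] pos ds limd lime
  by (intro exI[of _ "u \<sigma>"] exI[of _ "v \<sigma>"]) (force simp: d_def[abs_def] e_def[abs_def])
qed

text \<open>The equation is odd, so a negative \<open>s\<close> reduces to a positive one by
  reflecting both solutions; for \<open>s = 0\<close> the solution is \<open>U\<close>
  itself.\<close>

lemma decaying_solution_exists:
 assumes UV: "tsol U V" and le2: "\<And>t. t \<le> T \<Longrightarrow> \<bar>U t\<bar> + \<bar>s\<bar> \<le> 2" and "0 < q"
  and Q: "\<And>t x. t \<le> T \<Longrightarrow> \<bar>x - U t\<bar> \<le> \<bar>s\<bar> \<Longrightarrow> q \<le> x\<^sup>2 + x * U t + (U t)\<^sup>2 - m t"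
 shows "\<exists>u v. tsol u v \<and> u T = U T + s \<and> (\<forall>t\<le>T. \<bar>u t - U t\<bar> \<le> \<bar>s\<bar>) \<and>
  ((\<lambda>t. u t - U t) \<longlongrightarrow> 0) at_bot \<and> ((\<lambda>t. v t - V t) \<longlongrightarrow> 0) at_bot"
proof -
 consider "s = 0" | "0 < s" | "s < 0" by linarith
 then show ?thesis
 proof cases
  case 1
  then show ?thesis using UV by (intro exI[of _ U] exI[of _ V]) auto
 next
  case 2
  obtain u v where uv: "tsol u v" "u T = U T + s" "\<And>t. t \<le> T \<Longrightarrow> U t < u t \<and> u t \<le> U t + s"
   "((\<lambda>t. u t - U t) \<longlongrightarrow> 0) at_bot" "((\<lambda>t. v t - V t) \<longlongrightarrow> 0) at_bot"
   using decaying_solution_exists_pos[OF UV 2 _ \<open>0 < q\<close>, of T] le2 Q 2 by force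
  have "\<bar>u t - U t\<bar> \<le> \<bar>s\<bar>" if "t \<le> T" for t using uv(3)[OF that] by linarith
  then show ?thesis using uv by blast
 next
  case 3
  have "\<exists>u v. tsol u v \<and> u T = - U T + (- s) \<and> (\<forall>t\<le>T. - U t < u t \<and> u t \<le> - U t + (- s)) \<and>
   ((\<lambda>t. u t - - U t) \<longlongrightarrow> 0) at_bot \<and> ((\<lambda>t. v t - - V t) \<longlongrightarrow> 0) at_bot"
  proof (rule decaying_solution_exists_pos[OF tsol_minus[OF UV] _ _ \<open>0 < q\<close>])
   fix t x assume "t \<le> T" "- U t \<le> x" "x \<le> - U t + - s"
   then show "q \<le> x\<^sup>2 + x * - U t + (- U t)\<^sup>2 - m t" using Q[of t "-x"] 3 by simp
  qed (use 3 le2 in auto)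
  then obtain u v where uv: "tsol u v" "u T = - U T + (- s)" "\<And>t. t \<le> T \<Longrightarrow> - U t < u t \<and> u t \<le> - U t + (- s)"
   "((\<lambda>t. u t - - U t) \<longlongrightarrow> 0) at_bot" "((\<lambda>t. v t - - V t) \<longlongrightarrow> 0) at_bot" by blast
  have "\<bar>- u t - U t\<bar> \<le> \<bar>s\<bar>" if "t \<le> T" for t using uv(3)[OF that] by linarith
  moreover have "((\<lambda>t. - u t - U t) \<longlongrightarrow> 0) at_bot" "((\<lambda>t. - v t - V t) \<longlongrightarrow> 0) at_bot"
   using tendsto_minus[OF uv(4)] tendsto_minus[OF uv(5)] by simp_all
  ultimately show ?thesis using tsol_minus[OF uv(1)] uv(2)
   by (intro exI[of _ "\<lambda>t. - u t"] exI[of _ "\<lambda>t. - v t"]) auto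
 qed
qed

end

section \<open>Families of solutions asymptotic to a given one\<close>

text \<open>Quotients with a common endpoint are Cauchy as the other endpoint approaches it, and the
  Lipschitz bound passes to the limit. In this way C^1 dependence on a parameter is obtained from
  differences of solutions, in place of the variational equation.\<close>

lemma lipschitz_quotients_imp_derivative:
 fixes f :: "real \<Rightarrow> real"
 assumes "0 < \<eta>" "0 \<le> C"
  and quot: "\<And>a b a' b'. \<lbrakk>-\<eta> \<le> a; a < b; b \<le> \<eta>; -\<eta> \<le> a'; a' < b'; b' \<le> \<eta>\<rbrakk> \<Longrightarrow>
   \<bar>(f b - f a) / (b - a) - (f b' - f a') / (b' - a')\<bar> \<le> C * (\<bar>a - a'\<bar> + \<bar>b - b'\<bar>)"
 shows "\<exists>g. (\<forall>a. \<bar>a\<bar> < \<eta> \<longrightarrow> DERIV f a :> g a) \<and>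
   (\<forall>a b. \<bar>a\<bar> < \<eta> \<longrightarrow> \<bar>b\<bar> < \<eta> \<longrightarrow> \<bar>g a - g b\<bar> \<le> 2 * C * \<bar>a - b\<bar>) \<and>
   (\<forall>a b. \<bar>a\<bar> < \<eta> \<longrightarrow> \<bar>b\<bar> < \<eta> \<longrightarrow> a \<noteq> b \<longrightarrow> \<bar>(f b - f a) / (b - a) - g a\<bar> \<le> 2 * C * \<bar>b - a\<bar>)"
proof -
 have quot': "\<bar>(f b - f a) / (b - a) - (f c - f a) / (c - a)\<bar> \<le> C * (\<bar>b - a\<bar> + \<bar>c - a\<bar>)"
  if "\<bar>a\<bar> < \<eta>" "\<bar>b\<bar> < \<eta>" "\<bar>c\<bar> < \<eta>" "a \<noteq> b" "a \<noteq> c" for a b c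
 proof -
  have sym: "(f x - f y) / (x - y) = (f y - f x) / (y - x)" for x y
   by (metis minus_diff_eq minus_divide_divide)
  have "\<bar>(f b - f a) / (b - a) - (f c - f a) / (c - a)\<bar> \<le> C * (\<bar>min a b - min a c\<bar> + \<bar>max a b - max a c\<bar>)"
  proof -
   have "(f (max a x) - f (min a x)) / (max a x - min a x) = (f x - f a) / (x - a)" for x
    by (cases "a \<le> x") (auto simp: max_def min_def sym)
   then show ?thesis using quot[of "min a b" "max a b" "min a c" "max a c"] that
    by (auto simp: abs_less_iff min_def max_def split: if_splits)
  qed
  also have "\<dots> \<le> C * (\<bar>b - a\<bar> + \<bar>c - a\<bar>)"
   using \<open>0 \<le> C\<close> by (intro mult_left_mono) (auto simp: min_def max_def)
  finally show ?thesis .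
 qed
 have "\<exists>l. (\<forall>b. \<bar>b\<bar> < \<eta> \<longrightarrow> b \<noteq> a \<longrightarrow> \<bar>(f b - f a) / (b - a) - l\<bar> \<le> C * \<bar>b - a\<bar>)" if a: "\<bar>a\<bar> < \<eta>" for a
 proof -
  define \<rho> where "\<rho> = \<eta> - \<bar>a\<bar>"
  have \<rho>: "\<rho> > 0" using a by (simp add: \<rho>_def)
  \<comment> \<open>The offset 2 keeps every \<open>b n\<close> strictly inside the interval,
    already for n = 0.\<close>
  define b where "b n = a + \<rho> / real (n + 2)" for n
  have b: "\<bar>b n\<bar> < \<eta>" "b n \<noteq> a" "\<bar>b n - a\<bar> = \<rho> / real (n + 2)" for n
  proof -
   have "\<rho> / real (n + 2) < \<rho>" "0 < \<rho> / real (n + 2)" using \<rho> by (auto simp: divide_less_eq)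
   then show "\<bar>b n\<bar> < \<eta>" "b n \<noteq> a" "\<bar>b n - a\<bar> = \<rho> / real (n + 2)" by (auto simp: b_def \<rho>_def)
  qed
  have lim: "(\<lambda>n. C * (\<rho> / real (n + 2))) \<longlonglongrightarrow> 0"
  proof -
   have "(\<lambda>n. C * (\<rho> * inverse (real (n + 2)))) \<longlonglongrightarrow> C * (\<rho> * 0)"
    by (intro tendsto_intros LIMSEQ_ignore_initial_segment[OF LIMSEQ_inverse_real_of_nat, of 1, simplified, folded Suc_eq_plus1] )
      (use LIMSEQ_ignore_initial_segment[OF lim_inverse_n', of 2] in \<open>simp add: field_simps inverse_eq_divide\<close>)
   then show ?thesis by (simp add: divide_inverse)
  qed
  define q where "q n = (f (b n) - f a) / (b n - a)" for n
  have "Cauchy q"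
  proof (rule CauchyI)
   fix e :: real assume "e > 0"
   then have "\<forall>\<^sub>F n in sequentially. C * (\<rho> / real (n + 2)) < e / 2"
    using order_tendstoD(2)[OF lim, of "e/2"] by simp
   then obtain N where N: "\<And>n. n \<ge> N \<Longrightarrow> C * (\<rho> / real (n + 2)) < e / 2" by (auto simp: eventually_sequentially)
   have "norm (q i - q j) < e" if "i \<ge> N" "j \<ge> N" for i j
   proof -
    have "\<bar>q i - q j\<bar> \<le> C * (\<bar>b i - a\<bar> + \<bar>b j - a\<bar>)"
     unfolding q_def by (rule quot'[OF a b(1)[of i] b(1)[of j]]) (use b(2)[of i] b(2)[of j] in auto)
    then have "\<bar>q i - q j\<bar> \<le> C * (\<rho> / real (i + 2)) + C * (\<rho> / real (j + 2))"
     unfolding b(3) distrib_left .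
    then show ?thesis using N[OF that(1)] N[OF that(2)] unfolding real_norm_def by linarith
   qed
   then show "\<exists>M. \<forall>m\<ge>M. \<forall>n\<ge>M. norm (q m - q n) < e" by blast
  qed
  then obtain l where l: "q \<longlonglongrightarrow> l" using Cauchy_convergent_iff convergent_def by blast
  have "\<bar>(f x - f a) / (x - a) - l\<bar> \<le> C * \<bar>x - a\<bar>" if x: "\<bar>x\<bar> < \<eta>" "x \<noteq> a" for x
  proof -
   have "(\<lambda>n. \<bar>(f x - f a) / (x - a) - q n\<bar>) \<longlonglongrightarrow> \<bar>(f x - f a) / (x - a) - l\<bar>"
    by (intro tendsto_intros l)
   moreover have "(\<lambda>n. C * \<bar>x - a\<bar> + C * (\<rho> / real (n + 2))) \<longlonglongrightarrow> C * \<bar>x - a\<bar> + 0"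
    by (intro tendsto_intros lim)
   ultimately have "\<bar>(f x - f a) / (x - a) - l\<bar> \<le> C * \<bar>x - a\<bar> + 0"
   proof (rule LIMSEQ_le)
    show "\<exists>N. \<forall>n\<ge>N. \<bar>(f x - f a) / (x - a) - q n\<bar> \<le> C * \<bar>x - a\<bar> + C * (\<rho> / real (n + 2))"
    proof (intro exI allI impI)
     fix n
     show "\<bar>(f x - f a) / (x - a) - q n\<bar> \<le> C * \<bar>x - a\<bar> + C * (\<rho> / real (n + 2))"
      using quot'[OF a x(1) b(1)[of n]] x(2) b(2)[of n] unfolding q_def b(3) distrib_left by auto
    qed
   qed
   then show ?thesis by simp
  qed
  then show ?thesis by blast
 qed
 then obtain g where g: "\<And>a b. \<bar>a\<bar> < \<eta> \<Longrightarrow> \<bar>b\<bar> < \<eta> \<Longrightarrow> b \<noteq> a \<Longrightarrow> \<bar>(f b - f a) / (b - a) - g a\<bar> \<le> C * \<bar>b - a\<bar>"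
  by metis
 have "DERIV f a :> g a" if a: "\<bar>a\<bar> < \<eta>" for a
  unfolding has_field_derivative_iff
 proof (rule tendstoI)
  fix e :: real assume "e > 0"
  define r where "r = min (\<eta> - \<bar>a\<bar>) (e / (C + 1))"
  have "r > 0" using a \<open>e > 0\<close> \<open>0 \<le> C\<close> by (simp add: r_def)
  moreover have "dist ((f b - f a) / (b - a)) (g a) < e" if "b \<noteq> a" "dist b a < r" for b
  proof -
   have "\<bar>b\<bar> < \<eta>" using that by (auto simp: r_def dist_real_def)
   then have "\<bar>(f b - f a) / (b - a) - g a\<bar> \<le> C * \<bar>b - a\<bar>" using g a that by blast
   also have "\<dots> \<le> (C + 1) * \<bar>b - a\<bar>" by (intro mult_right_mono) auto
   also have "\<dots> < (C + 1) * (e / (C + 1))"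
    using that \<open>0 \<le> C\<close> by (intro mult_strict_left_mono) (auto simp: r_def dist_real_def)
   also have "\<dots> = e" using \<open>0 \<le> C\<close> by simp
   finally show ?thesis by (simp add: dist_real_def)
  qed
  ultimately show "\<forall>\<^sub>F b in at a. dist ((f b - f a) / (b - a)) (g a) < e"
   unfolding eventually_at by blast
 qed
 moreover have "\<bar>g a - g b\<bar> \<le> 2 * C * \<bar>a - b\<bar>" if "\<bar>a\<bar> < \<eta>" "\<bar>b\<bar> < \<eta>" for a b
 proof (cases "a = b")
  case False
  have "(f b - f a) / (b - a) = (f a - f b) / (a - b)" by (metis minus_diff_eq minus_divide_divide)
  then show ?thesis using g[OF that] g[OF that(2,1)] False abs_minus_commute[of a b] by simp
 qed simp
 moreover have "\<bar>(f b - f a) / (b - a) - g a\<bar> \<le> 2 * C * \<bar>b - a\<bar>" if "\<bar>a\<bar> < \<eta>" "\<bar>b\<bar> < \<eta>" "a \<noteq> b" for a b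
  using g[OF that(1,2)] that(3) mult_nonneg_nonneg[OF \<open>0 \<le> C\<close>, of "\<bar>b - a\<bar>"] by simp
 ultimately show ?thesis by blast
qed

lemma continuous_on_prod_lipschitz:
 fixes f :: "real \<Rightarrow> real \<Rightarrow> real"
 assumes cont: "\<And>s. s \<in> X \<Longrightarrow> continuous_on Y (f s)" and "0 \<le> C"
  and lip: "\<And>s s' t. s \<in> X \<Longrightarrow> s' \<in> X \<Longrightarrow> t \<in> Y \<Longrightarrow> \<bar>f s t - f s' t\<bar> \<le> C * \<bar>s - s'\<bar>"
 shows "continuous_on (X \<times> Y) (\<lambda>p. f (fst p) (snd p))"
 unfolding continuous_on_iff
proof (intro ballI allI impI)
 fix p e assume p: "p \<in> X \<times> Y" and "0 < (e::real)"
 have "continuous_on Y (f (fst p))" using cont p by auto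
 then obtain r where r: "r > 0" "\<And>t. t \<in> Y \<Longrightarrow> dist t (snd p) < r \<Longrightarrow> dist (f (fst p) t) (f (fst p) (snd p)) < e / 2"
  using p \<open>0 < e\<close> unfolding continuous_on_iff by (metis half_gt_zero mem_Times_iff)
 define r' where "r' = min r (e / (2 * (C + 1)))"
 have "r' > 0" using r \<open>0 < e\<close> \<open>0 \<le> C\<close> by (simp add: r'_def)
 moreover have "dist (f (fst x) (snd x)) (f (fst p) (snd p)) < e" if x: "x \<in> X \<times> Y" "dist x p < r'" for x
 proof -
  have 1: "dist (fst x) (fst p) < r'" "dist (snd x) (snd p) < r'"
   using x(2) dist_fst_le[of x p] dist_snd_le[of x p] by linarith+
  have "\<bar>f (fst x) (snd x) - f (fst p) (snd x)\<bar> \<le> C * \<bar>fst x - fst p\<bar>" using lip x p by auto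
  also have "\<dots> \<le> (C + 1) * \<bar>fst x - fst p\<bar>" by (intro mult_right_mono) auto
  also have "\<dots> \<le> (C + 1) * (e / (2 * (C + 1)))"
   using 1 \<open>0 \<le> C\<close> by (intro mult_left_mono) (auto simp: r'_def dist_real_def)
  also have "\<dots> = e / 2" using \<open>0 \<le> C\<close> by (simp add: field_simps)
  finally have "dist (f (fst x) (snd x)) (f (fst p) (snd x)) \<le> e / 2" by (simp only: dist_real_def)
  moreover have "dist (f (fst p) (snd x)) (f (fst p) (snd p)) < e / 2"
   using r(2)[of "snd x"] 1(2) x(1) by (auto simp: r'_def)
  ultimately show ?thesis using dist_triangle[of "f (fst x) (snd x)" "f (fst p) (snd p)" "f (fst p) (snd x)"] by linarith
 qed
 ultimately show "\<exists>d>0. \<forall>x\<in>X \<times> Y. dist x p < d \<longrightarrow> dist (f (fst x) (snd x)) (f (fst p) (snd p)) < e" by blast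
qed

text \<open>A solution \<open>U\<close> together with a half line \<open>{..T}\<close> on which the linearization along \<open>U\<close> is
 uniformly hyperbolic. The solutions asymptotic to \<open>U\<close> at \<open>-\<infinity>\<close> form a one-parameter family. Up to
 reversal of time this covers the unstable manifold of \<open>(0, 0, -1)\<close> (second alternative of
 \<open>sign\<close>) as well as the stable manifold of \<open>(1, 0, 1)\<close> (first alternative).\<close>

locale branch = ramp_eq +
 fixes U V :: "real \<Rightarrow> real" and T \<delta> q :: real
 assumes UV: "tsol U V" and U_pos: "\<And>t. 0 < U t" and U_less: "\<And>t. U t < 1"
  and V_lim: "(V \<longlongrightarrow> 0) at_bot" and kU: "\<exists>B. \<forall>t\<le>T. exp (- k * t) * U t \<le> B" and k_ne: "k \<noteq> 0"
  and \<delta>: "0 < \<delta>" "\<delta> \<le> 1/2" and q: "0 < q"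
  and Q: "\<And>t a b. \<lbrakk>t \<le> T; \<bar>a - U t\<bar> \<le> \<delta>; \<bar>b - U t\<bar> \<le> \<delta>\<rbrakk> \<Longrightarrow> q \<le> a\<^sup>2 + a * b + b\<^sup>2 - m t"
  and sign: "(\<forall>t\<le>T. \<delta> < U t) \<or> (\<forall>t\<le>T. U t \<le> \<delta>) \<and> (U \<longlongrightarrow> 0) at_bot"
begin

definition cls :: "(real \<Rightarrow> real) \<Rightarrow> (real \<Rightarrow> real) \<Rightarrow> bool" where
 "cls u v \<longleftrightarrow> tsol u v \<and> (\<forall>t\<le>T. \<bar>u t - U t\<bar> \<le> \<delta>) \<and>
   ((\<lambda>t. u t - U t) \<longlongrightarrow> 0) at_bot \<and> ((\<lambda>t. v t - V t) \<longlongrightarrow> 0) at_bot"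

lemma cls_tsol: "cls u v \<Longrightarrow> tsol u v" by (simp add: cls_def)

lemma cls_le2: assumes "cls u v" "t \<le> T" shows "\<bar>u t\<bar> \<le> 2"
proof -
 have "\<bar>u t - U t\<bar> \<le> \<delta>" using assms by (auto simp: cls_def)
 then show ?thesis using U_pos[of t] U_less[of t] \<delta> by linarith
qed

lemma cls_base: "cls U V" using UV \<delta> by (simp add: cls_def)

definition quot :: "(real \<Rightarrow> real) \<Rightarrow> (real \<Rightarrow> real) \<Rightarrow> real \<Rightarrow> real" where
 "quot u u' t = (u t)\<^sup>2 + u t * u' t + (u' t)\<^sup>2 - m t"

lemma cls_quot: "cls u v \<Longrightarrow> cls u' v' \<Longrightarrow> t \<le> T \<Longrightarrow> q \<le> quot u u' t"
 unfolding quot_def by (rule Q) (auto simp: cls_def)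

lemma cls_limits:
 assumes "cls u v" "cls u' v'"
 shows "((\<lambda>t. u t - u' t) \<longlongrightarrow> 0) at_bot" "((\<lambda>t. v t - v' t) \<longlongrightarrow> 0) at_bot"
proof -
 have l: "((\<lambda>t. u t - U t) \<longlongrightarrow> 0) at_bot" "((\<lambda>t. v t - V t) \<longlongrightarrow> 0) at_bot"
  "((\<lambda>t. u' t - U t) \<longlongrightarrow> 0) at_bot" "((\<lambda>t. v' t - V t) \<longlongrightarrow> 0) at_bot"
  using assms unfolding cls_def by blast+
 from tendsto_diff[OF l(1,3)] tendsto_diff[OF l(2,4)] show "((\<lambda>t. u t - u' t) \<longlongrightarrow> 0) at_bot" "((\<lambda>t. v t - v' t) \<longlongrightarrow> 0) at_bot" by simp_all
qed

lemma cls_diff: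
 assumes "cls u v" "cls u' v'" "t \<le> T"
 shows "DERIV (\<lambda>t. u t - u' t) t :> v t - v' t"
  "DERIV (\<lambda>t. v t - v' t) t :> k * (v t - v' t) + quot u u' t * (u t - u' t)"
  "0 \<le> quot u u' t"
 using tsol_diff(1)[of u v u' v'] tsol_diff_quotient[of u v u' v'] cls_le2 cls_tsol cls_quot[OF assms] q assms
 by (auto simp: quot_def)

text \<open>By the maximum principle |u - u'| is nondecreasing up to \<open>T\<close>, so a common
  value at \<open>c\<close> forces agreement on the half line before it, hence also equal slopes
  there.\<close>

lemma cls_eqI:
 assumes uu: "cls u v" "cls u' v'" and "c \<le> T" "u c = u' c"
 shows "u = u'" "v = v'"
proof -
 have d0: "u s - u' s = 0" if "s \<le> c" for s
  using vanishing_abs_mono[of T "\<lambda>t. u t - u' t" "\<lambda>t. v t - v' t" k "quot u u'" s c]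
   cls_diff[OF uu] cls_limits[OF uu] that assms(3,4) by auto
 have "v (c - 1) - v' (c - 1) = 0"
  using DERIV_local_const[OF cls_diff(1)[OF uu, of "c - 1"], of 1] d0 \<open>c \<le> T\<close>
  by (auto simp: abs_less_iff)
 then show "u = u'" "v = v'"
  using tsol_unique[OF cls_tsol[OF uu(1)] cls_tsol[OF uu(2)], of "c - 1"] d0[of "c - 1"] by auto
qed

lemma cls_order:
 assumes uu: "cls u v" "cls u' v'" and "u T < u' T" "t \<le> T"
 shows "u t < u' t"
proof (rule ccontr)
 assume "\<not> u t < u' t"
 moreover have "continuous_on {t..T} (\<lambda>t. u' t - u t)"
  by (intro continuous_intros tsol_cont[OF cls_tsol[OF uu(1)]] tsol_cont[OF cls_tsol[OF uu(2)]])
 moreover have "u' t - u t \<le> 0" "0 < u' T - u T" using calculation(1) assms(3) by simp_all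
 ultimately obtain c where "c < T" "u' c - u c = 0"
  by (rule_tac last_zero[of t T "\<lambda>t. u' t - u t"]) (use assms(4) in simp_all)
 then have "u = u'" using cls_eqI(1)[OF uu, of c] by simp
 then show False using assms(3) by simp
qed

text \<open>When \<open>U\<close> stays away from zero this is closeness to \<open>U\<close>. When
  \<open>U\<close> tends to zero, the zero solution itself belongs to the family, and the order of
  the family gives positivity.\<close>

lemma cls_pos:
 assumes "cls u v" "0 < u T" "t \<le> T" shows "0 < u t"
 using sign
proof
 assume "\<forall>t\<le>T. \<delta> < U t"
 then have "\<delta> < U t" "\<bar>u t - U t\<bar> \<le> \<delta>" using assms by (auto simp: cls_def)
 then show ?thesis by linarith
next
 assume *: "(\<forall>t\<le>T. U t \<le> \<delta>) \<and> (U \<longlongrightarrow> 0) at_bot"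
 have "cls (\<lambda>_. 0) (\<lambda>_. 0)"
  using * tsol_zero U_pos tendsto_minus[OF V_lim] tendsto_minus[of U 0 at_bot] less_imp_le[OF U_pos]
  by (auto simp: cls_def)
 then show ?thesis using cls_order[of "\<lambda>_. 0" "\<lambda>_. 0" u v t] assms by auto
qed

lemma cls_slopes:
 assumes uu: "cls u v" "cls u' v'" and less: "u T < u' T" and t: "t \<le> T"
 shows "0 \<le> v' t - v t" "k * (u' t - u t) \<le> v' t - v t" "v' t - v t \<le> 200 * (u' t - u t)"
  "u' t - u t \<le> u' T - u T"
proof -
 have pos: "\<And>t. t \<le> T \<Longrightarrow> 0 < u' t - u t" using cls_order[OF uu less] by simp
 show "0 \<le> v' t - v t" "k * (u' t - u t) \<le> v' t - v t"
  using vanishing_slope_bound[of T "\<lambda>t. u' t - u t" "\<lambda>t. v' t - v t" k "quot u' u" t]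
   cls_diff[OF uu(2,1)] cls_limits[OF uu(2,1)] pos t by auto
 show "v' t - v t \<le> 200 * (u' t - u t)"
  by (rule log_slope_bound[OF cls_tsol[OF uu(2)] cls_tsol[OF uu(1)]]) (use pos t in auto)
 have "\<bar>u' t - u t\<bar> \<le> \<bar>u' T - u T\<bar>"
  using vanishing_abs_mono[of T "\<lambda>t. u' t - u t" "\<lambda>t. v' t - v t" k "quot u' u" t T]
   cls_diff[OF uu(2,1)] cls_limits[OF uu(2,1)] t by auto
 then show "u' t - u t \<le> u' T - u T" using pos[OF t] pos[of T] by simp
qed

text \<open>Differences grow at least at the rate \<open>k\<close> by \<open>cls_slopes\<close>, so
  the weighted difference is nondecreasing. The weight is the one from Abel's formula, and the
  resulting boundedness makes weighted Wronskians vanish at minus infinity.\<close>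

lemma cls_weighted_bounded_aux:
 assumes uu: "cls u v" "cls u' v'" and less: "u T < u' T" and t: "t \<le> T"
 shows "exp (- k * t) * (u' t - u t) \<le> exp (- k * T) * (u' T - u T)"
proof (rule deriv_nonneg_mono[OF t])
 fix x assume x: "t \<le> x" "x \<le> T"
 note d = cls_diff[OF uu(2,1) x(2)]
 show "((\<lambda>t. exp (- k * t) * (u' t - u t)) has_real_derivative
   exp (- k * x) * ((v' x - v x) - k * (u' x - u x))) (at x)"
  by (rule DERIV_cong, rule DERIV_mult[OF _ d(1)]) (auto intro!: derivative_eq_intros simp: algebra_simps)
 show "0 \<le> exp (- k * x) * ((v' x - v x) - k * (u' x - u x))"
  using cls_slopes(2)[OF uu less x(2)] by simp
qed

lemma cls_weighted_bounded:
 assumes "cls u v" "cls u' v'"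
 shows "\<exists>B. \<forall>t\<le>T. \<bar>exp (- k * t) * (u' t - u t)\<bar> \<le> B"
proof (cases "u T = u' T")
 case True
 then have "u = u'" using cls_eqI[OF assms, of T] by auto
 then show ?thesis by auto
next
 case False
 then have "\<bar>exp (- k * t) * (u' t - u t)\<bar> \<le> exp (- k * T) * \<bar>u' T - u T\<bar>" if "t \<le> T" for t
  using cls_weighted_bounded_aux[OF assms _ that] cls_weighted_bounded_aux[OF assms(2,1) _ that]
   cls_order[OF assms _ that] cls_order[OF assms(2,1) _ that]
  by (cases "u T < u' T") (auto simp: abs_mult)
 then show ?thesis by blast
qed

lemma cls_weighted_bounded0:
 assumes "cls u v"
 shows "\<exists>B. \<forall>t\<le>T. \<bar>exp (- k * t) * u t\<bar> \<le> B"
proof -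
 obtain B where B: "\<And>t. t \<le> T \<Longrightarrow> \<bar>exp (- k * t) * (u t - U t)\<bar> \<le> B"
  using cls_weighted_bounded[OF cls_base assms] by auto
 obtain B' where B': "\<And>t. t \<le> T \<Longrightarrow> exp (- k * t) * U t \<le> B'" using kU by auto
 have "\<bar>exp (- k * t) * u t\<bar> \<le> B + B'" if "t \<le> T" for t
 proof -
  have "exp (- k * t) * u t = exp (- k * t) * (u t - U t) + exp (- k * t) * U t" by (simp add: algebra_simps)
  moreover have "0 \<le> exp (- k * t) * U t" using U_pos[of t] by simp
  ultimately show ?thesis using B[OF that] B'[OF that] by linarith
 qed
 then show ?thesis by blast
qed

lemma cls_v_lim: assumes "cls u v" shows "(v \<longlongrightarrow> 0) at_bot"
proof -
 have "((\<lambda>t. (v t - V t) + V t) \<longlongrightarrow> 0 + 0) at_bot"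
  using assms V_lim by (intro tendsto_add) (auto simp: cls_def)
 then show ?thesis by simp
qed

text \<open>The parameter is the offset from \<open>U\<close> at time \<open>T\<close>. For |s|
  \<le> \<delta> a member with this offset exists, and by \<open>cls_eqI\<close> it is the only
  one.\<close>

definition fam :: "real \<Rightarrow> (real \<Rightarrow> real) \<times> (real \<Rightarrow> real)" where
 "fam s = (SOME p. cls (fst p) (snd p) \<and> fst p T = U T + s)"

definition us :: "real \<Rightarrow> real \<Rightarrow> real" where "us s = fst (fam s)"
definition vs :: "real \<Rightarrow> real \<Rightarrow> real" where "vs s = snd (fam s)"

lemma cls_us: assumes "\<bar>s\<bar> \<le> \<delta>" shows "cls (us s) (vs s)" "us s T = U T + s"
proof -
 have "\<exists>u v. tsol u v \<and> u T = U T + s \<and> (\<forall>t\<le>T. \<bar>u t - U t\<bar> \<le> \<bar>s\<bar>) \<and>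
  ((\<lambda>t. u t - U t) \<longlongrightarrow> 0) at_bot \<and> ((\<lambda>t. v t - V t) \<longlongrightarrow> 0) at_bot"
 proof (rule decaying_solution_exists[OF UV _ q])
  show "\<bar>U t\<bar> + \<bar>s\<bar> \<le> 2" for t using U_pos[of t] U_less[of t] \<delta> assms by linarith
  show "q \<le> x\<^sup>2 + x * U t + (U t)\<^sup>2 - m t" if "t \<le> T" "\<bar>x - U t\<bar> \<le> \<bar>s\<bar>" for t x
   using Q[of t x "U t"] that assms \<delta> by auto
 qed
 then obtain u v where "cls u v" "u T = U T + s" unfolding cls_def using assms by force
 then have "\<exists>p. cls (fst p) (snd p) \<and> fst p T = U T + s" by (metis fst_conv snd_conv)
 from someI_ex[OF this] show "cls (us s) (vs s)" "us s T = U T + s"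
  unfolding us_def vs_def fam_def by auto
qed

lemma us_unique: assumes "cls u v" "\<bar>u T - U T\<bar> \<le> \<delta>"
 shows "us (u T - U T) = u" "vs (u T - U T) = v"
 using cls_eqI[OF cls_us(1)[OF assms(2)] assms(1), of T] cls_us(2)[OF assms(2)] by auto

lemma us_0: "us 0 = U" "vs 0 = V" using us_unique[OF cls_base] \<delta> by auto

lemma us_lipschitz:
 assumes "\<bar>s\<bar> \<le> \<delta>" "\<bar>s'\<bar> \<le> \<delta>" "t \<le> t1" "T \<le> t1"
 shows "\<bar>us s t - us s' t\<bar> \<le> 400 * exp (9 * (t1 - T)) * \<bar>s - s'\<bar>"
  "\<bar>vs s t - vs s' t\<bar> \<le> 400 * exp (9 * (t1 - T)) * \<bar>s - s'\<bar>"
proof -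
 have main: "\<bar>us s t - us s' t\<bar> \<le> 400 * exp (9 * (t1 - T)) * \<bar>s - s'\<bar> \<and>
  \<bar>vs s t - vs s' t\<bar> \<le> 400 * exp (9 * (t1 - T)) * \<bar>s - s'\<bar>" if s: "\<bar>s\<bar> \<le> \<delta>" "\<bar>s'\<bar> \<le> \<delta>" "s < s'" for s s'
 proof -
  note c = cls_us[OF s(1)] cls_us[OF s(2)]
  have less: "us s T < us s' T" using c s by simp
  have left: "\<bar>us s r - us s' r\<bar> \<le> 200 * \<bar>s - s'\<bar> \<and> \<bar>vs s r - vs s' r\<bar> \<le> 200 * \<bar>s - s'\<bar>" if "r \<le> T" for r
   using cls_slopes[OF c(1,3) less that] cls_order[OF c(1,3) less that] c(2,4) by auto
  show ?thesis
  proof (cases "t \<le> T")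
   case True
   have "1 \<le> exp (9 * (t1 - T))" using assms(4) by simp
   then have "200 * \<bar>s - s'\<bar> \<le> 400 * exp (9 * (t1 - T)) * \<bar>s - s'\<bar>"
    by (intro mult_right_mono) (linarith, simp)
   then show ?thesis using left[OF True] by linarith
  next
   case False
   then show ?thesis
    using tsol_dependence_abs[OF cls_tsol[OF c(1)] cls_tsol[OF c(3)], of T "200 * \<bar>s - s'\<bar>" t "t1 - T"] left[of T] assms
    by (auto simp: mult_ac)
  qed
 qed
 show "\<bar>us s t - us s' t\<bar> \<le> 400 * exp (9 * (t1 - T)) * \<bar>s - s'\<bar>"
  "\<bar>vs s t - vs s' t\<bar> \<le> 400 * exp (9 * (t1 - T)) * \<bar>s - s'\<bar>"
  using main[OF assms(1,2)] main[OF assms(2,1)]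
  by (cases s s' rule: linorder_cases; simp add: abs_minus_commute)+
qed

text \<open>Past \<open>T\<close> finite-time dependence takes the place of hyperbolicity. On the
  compact interval up to \<open>t1\<close> the positive minimum of \<open>U\<close> and the bound on
  |V| survive for small |s|; before \<open>T\<close> positivity comes from
  \<open>cls_pos\<close>.\<close>

lemma us_bounds:
 assumes "T \<le> t1"
 obtains \<eta> K where "0 < \<eta>" "\<eta> \<le> \<delta>" "0 \<le> K"
  "\<And>s t. \<bar>s\<bar> \<le> \<eta> \<Longrightarrow> t \<le> t1 \<Longrightarrow> 0 < us s t \<and> us s t < 2"
  "\<And>s t. \<bar>s\<bar> \<le> \<eta> \<Longrightarrow> T \<le> t \<Longrightarrow> t \<le> t1 \<Longrightarrow> - K * us s t \<le> vs s t"
proof -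
 define L where "L = 400 * exp (9 * (t1 - T))"
 have "L > 0" by (simp add: L_def)
 have "\<exists>a\<in>{T..t1}. \<forall>t\<in>{T..t1}. U a \<le> U t"
  by (rule continuous_attains_inf) (use assms tsol_cont[OF UV] in auto)
 then obtain a where a: "\<And>t. t \<in> {T..t1} \<Longrightarrow> U a \<le> U t" by blast
 have "\<exists>b\<in>{T..t1}. \<forall>t\<in>{T..t1}. \<bar>V t\<bar> \<le> \<bar>V b\<bar>"
  by (rule continuous_attains_sup) (use assms tsol_cont[OF UV] in \<open>auto intro!: continuous_on_rabs\<close>)
 then obtain b where b: "\<And>t. t \<in> {T..t1} \<Longrightarrow> \<bar>V t\<bar> \<le> \<bar>V b\<bar>" by blast
 define \<eta> where "\<eta> = min \<delta> (U a / (2 * L))"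
 define K where "K = (\<bar>V b\<bar> + 1) * (2 / U a)"
 have \<eta>: "0 < \<eta>" "\<eta> \<le> \<delta>" using \<delta> U_pos \<open>L > 0\<close> by (auto simp: \<eta>_def)
 have L\<eta>: "L * \<bar>s\<bar> \<le> U a / 2" if "\<bar>s\<bar> \<le> \<eta>" for s
  using that \<open>L > 0\<close> by (simp add: \<eta>_def field_simps)
 have near: "\<bar>us s t - U t\<bar> \<le> U a / 2" "\<bar>vs s t - V t\<bar> \<le> U a / 2" if "\<bar>s\<bar> \<le> \<eta>" "t \<le> t1" for s t
  using us_lipschitz[of s 0 t t1] that \<eta> \<delta> assms L\<eta>[OF that(1)] by (auto simp: us_0 L_def)
 have pos: "U a / 2 \<le> us s t" if "\<bar>s\<bar> \<le> \<eta>" "t \<in> {T..t1}" for s t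
 proof -
  have "t \<le> t1" using that by simp
  then show ?thesis using near(1)[OF that(1), of t] a[OF that(2)] by linarith
 qed
 have "0 < us s t \<and> us s t < 2" if s: "\<bar>s\<bar> \<le> \<eta>" and t: "t \<le> t1" for s t
 proof -
  have "0 < us s t"
  proof (cases "t \<le> T")
   case True
   have "0 < us s T" using pos[OF s, of T] U_pos[of a] assms by auto
   then show ?thesis using cls_pos[OF cls_us(1)] s \<eta> True by force
  next
   case False
   then show ?thesis using pos[OF s, of t] t U_pos[of a] by auto
  qed
  moreover have "us s t < 2" using near(1)[OF s t] U_less[of t] U_less[of a] by linarith
  ultimately show ?thesis by simp
 qed
 moreover have "- K * us s t \<le> vs s t" if "\<bar>s\<bar> \<le> \<eta>" "T \<le> t" "t \<le> t1" for s t
 proof -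
  have "\<bar>V b\<bar> + 1 = K * (U a / 2)" using U_pos[of a] by (simp add: K_def)
  also have "\<dots> \<le> K * us s t" using pos[of s t] that U_pos[of a] by (intro mult_left_mono) (auto simp: K_def)
  finally have "\<bar>V b\<bar> + 1 \<le> K * us s t" .
  moreover have "\<bar>vs s t - V t\<bar> \<le> U a / 2" "\<bar>V t\<bar> \<le> \<bar>V b\<bar>" using near(2)[of s t] b[of t] that by auto
  moreover have "- K * us s t = - (K * us s t)" by simp
  ultimately show ?thesis using U_less[of a] by linarith
 qed
 moreover have "0 \<le> K" using U_pos[of a] by (simp add: K_def)
 ultimately show ?thesis using that \<eta> by blast
qed

end

section \<open>Differentiable dependence on the family parameter\<close>

lemma abs_diff_le_ln_diff:
 fixes x y M :: real
 assumes "0 < x" "x \<le> M" "0 < y" "y \<le> M"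
 shows "\<bar>x - y\<bar> \<le> M * \<bar>ln x - ln y\<bar>"
proof -
 have *: "x - y \<le> M * (ln x - ln y)" if "0 < y" "y \<le> x" "x \<le> M" for x y :: real
 proof -
  have "ln y - ln x \<le> (y - x) / x" using that by (intro ln_diff_le) auto
  then have "(x - y) / x \<le> ln x - ln y" by (simp add: diff_divide_distrib)
  then have "x - y \<le> x * (ln x - ln y)" using that by (simp add: field_simps)
  also have "\<dots> \<le> M * (ln x - ln y)" using that by (intro mult_right_mono) auto
  finally show ?thesis .
 qed
 show ?thesis using *[of y x] *[of x y] assms by (cases "x \<le> y") (auto simp: abs_minus_commute)
qed

text \<open>A context for the constants that \<open>us_bounds\<close> delivers for a fixed end time
  \<open>t1\<close>.\<close>

locale branch_box = branch +
 fixes t1 \<eta> K :: real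
 assumes Tt1: "T \<le> t1" and \<eta>: "0 < \<eta>" "\<eta> \<le> \<delta>" and K0: "0 \<le> K"
  and us_range: "\<And>s t. \<bar>s\<bar> \<le> \<eta> \<Longrightarrow> t \<le> t1 \<Longrightarrow> 0 < us s t \<and> us s t < 2"
  and lower: "\<And>s t. \<bar>s\<bar> \<le> \<eta> \<Longrightarrow> T \<le> t \<Longrightarrow> t \<le> t1 \<Longrightarrow> - K * us s t \<le> vs s t"
begin

definition d :: "real \<Rightarrow> real \<Rightarrow> real \<Rightarrow> real" where "d a b t = us b t - us a t"
definition e :: "real \<Rightarrow> real \<Rightarrow> real \<Rightarrow> real" where "e a b t = vs b t - vs a t"

definition pair :: "real \<Rightarrow> real \<Rightarrow> bool" where "pair a b \<longleftrightarrow> - \<eta> \<le> a \<and> a < b \<and> b \<le> \<eta>"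

lemma pairD: assumes "pair a b" shows "\<bar>a\<bar> \<le> \<eta>" "\<bar>b\<bar> \<le> \<eta>" "a < b"
 using assms by (auto simp: pair_def)

lemma cls_u: "\<bar>s\<bar> \<le> \<eta> \<Longrightarrow> cls (us s) (vs s)" and us_T: "\<bar>s\<bar> \<le> \<eta> \<Longrightarrow> us s T = U T + s"
 using cls_us[of s] \<eta> by auto

lemma tsol_u: "\<bar>s\<bar> \<le> \<eta> \<Longrightarrow> tsol (us s) (vs s)" using cls_u cls_tsol by blast

lemma d_T: "pair a b \<Longrightarrow> d a b T = b - a" using us_T pairD by (simp add: d_def)

lemma d_deriv: assumes "pair a b" shows "DERIV (d a b) t :> e a b t"
 unfolding d_def[abs_def] e_def using tsol_diff(1)[OF tsol_u tsol_u] pairD[OF assms] by blast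

lemma e_deriv:
 assumes "pair a b" "t \<le> t1"
 shows "DERIV (e a b) t :> k * e a b t + quot (us b) (us a) t * d a b t"
proof -
 have "\<bar>us a t\<bar> \<le> 2" "\<bar>us b t\<bar> \<le> 2"
  using us_range[OF pairD(1)[OF assms(1)] assms(2)] us_range[OF pairD(2)[OF assms(1)] assms(2)] by auto
 then show ?thesis unfolding d_def e_def[abs_def] quot_def
  using tsol_diff_quotient[OF tsol_u tsol_u] pairD[OF assms(1)] by blast
qed

text \<open>The Wronskian of two members, times the factor from Abel's formula. The first-order term
  and \<open>m\<close> cancel in its derivative, and what the cubic leaves has the sign of
  \<open>us b - us a\<close>. It compares the logarithmic slopes of the two members.\<close>

definition wr :: "real \<Rightarrow> real \<Rightarrow> real \<Rightarrow> real" where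
 "wr a b t = exp (- k * t) * (vs b t * us a t - us b t * vs a t)"

lemma wr_eq: "wr a b t = exp (- k * t) * (e a b t * us a t - d a b t * vs a t)"
 by (simp add: wr_def e_def d_def algebra_simps)

lemma wr_deriv:
 assumes "\<bar>a\<bar> \<le> \<eta>" "\<bar>b\<bar> \<le> \<eta>" "t \<le> t1"
 shows "DERIV (wr a b) t :> exp (- k * t) * (us a t * us b t * ((us b t)\<^sup>2 - (us a t)\<^sup>2))"
proof -
 have 2: "\<bar>us a t\<bar> \<le> 2" "\<bar>us b t\<bar> \<le> 2"
  using us_range[OF assms(1,3)] us_range[OF assms(2,3)] by auto
 note a = tsolD[OF tsol_u[OF assms(1)], of t] and b = tsolD[OF tsol_u[OF assms(2)], of t]
 have E: "DERIV (\<lambda>t. exp (- k * t)) t :> - k * exp (- k * t)"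
  by (auto intro!: derivative_eq_intros)
 show ?thesis unfolding wr_def[abs_def]
  by (rule DERIV_cong[OF DERIV_mult[OF E DERIV_diff[OF DERIV_mult[OF b(2) a(1)] DERIV_mult[OF b(1) a(2)]]]])
    (simp add: cub_eq[OF 2(1)] cub_eq[OF 2(2)] power2_eq_square power3_eq_cube algebra_simps)
qed

lemma wr_lim:
 assumes "\<bar>a\<bar> \<le> \<eta>" "\<bar>b\<bar> \<le> \<eta>" shows "(wr a b \<longlongrightarrow> 0) at_bot"
proof -
 obtain B where B: "\<And>t. t \<le> T \<Longrightarrow> \<bar>exp (- k * t) * us a t\<bar> \<le> B"
  using cls_weighted_bounded0[OF cls_u[OF assms(1)]] by blast
 obtain B' where B': "\<And>t. t \<le> T \<Longrightarrow> \<bar>exp (- k * t) * (us b t - us a t)\<bar> \<le> B'"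
  using cls_weighted_bounded[OF cls_u[OF assms(1)] cls_u[OF assms(2)]] by blast
 have "((\<lambda>t. exp (- k * t) * us a t * (vs b t - vs a t)) \<longlongrightarrow> 0) at_bot"
  by (rule lim_null_mult_left_bounded[OF _ cls_limits(2)[OF cls_u[OF assms(2)] cls_u[OF assms(1)]]])
    (use B in \<open>auto intro!: eventually_at_bot_linorderI[of T]\<close>)
 moreover have "((\<lambda>t. exp (- k * t) * (us b t - us a t) * vs a t) \<longlongrightarrow> 0) at_bot"
  by (rule lim_null_mult_left_bounded[OF _ cls_v_lim[OF cls_u[OF assms(1)]]])
    (use B' in \<open>auto intro!: eventually_at_bot_linorderI[of T]\<close>)
 ultimately have "((\<lambda>t. exp (- k * t) * us a t * (vs b t - vs a t) - exp (- k * t) * (us b t - us a t) * vs a t)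
   \<longlongrightarrow> 0 - 0) at_bot" by (rule tendsto_diff)
 then show ?thesis unfolding wr_eq[abs_def] e_def d_def by (simp add: algebra_simps)
qed

lemma wr_mono_aux:
 assumes "pair a b" "s \<le> t" "t \<le> t1" "\<And>r. s \<le> r \<Longrightarrow> r \<le> t \<Longrightarrow> 0 \<le> d a b r"
 shows "wr a b s \<le> wr a b t"
proof (rule deriv_nonneg_mono[OF assms(2)])
 fix x assume x: "s \<le> x" "x \<le> t"
 then have xt: "x \<le> t1" using assms(3) by simp
 show "DERIV (wr a b) x :> exp (- k * x) * (us a x * us b x * ((us b x)\<^sup>2 - (us a x)\<^sup>2))"
  by (rule wr_deriv[OF pairD(1,2)[OF assms(1)] xt])
 have "0 < us a x" "0 < us b x" "us a x \<le> us b x"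
  using us_range[OF pairD(1)[OF assms(1)] xt] us_range[OF pairD(2)[OF assms(1)] xt] assms(4)[OF x] by (auto simp: d_def)
 then have "(us a x)\<^sup>2 \<le> (us b x)\<^sup>2" by (intro power_mono) auto
 then show "0 \<le> exp (- k * x) * (us a x * us b x * ((us b x)\<^sup>2 - (us a x)\<^sup>2))"
  using \<open>0 < us a x\<close> \<open>0 < us b x\<close> by simp
qed

lemma wr_nonneg_aux:
 assumes "pair a b" "t \<le> t1" "\<And>r. r \<le> t \<Longrightarrow> 0 \<le> d a b r"
 shows "0 \<le> wr a b t"
proof (rule tendsto_upperbound[OF wr_lim[OF pairD(1,2)[OF assms(1)]]])
 show "\<forall>\<^sub>F s in at_bot. wr a b s \<le> wr a b t"
  by (rule eventually_at_bot_linorderI[of t]) (use wr_mono_aux[OF assms(1) _ assms(2)] assms(3) in auto)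
qed simp

text \<open>Past \<open>T\<close> the coefficient \<open>quot\<close> may be negative, so the
  Wronskian replaces the maximum principle. At a first contact it is nonnegative and forces e \<ge>
  0, whereas d falling to zero forces e \<le> 0; then both vanish and the two solutions
  coincide.\<close>

lemma d_pos:
 assumes p: "pair a b" and t: "t \<le> t1" shows "0 < d a b t"
proof (rule ccontr)
 assume neg: "\<not> 0 < d a b t"
 note cl = cls_u[OF pairD(1)[OF p]] cls_u[OF pairD(2)[OF p]]
 have left: "0 < d a b r" if "r \<le> T" for r
  using cls_order[OF cl _ that] us_T pairD[OF p] by (auto simp: d_def)
 then have "T \<le> t" using neg left[of t] by linarith
 moreover have "continuous_on {T..t} (d a b)"
  by (rule DERIV_continuous_on, rule has_field_derivative_at_within, rule d_deriv[OF p])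
 ultimately obtain c where c: "T < c" "c \<le> t" "d a b c = 0" "\<And>r. T \<le> r \<Longrightarrow> r < c \<Longrightarrow> 0 < d a b r"
  using first_zero[of T t "d a b"] neg left[of T] by (metis linorder_not_less order_refl)
 have nn: "0 \<le> d a b r" if "r \<le> c" for r
  using left[of r] c(4)[of r] c(3) that by (cases "r \<le> T"; cases "r = c") auto
 have ct: "c \<le> t1" using c t by simp
 have "0 \<le> wr a b c" using wr_nonneg_aux[OF p ct nn] .
 then have "0 \<le> e a b c * us a c" using c(3) by (simp add: wr_eq zero_le_mult_iff)
 then have "0 \<le> e a b c" using us_range[OF pairD(1)[OF p] ct] by (simp add: zero_le_mult_iff)
 moreover have "e a b c \<le> 0"
 proof (rule ccontr)
  assume "\<not> e a b c \<le> 0"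
  then obtain h where h: "h > 0" "\<And>x. 0 < x \<Longrightarrow> x < h \<Longrightarrow> d a b (c - x) < d a b c"
   using DERIV_pos_inc_left[OF d_deriv[OF p], of c] by auto
  then have "d a b (c - h / 2) < 0" using h(2)[of "h / 2"] c(3) by simp
  then show False using nn[of "c - h / 2"] h(1) by simp
 qed
 ultimately have "us b = us a"
  using tsol_unique(1)[OF tsol_u[OF pairD(2)[OF p]] tsol_u[OF pairD(1)[OF p]], of c] c(3) by (auto simp: d_def e_def)
 then show False using left[of T] by (simp add: d_def)
qed

lemma wr_nonneg: "pair a b \<Longrightarrow> t \<le> t1 \<Longrightarrow> 0 \<le> wr a b t"
 using wr_nonneg_aux d_pos less_imp_le order_trans by metis

text \<open>The upper bound is \<open>log_slope_bound\<close>. For the lower one, nonnegativity of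
  the Wronskian says that e / d is at least v / u of the lower member, and \<open>lower\<close>
  bounds that ratio on the compact part.\<close>

lemma slope_bounds:
 assumes p: "pair a b" and t: "t \<le> t1"
 shows "e a b t \<le> 200 * d a b t" "- K * d a b t \<le> e a b t"
proof -
 show "e a b t \<le> 200 * d a b t" unfolding e_def d_def
  by (rule log_slope_bound[OF tsol_u tsol_u]) (use pairD[OF p] d_pos[OF p] t in \<open>auto simp: d_def\<close>)
 show "- K * d a b t \<le> e a b t"
 proof (cases "t \<le> T")
  case True
  have "0 \<le> e a b t" unfolding e_def
   using cls_slopes(1)[OF cls_u[OF pairD(1)[OF p]] cls_u[OF pairD(2)[OF p]] _ True] us_T pairD[OF p] by auto
  then show ?thesis using mult_nonneg_nonneg[OF K0, of "d a b t"] d_pos[OF p t] by auto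
 next
  case False
  have ua: "0 < us a t" using us_range pairD[OF p] t by blast
  have "0 \<le> e a b t * us a t - d a b t * vs a t"
   using wr_nonneg[OF p t] by (simp add: wr_eq zero_le_mult_iff)
  moreover have "d a b t * (- K * us a t) \<le> d a b t * vs a t"
   using lower[of a t] pairD[OF p] False t d_pos[OF p t] by (intro mult_left_mono) auto
  ultimately have "(- K * d a b t) * us a t \<le> e a b t * us a t" by (simp add: algebra_simps)
  then show ?thesis using ua by (simp only: mult_le_cancel_right_pos)
 qed
qed

lemma slope_bounds_left:
 assumes p: "pair a b" and t: "t \<le> T"
 shows "0 \<le> e a b t" "k * d a b t \<le> e a b t" "0 < d a b t"
 using cls_slopes(1,2)[OF cls_u[OF pairD(1)[OF p]] cls_u[OF pairD(2)[OF p]] _ t] us_T pairD[OF p]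
  d_pos[OF p order_trans[OF t Tt1]] by (auto simp: e_def d_def)

definition "LU = 400 * exp (9 * (t1 - T))"
text \<open>The constant of \<open>slope_quotient_one_sided\<close>: the summand with |k| comes from
  the half line before \<open>T\<close>, the other summand and the exponential from comparison on
  the interval between \<open>T\<close> and \<open>t1\<close>.\<close>

definition "CY = (6 * LU / \<bar>k\<bar> + 6 * LU * (t1 - T)) * exp ((2 + 2 * K) * (t1 - T))"

lemma LU_pos: "0 < LU" by (simp add: LU_def)
lemma CY_nonneg: "0 \<le> CY" using LU_pos Tt1 by (simp add: CY_def)

lemma quot_lipschitz:
 assumes "\<bar>a\<bar> \<le> \<eta>" "\<bar>b\<bar> \<le> \<eta>" "\<bar>a'\<bar> \<le> \<eta>" "\<bar>b'\<bar> \<le> \<eta>" "t \<le> t1"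
 shows "\<bar>quot (us b) (us a) t - quot (us b') (us a') t\<bar> \<le> 6 * LU * (\<bar>a - a'\<bar> + \<bar>b - b'\<bar>)"
proof -
 define x y x' y' where "x = us b t" and "y = us a t" and "x' = us b' t" and "y' = us a' t"
 have r: "0 < x" "x < 2" "0 < y" "y < 2" "0 < x'" "x' < 2" "0 < y'" "y' < 2"
  using us_range[OF assms(1,5)] us_range[OF assms(2,5)] us_range[OF assms(3,5)] us_range[OF assms(4,5)]
  by (simp_all add: x_def y_def x'_def y'_def)
 have l: "\<bar>x - x'\<bar> \<le> LU * \<bar>b - b'\<bar>" "\<bar>y - y'\<bar> \<le> LU * \<bar>a - a'\<bar>"
  unfolding x_def y_def x'_def y'_def LU_def
  by (rule us_lipschitz(1)[OF order_trans[OF assms(2) \<eta>(2)] order_trans[OF assms(4) \<eta>(2)] assms(5) Tt1],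
    rule us_lipschitz(1)[OF order_trans[OF assms(1) \<eta>(2)] order_trans[OF assms(3) \<eta>(2)] assms(5) Tt1])
 have "quot (us b) (us a) t - quot (us b') (us a') t = (x - x') * (x + x' + y) + (y - y') * (y + y' + x')"
  by (simp add: quot_def x_def y_def x'_def y'_def power2_eq_square algebra_simps)
 then have "\<bar>quot (us b) (us a) t - quot (us b') (us a') t\<bar> = \<bar>(x - x') * (x + x' + y) + (y - y') * (y + y' + x')\<bar>"
  by (rule arg_cong)
 also have "\<dots> \<le> \<bar>x - x'\<bar> * \<bar>x + x' + y\<bar> + \<bar>y - y'\<bar> * \<bar>y + y' + x'\<bar>"
  using abs_triangle_ineq[of "(x - x') * (x + x' + y)" "(y - y') * (y + y' + x')"] unfolding abs_mult .
 also have "\<dots> \<le> (LU * \<bar>b - b'\<bar>) * 6 + (LU * \<bar>a - a'\<bar>) * 6"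
  using r l LU_pos by (intro add_mono mult_mono) simp_all
 finally show ?thesis by (simp add: algebra_simps)
qed

text \<open>Again a weighted Wronskian, now of two differences: R' = (q1 - q2) P with P the weighted
  product of the differences, and |q1 - q2| \<le> H by Lipschitz dependence. The bound R \<le> C P
  holds because P grows at least at the rate |k| before \<open>T\<close> and decays at most
  exponentially after it. Division by P turns it into a Lipschitz bound for logarithmic
  slopes.\<close>

lemma slope_quotient_one_sided:
 assumes p: "pair a b" and p': "pair a' b'" and t: "t \<le> t1"
 shows "e a b t * d a' b' t - d a b t * e a' b' t \<le> CY * (\<bar>a - a'\<bar> + \<bar>b - b'\<bar>) * (d a b t * d a' b' t)"
proof -
 define H where "H = 6 * LU * (\<bar>a - a'\<bar> + \<bar>b - b'\<bar>)"
 have H0: "0 \<le> H" using LU_pos by (simp add: H_def)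
 define R where "R t = exp (- k * t) * (e a b t * d a' b' t - d a b t * e a' b' t)" for t
 define P where "P t = exp (- k * t) * (d a b t * d a' b' t)" for t
 define P' where "P' t = exp (- k * t) * (e a b t * d a' b' t + d a b t * e a' b' t - k * (d a b t * d a' b' t))" for t
 define q1 q2 where "q1 t = quot (us b) (us a) t" and "q2 t = quot (us b') (us a') t" for t
 have E: "DERIV (\<lambda>t. exp (- k * t)) t :> - k * exp (- k * t)" for t
  by (auto intro!: derivative_eq_intros)
 have dR: "DERIV R t :> (q1 t - q2 t) * P t" if "t \<le> t1" for t
  unfolding R_def[abs_def] P_def q1_def q2_def
  by (rule DERIV_cong[OF DERIV_mult[OF E DERIV_diff[OF DERIV_mult[OF e_deriv[OF p that] d_deriv[OF p']]
       DERIV_mult[OF d_deriv[OF p] e_deriv[OF p' that]]]]]) (simp add: algebra_simps)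
 have dP: "DERIV P t :> P' t" for t
  unfolding P_def[abs_def] P'_def
  by (rule DERIV_cong[OF DERIV_mult[OF E DERIV_mult[OF d_deriv[OF p] d_deriv[OF p']]]]) (simp add: algebra_simps)
 have P0: "0 < P t" if "t \<le> t1" for t using d_pos[OF p that] d_pos[OF p' that] by (simp add: P_def)
 have qq: "(q1 t - q2 t) * P t \<le> H * P t" if "t \<le> t1" for t
  using quot_lipschitz[OF pairD(1,2)[OF p] pairD(1,2)[OF p'] that] P0[OF that]
  by (intro mult_right_mono) (auto simp: q1_def q2_def H_def)
 \<comment> \<open>For k \<ge> 0 both differences grow at least at the rate k, and 2 k - k = |k|;
   for k < 0 both slopes are nonnegative, and - k = |k|.\<close>
 have P'_left: "\<bar>k\<bar> * P t \<le> P' t" if "t \<le> T" for t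
 proof -
  define x y where "x = d a b t" and "y = d a' b' t"
  note s = slope_bounds_left[OF p that] slope_bounds_left[OF p' that]
  have "0 \<le> e a b t * y" "0 \<le> x * e a' b' t" "(k * x) * y \<le> e a b t * y" "x * (k * y) \<le> x * e a' b' t"
   unfolding x_def y_def using s by (auto intro: mult_right_mono mult_left_mono)
  then have "\<bar>k\<bar> * (x * y) \<le> e a b t * y + x * e a' b' t - k * (x * y)"
   by (cases "0 \<le> k") (auto simp: algebra_simps)
  from mult_left_mono[OF this, of "exp (- k * t)"]
  show ?thesis unfolding P_def P'_def x_def y_def by (simp add: mult.left_commute)
 qed
 have P'_right: "- (2 + 2 * K) * P t \<le> P' t" if "t \<le> t1" for t
 proof -
  define x y where "x = d a b t" and "y = d a' b' t"
  have xy: "0 < x" "0 < y" using d_pos[OF p that] d_pos[OF p' that] by (auto simp: x_def y_def)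
  have "(- K * x) * y \<le> e a b t * y"
   by (rule mult_right_mono) (use slope_bounds(2)[OF p that] xy in \<open>simp_all add: x_def\<close>)
  moreover have "x * (- K * y) \<le> x * e a' b' t"
   by (rule mult_left_mono) (use slope_bounds(2)[OF p' that] xy in \<open>simp_all add: y_def\<close>)
  moreover have "k * (x * y) \<le> 2 * (x * y)" using k_le xy by (intro mult_right_mono) auto
  ultimately have "- (2 + 2 * K) * (x * y) \<le> e a b t * y + x * e a' b' t - k * (x * y)" by (simp add: algebra_simps)
  from mult_left_mono[OF this, of "exp (- k * t)"]
  show ?thesis unfolding P_def P'_def x_def y_def by (simp add: mult.left_commute)
 qed
 note cl = cls_u[OF pairD(1)[OF p]] cls_u[OF pairD(2)[OF p]] and cl' = cls_u[OF pairD(1)[OF p']] cls_u[OF pairD(2)[OF p']]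
 obtain B where B: "\<And>t. t \<le> T \<Longrightarrow> \<bar>exp (- k * t) * d a b t\<bar> \<le> B"
  using cls_weighted_bounded[OF cl] unfolding d_def by blast
 obtain B' where B': "\<And>t. t \<le> T \<Longrightarrow> \<bar>exp (- k * t) * d a' b' t\<bar> \<le> B'"
  using cls_weighted_bounded[OF cl'] unfolding d_def by blast
 have lims: "(e a b \<longlongrightarrow> 0) at_bot" "(e a' b' \<longlongrightarrow> 0) at_bot" "(d a' b' \<longlongrightarrow> 0) at_bot"
  unfolding d_def[abs_def] e_def[abs_def]
  using cls_limits[OF cl(2,1)] cls_limits[OF cl'(2,1)] by auto
 have "((\<lambda>t. exp (- k * t) * d a' b' t * e a b t) \<longlongrightarrow> 0) at_bot"
  by (rule lim_null_mult_left_bounded[OF _ lims(1)]) (use B' in \<open>auto intro!: eventually_at_bot_linorderI[of T]\<close>)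
 moreover have *: "((\<lambda>t. exp (- k * t) * d a b t * e a' b' t) \<longlongrightarrow> 0) at_bot" "((\<lambda>t. exp (- k * t) * d a b t * d a' b' t) \<longlongrightarrow> 0) at_bot"
  by (rule lim_null_mult_left_bounded[OF _ lims(2)] lim_null_mult_left_bounded[OF _ lims(3)],
    use B in \<open>auto intro!: eventually_at_bot_linorderI[of T]\<close>)+
 ultimately have "((\<lambda>t. (exp (- k * t) * d a' b' t * e a b t - exp (- k * t) * d a b t * e a' b' t)
   - H / \<bar>k\<bar> * (exp (- k * t) * d a b t * d a' b' t)) \<longlongrightarrow> (0 - 0) - H / \<bar>k\<bar> * 0) at_bot"
  by (intro tendsto_intros)
 then have limPhi: "((\<lambda>t. R t - H / \<bar>k\<bar> * P t) \<longlongrightarrow> 0) at_bot"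
  by (simp add: R_def P_def algebra_simps)
 \<comment> \<open>Both R and P vanish at minus infinity, and R - (H / |k|) P is
   nonincreasing.\<close>
 have left: "R t \<le> H / \<bar>k\<bar> * P t" if t: "t \<le> T" for t
 proof -
  have mono: "R t - H / \<bar>k\<bar> * P t \<le> R s - H / \<bar>k\<bar> * P s" if st: "s \<le> t" for s
  proof (rule deriv_nonpos_mono[OF st, where f="\<lambda>t. R t - H / \<bar>k\<bar> * P t" and f'="\<lambda>x. (q1 x - q2 x) * P x - H / \<bar>k\<bar> * P' x"])
   fix x assume "s \<le> x" "x \<le> t"
   then have x: "x \<le> T" "x \<le> t1" using t Tt1 by auto
   show "DERIV (\<lambda>t. R t - H / \<bar>k\<bar> * P t) x :> (q1 x - q2 x) * P x - H / \<bar>k\<bar> * P' x"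
    by (intro DERIV_diff dR x DERIV_cmult dP)
   have "H * P x = H / \<bar>k\<bar> * (\<bar>k\<bar> * P x)" using k_ne by simp
   also have "\<dots> \<le> H / \<bar>k\<bar> * P' x" using P'_left[OF x(1)] H0 by (intro mult_left_mono) auto
   finally show "(q1 x - q2 x) * P x - H / \<bar>k\<bar> * P' x \<le> 0" using qq[OF x(2)] by linarith
  qed
  have "R t - H / \<bar>k\<bar> * P t \<le> 0"
   by (rule tendsto_lowerbound[OF limPhi]) (use mono in \<open>auto intro!: eventually_at_bot_linorderI[of t]\<close>)
  then show ?thesis by simp
 qed
 have "R t \<le> CY * (\<bar>a - a'\<bar> + \<bar>b - b'\<bar>) * P t"
 proof (cases "t \<le> T")
  case True
  have "H / \<bar>k\<bar> \<le> CY * (\<bar>a - a'\<bar> + \<bar>b - b'\<bar>)"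
  proof -
   have "6 * LU / \<bar>k\<bar> * 1 \<le> CY" unfolding CY_def
    using LU_pos Tt1 K0 by (intro mult_mono) auto
   from mult_right_mono[OF this, of "\<bar>a - a'\<bar> + \<bar>b - b'\<bar>"] show ?thesis by (simp add: H_def)
  qed
  then have "H / \<bar>k\<bar> * P t \<le> CY * (\<bar>a - a'\<bar> + \<bar>b - b'\<bar>) * P t" by (rule mult_right_mono) (use P0[OF t] in simp)
  then show ?thesis using left[OF True] by linarith
 next
  case False
  \<comment> \<open>The exponential absorbs the possible decay of P, and the derivative of the
    linear factor supplies the term H P that dominates R'.\<close>
  define G where "G t = (H / \<bar>k\<bar> + H * (t - T)) * (exp ((2 + 2 * K) * (t - T)) * P t)" for t
  have "R t - G t \<le> R T - G T"
  proof (rule deriv_nonpos_mono[where f="\<lambda>x. R x - G x" and f'="\<lambda>x. (q1 x - q2 x) * P x - (H * (exp ((2 + 2 * K) * (x - T)) * P x) +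
    (H / \<bar>k\<bar> + H * (x - T)) * (exp ((2 + 2 * K) * (x - T)) * ((2 + 2 * K) * P x + P' x)))"])
   fix x assume "T \<le> x" "x \<le> t"
   then have x: "T \<le> x" "x \<le> t1" using t by auto
   have dE: "DERIV (\<lambda>x. exp ((2 + 2 * K) * (x - T))) x :> (2 + 2 * K) * exp ((2 + 2 * K) * (x - T))"
    by (auto intro!: derivative_eq_intros)
   have dL: "DERIV (\<lambda>x. H / \<bar>k\<bar> + H * (x - T)) x :> H"
    by (auto intro!: derivative_eq_intros)
   show "((\<lambda>x. R x - G x) has_real_derivative (q1 x - q2 x) * P x - (H * (exp ((2 + 2 * K) * (x - T)) * P x) +
    (H / \<bar>k\<bar> + H * (x - T)) * (exp ((2 + 2 * K) * (x - T)) * ((2 + 2 * K) * P x + P' x)))) (at x)"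
    unfolding G_def[abs_def]
    by (rule DERIV_cong[OF DERIV_diff[OF dR[OF x(2)] DERIV_mult[OF dL DERIV_mult[OF dE dP]]]])
      (simp add: algebra_simps)
   have 1: "H * (1 * P x) \<le> H * (exp ((2 + 2 * K) * (x - T)) * P x)"
    using H0 P0[OF x(2)] K0 x by (intro mult_left_mono mult_right_mono) auto
   have 2: "0 \<le> (H / \<bar>k\<bar> + H * (x - T)) * (exp ((2 + 2 * K) * (x - T)) * ((2 + 2 * K) * P x + P' x))"
   proof -
    have "0 \<le> (2 + 2 * K) * P x + P' x"
     using P'_right[OF x(2)] mult_minus_left[of "2 + 2 * K" "P x"] by linarith
    moreover have "0 \<le> H / \<bar>k\<bar> + H * (x - T)" using H0 x by simp
    ultimately show ?thesis by simp
   qed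
   show "(q1 x - q2 x) * P x - (H * (exp ((2 + 2 * K) * (x - T)) * P x) +
    (H / \<bar>k\<bar> + H * (x - T)) * (exp ((2 + 2 * K) * (x - T)) * ((2 + 2 * K) * P x + P' x))) \<le> 0"
    using qq[OF x(2)] 1 2 by linarith
  qed (use False in simp)
  moreover have "R T \<le> G T" using left[of T] by (simp add: G_def)
  ultimately have "R t \<le> G t" by simp
  also have "G t \<le> (H / \<bar>k\<bar> + H * (t1 - T)) * (exp ((2 + 2 * K) * (t1 - T)) * P t)"
   unfolding G_def using False t H0 K0 P0[OF t] Tt1
   by (intro mult_mono add_mono) (auto intro!: mult_left_mono mult_nonneg_nonneg add_nonneg_nonneg)
  also have "\<dots> = CY * (\<bar>a - a'\<bar> + \<bar>b - b'\<bar>) * P t"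
   by (simp add: CY_def H_def field_simps)
  finally show ?thesis .
 qed
 then have "exp (- k * t) * (e a b t * d a' b' t - d a b t * e a' b' t)
   \<le> exp (- k * t) * (CY * (\<bar>a - a'\<bar> + \<bar>b - b'\<bar>) * (d a b t * d a' b' t))"
  by (simp only: R_def P_def mult.left_commute)
 then show ?thesis by (simp only: mult_le_cancel_left_pos exp_gt_zero)
qed

definition y :: "real \<Rightarrow> real \<Rightarrow> real \<Rightarrow> real" where "y a b t = e a b t / d a b t"

lemma y_lipschitz:
 assumes p: "pair a b" and p': "pair a' b'" and t: "t \<le> t1"
 shows "\<bar>y a b t - y a' b' t\<bar> \<le> CY * (\<bar>a - a'\<bar> + \<bar>b - b'\<bar>)"
proof -
 note d = d_pos[OF p t] d_pos[OF p' t]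
 have eq: "(y a b t - y a' b' t) * (d a b t * d a' b' t) = e a b t * d a' b' t - d a b t * e a' b' t"
  using d by (simp add: y_def field_simps)
 have dd: "0 < d a b t * d a' b' t" using d by simp
 have "y a b t - y a' b' t \<le> CY * (\<bar>a - a'\<bar> + \<bar>b - b'\<bar>)"
  using slope_quotient_one_sided[OF p p' t] dd unfolding eq[symmetric] by (simp only: mult_le_cancel_right_pos)
 moreover have "- (y a b t - y a' b' t) * (d a b t * d a' b' t) \<le> CY * (\<bar>a - a'\<bar> + \<bar>b - b'\<bar>) * (d a b t * d a' b' t)"
 proof -
  have h: "\<bar>a' - a\<bar> + \<bar>b' - b\<bar> = \<bar>a - a'\<bar> + \<bar>b - b'\<bar>" by (simp add: abs_minus_commute)
  have "- (y a b t - y a' b' t) * (d a b t * d a' b' t) = - ((y a b t - y a' b' t) * (d a b t * d a' b' t))"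
   by (rule mult_minus_left)
  also have "\<dots> = e a' b' t * d a b t - d a' b' t * e a b t" unfolding eq by simp
  also have "\<dots> \<le> CY * (\<bar>a - a'\<bar> + \<bar>b - b'\<bar>) * (d a b t * d a' b' t)"
   using slope_quotient_one_sided[OF p' p t] unfolding h by (simp only: mult.commute[of "d a' b' t" "d a b t"])
  finally show ?thesis .
 qed
 then have "- (y a b t - y a' b' t) \<le> CY * (\<bar>a - a'\<bar> + \<bar>b - b'\<bar>)"
  using dd by (simp only: mult_le_cancel_right_pos)
 ultimately show ?thesis by linarith
qed

lemma y_bounds: assumes "pair a b" "t \<le> t1" shows "y a b t \<le> 200" "- K \<le> y a b t"
 using slope_bounds[OF assms] d_pos[OF assms] by (auto simp: y_def field_simps)

lemma d_ln_deriv: assumes "pair a b" "t \<le> t1"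
 shows "DERIV (\<lambda>t. ln (d a b t)) t :> y a b t"
 using d_deriv[OF assms(1)] d_pos[OF assms] unfolding y_def
 by (auto intro!: derivative_eq_intros simp: field_simps)

text \<open>The difference quotient in the parameter. It equals 1 at \<open>T\<close> and its
  logarithm is the integral of \<open>y\<close>, so a Lipschitz bound for \<open>y\<close> yields
  one for it.\<close>

definition X :: "real \<Rightarrow> real \<Rightarrow> real \<Rightarrow> real" where "X a b t = d a b t / (b - a)"

lemma X_pos: "pair a b \<Longrightarrow> t \<le> t1 \<Longrightarrow> 0 < X a b t" using d_pos pairD by (simp add: X_def)

lemma ln_X: assumes "pair a b" "t \<le> t1" shows "ln (X a b t) = ln (d a b t) - ln (d a b T)"
 using d_pos[OF assms] pairD[OF assms(1)] d_T[OF assms(1)] by (simp add: X_def ln_div)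

lemma X_bounds:
 assumes p: "pair a b" and t: "T \<le> t" "t \<le> t1"
 shows "X a b t \<le> exp (200 * (t1 - T))" "exp (- K * (t1 - T)) \<le> X a b t"
proof -
 have "ln (d a b t) - 200 * t \<le> ln (d a b T) - 200 * T"
  by (rule deriv_nonpos_mono[OF t(1) DERIV_diff[OF d_ln_deriv[OF p] DERIV_cmult_Id]]) (use t y_bounds[OF p] in auto)
 moreover have "ln (d a b T) + K * T \<le> ln (d a b t) + K * t"
 proof (rule deriv_nonneg_mono[OF t(1) DERIV_add[OF d_ln_deriv[OF p] DERIV_cmult_Id]])
  show "0 \<le> y a b x + K" if "T \<le> x" "x \<le> t" for x using y_bounds(2)[OF p, of x] that t by linarith
 qed (use t in auto)
 moreover have "200 * (t - T) \<le> 200 * (t1 - T)" "K * (t - T) \<le> K * (t1 - T)"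
  using t K0 by (auto intro: mult_left_mono)
 ultimately have "ln (X a b t) \<le> 200 * (t1 - T)" "- K * (t1 - T) \<le> ln (X a b t)"
  unfolding ln_X[OF p t(2)] by (simp_all add: algebra_simps)
 then have "exp (ln (X a b t)) \<le> exp (200 * (t1 - T))" "exp (- K * (t1 - T)) \<le> exp (ln (X a b t))"
  by (simp_all only: exp_le_cancel_iff)
 then show "X a b t \<le> exp (200 * (t1 - T))" "exp (- K * (t1 - T)) \<le> X a b t"
  unfolding exp_ln[OF X_pos[OF p t(2)]] .
qed

lemma X_lipschitz:
 assumes p: "pair a b" and p': "pair a' b'" and t: "T \<le> t" "t \<le> t1"
 shows "\<bar>X a b t - X a' b' t\<bar> \<le> exp (200 * (t1 - T)) * (CY * (t1 - T)) * (\<bar>a - a'\<bar> + \<bar>b - b'\<bar>)"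
proof -
 define h where "h = CY * (\<bar>a - a'\<bar> + \<bar>b - b'\<bar>)"
 have h: "0 \<le> h" using CY_nonneg by (simp add: h_def)
 have "(ln (d a b t) - ln (d a' b' t)) - h * t \<le> (ln (d a b T) - ln (d a' b' T)) - h * T"
 proof (rule deriv_nonpos_mono[OF t(1) DERIV_diff[OF DERIV_diff[OF d_ln_deriv[OF p] d_ln_deriv[OF p']] DERIV_cmult_Id]])
  show "y a b x - y a' b' x - h \<le> 0" if "T \<le> x" "x \<le> t" for x
  proof -
   have "\<bar>y a b x - y a' b' x\<bar> \<le> h" unfolding h_def by (rule y_lipschitz[OF p p']) (use that t in simp)
   then show ?thesis by linarith
  qed
 qed (use t in auto)
 moreover have "(ln (d a b T) - ln (d a' b' T)) + h * T \<le> (ln (d a b t) - ln (d a' b' t)) + h * t"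
 proof (rule deriv_nonneg_mono[OF t(1) DERIV_add[OF DERIV_diff[OF d_ln_deriv[OF p] d_ln_deriv[OF p']] DERIV_cmult_Id]])
  show "0 \<le> y a b x - y a' b' x + h" if "T \<le> x" "x \<le> t" for x
  proof -
   have "\<bar>y a b x - y a' b' x\<bar> \<le> h" unfolding h_def by (rule y_lipschitz[OF p p']) (use that t in simp)
   then show ?thesis by linarith
  qed
 qed (use t in auto)
 moreover have "h * (t - T) \<le> h * (t1 - T)" using t h by (intro mult_left_mono) auto
 ultimately have "\<bar>ln (X a b t) - ln (X a' b' t)\<bar> \<le> h * (t1 - T)"
  unfolding ln_X[OF p t(2)] ln_X[OF p' t(2)] right_diff_distrib by linarith
 then have "exp (200 * (t1 - T)) * \<bar>ln (X a b t) - ln (X a' b' t)\<bar> \<le> exp (200 * (t1 - T)) * (h * (t1 - T))"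
  by (rule mult_left_mono) simp
 also have "\<dots> = exp (200 * (t1 - T)) * (CY * (t1 - T)) * (\<bar>a - a'\<bar> + \<bar>b - b'\<bar>)" by (simp add: h_def)
 finally show ?thesis
  using abs_diff_le_ln_diff[OF X_pos[OF p t(2)] X_bounds(1)[OF p t] X_pos[OF p' t(2)] X_bounds(1)[OF p' t]]
  by linarith
qed

text \<open>The quotients of \<open>us\<close> are \<open>X\<close>, those of \<open>vs\<close> are
  \<open>X * y\<close>, and both factors are bounded and Lipschitz.\<close>

lemma difference_quotients_lipschitz:
 obtains C where "0 \<le> C"
  "\<And>a b a' b' t. pair a b \<Longrightarrow> pair a' b' \<Longrightarrow> T \<le> t \<Longrightarrow> t \<le> t1 \<Longrightarrow>
   \<bar>(us b t - us a t) / (b - a) - (us b' t - us a' t) / (b' - a')\<bar> \<le> C * (\<bar>a - a'\<bar> + \<bar>b - b'\<bar>)"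
  "\<And>a b a' b' t. pair a b \<Longrightarrow> pair a' b' \<Longrightarrow> T \<le> t \<Longrightarrow> t \<le> t1 \<Longrightarrow>
   \<bar>(vs b t - vs a t) / (b - a) - (vs b' t - vs a' t) / (b' - a')\<bar> \<le> C * (\<bar>a - a'\<bar> + \<bar>b - b'\<bar>)"
proof -
 define C1 where "C1 = exp (200 * (t1 - T)) * (CY * (t1 - T))"
 define C where "C = C1 * (201 + K) + exp (200 * (t1 - T)) * CY"
 have C1: "0 \<le> C1" using CY_nonneg Tt1 by (simp add: C1_def)
 then have C0: "0 \<le> C" using CY_nonneg K0 by (simp add: C_def)
 have C1C: "C1 \<le> C"
 proof -
  have "0 \<le> exp (200 * (t1 - T)) * CY" using CY_nonneg by simp
  moreover have "C1 * 1 \<le> C1 * (201 + K)" using C1 K0 by (intro mult_left_mono) auto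
  ultimately show ?thesis unfolding C_def by linarith
 qed
 have 1: "\<bar>X a b t - X a' b' t\<bar> \<le> C * (\<bar>a - a'\<bar> + \<bar>b - b'\<bar>)"
  if "pair a b" "pair a' b'" "T \<le> t" "t \<le> t1" for a b a' b' t
 proof -
  have "C1 * (\<bar>a - a'\<bar> + \<bar>b - b'\<bar>) \<le> C * (\<bar>a - a'\<bar> + \<bar>b - b'\<bar>)"
   by (rule mult_right_mono[OF C1C]) simp
  then show ?thesis using X_lipschitz[OF that] unfolding C1_def by linarith
 qed
 have 2: "\<bar>X a b t * y a b t - X a' b' t * y a' b' t\<bar> \<le> C * (\<bar>a - a'\<bar> + \<bar>b - b'\<bar>)"
  if p: "pair a b" "pair a' b'" "T \<le> t" "t \<le> t1" for a b a' b' t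
 proof -
  define h where "h = \<bar>a - a'\<bar> + \<bar>b - b'\<bar>"
  have "X a b t * y a b t - X a' b' t * y a' b' t = (X a b t - X a' b' t) * y a b t + X a' b' t * (y a b t - y a' b' t)"
   by (simp add: algebra_simps)
  then have "\<bar>X a b t * y a b t - X a' b' t * y a' b' t\<bar> =
   \<bar>(X a b t - X a' b' t) * y a b t + X a' b' t * (y a b t - y a' b' t)\<bar>" by (rule arg_cong)
  also have "\<dots> \<le> \<bar>X a b t - X a' b' t\<bar> * \<bar>y a b t\<bar> + \<bar>X a' b' t\<bar> * \<bar>y a b t - y a' b' t\<bar>"
   using abs_triangle_ineq[of "(X a b t - X a' b' t) * y a b t" "X a' b' t * (y a b t - y a' b' t)"]
   unfolding abs_mult .
  also have "\<dots> \<le> (C1 * h) * (201 + K) + exp (200 * (t1 - T)) * (CY * h)"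
  proof (intro add_mono mult_mono)
   show "\<bar>X a b t - X a' b' t\<bar> \<le> C1 * h" using X_lipschitz[OF p] by (simp add: C1_def h_def)
   show "\<bar>y a b t\<bar> \<le> 201 + K" using y_bounds[OF p(1,4)] K0 by linarith
   show "\<bar>X a' b' t\<bar> \<le> exp (200 * (t1 - T))" using X_bounds[OF p(2-4)] X_pos[OF p(2,4)] by simp
   show "\<bar>y a b t - y a' b' t\<bar> \<le> CY * h" using y_lipschitz[OF p(1,2,4)] by (simp add: h_def)
  qed (use C1 K0 in \<open>auto simp: h_def\<close>)
  also have "\<dots> = C * h" by (simp add: C_def algebra_simps)
  finally show ?thesis by (simp add: h_def)
 qed
 have Xy: "X a b t * y a b t = (vs b t - vs a t) / (b - a)" if "pair a b" "t \<le> t1" for a b t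
  using d_pos[OF that] by (simp add: X_def y_def e_def)
 show ?thesis
 proof (rule that[OF C0])
  show "\<bar>(us b t - us a t) / (b - a) - (us b' t - us a' t) / (b' - a')\<bar> \<le> C * (\<bar>a - a'\<bar> + \<bar>b - b'\<bar>)"
   if "pair a b" "pair a' b'" "T \<le> t" "t \<le> t1" for a b a' b' t
   using 1[OF that] by (simp add: X_def d_def)
  show "\<bar>(vs b t - vs a t) / (b - a) - (vs b' t - vs a' t) / (b' - a')\<bar> \<le> C * (\<bar>a - a'\<bar> + \<bar>b - b'\<bar>)"
   if "pair a b" "pair a' b'" "T \<le> t" "t \<le> t1" for a b a' b' t
   using 2[OF that] Xy that by simp
 qed
qed

end

section \<open>The family as a surface with a tangent plane\<close>

lemma continuous_on_uniform_approx:
 fixes f :: "real \<Rightarrow> real"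
 assumes "\<And>e. e > 0 \<Longrightarrow> \<exists>g. continuous_on S g \<and> (\<forall>t\<in>S. \<bar>f t - g t\<bar> \<le> e)"
 shows "continuous_on S f"
 unfolding continuous_on_iff
proof (intro ballI allI impI)
 fix x e assume x: "x \<in> S" and "0 < (e::real)"
 obtain g where g: "continuous_on S g" "\<And>t. t \<in> S \<Longrightarrow> \<bar>f t - g t\<bar> \<le> e / 4"
  using assms[of "e / 4"] \<open>0 < e\<close> by auto
 obtain r where r: "r > 0" "\<And>y. y \<in> S \<Longrightarrow> dist y x < r \<Longrightarrow> dist (g y) (g x) < e / 4"
  using g(1) x \<open>0 < e\<close> unfolding continuous_on_iff by (metis zero_less_divide_iff zero_less_numeral)
 have "dist (f y) (f x) < e" if "y \<in> S" "dist y x < r" for y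
  using g(2)[OF that(1)] g(2)[OF x] r(2)[OF that] unfolding dist_real_def by linarith
 then show "\<exists>d>0. \<forall>x'\<in>S. dist x' x < d \<longrightarrow> dist (f x') (f x) < e" using r(1) by blast
qed

lemma limit_of_quotients_ge:
 fixes g c C s \<eta> :: real
 assumes "s < \<eta>" "\<And>b. s < b \<Longrightarrow> b < \<eta> \<Longrightarrow> c \<le> g + C * \<bar>b - s\<bar>" "0 \<le> C"
 shows "c \<le> g"
proof (rule ccontr)
 assume "\<not> c \<le> g"
 define h where "h = min ((\<eta> - s) / 2) ((c - g) / (2 * (C + 1)))"
 have h: "0 < h" "h < \<eta> - s" using assms \<open>\<not> c \<le> g\<close> by (auto simp: h_def min_less_iff_disj)
 have "C * h \<le> (C + 1) * ((c - g) / (2 * (C + 1)))" using h \<open>0 \<le> C\<close> by (intro mult_mono) (auto simp: h_def)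
 also have "\<dots> = (c - g) / 2" using \<open>0 \<le> C\<close> by (simp add: field_simps)
 finally show False using assms(2)[of "s + h"] h \<open>\<not> c \<le> g\<close> by simp
qed

context branch_box
begin

lemma family_derivatives:
 "\<exists>zs ws C. 0 \<le> C \<and>
  (\<forall>s t. \<bar>s\<bar> < \<eta> \<longrightarrow> t \<in> {T..t1} \<longrightarrow> DERIV (\<lambda>s. us s t) s :> zs s t) \<and>
  (\<forall>s t. \<bar>s\<bar> < \<eta> \<longrightarrow> t \<in> {T..t1} \<longrightarrow> DERIV (\<lambda>s. vs s t) s :> ws s t) \<and>
  (\<forall>s s' t. \<bar>s\<bar> < \<eta> \<longrightarrow> \<bar>s'\<bar> < \<eta> \<longrightarrow> t \<in> {T..t1} \<longrightarrow> \<bar>zs s t - zs s' t\<bar> \<le> C * \<bar>s - s'\<bar>) \<and>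
  (\<forall>s s' t. \<bar>s\<bar> < \<eta> \<longrightarrow> \<bar>s'\<bar> < \<eta> \<longrightarrow> t \<in> {T..t1} \<longrightarrow> \<bar>ws s t - ws s' t\<bar> \<le> C * \<bar>s - s'\<bar>) \<and>
  (\<forall>s b t. \<bar>s\<bar> < \<eta> \<longrightarrow> \<bar>b\<bar> < \<eta> \<longrightarrow> s \<noteq> b \<longrightarrow> t \<in> {T..t1} \<longrightarrow> \<bar>(us b t - us s t) / (b - s) - zs s t\<bar> \<le> C * \<bar>b - s\<bar>) \<and>
  (\<forall>s b t. \<bar>s\<bar> < \<eta> \<longrightarrow> \<bar>b\<bar> < \<eta> \<longrightarrow> s \<noteq> b \<longrightarrow> t \<in> {T..t1} \<longrightarrow> \<bar>(vs b t - vs s t) / (b - s) - ws s t\<bar> \<le> C * \<bar>b - s\<bar>)"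
proof -
 obtain C where C: "0 \<le> C"
  and qu: "\<And>a b a' b' t. pair a b \<Longrightarrow> pair a' b' \<Longrightarrow> T \<le> t \<Longrightarrow> t \<le> t1 \<Longrightarrow>
   \<bar>(us b t - us a t) / (b - a) - (us b' t - us a' t) / (b' - a')\<bar> \<le> C * (\<bar>a - a'\<bar> + \<bar>b - b'\<bar>)"
  and qv: "\<And>a b a' b' t. pair a b \<Longrightarrow> pair a' b' \<Longrightarrow> T \<le> t \<Longrightarrow> t \<le> t1 \<Longrightarrow>
   \<bar>(vs b t - vs a t) / (b - a) - (vs b' t - vs a' t) / (b' - a')\<bar> \<le> C * (\<bar>a - a'\<bar> + \<bar>b - b'\<bar>)"
  using difference_quotients_lipschitz by blast
 define P where "P f g \<longleftrightarrow> (\<forall>a. \<bar>a\<bar> < \<eta> \<longrightarrow> DERIV f a :> g a) \<and>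
   (\<forall>a b. \<bar>a\<bar> < \<eta> \<longrightarrow> \<bar>b\<bar> < \<eta> \<longrightarrow> \<bar>g a - g b\<bar> \<le> 2 * C * \<bar>a - b\<bar>) \<and>
   (\<forall>a b. \<bar>a\<bar> < \<eta> \<longrightarrow> \<bar>b\<bar> < \<eta> \<longrightarrow> a \<noteq> b \<longrightarrow> \<bar>(f b - f a) / (b - a) - g a\<bar> \<le> 2 * C * \<bar>b - a\<bar>)"
  for f g :: "real \<Rightarrow> real"
 have P1: "DERIV f a :> g a" if "P f g" "\<bar>a\<bar> < \<eta>" for f g a
  using that unfolding P_def by blast
 have P2: "\<bar>g a - g b\<bar> \<le> 2 * C * \<bar>a - b\<bar>" if "P f g" "\<bar>a\<bar> < \<eta>" "\<bar>b\<bar> < \<eta>" for f g a b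
  using that unfolding P_def by blast
 have P3: "\<bar>(f b - f a) / (b - a) - g a\<bar> \<le> 2 * C * \<bar>b - a\<bar>"
  if "P f g" "\<bar>a\<bar> < \<eta>" "\<bar>b\<bar> < \<eta>" "a \<noteq> b" for f g a b
  using that unfolding P_def by blast
 have ex: "\<exists>g. P f g"
  if "\<And>a b a' b'. \<lbrakk>-\<eta> \<le> a; a < b; b \<le> \<eta>; -\<eta> \<le> a'; a' < b'; b' \<le> \<eta>\<rbrakk> \<Longrightarrow>
   \<bar>(f b - f a) / (b - a) - (f b' - f a') / (b' - a')\<bar> \<le> C * (\<bar>a - a'\<bar> + \<bar>b - b'\<bar>)" for f
 proof -
  note q = that
  from lipschitz_quotients_imp_derivative[OF \<eta>(1) C q] show ?thesis unfolding P_def .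
 qed
 have "\<exists>g. t \<in> {T..t1} \<longrightarrow> P (\<lambda>s. us s t) g" for t
 proof (cases "t \<in> {T..t1}")
  case True
  have "\<exists>g. P (\<lambda>s. us s t) g" by (rule ex, rule qu) (use True in \<open>simp_all add: pair_def\<close>)
  then show ?thesis by blast
 next
  case False
  then show ?thesis by blast
 qed
 then have "\<exists>z. \<forall>t. t \<in> {T..t1} \<longrightarrow> P (\<lambda>s. us s t) (z t)" by (intro choice allI)
 then obtain zs where zs: "\<And>t. t \<in> {T..t1} \<Longrightarrow> P (\<lambda>s. us s t) (zs t)" by blast
 have "\<exists>g. t \<in> {T..t1} \<longrightarrow> P (\<lambda>s. vs s t) g" for t
 proof (cases "t \<in> {T..t1}")
  case True
  have "\<exists>g. P (\<lambda>s. vs s t) g" by (rule ex, rule qv) (use True in \<open>simp_all add: pair_def\<close>)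
  then show ?thesis by blast
 next
  case False
  then show ?thesis by blast
 qed
 then have "\<exists>z. \<forall>t. t \<in> {T..t1} \<longrightarrow> P (\<lambda>s. vs s t) (z t)" by (intro choice allI)
 then obtain ws where ws: "\<And>t. t \<in> {T..t1} \<Longrightarrow> P (\<lambda>s. vs s t) (ws t)" by blast
 show ?thesis
 proof (rule exI[of _ "\<lambda>s t. zs t s"], rule exI[of _ "\<lambda>s t. ws t s"], rule exI[of _ "2 * C"], intro conjI allI impI)
  show "0 \<le> 2 * C" using C by simp
 qed (rule P1[OF zs] P1[OF ws] P2[OF zs] P2[OF ws] P3[OF zs] P3[OF ws]; assumption)+
qed

lemma u_continuous: "\<bar>s\<bar> \<le> \<eta> \<Longrightarrow> continuous_on S (us s)" "\<bar>s\<bar> \<le> \<eta> \<Longrightarrow> continuous_on S (vs s)"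
 by (rule tsol_cont[OF tsol_u], assumption)+

text \<open>The parametrization sends (s, \<tau>) to the point at time t0 + \<tau> of the member
  with parameter s; \<sigma> corrects the sign of v under a reversal of time. \<open>inS\<close> and
  \<open>outS\<close> say that near the orbit \<open>S\<close> consists of such points and of
  nothing else. The strict inequality puts the logarithmic slope w / z of the transverse tangent
  vector above that of the orbit itself.\<close>

lemma surface_at:
 fixes S :: "(real \<times> real \<times> real) set" and \<sigma> t0 :: real
 assumes T: "T \<le> t0 - 1" "t0 + 1 \<le> t1" and "\<sigma> \<noteq> 0"
  and dm: "\<And>t. DERIV m t :> m' t" and cm': "continuous_on UNIV m'"
  and m': "\<And>t. m' t \<noteq> 0" and injm: "inj m"
  and inS: "\<And>u v t. cls u v \<Longrightarrow> (\<And>r. r \<le> t \<Longrightarrow> 0 < u r \<and> u r < 2) \<Longrightarrow> (u t, \<sigma> * v t, m t) \<in> S"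
  and outS: "\<And>\<rho>. \<rho> > 0 \<Longrightarrow> \<exists>N. open N \<and> (U t0, \<sigma> * V t0, m t0) \<in> N \<and>
   (\<forall>p\<in>S \<inter> N. \<exists>u v t. cls u v \<and> \<bar>t - t0\<bar> < \<rho> \<and> \<bar>u T - U T\<bar> < \<rho> \<and> p = (u t, \<sigma> * v t, m t))"
 shows "\<exists>z w. 0 < z \<and> z * V t0 < w * U t0 \<and>
  surface_with_tangent_plane S (U t0, \<sigma> * V t0, m t0)
   {(\<alpha> * z + \<beta> * V t0, \<sigma> * (\<alpha> * w + \<beta> * (k * V t0 + U t0 ^ 3 - m t0 * U t0)), \<beta> * m' t0) |\<alpha> \<beta>. True}"
proof -
 obtain zs ws C where C: "0 \<le> C" and
  * : "\<forall>s t. \<bar>s\<bar> < \<eta> \<longrightarrow> t \<in> {T..t1} \<longrightarrow> DERIV (\<lambda>s. us s t) s :> zs s t"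
  "\<forall>s t. \<bar>s\<bar> < \<eta> \<longrightarrow> t \<in> {T..t1} \<longrightarrow> DERIV (\<lambda>s. vs s t) s :> ws s t"
  "\<forall>s s' t. \<bar>s\<bar> < \<eta> \<longrightarrow> \<bar>s'\<bar> < \<eta> \<longrightarrow> t \<in> {T..t1} \<longrightarrow> \<bar>zs s t - zs s' t\<bar> \<le> C * \<bar>s - s'\<bar>"
  "\<forall>s s' t. \<bar>s\<bar> < \<eta> \<longrightarrow> \<bar>s'\<bar> < \<eta> \<longrightarrow> t \<in> {T..t1} \<longrightarrow> \<bar>ws s t - ws s' t\<bar> \<le> C * \<bar>s - s'\<bar>"
  "\<forall>s b t. \<bar>s\<bar> < \<eta> \<longrightarrow> \<bar>b\<bar> < \<eta> \<longrightarrow> s \<noteq> b \<longrightarrow> t \<in> {T..t1} \<longrightarrow> \<bar>(us b t - us s t) / (b - s) - zs s t\<bar> \<le> C * \<bar>b - s\<bar>"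
  "\<forall>s b t. \<bar>s\<bar> < \<eta> \<longrightarrow> \<bar>b\<bar> < \<eta> \<longrightarrow> s \<noteq> b \<longrightarrow> t \<in> {T..t1} \<longrightarrow> \<bar>(vs b t - vs s t) / (b - s) - ws s t\<bar> \<le> C * \<bar>b - s\<bar>"
  using family_derivatives by (elim exE conjE) (rule that)
 note dz = *(1)[rule_format] and dw = *(2)[rule_format] and lz = *(3)[rule_format]
  and lw = *(4)[rule_format] and qz = *(5)[rule_format] and qw = *(6)[rule_format]
 define Xs where "Xs = {- \<eta><..<\<eta>}"
 define Ys where "Ys = {-1<..<1::real}"
 have XD: "\<bar>s\<bar> < \<eta>" "\<bar>s\<bar> \<le> \<eta>" if "s \<in> Xs" for s using that by (auto simp: Xs_def)
 have YD: "t0 + \<tau> \<in> {T..t1}" if "\<tau> \<in> Ys" for \<tau> using that T by (auto simp: Ys_def)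
 have oX: "open Xs" and oY: "open Ys" by (auto simp: Xs_def Ys_def)
 define ac where "ac s t = k * vs s t + us s t ^ 3 - m t * us s t" for s t
 define \<phi> where "\<phi> p = (us (fst p) (t0 + snd p), \<sigma> * vs (fst p) (t0 + snd p), m (t0 + snd p))" for p :: "real \<times> real"
 \<comment> \<open>The lower bound in \<open>X_bounds\<close> is the same for all quotients, so the
   derivative inherits it.\<close>
 have zpos: "0 < zs s t" if s: "\<bar>s\<bar> < \<eta>" and t: "t \<in> {T..t1}" for s t
 proof -
  have "exp (- K * (t1 - T)) \<le> zs s t"
  proof (rule limit_of_quotients_ge[of s \<eta> _ _ C])
   fix b assume b: "s < b" "b < \<eta>"
   have "\<bar>b\<bar> < \<eta>" "pair s b" using s b by (auto simp: pair_def)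
   then have "exp (- K * (t1 - T)) \<le> X s b t" using X_bounds(2) t by auto
   then show "exp (- K * (t1 - T)) \<le> zs s t + C * \<bar>b - s\<bar>"
    using qz[OF s \<open>\<bar>b\<bar> < \<eta>\<close> _ t] b(1) unfolding X_def d_def by linarith
  qed (use s C in auto)
  then show ?thesis using exp_gt_zero[of "- K * (t1 - T)"] by linarith
 qed
 have cz: "continuous_on {T..t1} (zs s)" "continuous_on {T..t1} (ws s)" if s: "\<bar>s\<bar> < \<eta>" for s
 proof -
  have "\<exists>b. \<bar>b\<bar> < \<eta> \<and> s \<noteq> b \<and> C * \<bar>b - s\<bar> \<le> \<epsilon>" if "\<epsilon> > 0" for \<epsilon>
  proof -
   define h where "h = min ((\<eta> - s) / 2) (\<epsilon> / (C + 1))"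
   have h: "0 < h" "h < \<eta> - s" using s that C by (auto simp: h_def min_less_iff_disj)
   have "C * h \<le> (C + 1) * (\<epsilon> / (C + 1))" using h C by (intro mult_mono) (auto simp: h_def)
   also have "\<dots> = \<epsilon>" using C by simp
   finally show ?thesis using h s by (intro exI[of _ "s + h"]) auto
  qed
  then obtain b where b: "\<And>\<epsilon>. \<epsilon> > 0 \<Longrightarrow> \<bar>b \<epsilon>\<bar> < \<eta> \<and> s \<noteq> b \<epsilon> \<and> C * \<bar>b \<epsilon> - s\<bar> \<le> \<epsilon>" by metis
  show "continuous_on {T..t1} (zs s)"
  proof (rule continuous_on_uniform_approx)
   fix \<epsilon> :: real assume "\<epsilon> > 0"
   note b = b[OF this]
   have "\<bar>zs s t - (us (b \<epsilon>) t - us s t) / (b \<epsilon> - s)\<bar> \<le> \<epsilon>" if "t \<in> {T..t1}" for t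
    using qz[OF s _ _ that, of "b \<epsilon>"] b by (simp add: abs_minus_commute)
   moreover have "continuous_on {T..t1} (\<lambda>t. (us (b \<epsilon>) t - us s t) / (b \<epsilon> - s))"
    using b s by (intro continuous_intros u_continuous) auto
   ultimately show "\<exists>g. continuous_on {T..t1} g \<and> (\<forall>t\<in>{T..t1}. \<bar>zs s t - g t\<bar> \<le> \<epsilon>)" by blast
  qed
  show "continuous_on {T..t1} (ws s)"
  proof (rule continuous_on_uniform_approx)
   fix \<epsilon> :: real assume "\<epsilon> > 0"
   note b = b[OF this]
   have "\<bar>ws s t - (vs (b \<epsilon>) t - vs s t) / (b \<epsilon> - s)\<bar> \<le> \<epsilon>" if "t \<in> {T..t1}" for t
    using qw[OF s _ _ that, of "b \<epsilon>"] b by (simp add: abs_minus_commute)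
   moreover have "continuous_on {T..t1} (\<lambda>t. (vs (b \<epsilon>) t - vs s t) / (b \<epsilon> - s))"
    using b s by (intro continuous_intros u_continuous) auto
   ultimately show "\<exists>g. continuous_on {T..t1} g \<and> (\<forall>t\<in>{T..t1}. \<bar>ws s t - g t\<bar> \<le> \<epsilon>)" by blast
  qed
 qed
 have shift: "continuous_on Ys (\<lambda>\<tau>. f (t0 + \<tau>))" if "continuous_on {T..t1} f" for f :: "real \<Rightarrow> real"
  by (rule continuous_on_compose2[OF that]) (auto intro!: continuous_intros YD)
 have joint: "continuous_on (Xs \<times> Ys) (\<lambda>p. us (fst p) (t0 + snd p))"
  "continuous_on (Xs \<times> Ys) (\<lambda>p. vs (fst p) (t0 + snd p))"
  "continuous_on (Xs \<times> Ys) (\<lambda>p. zs (fst p) (t0 + snd p))"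
  "continuous_on (Xs \<times> Ys) (\<lambda>p. ws (fst p) (t0 + snd p))"
 proof -
  have \<delta>X: "\<bar>s\<bar> \<le> \<delta>" if "s \<in> Xs" for s using XD[OF that] \<eta> by simp
  show "continuous_on (Xs \<times> Ys) (\<lambda>p. us (fst p) (t0 + snd p))"
   by (rule continuous_on_prod_lipschitz[where f="\<lambda>s \<tau>. us s (t0 + \<tau>)" and C=LU])
     (use XD YD \<delta>X Tt1 LU_pos in \<open>auto intro!: shift u_continuous us_lipschitz(1)[where ?t1.0=t1, folded LU_def]\<close>)
  show "continuous_on (Xs \<times> Ys) (\<lambda>p. vs (fst p) (t0 + snd p))"
   by (rule continuous_on_prod_lipschitz[where f="\<lambda>s \<tau>. vs s (t0 + \<tau>)" and C=LU])
     (use XD YD \<delta>X Tt1 LU_pos in \<open>auto intro!: shift u_continuous us_lipschitz(2)[where ?t1.0=t1, folded LU_def]\<close>)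
  show "continuous_on (Xs \<times> Ys) (\<lambda>p. zs (fst p) (t0 + snd p))"
   by (rule continuous_on_prod_lipschitz[where f="\<lambda>s \<tau>. zs s (t0 + \<tau>)" and C=C])
     (use XD YD C in \<open>auto intro!: shift cz lz\<close>)
  show "continuous_on (Xs \<times> Ys) (\<lambda>p. ws (fst p) (t0 + snd p))"
   by (rule continuous_on_prod_lipschitz[where f="\<lambda>s \<tau>. ws s (t0 + \<tau>)" and C=C])
     (use XD YD C in \<open>auto intro!: shift cz lw\<close>)
 qed
 have mjoint: "continuous_on (Xs \<times> Ys) (\<lambda>p. m (t0 + snd p))" "continuous_on (Xs \<times> Ys) (\<lambda>p. m' (t0 + snd p))"
  by (rule continuous_on_compose2[OF m_cont], auto intro!: continuous_intros)
    (rule continuous_on_compose2[OF cm'], auto intro!: continuous_intros)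
 have acjoint: "continuous_on (Xs \<times> Ys) (\<lambda>p. ac (fst p) (t0 + snd p))"
  unfolding ac_def by (intro continuous_intros joint mjoint)
 \<comment> \<open>Total differentiability follows from the partial derivative in s and a jointly
   continuous one in \<tau>; joint continuity of both makes the derivative continuous.\<close>
 define fy where "fy p = blinfun_scaleR_left (vs (fst p) (t0 + snd p), \<sigma> * ac (fst p) (t0 + snd p), m' (t0 + snd p))" for p :: "real \<times> real"
 define fx where "fx p = blinfun_scaleR_left (zs (fst p) (t0 + snd p), \<sigma> * ws (fst p) (t0 + snd p), 0::real)" for p :: "real \<times> real"
 define D where "D p = (fx p o\<^sub>L fst_blinfun) + (fy p o\<^sub>L snd_blinfun)" for p
 have cfy: "continuous_on (Xs \<times> Ys) fy" unfolding fy_def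
  by (intro bounded_linear.continuous_on[OF bounded_linear_blinfun_scaleR_left] continuous_intros joint acjoint mjoint)
 have cfx: "continuous_on (Xs \<times> Ys) fx" unfolding fx_def
  by (intro bounded_linear.continuous_on[OF bounded_linear_blinfun_scaleR_left] continuous_intros joint)
 have cD: "continuous_on (Xs \<times> Ys) D" unfolding D_def
  by (intro continuous_on_add bounded_bilinear.continuous_on[OF bounded_bilinear_blinfun_compose] cfx cfy continuous_on_const)
 have D_apply: "blinfun_apply (D p) h = fst h *\<^sub>R (zs (fst p) (t0 + snd p), \<sigma> * ws (fst p) (t0 + snd p), 0) +
   snd h *\<^sub>R (vs (fst p) (t0 + snd p), \<sigma> * ac (fst p) (t0 + snd p), m' (t0 + snd p))" for p h
  by (simp add: D_def fx_def fy_def plus_blinfun.rep_eq)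
 have der: "(\<phi> has_derivative blinfun_apply (D p)) (at p)" if p: "p \<in> Xs \<times> Ys" for p
 proof -
  obtain s \<tau> where st: "p = (s, \<tau>)" "s \<in> Xs" "\<tau> \<in> Ys" using p by auto
  define F where "F s \<tau> = \<phi> (s, \<tau>)" for s \<tau>
  have "((\<lambda>(s, \<tau>). F s \<tau>) has_derivative (\<lambda>(h, l). blinfun_apply (fx (s, \<tau>)) h + blinfun_apply (fy (s, \<tau>)) l)) (at (s, \<tau>) within Xs \<times> Ys)"
  proof (rule has_derivative_partialsI[where fy="\<lambda>s \<tau>. fy (s, \<tau>)"])
   have "((\<lambda>s. F s \<tau>) has_derivative (\<lambda>h. (zs s (t0 + \<tau>) * h, \<sigma> * (ws s (t0 + \<tau>) * h), 0))) (at s)"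
    unfolding F_def \<phi>_def fst_conv snd_conv
    using dz[OF XD(1)[OF st(2)] YD[OF st(3)]] dw[OF XD(1)[OF st(2)] YD[OF st(3)]]
    unfolding has_field_derivative_def
    by (intro has_derivative_Pair has_derivative_const has_derivative_mult_right)
   moreover have "blinfun_apply (fx (s, \<tau>)) = (\<lambda>h. (zs s (t0 + \<tau>) * h, \<sigma> * (ws s (t0 + \<tau>) * h), 0))"
    by (auto simp: fx_def mult.commute)
   ultimately show "((\<lambda>s. F s \<tau>) has_derivative blinfun_apply (fx (s, \<tau>))) (at s within Xs)"
    using has_derivative_at_withinI by metis
  next
   fix s \<tau> assume s: "s \<in> Xs" and \<tau>: "\<tau> \<in> Ys"
   have t1: "t0 + \<tau> \<le> t1" using YD[OF \<tau>] by simp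
   have "\<bar>us s (t0 + \<tau>)\<bar> \<le> 2" using us_range[OF XD(2)[OF s] t1] by simp
   then have vd: "DERIV (vs s) (t0 + \<tau>) :> ac s (t0 + \<tau>)"
    using tsolD(2)[OF tsol_u[OF XD(2)[OF s]], of "t0 + \<tau>"] by (simp add: ac_def cub_eq)
   have sh: "((\<lambda>x. f (t0 + x)) has_real_derivative l) (at \<tau>)" if "DERIV f (t0 + \<tau>) :> l" for f l
    using DERIV_shift[of f l \<tau> t0] that by (simp add: add.commute)
   have "((\<lambda>\<tau>. F s \<tau>) has_derivative (\<lambda>l. (vs s (t0 + \<tau>) * l, \<sigma> * (ac s (t0 + \<tau>) * l), m' (t0 + \<tau>) * l))) (at \<tau>)"
    unfolding F_def \<phi>_def fst_conv snd_conv
    using sh[OF tsolD(1)[OF tsol_u[OF XD(2)[OF s]]]] sh[OF vd] sh[OF dm]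
    unfolding has_field_derivative_def
    by (intro has_derivative_Pair has_derivative_mult_right)
   moreover have "blinfun_apply (fy (s, \<tau>)) = (\<lambda>l. (vs s (t0 + \<tau>) * l, \<sigma> * (ac s (t0 + \<tau>) * l), m' (t0 + \<tau>) * l))"
    by (auto simp: fy_def mult.commute)
   ultimately show "((\<lambda>\<tau>. F s \<tau>) has_derivative blinfun_apply (fy (s, \<tau>))) (at \<tau> within Ys)"
    using has_derivative_at_withinI by metis
  next
   show "continuous (at (s, \<tau>) within Xs \<times> Ys) (\<lambda>(s, \<tau>). fy (s, \<tau>))"
    using cfy st by (simp add: continuous_on_eq_continuous_within)
  qed (use st in \<open>auto simp: Ys_def\<close>)
  moreover have "(\<lambda>(s, \<tau>). F s \<tau>) = \<phi>" by (auto simp: F_def)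
  moreover have "(\<lambda>(h, l). blinfun_apply (fx (s, \<tau>)) h + blinfun_apply (fy (s, \<tau>)) l) = blinfun_apply (D p)"
   by (auto simp: D_def st plus_blinfun.rep_eq)
  moreover have "at p within Xs \<times> Ys = at p" using p oX oY by (intro at_within_open) (auto simp: open_Times)
  ultimately show ?thesis using st(1) by simp
 qed
 have cphi: "continuous_on (Xs \<times> Ys) \<phi>"
  by (rule continuous_at_imp_continuous_on) (use der has_derivative_continuous in blast)
 have Dinj: "inj (blinfun_apply (D p))" if p: "p \<in> Xs \<times> Ys" for p
 proof (rule injI)
  fix h l assume eq: "blinfun_apply (D p) h = blinfun_apply (D p) l"
  have "zs (fst p) (t0 + snd p) \<noteq> 0" using zpos[OF XD(1) YD, of "fst p" "snd p"] p by auto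
  then show "h = l" using eq m'[of "t0 + snd p"] by (auto simp: D_apply prod_eq_iff)
 qed
 have injphi: "inj_on \<phi> (Xs \<times> Ys)"
 proof (rule inj_onI)
  fix p p' assume p: "p \<in> Xs \<times> Ys" "p' \<in> Xs \<times> Ys" and eq: "\<phi> p = \<phi> p'"
  have "m (t0 + snd p) = m (t0 + snd p')" using eq by (simp add: \<phi>_def)
  from injD[OF injm this] have 1: "snd p = snd p'" by simp
  have t: "t0 + snd p \<le> t1" using YD[of "snd p"] p by auto
  have ne: "us s (t0 + snd p) < us s' (t0 + snd p)" if "s \<in> Xs" "s' \<in> Xs" "s < s'" for s s'
   using d_pos[of s s', OF _ t] that by (auto simp: pair_def d_def Xs_def)
  have "fst p = fst p'"
   using ne[of "fst p" "fst p'"] ne[of "fst p'" "fst p"] p eq 1 by (cases "fst p" "fst p'" rule: linorder_cases) (auto simp: \<phi>_def)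
  then show "p = p'" using 1 by (simp add: prod_eq_iff)
 qed
 \<comment> \<open>A smaller closed box: on a compact set the inverse of a continuous injection is
   continuous.\<close>
 define Kc where "Kc = {- \<eta>/2..\<eta>/2} \<times> {-1/2..1/2::real}"
 have Kc: "Kc \<subseteq> Xs \<times> Ys" "compact Kc" using \<eta> by (auto simp: Kc_def Xs_def Ys_def compact_Times)
 define \<psi> where "\<psi> = inv_into Kc \<phi>"
 have \<psi>\<phi>: "\<psi> (\<phi> p) = p" if "p \<in> Kc" for p
  unfolding \<psi>_def by (rule inv_into_f_f) (use that inj_on_subset[OF injphi Kc(1)] in auto)
 have c\<psi>: "continuous_on (\<phi> ` Kc) \<psi>"
  by (rule continuous_on_inv[OF continuous_on_subset[OF cphi Kc(1)] Kc(2)]) (use \<psi>\<phi> in auto)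
 define \<rho> where "\<rho> = min (\<eta> / 2) (1/2)"
 have \<rho>: "\<rho> > 0" "\<rho> \<le> \<eta> / 2" "\<rho> \<le> 1/2" using \<eta> by (auto simp: \<rho>_def)
 obtain N where N: "open N" "(U t0, \<sigma> * V t0, m t0) \<in> N"
  "\<forall>p\<in>S \<inter> N. \<exists>u v t. cls u v \<and> \<bar>t - t0\<bar> < \<rho> \<and> \<bar>u T - U T\<bar> < \<rho> \<and> p = (u t, \<sigma> * v t, m t)"
  using outS[OF \<rho>(1)] by blast
 define I where "I = {- \<eta>/2<..<\<eta>/2} \<times> {-1/2<..<1/2::real}"
 have I: "I \<subseteq> Kc" "open I" by (auto simp: I_def Kc_def open_Times)
 define U' where "U' = I \<inter> \<phi> -` N"
 have "open U'" unfolding U'_def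
  by (rule continuous_open_preimage[OF continuous_on_subset[OF cphi] I(2) N(1)]) (use I Kc in blast)
 have phi0: "\<phi> 0 = (U t0, \<sigma> * V t0, m t0)" by (simp add: \<phi>_def us_0)
 have "0 \<in> I" using \<eta> by (simp add: I_def zero_prod_def)
 moreover have "\<phi> 0 \<in> N" using N(2) phi0 by simp
 ultimately have "0 \<in> U'" by (simp add: U'_def)
 have img: "\<phi> ` U' = S \<inter> N"
 proof (rule set_eqI, rule iffI)
  fix q assume "q \<in> \<phi> ` U'"
  then obtain p where p: "p \<in> U'" "q = \<phi> p" by blast
  then have pXY: "p \<in> Xs \<times> Ys" using I Kc by (auto simp: U'_def)
  have "\<phi> p \<in> S" unfolding \<phi>_def
  proof (rule inS)
   show "cls (us (fst p)) (vs (fst p))" using cls_u XD pXY by auto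
   show "0 < us (fst p) r \<and> us (fst p) r < 2" if "r \<le> t0 + snd p" for r
    using us_range[OF XD(2), of "fst p" r] pXY YD[of "snd p"] that by auto
  qed
  then show "q \<in> S \<inter> N" using p by (auto simp: U'_def)
 next
  fix q assume q: "q \<in> S \<inter> N"
  then obtain u v t where u: "cls u v" "\<bar>t - t0\<bar> < \<rho>" "\<bar>u T - U T\<bar> < \<rho>" "q = (u t, \<sigma> * v t, m t)"
   using N(3) by blast
  have "us (u T - U T) = u" "vs (u T - U T) = v" using us_unique[OF u(1)] u(3) \<eta> \<rho> by simp_all
  then have "q = \<phi> (u T - U T, t - t0)" using u(4) by (simp add: \<phi>_def)
  moreover have "(u T - U T, t - t0) \<in> I"
   using u(2,3) \<rho> unfolding I_def mem_Times_iff greaterThanLessThan_iff fst_conv snd_conv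
   by (intro conjI; linarith)
  ultimately show "q \<in> \<phi> ` U'" using q by (auto simp: U'_def)
 qed
 have U'K: "U' \<subseteq> Kc" "U' \<subseteq> Xs \<times> Ys" using I Kc by (auto simp: U'_def)
 have homeo: "homeomorphism U' (S \<inter> N) \<phi> \<psi>"
  unfolding homeomorphism_def
 proof (intro conjI ballI)
  show "\<psi> (\<phi> x) = x" if "x \<in> U'" for x using \<psi>\<phi>[of x] U'K(1) that by blast
  show "\<phi> ` U' = S \<inter> N" by (rule img)
  show "continuous_on U' \<phi>" using continuous_on_subset[OF cphi U'K(2)] .
  show "\<psi> ` (S \<inter> N) = U'" unfolding img[symmetric] using \<psi>\<phi> U'K by (force simp: image_image)
  show "\<phi> (\<psi> y) = y" if "y \<in> S \<inter> N" for y using that \<psi>\<phi> U'K unfolding img[symmetric] by force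
  show "continuous_on (S \<inter> N) \<psi>" unfolding img[symmetric]
   by (rule continuous_on_subset[OF c\<psi>]) (use U'K in auto)
 qed
 have t0: "t0 \<in> {T..t1}" "t0 \<le> t1" using T by auto
 have rangeD: "range (blinfun_apply (D 0)) =
   {(\<alpha> * zs 0 t0 + \<beta> * V t0, \<sigma> * (\<alpha> * ws 0 t0 + \<beta> * (k * V t0 + U t0 ^ 3 - m t0 * U t0)), \<beta> * m' t0) |\<alpha> \<beta>. True}"
  by (auto simp: D_apply us_0 ac_def algebra_simps image_def; blast?)
 have surf: "surface_with_tangent_plane S (U t0, \<sigma> * V t0, m t0) (range (blinfun_apply (D 0)))"
  unfolding surface_with_tangent_plane_def
  using \<open>open U'\<close> \<open>0 \<in> U'\<close> N(1,2) homeo phi0 der Dinj U'K(2) continuous_on_subset[OF cD U'K(2)]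
  by (intro exI[of _ U'] exI[of _ N] exI[of _ \<phi>] exI[of _ \<psi>] exI[of _ D]) auto
 have "zs 0 t0 * V t0 < ws 0 t0 * U t0"
 proof -
  have "\<exists>x\<in>{t0 - 1..t0}. \<forall>t\<in>{t0 - 1..t0}. exp (- k * x) * U x ^ 3 \<le> exp (- k * t) * U t ^ 3"
   by (rule continuous_attains_inf) (auto intro!: continuous_intros tsol_cont[OF UV])
  then obtain x where x: "\<And>t. t \<in> {t0 - 1..t0} \<Longrightarrow> exp (- k * x) * U x ^ 3 \<le> exp (- k * t) * U t ^ 3" by blast
  define \<kappa> where "\<kappa> = exp (- k * x) * U x ^ 3 * exp (- K * (t1 - T))"
  have "\<kappa> > 0" using U_pos by (simp add: \<kappa>_def)
  \<comment> \<open>In the unit of time before t0 the Wronskian gains at least \<kappa> b. As this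
    is linear in b, it survives division by b and the limit b to 0, and the inequality stays
    strict.\<close>
  have wr_ge: "\<kappa> * b \<le> wr 0 b t0" if b: "0 < b" "b < \<eta>" for b
  proof -
   have p: "pair 0 b" using b by (simp add: pair_def)
   have "wr 0 b (t0 - 1) - \<kappa> * b * (t0 - 1) \<le> wr 0 b t0 - \<kappa> * b * t0"
   proof (rule deriv_nonneg_mono[where f="\<lambda>t. wr 0 b t - \<kappa> * b * t"])
    fix r assume r: "t0 - 1 \<le> r" "r \<le> t0"
    then have rt: "T \<le> r" "r \<le> t1" using T by auto
    show "((\<lambda>t. wr 0 b t - \<kappa> * b * t) has_real_derivative
      exp (- k * r) * (us 0 r * us b r * ((us b r)\<^sup>2 - (us 0 r)\<^sup>2)) - \<kappa> * b) (at r)"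
     by (intro DERIV_diff wr_deriv DERIV_cmult_Id) (use b rt \<eta> in auto)
    have X: "exp (- K * (t1 - T)) * b \<le> d 0 b r"
     using X_bounds(2)[OF p rt] b by (simp add: X_def field_simps)
    have ub: "U r \<le> us b r" using d_pos[OF p rt(2)] by (simp add: d_def us_0)
    have "\<kappa> * b = (exp (- k * x) * U x ^ 3) * (exp (- K * (t1 - T)) * b)" by (simp add: \<kappa>_def)
    also have "\<dots> \<le> (exp (- k * r) * U r ^ 3) * d 0 b r"
     by (rule mult_mono[OF x X]) (use r U_pos[of x] U_pos[of r] b in auto)
    also have "\<dots> \<le> (exp (- k * r) * (U r * us b r * (us b r + U r))) * d 0 b r"
    proof -
     have "U r ^ 3 = U r * U r * U r" by (simp add: power3_eq_cube)
     also have "\<dots> \<le> U r * us b r * (us b r + U r)"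
      using U_pos[of r] ub by (intro mult_mono) auto
     finally show ?thesis using d_pos[OF p rt(2)] by (intro mult_right_mono mult_left_mono) auto
    qed
    also have "\<dots> = exp (- k * r) * (us 0 r * us b r * ((us b r)\<^sup>2 - (us 0 r)\<^sup>2))"
     by (simp add: us_0 d_def power2_eq_square algebra_simps)
    finally show "0 \<le> exp (- k * r) * (us 0 r * us b r * ((us b r)\<^sup>2 - (us 0 r)\<^sup>2)) - \<kappa> * b" by simp
   qed simp
   moreover have "0 \<le> wr 0 b (t0 - 1)" using wr_nonneg[OF p, of "t0 - 1"] t0 by simp
   moreover have "\<kappa> * b * (t0 - 1) = \<kappa> * b * t0 - \<kappa> * b" by (simp add: algebra_simps)
   ultimately show ?thesis by linarith
  qed
  define C' where "C' = exp (- k * t0) * (C * U t0 + C * \<bar>V t0\<bar>)"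
  have "\<kappa> \<le> exp (- k * t0) * (ws 0 t0 * U t0 - zs 0 t0 * V t0)"
  proof (rule limit_of_quotients_ge[of 0 \<eta> _ _ C'])
   fix b assume b: "0 < b" "b < \<eta>"
   define x y where "x = (us b t0 - U t0) / b" and "y = (vs b t0 - V t0) / b"
   have xy: "\<bar>x - zs 0 t0\<bar> \<le> C * b" "\<bar>y - ws 0 t0\<bar> \<le> C * b"
    using qz[of 0 b t0] qw[of 0 b t0] b t0 \<eta> by (auto simp: us_0 x_def y_def)
   have "\<kappa> * b \<le> wr 0 b t0" using wr_ge b by blast
   also have "wr 0 b t0 = (exp (- k * t0) * (y * U t0 - x * V t0)) * b"
    using b by (simp add: wr_eq e_def d_def us_0 x_def y_def field_simps)
   finally have "\<kappa> \<le> exp (- k * t0) * (y * U t0 - x * V t0)" using b by (simp only: mult_le_cancel_right_pos)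
   also have "\<dots> \<le> exp (- k * t0) * (ws 0 t0 * U t0 - zs 0 t0 * V t0 + (C * U t0 + C * \<bar>V t0\<bar>) * b)"
   proof (rule mult_left_mono)
    have "(y - ws 0 t0) * U t0 \<le> (C * b) * U t0" using xy U_pos[of t0] by (intro mult_right_mono) auto
    moreover have "- ((x - zs 0 t0) * V t0) \<le> (C * b) * \<bar>V t0\<bar>"
    proof -
     have "- ((x - zs 0 t0) * V t0) \<le> \<bar>x - zs 0 t0\<bar> * \<bar>V t0\<bar>" by (metis abs_ge_minus_self abs_mult)
     also have "\<dots> \<le> (C * b) * \<bar>V t0\<bar>" by (rule mult_right_mono[OF xy(1)]) simp
     finally show ?thesis .
    qed
    ultimately show "y * U t0 - x * V t0 \<le> ws 0 t0 * U t0 - zs 0 t0 * V t0 + (C * U t0 + C * \<bar>V t0\<bar>) * b"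
     by (simp add: algebra_simps)
   qed simp
   finally show "\<kappa> \<le> exp (- k * t0) * (ws 0 t0 * U t0 - zs 0 t0 * V t0) + C' * \<bar>b - 0\<bar>"
    using b by (simp add: C'_def algebra_simps)
  qed (use \<eta> C U_pos[of t0] in \<open>auto simp: C'_def\<close>)
  then have "0 < exp (- k * t0) * (ws 0 t0 * U t0 - zs 0 t0 * V t0)" using \<open>\<kappa> > 0\<close> by linarith
  then show ?thesis by (simp add: zero_less_mult_iff)
 qed
 then show ?thesis using surf zpos[of 0 t0] \<eta> t0 unfolding rangeD
  by (intro exI[of _ "zs 0 t0"] exI[of _ "ws 0 t0"]) auto
qed

end

section \<open>Existence of the front\<close>

text \<open>R = f' w - f w' would be strictly decreasing, whereas w vanishing at both ends and
  positive between them gives R(a) \<le> 0 \<le> R(b).\<close>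

lemma sturm_comparison:
 fixes f f' f'' w w' w'' :: "real \<Rightarrow> real"
 assumes "a < b"
  and f: "\<And>t. a \<le> t \<Longrightarrow> t \<le> b \<Longrightarrow> DERIV f t :> f' t"
   "\<And>t. a \<le> t \<Longrightarrow> t \<le> b \<Longrightarrow> DERIV f' t :> f'' t"
  and w: "\<And>t. a \<le> t \<Longrightarrow> t \<le> b \<Longrightarrow> DERIV w t :> w' t"
   "\<And>t. a \<le> t \<Longrightarrow> t \<le> b \<Longrightarrow> DERIV w' t :> w'' t"
  and fpos: "\<And>t. a \<le> t \<Longrightarrow> t \<le> b \<Longrightarrow> 0 < f t"
  and wa: "w a = 0" and wb: "w b = 0" and wpos: "\<And>t. a < t \<Longrightarrow> t < b \<Longrightarrow> 0 < w t"
  and less: "\<And>t. a < t \<Longrightarrow> t < b \<Longrightarrow> f'' t * w t < f t * w'' t"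
 shows False
proof -
 have "0 \<le> w' a"
 proof (rule ccontr)
  assume "\<not> 0 \<le> w' a"
  then obtain h where h: "h > 0" "\<And>x. 0 < x \<Longrightarrow> x < h \<Longrightarrow> w (a + x) < w a"
   using DERIV_neg_dec_right[OF w(1), of a] \<open>a < b\<close> by auto
  define x where "x = min (h / 2) ((b - a) / 2)"
  have "0 < x" "x < h" "a + x < b" using h(1) \<open>a < b\<close> by (auto simp: x_def min_def field_simps)
  then show False using h(2)[of x] wpos[of "a + x"] wa by simp
 qed
 moreover have "w' b \<le> 0"
 proof (rule ccontr)
  assume "\<not> w' b \<le> 0"
  then obtain h where h: "h > 0" "\<And>x. 0 < x \<Longrightarrow> x < h \<Longrightarrow> w (b - x) < w b"
   using DERIV_pos_inc_left[OF w(1), of b] \<open>a < b\<close> by auto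
  define x where "x = min (h / 2) ((b - a) / 2)"
  have "0 < x" "x < h" "a < b - x" using h(1) \<open>a < b\<close> by (auto simp: x_def min_def field_simps)
  then show False using h(2)[of x] wpos[of "b - x"] wb by simp
 qed
 moreover define R where "R t = f' t * w t - f t * w' t" for t
 have dR: "DERIV R t :> f'' t * w t - f t * w'' t" if "a \<le> t" "t \<le> b" for t
  unfolding R_def[abs_def]
  by (rule DERIV_cong[OF DERIV_diff[OF DERIV_mult[OF f(2)[OF that] w(1)[OF that]] DERIV_mult[OF f(1)[OF that] w(2)[OF that]]]]) simp
 have "R b < R a"
 proof (rule DERIV_neg_imp_decreasing_open[OF \<open>a < b\<close>])
  show "\<exists>y. DERIV R x :> y \<and> y < 0" if "a < x" "x < b" for x
   using dR[of x] less[OF that] that by (intro exI[of _ "f'' x * w x - f x * w'' x"]) auto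
  show "continuous_on {a..b} R"
   by (rule DERIV_atLeastAtMost_imp_continuous_on) (use dR in blast)
 qed
 moreover have "R a \<le> 0"
  using \<open>0 \<le> w' a\<close> fpos[of a] \<open>a < b\<close> wa by (simp add: R_def)
 moreover have "0 \<le> R b"
  using \<open>w' b \<le> 0\<close> fpos[of b] \<open>a < b\<close> wb by (simp add: R_def mult_nonneg_nonpos)
 ultimately show False by linarith
qed

text \<open>The order of decaying solutions when the sign of Q comes from \<open>m \<le> 0\<close>
  alone. It makes the slope at \<open>T\<close> a Lipschitz function of the value there, before any
  front is at hand to serve as \<open>U\<close>.\<close>

lemma (in ramp_eq) ordered_decaying:
 assumes uv: "tsol u v" "tsol u' v'" and le2: "\<And>t. t \<le> T \<Longrightarrow> \<bar>u t\<bar> \<le> 2" "\<And>t. t \<le> T \<Longrightarrow> \<bar>u' t\<bar> \<le> 2"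
  and m: "\<And>t. t \<le> T \<Longrightarrow> m t \<le> 0" and lim: "(u \<longlongrightarrow> 0) at_bot" "(u' \<longlongrightarrow> 0) at_bot"
  and less: "u T < u' T"
 shows "0 \<le> v' T - v T" "v' T - v T \<le> 200 * (u' T - u T)"
proof -
 define Q where "Q t = (u' t)\<^sup>2 + u' t * u t + (u t)\<^sup>2 - m t" for t
 have Q: "0 \<le> Q t" if "t \<le> T" for t
 proof -
  have "(u' t)\<^sup>2 + u' t * u t + (u t)\<^sup>2 = (u' t + u t / 2)\<^sup>2 + 3/4 * (u t)\<^sup>2"
   by (simp add: power2_eq_square algebra_simps)
  moreover have "0 \<le> (u' t + u t / 2)\<^sup>2" "0 \<le> 3/4 * (u t)\<^sup>2" by simp_all
  ultimately show ?thesis using m[OF that] unfolding Q_def by linarith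
 qed
 have dd: "DERIV (\<lambda>t. u' t - u t) t :> v' t - v t" for t by (rule tsol_diff(1)[OF uv(2,1)])
 have de: "DERIV (\<lambda>t. v' t - v t) t :> k * (v' t - v t) + Q t * (u' t - u t)" if "t \<le> T" for t
  unfolding Q_def by (rule tsol_diff_quotient[OF uv(2,1) le2(2)[OF that] le2(1)[OF that]])
 have l: "((\<lambda>t. u' t - u t) \<longlongrightarrow> 0) at_bot" using tendsto_diff[OF lim(2,1)] by simp
 have pos: "0 < u' t - u t" if t: "t \<le> T" for t
 proof (rule ccontr)
  assume neg: "\<not> 0 < u' t - u t"
  have "continuous_on {t..T} (\<lambda>t. u' t - u t)"
   by (intro continuous_intros tsol_cont[OF uv(1)] tsol_cont[OF uv(2)])
  moreover have "u' t - u t \<le> 0" "0 < u' T - u T" using neg less by auto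
  ultimately obtain c where c: "c < T" "u' c - u c = 0"
   by (rule_tac last_zero[of t T "\<lambda>t. u' t - u t"]) (use t in simp_all)
  have z: "u' s - u s = 0" if "s \<le> c" for s
   using vanishing_abs_mono[of T "\<lambda>t. u' t - u t" "\<lambda>t. v' t - v t" k Q s c] dd de Q l that c by simp
  have "v' (c - 1) - v (c - 1) = 0"
  proof (rule DERIV_local_const[OF dd zero_less_one])
   show "\<forall>y. \<bar>c - 1 - y\<bar> < 1 \<longrightarrow> u' (c - 1) - u (c - 1) = u' y - u y"
   proof (intro allI impI)
    fix y assume "\<bar>c - 1 - y\<bar> < 1"
    then have "y \<le> c" by linarith
    then show "u' (c - 1) - u (c - 1) = u' y - u y" using z[of "c - 1"] z[of y] by simp
   qed
  qed
  then have "u' = u" using tsol_unique(1)[OF uv(2,1), of "c - 1"] z[of "c - 1"] by simp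
  then show False using less by simp
 qed
 show "0 \<le> v' T - v T"
  by (rule vanishing_slope_bound(1)[of T "\<lambda>t. u' t - u t" "\<lambda>t. v' t - v t" k Q, OF dd de Q l pos]) simp_all
 show "v' T - v T \<le> 200 * (u' T - u T)"
  by (rule log_slope_bound[OF uv(2,1)]) (rule pos)
qed

lemma tanh_deriv: "DERIV (\<lambda>t. tanh (\<epsilon> * t)) t :> \<epsilon> * (1 - (tanh (\<epsilon> * t))\<^sup>2)" for \<epsilon> :: real
 by (auto intro!: derivative_eq_intros)

text \<open>The ramp equation is solved explicitly; taking \<mu> = 0 at time 0 fixes the time
  shift.\<close>

locale front_eq =
 fixes c \<epsilon> :: real
 assumes c_pos: "0 < c" and c_less: "c < 2" and eps: "0 < \<epsilon>"
begin

sublocale ramp_eq c "\<lambda>t. tanh (\<epsilon> * t)"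
proof
 show "\<bar>c\<bar> \<le> 2" using c_pos c_less by simp
 show "continuous_on UNIV (\<lambda>t. tanh (\<epsilon> * t))" by (intro continuous_intros) auto
 show "\<bar>tanh (\<epsilon> * t)\<bar> \<le> 1" for t
  using tanh_real_lt_1[of "\<epsilon> * t"] tanh_real_gt_neg1[of "\<epsilon> * t"] by linarith
qed

abbreviation m :: "real \<Rightarrow> real" where "m t \<equiv> tanh (\<epsilon> * t)"

lemma m_mono: "s < t \<Longrightarrow> m s < m t" using eps by simp
lemma m_bounds: "-1 < m t" "m t < 1" by (auto simp: tanh_real_gt_neg1 tanh_real_lt_1)
lemma m_sgn: "t \<le> 0 \<Longrightarrow> m t \<le> 0" "0 \<le> t \<Longrightarrow> 0 \<le> m t"
 using eps by (auto simp: mult_le_0_iff)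

lemma m_lim: "(m \<longlongrightarrow> 1) at_top" "(m \<longlongrightarrow> -1) at_bot"
proof -
 have "filterlim (\<lambda>t. \<epsilon> * t) at_top at_top"
  by (rule filterlim_tendsto_pos_mult_at_top[OF tendsto_const eps filterlim_ident])
 from filterlim_compose[OF tanh_real_at_top this] show "(m \<longlongrightarrow> 1) at_top" .
 have "filterlim (\<lambda>t. \<epsilon> * t) at_bot at_bot"
  by (rule filterlim_tendsto_pos_mult_at_bot[OF tendsto_const eps filterlim_ident])
 from filterlim_compose[OF tanh_real_at_bot this] show "(m \<longlongrightarrow> -1) at_bot" .
qed

lemma m_large: assumes "x < 1" obtains t1 where "0 \<le> t1" "\<And>t. t1 \<le> t \<Longrightarrow> x < m t"
proof -
 have "\<forall>\<^sub>F t in at_top. x < m t" using m_lim(1) assms by (rule order_tendstoD)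
 then obtain t1 where "\<And>t. t1 \<le> t \<Longrightarrow> x < m t" by (auto simp: eventually_at_top_linorder)
 then show ?thesis using that[of "max t1 0"] by simp
qed

text \<open>Removing the first-order term is exact also for the nonlinear equation: the cubic
  becomes the nonnegative potential u^2, so Sturm comparison applies to the solution itself and not
  just to a linearization.\<close>

lemma liouville:
 assumes "tsol u v"
 shows "DERIV (\<lambda>t. exp (- c / 2 * t) * u t) t :> exp (- c / 2 * t) * (v t - c / 2 * u t)"
  and "\<bar>u t\<bar> \<le> 2 \<Longrightarrow> ((\<lambda>t. exp (- c / 2 * t) * (v t - c / 2 * u t)) has_real_derivative
   exp (- c / 2 * t) * u t * (c\<^sup>2 / 4 - m t + (u t)\<^sup>2)) (at t)"
proof -
 have E: "DERIV (\<lambda>t. exp (- c / 2 * t)) t :> - c / 2 * exp (- c / 2 * t)"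
  by (auto intro!: derivative_eq_intros)
 show "DERIV (\<lambda>t. exp (- c / 2 * t) * u t) t :> exp (- c / 2 * t) * (v t - c / 2 * u t)"
  by (rule DERIV_cong[OF DERIV_mult[OF E tsolD(1)[OF assms]]]) (simp add: algebra_simps)
 assume 2: "\<bar>u t\<bar> \<le> 2"
 show "((\<lambda>t. exp (- c / 2 * t) * (v t - c / 2 * u t)) has_real_derivative
   exp (- c / 2 * t) * u t * (c\<^sup>2 / 4 - m t + (u t)\<^sup>2)) (at t)"
  by (rule DERIV_cong[OF DERIV_mult[OF E DERIV_diff[OF tsolD(2)[OF assms] DERIV_cmult[OF tsolD(1)[OF assms], of "c / 2"]]]])
    (simp add: cub_eq[OF 2] field_simps power2_eq_square power3_eq_cube)
qed

text \<open>Beyond \<open>\<mu> = c\<^sup>2/4\<close> the linearization at zero oscillates, so small solutions change sign.\<close>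

lemma small_solution_vanishes:
 assumes uv: "tsol u v" and "\<kappa> > 0"
  and m: "\<And>t. t1 \<le> t \<Longrightarrow> t \<le> t1 + pi / sqrt \<kappa> \<Longrightarrow> c\<^sup>2 / 4 + 3 * \<kappa> \<le> m t"
  and small: "\<And>t. t1 \<le> t \<Longrightarrow> t \<le> t1 + pi / sqrt \<kappa> \<Longrightarrow> (u t)\<^sup>2 \<le> \<kappa>"
 shows "\<exists>t. t1 \<le> t \<and> t \<le> t1 + pi / sqrt \<kappa> \<and> u t \<le> 0"
proof (rule ccontr)
 assume "\<not> ?thesis"
 then have pos: "0 < u t" if "t1 \<le> t" "t \<le> t1 + pi / sqrt \<kappa>" for t using that by force
 define r where "r = sqrt \<kappa>"
 have r: "r > 0" "r\<^sup>2 = \<kappa>" using \<open>\<kappa> > 0\<close> by (auto simp: r_def)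
 have \<kappa>1: "\<kappa> \<le> 1"
 proof -
  have "c\<^sup>2 / 4 + 3 * \<kappa> \<le> m t1" using m[of t1] \<open>\<kappa> > 0\<close> by simp
  then show ?thesis using m_bounds(2)[of t1] zero_le_power2[of c] \<open>\<kappa> > 0\<close> by linarith
 qed
 have u2: "\<bar>u t\<bar> \<le> 2" if "t1 \<le> t" "t \<le> t1 + pi / sqrt \<kappa>" for t
 proof -
  have "(u t)\<^sup>2 \<le> 2\<^sup>2" using small[OF that] \<kappa>1 by simp
  then show ?thesis using abs_le_square_iff[of "u t" 2] by simp
 qed
 show False
 proof (rule sturm_comparison[where a=t1 and b="t1 + pi / sqrt \<kappa>"
    and f="\<lambda>t. exp (- c / 2 * t) * u t" and f'="\<lambda>t. exp (- c / 2 * t) * (v t - c / 2 * u t)"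
    and f''="\<lambda>t. exp (- c / 2 * t) * u t * (c\<^sup>2 / 4 - m t + (u t)\<^sup>2)"
    and w="\<lambda>t. sin (r * (t - t1))" and w'="\<lambda>t. r * cos (r * (t - t1))" and w''="\<lambda>t. - (r\<^sup>2 * sin (r * (t - t1)))"])
  show "t1 < t1 + pi / sqrt \<kappa>" using \<open>\<kappa> > 0\<close> by simp
  show "DERIV (\<lambda>t. exp (- c / 2 * t) * u t) t :> exp (- c / 2 * t) * (v t - c / 2 * u t)" for t
   by (rule liouville(1)[OF uv])
  show "((\<lambda>t. exp (- c / 2 * t) * (v t - c / 2 * u t)) has_real_derivative
   exp (- c / 2 * t) * u t * (c\<^sup>2 / 4 - m t + (u t)\<^sup>2)) (at t)" if "t1 \<le> t" "t \<le> t1 + pi / sqrt \<kappa>" for t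
   by (rule liouville(2)[OF uv u2[OF that]])
  show "DERIV (\<lambda>t. sin (r * (t - t1))) t :> r * cos (r * (t - t1))" for t
   by (auto intro!: derivative_eq_intros)
  show "DERIV (\<lambda>t. r * cos (r * (t - t1))) t :> - (r\<^sup>2 * sin (r * (t - t1)))" for t
   by (auto intro!: derivative_eq_intros simp: power2_eq_square)
  show "0 < exp (- c / 2 * t) * u t" if "t1 \<le> t" "t \<le> t1 + pi / sqrt \<kappa>" for t using pos[OF that] by simp
  show "sin (r * (t1 - t1)) = 0" by simp
  show "sin (r * (t1 + pi / sqrt \<kappa> - t1)) = 0" using r by (simp add: r_def)
  have s: "0 < sin (r * (t - t1))" if t: "t1 < t" "t < t1 + pi / sqrt \<kappa>" for t
  proof (rule sin_gt_zero)
   show "0 < r * (t - t1)" using r t by simp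
   have "r * (t - t1) < r * (pi / r)" using r t by (intro mult_strict_left_mono) (auto simp: r_def)
   then show "r * (t - t1) < pi" using r by simp
  qed
  then show "0 < sin (r * (t - t1))" if "t1 < t" "t < t1 + pi / sqrt \<kappa>" for t using that .
  show "exp (- c / 2 * t) * u t * (c\<^sup>2 / 4 - m t + (u t)\<^sup>2) * sin (r * (t - t1))
    < exp (- c / 2 * t) * u t * - (r\<^sup>2 * sin (r * (t - t1)))" if t: "t1 < t" "t < t1 + pi / sqrt \<kappa>" for t
  proof -
   \<comment> \<open>The margin 3 \<kappa> less u^2 \<le> \<kappa> leaves 2 \<kappa>, strictly more
     than the squared frequency of the comparison sine, whose arch has length pi / sqrt
     \<kappa>.\<close>
   have "c\<^sup>2 / 4 - m t + (u t)\<^sup>2 < - r\<^sup>2" using m[of t] small[of t] t r \<open>\<kappa> > 0\<close> by simp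
   then have "(c\<^sup>2 / 4 - m t + (u t)\<^sup>2) * sin (r * (t - t1)) < - r\<^sup>2 * sin (r * (t - t1))"
    using s[OF t] by (rule mult_strict_right_mono)
   then have "exp (- c / 2 * t) * u t * ((c\<^sup>2 / 4 - m t + (u t)\<^sup>2) * sin (r * (t - t1)))
     < exp (- c / 2 * t) * u t * (- r\<^sup>2 * sin (r * (t - t1)))"
    using pos[of t] t by (intro mult_strict_left_mono) auto
   then show ?thesis by (simp add: mult.assoc)
  qed
 qed
qed

end

context front_eq
begin

lemma true_sol: assumes "tsol u v" "\<And>t. \<bar>u t\<bar> \<le> 2"
 shows "DERIV u t :> v t" "DERIV v t :> c * v t + u t ^ 3 - m t * u t"
 using tsolD[OF assms(1), of t] cub_eq[OF assms(2)[of t]] by simp_all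

text \<open>Among the orbits leaving zero, those that cross 0 before reaching 1 and those that cross
  1 before reaching 0 have disjoint, nonempty, relatively open sets of values at time -1. By
  connectedness some orbit belongs to neither set, and it stays in the strip for all times.\<close>

lemma shooting:
 "\<exists>u v. tsol u v \<and> (u \<longlongrightarrow> 0) at_bot \<and> (v \<longlongrightarrow> 0) at_bot \<and> (\<forall>t. 0 < u t \<and> u t \<le> 1)"
proof -
 \<comment> \<open>At time -1 the ramp is negative, so decaying solutions with these values exist
   below the cut at 2. The end 3/2 exceeds 1 and thus lies in the second set at once.\<close>
 define S where "S = {0<..3/2::real}"
 have "\<exists>u v. tsol u v \<and> u (-1) = s \<and> (\<forall>t\<le>-1. 0 < u t \<and> u t \<le> s) \<and> (u \<longlongrightarrow> 0) at_bot \<and> (v \<longlongrightarrow> 0) at_bot"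
  if "s \<in> S" for s
 proof -
  have "\<exists>u v. tsol u v \<and> u (-1) = 0 + s \<and> (\<forall>t\<le>-1. 0 < u t \<and> u t \<le> 0 + s) \<and>
   ((\<lambda>t. u t - 0) \<longlongrightarrow> 0) at_bot \<and> ((\<lambda>t. v t - 0) \<longlongrightarrow> 0) at_bot"
  proof (rule decaying_solution_exists_pos[OF tsol_zero, where q="- m (-1)"])
   show "0 < s" "\<bar>0\<bar> + s \<le> 2" using that by (auto simp: S_def)
   show "0 < - m (-1)" using eps by simp
   fix t x :: real assume "t \<le> -1"
   then have "\<epsilon> * t \<le> \<epsilon> * (-1)" using eps by (intro mult_left_mono) auto
   then have "m t \<le> m (-1)" by (simp only: tanh_real_le_iff)
   moreover have "0 \<le> x\<^sup>2 + x * 0 + 0\<^sup>2" by simp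
   ultimately show "- m (-1) \<le> x\<^sup>2 + x * 0 + 0\<^sup>2 - m t" by linarith
  qed
  then show ?thesis by simp
 qed
 then have "\<forall>s\<in>S. \<exists>p. tsol (fst p) (snd p) \<and> fst p (-1) = s \<and> (\<forall>t\<le>-1. 0 < fst p t \<and> fst p t \<le> s) \<and>
   (fst p \<longlongrightarrow> 0) at_bot \<and> (snd p \<longlongrightarrow> 0) at_bot" by fastforce
 from bchoice[OF this] obtain f where f: "\<forall>s\<in>S. tsol (fst (f s)) (snd (f s)) \<and> fst (f s) (-1) = s \<and>
   (\<forall>t\<le>-1. 0 < fst (f s) t \<and> fst (f s) t \<le> s) \<and> (fst (f s) \<longlongrightarrow> 0) at_bot \<and> (snd (f s) \<longlongrightarrow> 0) at_bot" ..
 define us vs where "us s = fst (f s)" and "vs s = snd (f s)" for s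
 have uv: "tsol (us s) (vs s)" and u1: "us s (-1) = s"
  and lu: "(us s \<longlongrightarrow> 0) at_bot" and lv: "(vs s \<longlongrightarrow> 0) at_bot" if "s \<in> S" for s
  using f[rule_format, OF that] unfolding us_def vs_def by blast+
 have left: "0 < us s t \<and> us s t \<le> s" if "s \<in> S" "t \<le> -1" for s t
  using f[rule_format, OF that(1)] that(2) unfolding us_def by blast
 have le2: "\<bar>us s t\<bar> \<le> 2" if "s \<in> S" "t \<le> -1" for s t
  using left[OF that] that(1) by (auto simp: S_def)
 have mneg: "m t \<le> 0" if "t \<le> -1" for t using m_sgn(1)[of t] that by simp
 have vlip: "\<bar>vs s (-1) - vs s' (-1)\<bar> \<le> 200 * \<bar>s - s'\<bar>" if s: "s \<in> S" "s' \<in> S" for s s'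
 proof -
  have *: "\<bar>vs s (-1) - vs s' (-1)\<bar> \<le> 200 * \<bar>s - s'\<bar>" if "s \<in> S" "s' \<in> S" "s < s'" for s s'
   using ordered_decaying[where T="-1", OF uv[OF that(1)] uv[OF that(2)] le2[OF that(1)] le2[OF that(2)] mneg lu[OF that(1)] lu[OF that(2)]]
    u1 that by auto
  show ?thesis using *[OF s] *[OF s(2,1)] by (cases s s' rule: linorder_cases) (simp_all add: abs_minus_commute)
 qed
 have v1: "0 \<le> vs s (-1) \<and> vs s (-1) \<le> 200 * s" and c1: "c * us s t \<le> vs s t" if s: "s \<in> S" "t \<le> -1" for s t
 proof -
  show "0 \<le> vs s (-1) \<and> vs s (-1) \<le> 200 * s"
   using ordered_decaying[where T="-1", OF tsol_zero uv[OF s(1)] _ le2[OF s(1)] mneg tendsto_const lu[OF s(1)]] u1[OF s(1)] s(1)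
   by (auto simp: S_def)
  have z: "\<bar>0::real\<bar> \<le> 2" by simp
  show "c * us s t \<le> vs s t"
  proof (rule vanishing_slope_bound(2)[of "-1" "us s" "vs s" c "\<lambda>t. (us s t)\<^sup>2 - m t"])
   fix t :: real assume t: "t \<le> -1"
   show "DERIV (us s) t :> vs s t" by (rule tsolD(1)[OF uv[OF s(1)]])
   show "DERIV (vs s) t :> c * vs s t + ((us s t)\<^sup>2 - m t) * us s t"
    using tsolD(2)[OF uv[OF s(1)], of t] cub_eq[OF le2[OF s(1) t]]
    by (simp add: algebra_simps power2_eq_square power3_eq_cube)
   show "0 \<le> (us s t)\<^sup>2 - m t" using mneg[OF t] zero_le_power2[of "us s t"] by linarith
   show "0 < us s t" using left[OF s(1) t] by simp
  qed (use s lu in auto)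
 qed
 have near: "\<bar>us s t - us s' t\<bar> \<le> 400 * exp (9 * (b + 1)) * \<bar>s - s'\<bar>"
  if "s \<in> S" "s' \<in> S" "t \<in> {-1..b}" for s s' t b
 proof -
  have "\<bar>us s (-1) - us s' (-1)\<bar> \<le> 200 * \<bar>s - s'\<bar>" using u1 that by simp
  moreover have "\<bar>t - (-1)\<bar> \<le> b + 1" using that by auto
  ultimately have "\<bar>us s t - us s' t\<bar> \<le> 2 * (200 * \<bar>s - s'\<bar>) * exp (9 * (b + 1))"
   using tsol_dependence_abs(1)[OF uv[OF that(1)] uv[OF that(2)] _ vlip[OF that(1,2)]] by blast
  then show ?thesis by (simp add: mult_ac)
 qed
 have cont: "continuous_on X (us s)" if "s \<in> S" for X s using tsol_cont(1)[OF uv[OF that]] .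
 have no_touch: "0 < vs s t \<or> vs s t < 0" if "s \<in> S" "us s t = 0" for s t
 proof (rule ccontr)
  assume "\<not> ?thesis"
  then have "us s = (\<lambda>_. 0)" using tsol_unique(1)[OF uv[OF that(1)] tsol_zero, of t] that(2) by simp
  then show False using left[OF that(1), of "-1"] by simp
 qed
 define A where "A = {s \<in> S. \<exists>t\<ge>-1. us s t < 0 \<and> (\<forall>t'\<in>{-1..t}. us s t' < 1)}"
 define B where "B = {s \<in> S. \<exists>t\<ge>-1. 1 < us s t \<and> (\<forall>t'\<in>{-1..t}. 0 < us s t')}"
 have "openin (top_of_set S) A"
  unfolding openin_euclidean_subtopology_iff
 proof (intro conjI ballI)
  show "A \<subseteq> S" by (auto simp: A_def)
  fix s0 assume "s0 \<in> A"
  then obtain t where t: "-1 \<le> t" "us s0 t < 0" "\<And>t'. t' \<in> {-1..t} \<Longrightarrow> us s0 t' < 1" and s0: "s0 \<in> S" by (auto simp: A_def)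
  obtain \<rho> where \<rho>: "\<rho> > 0" "\<And>s t'. s \<in> S \<Longrightarrow> \<bar>s - s0\<bar> < \<rho> \<Longrightarrow> t' \<in> {-1..t} \<Longrightarrow> 0 < 1 - us s t'"
  proof (rule uniform_perturbation_positive[of "-1" t "\<lambda>s t. 1 - us s t" s0 "400 * exp (9 * (t + 1))" S])
   show "continuous_on {-1..t} (\<lambda>t. 1 - us s0 t)" by (intro continuous_intros cont s0)
   show "\<bar>1 - us s t' - (1 - us s0 t')\<bar> \<le> 400 * exp (9 * (t + 1)) * \<bar>s - s0\<bar>" if "s \<in> S" "t' \<in> {-1..t}" for s t'
    using near[OF that(1) s0 that(2)] by (simp add: abs_minus_commute)
  qed (use t in auto)
  obtain \<rho>' where \<rho>': "\<rho>' > 0" "\<And>s t'. s \<in> S \<Longrightarrow> \<bar>s - s0\<bar> < \<rho>' \<Longrightarrow> t' \<in> {t..t} \<Longrightarrow> 0 < - us s t'"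
  proof (rule uniform_perturbation_positive[of t t "\<lambda>s t. - us s t" s0 "400 * exp (9 * (t + 1))" S])
   show "continuous_on {t..t} (\<lambda>t. - us s0 t)" by (intro continuous_intros cont s0)
   show "\<bar>- us s t' - - us s0 t'\<bar> \<le> 400 * exp (9 * (t + 1)) * \<bar>s - s0\<bar>" if "s \<in> S" "t' \<in> {t..t}" for s t'
    using near[OF that(1) s0, of t t] that(2) t(1) by (simp add: abs_minus_commute)
  qed (use t in auto)
  show "\<exists>e>0. \<forall>s\<in>S. dist s s0 < e \<longrightarrow> s \<in> A"
   using \<rho> \<rho>' t(1) by (intro exI[of _ "min \<rho> \<rho>'"]) (force simp: A_def dist_real_def)
 qed
 moreover have "openin (top_of_set S) B"
  unfolding openin_euclidean_subtopology_iff
 proof (intro conjI ballI)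
  show "B \<subseteq> S" by (auto simp: B_def)
  fix s0 assume "s0 \<in> B"
  then obtain t where t: "-1 \<le> t" "1 < us s0 t" "\<And>t'. t' \<in> {-1..t} \<Longrightarrow> 0 < us s0 t'" and s0: "s0 \<in> S" by (auto simp: B_def)
  obtain \<rho> where \<rho>: "\<rho> > 0" "\<And>s t'. s \<in> S \<Longrightarrow> \<bar>s - s0\<bar> < \<rho> \<Longrightarrow> t' \<in> {-1..t} \<Longrightarrow> 0 < us s t'"
   by (rule uniform_perturbation_positive[of "-1" t us s0 "400 * exp (9 * (t + 1))" S])
     (use t cont[OF s0] near[OF _ s0] in auto)
  obtain \<rho>' where \<rho>': "\<rho>' > 0" "\<And>s t'. s \<in> S \<Longrightarrow> \<bar>s - s0\<bar> < \<rho>' \<Longrightarrow> t' \<in> {t..t} \<Longrightarrow> 0 < us s t' - 1"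
  proof (rule uniform_perturbation_positive[of t t "\<lambda>s t. us s t - 1" s0 "400 * exp (9 * (t + 1))" S])
   show "continuous_on {t..t} (\<lambda>t. us s0 t - 1)" by (intro continuous_intros cont s0)
   show "\<bar>us s t' - 1 - (us s0 t' - 1)\<bar> \<le> 400 * exp (9 * (t + 1)) * \<bar>s - s0\<bar>" if "s \<in> S" "t' \<in> {t..t}" for s t'
    using near[OF that(1) s0, of t t] that(2) t(1) by simp
  qed (use t in auto)
  show "\<exists>e>0. \<forall>s\<in>S. dist s s0 < e \<longrightarrow> s \<in> B"
   using \<rho> \<rho>' t(1) by (intro exI[of _ "min \<rho> \<rho>'"]) (force simp: B_def dist_real_def)
 qed
 moreover have "A \<inter> B = {}"
 proof (rule ccontr)
  assume "A \<inter> B \<noteq> {}"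
  then obtain s t t' where "-1 \<le> t" "us s t < 0" "\<forall>x\<in>{-1..t}. us s x < 1"
   "-1 \<le> t'" "1 < us s t'" "\<forall>x\<in>{-1..t'}. 0 < us s x" by (auto simp: A_def B_def)
  then show False by (cases "t \<le> t'") force+
 qed
 moreover have "3/2 \<in> B"
  using u1[of "3/2"] by (auto simp: B_def S_def intro!: exI[of _ "-1"])
 moreover have "A \<noteq> {}"
 proof -
  \<comment> \<open>A sufficiently small initial value keeps |u| below sqrt \<kappa> up to the time
    \<open>b\<close> by finite-time dependence, and by then the oscillation has forced a
    zero.\<close>
  define \<kappa> where "\<kappa> = (1 - c\<^sup>2 / 4) / 4"
  have c2: "c\<^sup>2 < 4" using power_strict_mono[OF c_less, of 2] c_pos by simp
  then have \<kappa>: "0 < \<kappa>" "\<kappa> \<le> 1/4" by (auto simp: \<kappa>_def)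
  have "c\<^sup>2 / 4 + 3 * \<kappa> < 1" using c2 unfolding \<kappa>_def by argo
  then obtain t1 where t1: "0 \<le> t1" "\<And>t. t1 \<le> t \<Longrightarrow> c\<^sup>2 / 4 + 3 * \<kappa> < m t" using m_large by blast
  define b where "b = t1 + pi / sqrt \<kappa>"
  have b: "t1 < b" using \<kappa> by (simp add: b_def)
  define s where "s = min (3/2) (sqrt \<kappa> / (400 * exp (9 * (b + 1))))"
  have sS: "s \<in> S" using \<kappa> by (simp add: s_def S_def)
  have small: "\<bar>us s t\<bar> \<le> sqrt \<kappa>" if "t \<in> {-1..b}" for t
  proof -
   have "\<bar>us s (-1) - 0\<bar> \<le> 200 * s" "\<bar>vs s (-1) - 0\<bar> \<le> 200 * s" "\<bar>t - (-1)\<bar> \<le> b + 1"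
    using u1[OF sS] v1[OF sS, of "-1"] sS that by (auto simp: S_def)
   then have "\<bar>us s t - 0\<bar> \<le> 2 * (200 * s) * exp (9 * (b + 1))"
    using tsol_dependence_abs(1)[OF uv[OF sS] tsol_zero] by blast
   also have "\<dots> = s * (400 * exp (9 * (b + 1)))" by simp
   also have "\<dots> \<le> (sqrt \<kappa> / (400 * exp (9 * (b + 1)))) * (400 * exp (9 * (b + 1)))"
    by (intro mult_right_mono) (auto simp: s_def)
   finally show ?thesis by simp
  qed
  have "sqrt \<kappa> \<le> sqrt (1/4)" using \<kappa> by (intro real_sqrt_le_mono)
  then have sq: "sqrt \<kappa> \<le> 1/2" by (simp add: real_sqrt_divide)
  have "\<exists>t. t1 \<le> t \<and> t \<le> b \<and> us s t \<le> 0"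
   unfolding b_def
  proof (rule small_solution_vanishes[OF uv[OF sS] \<kappa>(1)])
   fix t assume t: "t1 \<le> t" "t \<le> t1 + pi / sqrt \<kappa>"
   show "c\<^sup>2 / 4 + 3 * \<kappa> \<le> m t" using t1(2)[OF t(1)] by simp
   have "(us s t)\<^sup>2 \<le> (sqrt \<kappa>)\<^sup>2" using small[of t] t t1(1) by (simp add: abs_le_square_iff[symmetric] b_def)
   then show "(us s t)\<^sup>2 \<le> \<kappa>" using \<kappa> by simp
  qed
  then obtain t where t: "t1 \<le> t" "t \<le> b" "us s t \<le> 0" by blast
  obtain z where z: "-1 < z" "z \<le> t" "us s z = 0" "\<And>r. -1 \<le> r \<Longrightarrow> r < z \<Longrightarrow> 0 < us s r"
   by (rule first_zero[of "-1" t "us s", OF cont[OF sS]]) (use t t1(1) left[OF sS, of "-1"] in auto)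
  have "\<not> 0 < vs s z"
  proof
   assume "0 < vs s z"
   then obtain h where h: "h > 0" "\<And>x. 0 < x \<Longrightarrow> x < h \<Longrightarrow> us s (z - x) < us s z"
    using DERIV_pos_inc_left[OF tsolD(1)[OF uv[OF sS]]] by blast
   define x where "x = min (h / 2) ((z + 1) / 2)"
   have "0 < x" "x < h" "-1 \<le> z - x" using h(1) z(1) by (auto simp: x_def min_def field_simps)
   then show False using h(2)[of x] z(3) z(4)[of "z - x"] by simp
  qed
  then have "vs s z < 0" using no_touch[OF sS z(3)] by simp
  then obtain h where h: "h > 0" "\<And>x. 0 < x \<Longrightarrow> x < h \<Longrightarrow> us s (z + x) < us s z"
   using DERIV_neg_dec_right[OF tsolD(1)[OF uv[OF sS]]] by blast
  have "us s r < 1" if "r \<in> {-1..z + h / 2}" for r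
  proof (cases "r \<le> z")
   case True
   then show ?thesis using small[of r] that z t sq by auto
  next
   case False
   then show ?thesis using h(2)[of "r - z"] that z(3) h(1) by auto
  qed
  moreover have "us s (z + h / 2) < 0" using h(2)[of "h / 2"] h(1) z(3) by simp
  ultimately have "s \<in> A" using sS z(1) h(1) by (auto simp: A_def intro!: exI[of _ "z + h / 2"])
  then show ?thesis by blast
 qed
 moreover have "connected S" by (simp add: S_def)
 ultimately have "\<not> S \<subseteq> A \<union> B" unfolding connected_openin by blast
 then obtain s where s: "s \<in> S" "s \<notin> A" "s \<notin> B" by auto
 have upper: "us s t \<le> 1" if "-1 \<le> t" "\<And>r. r \<in> {-1..t} \<Longrightarrow> 0 < us s r" for t
  using s that unfolding B_def by force
 have pos: "0 < us s t" if t: "-1 \<le> t" for t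
 proof (rule ccontr)
  assume "\<not> 0 < us s t"
  then obtain z where z: "-1 < z" "z \<le> t" "us s z = 0" "\<And>r. -1 \<le> r \<Longrightarrow> r < z \<Longrightarrow> 0 < us s r"
   by (rule_tac first_zero[of "-1" t "us s", OF cont[OF s(1)]]) (use t left[OF s(1), of "-1"] in auto)
  have le1: "us s r \<le> 1" if "-1 \<le> r" "r < z" for r using upper[OF that(1)] z(4) that by auto
  \<comment> \<open>Membership in \<open>A\<close> demands u < 1 strictly. Touching 1 from below
    would be a local maximum with v = 0 and v' = 1 - m > 0, which is absurd; at the left end v \<ge>
    c u > 0 has the same effect.\<close>
  have less1: "us s r < 1" if r: "-1 \<le> r" "r \<le> z" for r
  proof (rule ccontr)
   assume "\<not> us s r < 1"
   then have eq: "us s r = 1" and rz: "r < z" using le1[of r] r z(3) by (cases "r = z"; force)+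
   show False
   proof (cases "r = -1")
    case True
    then have "0 < vs s r" using c1[OF s(1), of "-1"] eq c_pos by simp
    then obtain h where h: "h > 0" "\<And>x. 0 < x \<Longrightarrow> x < h \<Longrightarrow> us s r < us s (r + x)"
     using DERIV_pos_inc_right[OF tsolD(1)[OF uv[OF s(1)]]] by blast
    define x where "x = min (h / 2) ((z - r) / 2)"
    have "0 < x" "x < h" "r + x < z" using h(1) rz by (auto simp: x_def min_def field_simps)
    then show False using h(2)[of x] eq le1[of "r + x"] r by simp
   next
    case False
    define d where "d = min (r + 1) (z - r)"
    have d: "0 < d" using False r rz by (simp add: d_def)
    have "vs s r = 0"
    proof (rule DERIV_local_max[OF tsolD(1)[OF uv[OF s(1)]] d])
     show "\<forall>y. \<bar>r - y\<bar> < d \<longrightarrow> us s y \<le> us s r"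
     proof (intro allI impI)
      fix y assume "\<bar>r - y\<bar> < d"
      then have "-1 \<le> y" "y < z" unfolding d_def by linarith+
      then show "us s y \<le> us s r" using le1 eq by simp
     qed
    qed
    then have "DERIV (vs s) r :> 1 - m r"
     using tsolD(2)[OF uv[OF s(1)], of r] eq by (simp add: cub_eq)
    then obtain h where h: "h > 0" "\<And>x. 0 < x \<Longrightarrow> x < h \<Longrightarrow> vs s r < vs s (r + x)"
     using DERIV_pos_inc_right[of "vs s" "1 - m r" r] m_bounds[of r] by auto
    define x where "x = min (h / 2) ((z - r) / 2)"
    have x: "0 < x" "x < h" "r + x < z" using h(1) rz by (auto simp: x_def min_def field_simps)
    have "us s r < us s (r + x)"
    proof (rule DERIV_pos_imp_increasing_open[where f="us s"])
     show "\<exists>y. DERIV (us s) w :> y \<and> y > 0" if "r < w" "w < r + x" for w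
      using tsolD(1)[OF uv[OF s(1)], of w] h(2)[of "w - r"] that x \<open>vs s r = 0\<close> by auto
    qed (use x cont[OF s(1)] in auto)
    then show False using le1[of "r + x"] eq r x by simp
   qed
  qed
  have "\<not> 0 < vs s z"
  proof
   assume "0 < vs s z"
   then obtain h where h: "h > 0" "\<And>x. 0 < x \<Longrightarrow> x < h \<Longrightarrow> us s (z - x) < us s z"
    using DERIV_pos_inc_left[OF tsolD(1)[OF uv[OF s(1)]]] by blast
   define x where "x = min (h / 2) ((z + 1) / 2)"
   have "0 < x" "x < h" "-1 \<le> z - x" using h(1) z(1) by (auto simp: x_def min_def field_simps)
   then show False using h(2)[of x] z(3) z(4)[of "z - x"] by simp
  qed
  then have "vs s z < 0" using no_touch[OF s(1) z(3)] by simp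
  then obtain h where h: "h > 0" "\<And>x. 0 < x \<Longrightarrow> x < h \<Longrightarrow> us s (z + x) < us s z"
   using DERIV_neg_dec_right[OF tsolD(1)[OF uv[OF s(1)]]] by blast
  have "us s r < 1" if "r \<in> {-1..z + h / 2}" for r
  proof (cases "r \<le> z")
   case True
   then show ?thesis using less1[of r] that by auto
  next
   case False
   then show ?thesis using h(2)[of "r - z"] that z(3) h(1) by auto
  qed
  moreover have "us s (z + h / 2) < 0" using h(2)[of "h / 2"] h(1) z(3) by simp
  ultimately have "s \<in> A" using s(1) z(1) h(1) by (auto simp: A_def intro!: exI[of _ "z + h / 2"])
  then show False using s(2) by simp
 qed
 have right_le: "us s t \<le> 1" if "-1 \<le> t" for t by (rule upper[OF that]) (use pos in simp)
 have u_le: "us s t \<le> 1" for t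
 proof (cases "-1 \<le> t")
  case False
  then have "us s t \<le> s" using left[OF s(1), of t] by simp
  then show ?thesis using right_le[of "-1"] u1[OF s(1)] by simp
 qed (rule right_le)
 have "0 < us s t" for t
 proof (cases "-1 \<le> t")
  case False
  then show ?thesis using left[OF s(1), of t] by simp
 qed (rule pos)
 then show ?thesis using uv[OF s(1)] lu[OF s(1)] lv[OF s(1)]
  by (intro exI[of _ "us s"] exI[of _ "vs s"]) (simp add: u_le)
qed

lemma eventually_decreasing_unbounded:
 fixes g g' :: "real \<Rightarrow> real"
 assumes "\<And>t. t0 \<le> t \<Longrightarrow> DERIV g t :> g' t" "\<And>t. t0 \<le> t \<Longrightarrow> g' t \<le> - r" "0 < r"
 shows "\<exists>t1\<ge>t0. \<forall>t\<ge>t1. g t < b"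
proof -
 define t1 where "t1 = max t0 (t0 + (g t0 - b + 1) / r)"
 have "g t < b" if "t1 \<le> t" for t
 proof -
  have t: "t0 \<le> t" using that by (simp add: t1_def)
  have "g t + r * t \<le> g t0 + r * t0"
  proof (rule deriv_nonpos_mono[where f="\<lambda>t. g t + r * t" and f'="\<lambda>t. g' t + r"])
   show "DERIV (\<lambda>t. g t + r * t) x :> g' x + r" if "t0 \<le> x" for x
    by (intro DERIV_add assms(1) that DERIV_cmult_Id)
   show "g' x + r \<le> 0" if "t0 \<le> x" for x using assms(2)[OF that] by simp
  qed (use t in auto)
  moreover have "g t0 - b + 1 \<le> r * (t - t0)"
  proof -
   have "(g t0 - b + 1) / r \<le> t - t0" using that by (simp add: t1_def)
   then show ?thesis using \<open>0 < r\<close> by (simp add: field_simps)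
  qed
  ultimately show ?thesis unfolding right_diff_distrib by linarith
 qed
 then show ?thesis by (intro exI[of _ t1]) (auto simp: t1_def)
qed

text \<open>The orbit cannot turn back: once v < 0, u falls while \<mu> rises, so v' < 0 at any
  later zero of v and u decreases for ever. Then u either keeps away from zero, where v - c u falls
  without bound, or becomes small and is forced to vanish. An increasing bounded u can only converge
  to 1, and a zero of v would have v' = 0 and v'' = - \<mu>' u < 0, against v \<ge> 0.\<close>

lemma heteroclinic_solution_exists:
 "\<exists>u v. tsol u v \<and> (u \<longlongrightarrow> 0) at_bot \<and> (v \<longlongrightarrow> 0) at_bot \<and> (u \<longlongrightarrow> 1) at_top \<and> (v \<longlongrightarrow> 0) at_top \<and>
   (\<forall>t. 0 < u t \<and> u t < 1 \<and> 0 < v t \<and> v t \<le> 200 * u t) \<and> (\<forall>t\<le>0. c * u t \<le> v t)"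
proof -
 obtain u v where uv: "tsol u v" and lu: "(u \<longlongrightarrow> 0) at_bot" and lv: "(v \<longlongrightarrow> 0) at_bot"
  and u: "\<And>t. 0 < u t" "\<And>t. u t \<le> 1" using shooting by blast
 have u2: "\<bar>u t\<bar> \<le> 2" for t using u(1)[of t] u(2)[of t] by simp
 note du = true_sol(1)[OF uv u2] and dv = true_sol(2)[OF uv u2]
 have contv: "continuous_on X v" for X by (rule tsol_cont(2)[OF uv])
 have v200: "v t \<le> 200 * u t" for t
  using log_slope_bound[OF uv tsol_zero, of t] u by simp
 have vc: "c * u t \<le> v t" if "t \<le> 0" for t
 proof (rule vanishing_slope_bound(2)[of 0 u v c "\<lambda>t. (u t)\<^sup>2 - m t"])
  fix t :: real assume t: "t \<le> 0"
  show "DERIV u t :> v t" by (rule du)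
  show "DERIV v t :> c * v t + ((u t)\<^sup>2 - m t) * u t"
   by (rule DERIV_cong[OF dv]) (simp add: algebra_simps power2_eq_square power3_eq_cube)
  show "0 \<le> (u t)\<^sup>2 - m t" using m_sgn(1)[OF t] zero_le_power2[of "u t"] by linarith
  show "0 < u t" by (rule u)
 qed (use that lu in auto)
 have v0: "0 < v t" if "t \<le> 0" for t using vc[OF that] mult_pos_pos[OF c_pos u(1)[of t]] by linarith
 define g where "g t = v t - c * u t" for t
 have dg: "DERIV g t :> - u t * (m t - (u t)\<^sup>2)" for t
  unfolding g_def[abs_def]
  by (rule DERIV_cong[OF DERIV_diff[OF dv DERIV_cmult[OF du]]]) (simp add: algebra_simps power2_eq_square power3_eq_cube)
 have vnn: "0 \<le> v t" for t
 proof (rule ccontr)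
  assume neg: "\<not> 0 \<le> v t"
  then have t: "0 < t" using v0[of t] by force
  obtain ta where ta: "0 \<le> ta" "ta < t" "- v ta = 0" "\<And>r. ta < r \<Longrightarrow> r \<le> t \<Longrightarrow> 0 < - v r"
   by (rule last_zero[of 0 t "\<lambda>t. - v t"]) (use neg t v0[of 0] contv in \<open>auto intro!: continuous_intros\<close>)
  \<comment> \<open>As v is negative right after its last zero, v' \<le> 0 there, which reads u^2
    \<le> \<mu>.\<close>
  have uta: "(u ta)\<^sup>2 \<le> m ta"
  proof (rule ccontr)
   assume "\<not> (u ta)\<^sup>2 \<le> m ta"
   then have "0 < u ta * ((u ta)\<^sup>2 - m ta)" using u(1)[of ta] by simp
   then have "0 < c * v ta + u ta ^ 3 - m ta * u ta" using ta(3) by (simp add: algebra_simps power2_eq_square power3_eq_cube)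
   from DERIV_pos_inc_right[OF dv this] obtain h where h: "h > 0" "\<And>x. 0 < x \<Longrightarrow> x < h \<Longrightarrow> v ta < v (ta + x)" by blast
   define x where "x = min (h / 2) ((t - ta) / 2)"
   have "0 < x" "x < h" "ta + x < t" using h(1) ta(2) by (auto simp: x_def min_def field_simps)
   then show False using h(2)[of x] ta(3) ta(4)[of "ta + x"] by simp
  qed
  have vneg: "v r < 0" if r: "ta < r" for r
  proof (rule ccontr)
   assume nn: "\<not> v r < 0"
   then have tr: "t < r" using ta(4)[OF r] by force
   obtain tb where tb: "t < tb" "tb \<le> r" "- v tb = 0" "\<And>x. t \<le> x \<Longrightarrow> x < tb \<Longrightarrow> 0 < - v x"
    by (rule first_zero[of t r "\<lambda>t. - v t"]) (use neg tr nn contv in \<open>auto intro!: continuous_intros\<close>)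
   have vbetween: "v x \<le> 0" if "ta \<le> x" "x \<le> tb" for x
    using ta(3) ta(4)[of x] tb(3) tb(4)[of x] that by (cases "x = ta"; cases "x = tb"; cases "x \<le> t") auto
   have "u tb \<le> u ta"
    by (rule deriv_nonpos_mono[OF _ du]) (use vbetween ta tb in auto)
   then have "(u tb)\<^sup>2 \<le> (u ta)\<^sup>2" using u(1)[of tb] by (intro power_mono) auto
   moreover have "m ta < m tb" using m_mono ta tb by simp
   ultimately have "(u tb)\<^sup>2 < m tb" using uta by linarith
   then have "u tb * ((u tb)\<^sup>2 - m tb) < 0" using u(1)[of tb] by (simp add: mult_pos_neg)
   then have "c * v tb + u tb ^ 3 - m tb * u tb < 0" using tb(3) by (simp add: algebra_simps power2_eq_square power3_eq_cube)
   from DERIV_neg_dec_left[OF dv this] obtain h where h: "h > 0" "\<And>x. 0 < x \<Longrightarrow> x < h \<Longrightarrow> v tb < v (tb - x)" by blast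
   define x where "x = min (h / 2) ((tb - t) / 2)"
   have "0 < x" "x < h" "t < tb - x" using h(1) tb(1) by (auto simp: x_def min_def field_simps)
   then show False using h(2)[of x] tb(3) tb(4)[of "tb - x"] by simp
  qed
  have udec: "u y \<le> u x" if "ta \<le> x" "x \<le> y" for x y
   by (rule deriv_nonpos_mono[OF that(2) du]) (use vneg ta(3) that in \<open>auto simp: order_le_less\<close>)
  define U0 where "U0 = (u ta)\<^sup>2"
  have U0: "U0 < 1" using uta m_bounds(2)[of ta] by (simp add: U0_def)
  \<comment> \<open>One constant for both cases: half of the gap between \<open>U0\<close> and the
    final ramp value 1, and the margin demanded by \<open>small_solution_vanishes\<close>.\<close>
  define \<kappa> where "\<kappa> = min ((1 - U0) / 2) ((1 - c\<^sup>2 / 4) / 4)"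
  have c2: "c\<^sup>2 < 4" using power_strict_mono[OF c_less, of 2] c_pos by simp
  then have \<kappa>: "0 < \<kappa>" "\<kappa> \<le> (1 - U0) / 2" "\<kappa> \<le> (1 - c\<^sup>2 / 4) / 4"
   using U0 unfolding \<kappa>_def by (simp_all only: min.cobounded1 min.cobounded2) simp
  have "U0 + \<kappa> < 1" using \<kappa>(2) U0 by argo
  then obtain t2 where t2: "0 \<le> t2" "\<And>t. t2 \<le> t \<Longrightarrow> U0 + \<kappa> < m t" using m_large by blast
  have "c\<^sup>2 / 4 + 3 * \<kappa> < 1" using \<kappa>(3) c2 by argo
  then obtain t3 where t3: "0 \<le> t3" "\<And>t. t3 \<le> t \<Longrightarrow> c\<^sup>2 / 4 + 3 * \<kappa> < m t" using m_large by blast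
  show False
  proof (cases "\<forall>t\<ge>ta. sqrt \<kappa> \<le> u t")
   case True
   define t4 where "t4 = max ta t2"
   \<comment> \<open>The quantity g = v - c u decreases at least linearly, which pulls v below -1
     and then u below 0.\<close>
   have "\<exists>t1\<ge>t4. \<forall>t\<ge>t1. g t < - c - 1"
   proof (rule eventually_decreasing_unbounded[OF dg])
    fix x assume x: "t4 \<le> x"
    have "(u x)\<^sup>2 \<le> U0" unfolding U0_def using udec[of ta x] x u(1)[of x] by (intro power_mono) (auto simp: t4_def)
    then have "\<kappa> \<le> m x - (u x)\<^sup>2" using t2(2)[of x] x by (simp add: t4_def)
    then have "sqrt \<kappa> * \<kappa> \<le> u x * (m x - (u x)\<^sup>2)" using True x \<kappa> u(1)[of x] by (intro mult_mono) (auto simp: t4_def)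
    then show "- u x * (m x - (u x)\<^sup>2) \<le> - (sqrt \<kappa> * \<kappa>)" by simp
   qed (use \<kappa> in auto)
   then obtain t5 where t5: "\<And>t. t5 \<le> t \<Longrightarrow> g t < - c - 1" by blast
   have "\<exists>t1\<ge>t5. \<forall>t\<ge>t1. u t < 0"
   proof (rule eventually_decreasing_unbounded[OF du, of _ 1])
    fix x assume x: "t5 \<le> x"
    have "c * u x \<le> c * 1" using u(2)[of x] c_pos by (intro mult_left_mono) auto
    then show "v x \<le> - 1" using t5[OF x] by (simp add: g_def)
   qed simp
   then obtain t6 where "\<forall>t\<ge>t6. u t < 0" by blast
   then have "u t6 < 0" by blast
   then show False using u(1)[of t6] by simp
  next
   case False
   then obtain t4 where t4: "ta \<le> t4" "u t4 < sqrt \<kappa>" by force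
   define t5 where "t5 = max t3 t4"
   have "\<exists>t. t5 \<le> t \<and> t \<le> t5 + pi / sqrt \<kappa> \<and> u t \<le> 0"
   proof (rule small_solution_vanishes[OF uv \<kappa>(1)])
    fix t assume t: "t5 \<le> t"
    show "c\<^sup>2 / 4 + 3 * \<kappa> \<le> m t" using t3(2)[of t] t by (simp add: t5_def)
    have "u t \<le> sqrt \<kappa>" using udec[of t4 t] t t4 by (simp add: t5_def)
    then have "(u t)\<^sup>2 \<le> (sqrt \<kappa>)\<^sup>2" using u(1)[of t] by (intro power_mono) auto
    then show "(u t)\<^sup>2 \<le> \<kappa>" using \<kappa> by simp
   qed
   then show False using u(1) by (meson not_le)
  qed
 qed
 have umono: "u x \<le> u y" if "x \<le> y" for x y by (rule deriv_nonneg_mono[OF that du]) (rule vnn)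
 have limu: "(u \<longlongrightarrow> 1) at_top"
 proof (rule tendstoI)
  fix e :: real assume "e > 0"
  define \<eta> where "\<eta> = min e (1/2)"
  have \<eta>: "0 < \<eta>" "\<eta> \<le> e" "\<eta> < 1" using \<open>e > 0\<close> by (auto simp: \<eta>_def)
  have "\<exists>t. 1 - \<eta> < u t"
  proof (rule ccontr)
   assume "\<not> (\<exists>t. 1 - \<eta> < u t)"
   then have le: "u t \<le> 1 - \<eta>" for t by (meson not_le)
   have "1 - \<eta> / 2 < 1" using \<eta> by simp
   then obtain t2 where t2: "0 \<le> t2" "\<And>t. t2 \<le> t \<Longrightarrow> 1 - \<eta> / 2 < m t" using m_large by blast
   have "\<exists>t1\<ge>t2. \<forall>t\<ge>t1. g t < - c"
   proof (rule eventually_decreasing_unbounded[OF dg])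
    fix x assume x: "t2 \<le> x"
    have "(u x)\<^sup>2 \<le> u x" using u[of x] by (simp add: power2_eq_square mult_left_le)
    then have "\<eta> / 2 \<le> m x - (u x)\<^sup>2" using t2(2)[OF x] le[of x] by linarith
    then have "u t2 * (\<eta> / 2) \<le> u x * (m x - (u x)\<^sup>2)" using umono[OF x] \<eta> u(1)[of x] u(1)[of t2] by (intro mult_mono) auto
    then show "- u x * (m x - (u x)\<^sup>2) \<le> - (u t2 * (\<eta> / 2))" by simp
   qed (use \<eta> u in auto)
   then obtain t where "g t < - c" by blast
   moreover have "c * u t \<le> c * 1" using u(2)[of t] c_pos by (intro mult_left_mono) auto
   ultimately show False using vnn[of t] unfolding g_def by linarith
  qed
  then obtain t where t: "1 - \<eta> < u t" by blast
  have "dist (u x) 1 < e" if "t \<le> x" for x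
   using umono[OF that] t u(2)[of x] \<eta> by (simp add: dist_real_def)
  then show "\<forall>\<^sub>F x in at_top. dist (u x) 1 < e" by (auto simp: eventually_at_top_linorder)
 qed
 have limv: "(v \<longlongrightarrow> 0) at_top"
 proof (rule tendstoI)
  fix e :: real assume "e > 0"
  have "((\<lambda>t. u t * (m t - (u t)\<^sup>2)) \<longlongrightarrow> 1 * (1 - 1\<^sup>2)) at_top"
   by (intro tendsto_intros limu m_lim)
  then have "\<forall>\<^sub>F t in at_top. u t * (m t - (u t)\<^sup>2) < c * e / 2"
   by (rule order_tendstoD) (use c_pos \<open>e > 0\<close> in simp)
  then obtain t0 where t0: "\<And>t. t0 \<le> t \<Longrightarrow> u t * (m t - (u t)\<^sup>2) < c * e / 2" by (auto simp: eventually_at_top_linorder)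
  have "v t < e" if t: "t0 \<le> t" for t
  proof (rule ccontr)
   assume "\<not> v t < e"
   then have ge: "e / 2 \<le> v t - e / 2" by simp
   \<comment> \<open>Once u (m - u^2) < c e / 2, the quantity exp (- c t) (v - e / 2) is
     nondecreasing, so v would stay above e and carry u past 1.\<close>
   have big: "e \<le> v s" if s: "t \<le> s" for s
   proof -
    have "exp (- c * t) * (v t - e / 2) \<le> exp (- c * s) * (v s - e / 2)"
    proof (rule deriv_nonneg_mono[OF s, where f="\<lambda>t. exp (- c * t) * (v t - e / 2)"])
     fix x assume x: "t \<le> x"
     have E: "DERIV (\<lambda>t. exp (- c * t)) x :> - c * exp (- c * x)"
      by (auto intro!: derivative_eq_intros)
     show "DERIV (\<lambda>t. exp (- c * t) * (v t - e / 2)) x :> exp (- c * x) * (c * e / 2 - u x * (m x - (u x)\<^sup>2))"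
      by (rule DERIV_cong[OF DERIV_mult[OF E DERIV_diff[OF dv DERIV_const]]])
        (simp add: field_simps power2_eq_square power3_eq_cube)
     show "0 \<le> exp (- c * x) * (c * e / 2 - u x * (m x - (u x)\<^sup>2))"
      using t0[of x] x t by simp
    qed
    also have "\<dots> \<le> exp (- c * t) * (v s - e / 2)" if "0 \<le> v s - e / 2"
     using that s c_pos by (intro mult_right_mono) auto
    finally have 1: "v t \<le> v s" if "0 \<le> v s - e / 2" using that by simp
    have "0 < exp (- c * t) * (v t - e / 2)" using ge \<open>e > 0\<close> by simp
    with \<open>exp (- c * t) * (v t - e / 2) \<le> exp (- c * s) * (v s - e / 2)\<close>
    have "0 < exp (- c * s) * (v s - e / 2)" by linarith
    then have "0 \<le> v s - e / 2" by (simp add: zero_less_mult_iff)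
    from 1[OF this] show ?thesis using ge by simp
   qed
   have "u t - e * t \<le> u (t + 1 / e) - e * (t + 1 / e)"
   proof (rule deriv_nonneg_mono[where f="\<lambda>x. u x - e * x"])
    show "DERIV (\<lambda>x. u x - e * x) x :> v x - e" for x
     by (intro DERIV_diff du DERIV_cmult_Id)
    show "0 \<le> v x - e" if "t \<le> x" for x using big[OF that] by simp
   qed (use \<open>e > 0\<close> in auto)
   then have "u t + 1 \<le> u (t + 1 / e)" using \<open>e > 0\<close> by (simp add: algebra_simps)
   then show False using u(1)[of t] u(2)[of "t + 1 / e"] by simp
  qed
  then have "dist (v t) 0 < e" if "t0 \<le> t" for t using that vnn[of t] by (simp add: dist_real_def)
  then show "\<forall>\<^sub>F t in at_top. dist (v t) 0 < e" by (auto simp: eventually_at_top_linorder)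
 qed
 have vpos: "0 < v t" for t
 proof (rule ccontr)
  assume "\<not> 0 < v t"
  then have v0: "v t = 0" using vnn[of t] by simp
  have eq0: "c * v t + u t ^ 3 - m t * u t = 0"
   by (rule DERIV_local_min[OF dv zero_less_one]) (use v0 vnn in simp)
  have "((\<lambda>t. c * v t + u t ^ 3 - m t * u t) has_real_derivative
    c * (c * v t + u t ^ 3 - m t * u t) + 3 * (u t)\<^sup>2 * v t - (\<epsilon> * (1 - (m t)\<^sup>2) * u t + m t * v t)) (at t)"
   by (rule DERIV_cong[OF DERIV_diff[OF DERIV_add[OF DERIV_cmult[OF dv] DERIV_power[OF du]] DERIV_mult[OF tanh_deriv du]]])
     (simp add: power2_eq_square)
  moreover have "(m t)\<^sup>2 < 1" using m_bounds[of t] by (simp add: abs_square_less_1)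
  then have "0 < \<epsilon> * (1 - (m t)\<^sup>2) * u t" using eps u(1)[of t] by simp
  ultimately have "DERIV (\<lambda>t. c * v t + u t ^ 3 - m t * u t) t :> - (\<epsilon> * (1 - (m t)\<^sup>2) * u t)"
   "- (\<epsilon> * (1 - (m t)\<^sup>2) * u t) < 0" using v0 eq0 by simp_all
  from DERIV_neg_dec_right[OF this] obtain h where
   h: "h > 0" "\<And>x. 0 < x \<Longrightarrow> x < h \<Longrightarrow> c * v (t + x) + u (t + x) ^ 3 - m (t + x) * u (t + x) < 0"
   using eq0 by auto
  have "v (t + h / 2) < v t"
  proof (rule DERIV_neg_imp_decreasing_open[where f=v])
   show "\<exists>y. DERIV v x :> y \<and> y < 0" if "t < x" "x < t + h / 2" for x
    using dv[of x] h(2)[of "x - t"] that by force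
  qed (use h contv in auto)
  then show False using vnn[of "t + h / 2"] v0 by simp
 qed
 have u1: "u t < 1" for t
 proof -
  have "u t < u (t + 1)" by (rule DERIV_pos_imp_increasing[where f=u]) (use du vpos in auto)
  then show ?thesis using u(2)[of "t + 1"] by simp
 qed
 show ?thesis using uv lu lv limu limv u u1 vpos v200 vc by blast
qed

end

section \<open>The Airy function in terms of Bessel functions\<close>

definition clifford_coeff :: "real \<Rightarrow> nat \<Rightarrow> real" where
 "clifford_coeff \<nu> k = (-1) ^ k / fact k * rGamma (real k + \<nu> + 1)"

text \<open>The entire function with \<open>bessel_J \<nu> x = (x / 2) powr \<nu> * clifford \<nu> (x\<^sup>2 / 4)\<close>.\<close>

definition clifford :: "real \<Rightarrow> real \<Rightarrow> real" where
 "clifford \<nu> w = (\<Sum>k. clifford_coeff \<nu> k * w ^ k)"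

lemma clifford_coeff_Suc_aux: "real (Suc k) * clifford_coeff \<nu> (Suc k) = - ((-1) ^ k / fact k * rGamma (real k + \<nu> + 1 + 1))"
proof -
 have arg: "real (Suc k) + \<nu> + 1 = real k + \<nu> + 1 + 1" by simp
 have "fact (Suc k) = real (Suc k) * (fact k :: real)" by (rule fact_Suc)
 then show ?thesis unfolding clifford_coeff_def arg by (simp del: of_nat_Suc fact_Suc)
qed

lemma clifford_coeff_Suc: "clifford_coeff \<nu> (Suc k) * (real k + \<nu> + 1) * (real k + 1) = - clifford_coeff \<nu> k"
proof -
 have "(real k + \<nu> + 1) * rGamma (real k + \<nu> + 1 + 1) = rGamma (real k + \<nu> + 1)" by (rule rGamma_plus1)
 moreover have "clifford_coeff \<nu> (Suc k) * (real k + \<nu> + 1) * (real k + 1) = (real (Suc k) * clifford_coeff \<nu> (Suc k)) * (real k + \<nu> + 1)"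
  by simp
 ultimately show ?thesis unfolding clifford_coeff_Suc_aux by (simp add: clifford_coeff_def mult_ac)
qed

lemma clifford_coeff_shift: "real (Suc k) * clifford_coeff \<nu> (Suc k) = - clifford_coeff (\<nu> + 1) k"
 unfolding clifford_coeff_Suc_aux by (simp add: clifford_coeff_def add_ac)

lemma clifford_summable: "summable (\<lambda>k. clifford_coeff \<nu> k * w ^ k)"
proof -
 obtain N :: nat where N: "real N \<ge> max (\<bar>\<nu>\<bar> + 1) (2 * \<bar>w\<bar>)" using real_arch_simple by blast
 show ?thesis
 proof (rule summable_ratio_test[where c="1/2" and N=N])
  fix n assume "n \<ge> N"
  then have "real N \<le> real n" by simp
  moreover have "\<bar>\<nu>\<bar> + 1 \<le> real N" "2 * \<bar>w\<bar> \<le> real N" using N by simp_all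
  ultimately have n: "1 \<le> real n + \<nu> + 1" "2 * \<bar>w\<bar> \<le> real n + 1" by linarith+
  have "1 * (2 * \<bar>w\<bar>) \<le> (real n + \<nu> + 1) * (real n + 1)" using n by (intro mult_mono) simp_all
  then have w: "2 * \<bar>w\<bar> \<le> (real n + \<nu> + 1) * (real n + 1)" by simp
  have "\<bar>clifford_coeff \<nu> (Suc n)\<bar> * (2 * \<bar>w\<bar>) \<le> \<bar>clifford_coeff \<nu> (Suc n)\<bar> * ((real n + \<nu> + 1) * (real n + 1))"
   by (rule mult_left_mono[OF w]) simp
  also have "\<dots> = \<bar>clifford_coeff \<nu> (Suc n) * (real n + \<nu> + 1) * (real n + 1)\<bar>"
   using n by (simp add: abs_mult)
  also have "\<dots> = \<bar>clifford_coeff \<nu> n\<bar>" unfolding clifford_coeff_Suc by simp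
  finally have *: "\<bar>clifford_coeff \<nu> (Suc n)\<bar> * \<bar>w\<bar> \<le> 1/2 * \<bar>clifford_coeff \<nu> n\<bar>" by simp
  have "norm (clifford_coeff \<nu> (Suc n) * w ^ Suc n) = (\<bar>clifford_coeff \<nu> (Suc n)\<bar> * \<bar>w\<bar>) * \<bar>w\<bar> ^ n"
   by (simp add: abs_mult power_abs)
  also have "\<dots> \<le> (1/2 * \<bar>clifford_coeff \<nu> n\<bar>) * \<bar>w\<bar> ^ n" by (rule mult_right_mono[OF *]) simp
  finally show "norm (clifford_coeff \<nu> (Suc n) * w ^ Suc n) \<le> 1/2 * norm (clifford_coeff \<nu> n * w ^ n)"
   by (simp add: abs_mult power_abs)
 qed simp
qed

lemma clifford_sums: "(\<lambda>k. clifford_coeff \<nu> k * w ^ k) sums clifford \<nu> w"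
 unfolding clifford_def using clifford_summable by (rule summable_sums)

lemma clifford_deriv: "DERIV (clifford \<nu>) w :> - clifford (\<nu> + 1) w"
proof -
 have d: "diffs (clifford_coeff \<nu>) = (\<lambda>n. - clifford_coeff (\<nu> + 1) n)"
  by (rule ext) (simp only: diffs_def clifford_coeff_shift)
 have "(\<Sum>n. - clifford_coeff (\<nu> + 1) n * w ^ n) = - clifford (\<nu> + 1) w"
  unfolding mult_minus_left by (rule sums_unique[OF sums_minus[OF clifford_sums], symmetric])
 with termdiffs_strong_converges_everywhere[of "clifford_coeff \<nu>" w, OF clifford_summable]
 have "DERIV (\<lambda>x. \<Sum>n. clifford_coeff \<nu> n * x ^ n) w :> - clifford (\<nu> + 1) w"
  unfolding d by (simp only:)
 moreover have "clifford \<nu> = (\<lambda>x. \<Sum>n. clifford_coeff \<nu> n * x ^ n)"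
  by (rule ext) (rule clifford_def)
 ultimately show ?thesis by (simp only:)
qed

text \<open>The three-term recurrence of the Bessel functions with the powers stripped off. Together
  with \<open>clifford_deriv\<close>, which raises the order, it yields Airy's equation.\<close>

lemma clifford_recurrence: "clifford \<nu> w = (\<nu> + 1) * clifford (\<nu> + 1) w - w * clifford (\<nu> + 2) w"
proof -
 define f where "f k = clifford_coeff (\<nu> + 1) k * w ^ k" for k
 define g where "g k = (if k = 0 then 0 else w * (clifford_coeff (\<nu> + 2) (k - 1) * w ^ (k - 1)))" for k
 have "(\<lambda>k. (\<nu> + 1) * f k) sums ((\<nu> + 1) * clifford (\<nu> + 1) w)"
  unfolding f_def by (intro sums_mult clifford_sums)
 moreover have "g sums (w * clifford (\<nu> + 2) w)"
 proof -
  have "(\<lambda>k. g (Suc k)) sums (w * clifford (\<nu> + 2) w)" unfolding g_def by (auto intro!: sums_mult clifford_sums)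
  moreover have "g 0 = 0" by (simp add: g_def)
  ultimately show ?thesis using sums_Suc[of g] by simp
 qed
 ultimately have "(\<lambda>k. (\<nu> + 1) * f k - g k) sums ((\<nu> + 1) * clifford (\<nu> + 1) w - w * clifford (\<nu> + 2) w)"
  by (rule sums_diff)
 moreover have "(\<nu> + 1) * f k - g k = clifford_coeff \<nu> k * w ^ k" for k
 proof (cases k)
  case 0
  have "(\<nu> + 1) * rGamma (\<nu> + 1 + 1) = rGamma (\<nu> + 1)" by (rule rGamma_plus1)
  then show ?thesis using 0 by (simp add: f_def g_def clifford_coeff_def add.assoc)
 next
  case (Suc j)
  have 1: "clifford_coeff (\<nu> + 2) j = - (real k * clifford_coeff (\<nu> + 1) k)"
   using clifford_coeff_shift[of j "\<nu> + 1"] Suc by (simp add: add.assoc)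
  have 2: "(real k + \<nu> + 1) * rGamma (real k + \<nu> + 1 + 1) = rGamma (real k + \<nu> + 1)" by (rule rGamma_plus1)
  have arg: "real k + (\<nu> + 1) + 1 = real k + \<nu> + 1 + 1" by simp
  have 3: "(real k + \<nu> + 1) * clifford_coeff (\<nu> + 1) k = clifford_coeff \<nu> k"
   unfolding clifford_coeff_def arg 2[symmetric] by (simp only: mult_ac)
  have 4: "g k = - (real k * clifford_coeff (\<nu> + 1) k) * w ^ k"
   unfolding 1[symmetric] g_def using Suc by (simp add: mult_ac)
  show ?thesis unfolding f_def 4 3[symmetric] by algebra
 qed
 ultimately have "(\<lambda>k. clifford_coeff \<nu> k * w ^ k) sums ((\<nu> + 1) * clifford (\<nu> + 1) w - w * clifford (\<nu> + 2) w)" by simp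
 then show ?thesis using clifford_sums sums_unique2 by blast
qed

lemma bessel_J_eq_clifford: assumes "x > 0" shows "bessel_J \<nu> x = (x / 2) powr \<nu> * clifford \<nu> (x\<^sup>2 / 4)"
proof -
 have "(-1) ^ k / fact k * rGamma (real k + \<nu> + 1) * (x / 2) powr (2 * real k + \<nu>) =
   (x / 2) powr \<nu> * (clifford_coeff \<nu> k * (x\<^sup>2 / 4) ^ k)" for k
 proof -
  have "(x / 2) powr (2 * real k + \<nu>) = (x / 2) powr \<nu> * (x / 2) ^ (2 * k)"
   using assms powr_realpow[of "x / 2" "2 * k"] by (simp add: powr_add mult.commute)
  also have "(x / 2) ^ (2 * k) = (x\<^sup>2 / 4) ^ k" by (simp add: power_mult power_divide)
  finally show ?thesis by (simp add: clifford_coeff_def)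
 qed
 then have "bessel_J \<nu> x = (\<Sum>k. (x / 2) powr \<nu> * (clifford_coeff \<nu> k * (x\<^sup>2 / 4) ^ k))"
  by (simp add: bessel_J_def)
 also have "\<dots> = (x / 2) powr \<nu> * clifford \<nu> (x\<^sup>2 / 4)"
  unfolding clifford_def by (rule suminf_mult[OF clifford_summable])
 finally show ?thesis .
qed

text \<open>A multiple of \<open>Ai (- x)\<close>.\<close>

definition airy :: "real \<Rightarrow> real" where
 "airy x = 3 powr (1/3) * clifford (-1/3) (x ^ 3 / 9) + 3 powr (-1/3) * x * clifford (1/3) (x ^ 3 / 9)"

text \<open>The derivative of \<open>airy\<close>, with two terms merged by
  \<open>clifford_recurrence\<close>, so that differentiating again leads back to the functions in
  \<open>airy\<close>.\<close>

definition airy' :: "real \<Rightarrow> real" where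
 "airy' x = - (3 powr (1/3) / 3) * x\<^sup>2 * clifford (2/3) (x ^ 3 / 9) + 3 * 3 powr (-1/3) * clifford (-2/3) (x ^ 3 / 9)"

lemma clifford_cube_deriv: "DERIV (\<lambda>x. clifford \<nu> (x ^ 3 / 9)) x :> - clifford (\<nu> + 1) (x ^ 3 / 9) * (x\<^sup>2 / 3)"
proof -
 have "DERIV (\<lambda>x. x ^ 3 / 9) x :> x\<^sup>2 / 3" by (auto intro!: derivative_eq_intros)
 from DERIV_chain2[OF clifford_deriv this] show ?thesis .
qed

lemma airy_deriv: "DERIV airy x :> airy' x"
proof -
 define w where "w = x ^ 3 / 9"
 have rec: "clifford (-2/3) w = 1/3 * clifford (1/3) w - w * clifford (4/3) w" using clifford_recurrence[of "-2/3" w] by simp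
 have d1: "DERIV (\<lambda>x. clifford (-1/3) (x ^ 3 / 9)) x :> - clifford (2/3) w * (x\<^sup>2 / 3)"
  and d2: "DERIV (\<lambda>x. clifford (1/3) (x ^ 3 / 9)) x :> - clifford (4/3) w * (x\<^sup>2 / 3)"
  using clifford_cube_deriv[of "-1/3" x] clifford_cube_deriv[of "1/3" x] by (simp_all add: w_def)
 show ?thesis unfolding airy_def[abs_def] airy'_def w_def[symmetric] rec
  by (rule DERIV_cong[OF DERIV_add[OF DERIV_cmult[OF d1] DERIV_mult[OF DERIV_cmult[OF DERIV_ident] d2]]])
    (simp add: w_def field_simps power2_eq_square power3_eq_cube)
qed

lemma airy'_deriv: "DERIV airy' x :> - x * airy x"
proof -
 define w where "w = x ^ 3 / 9"
 have rec: "clifford (-1/3) w = 2/3 * clifford (2/3) w - w * clifford (5/3) w" using clifford_recurrence[of "-1/3" w] by simp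
 have d1: "DERIV (\<lambda>x. clifford (2/3) (x ^ 3 / 9)) x :> - clifford (5/3) w * (x\<^sup>2 / 3)"
  and d2: "DERIV (\<lambda>x. clifford (-2/3) (x ^ 3 / 9)) x :> - clifford (1/3) w * (x\<^sup>2 / 3)"
  using clifford_cube_deriv[of "2/3" x] clifford_cube_deriv[of "-2/3" x] by (simp_all add: w_def)
 have d3: "DERIV (\<lambda>x. - (3 powr (1/3) / 3) * x\<^sup>2) x :> - (3 powr (1/3) / 3) * (2 * x)"
  by (auto intro!: derivative_eq_intros)
 show ?thesis unfolding airy'_def[abs_def] airy_def w_def[symmetric] rec
  by (rule DERIV_cong[OF DERIV_add[OF DERIV_mult[OF d3 d1] DERIV_cmult[OF d2]]])
    (simp add: w_def field_simps power2_eq_square power3_eq_cube)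
qed

lemma airy_bessel:
 assumes "z > 0"
 shows "bessel_J (-1/3) (2 * z powr (3/2) / 3) + bessel_J (1/3) (2 * z powr (3/2) / 3) = airy z / sqrt z"
proof -
 define x where "x = 2 * z powr (3/2) / 3"
 have x: "x > 0" using assms by (simp add: x_def)
 have x2: "x / 2 = z powr (3/2) / 3" by (simp add: x_def)
 have "(z powr (3/2))\<^sup>2 = z ^ 3"
  using assms powr_realpow[of z 3] by (simp add: power2_eq_square flip: powr_add)
 then have x4: "x\<^sup>2 / 4 = z ^ 3 / 9" by (simp add: x_def power_divide power_mult_distrib)
 have p: "(x / 2) powr a = z powr (3/2 * a) * 3 powr (- a)" for a
 proof -
  have "(x / 2) powr a = (z powr (3/2)) powr a / 3 powr a" unfolding x2 by (rule powr_divide)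
  then show ?thesis by (simp add: powr_powr powr_minus_divide)
 qed
 define s where "s = sqrt z"
 have s: "s > 0" "z = s * s" using assms by (simp_all add: s_def)
 have s': "s = z powr (1/2)" using assms powr_half_sqrt[of z] by (simp only: s_def less_imp_le)
 have p1: "(x / 2) powr (-1/3) = 3 powr (1/3) / s"
 proof -
  have "z powr (3/2 * (-1/3)) = inverse s" unfolding s' powr_minus[symmetric] by (rule arg_cong[where f="\<lambda>p. z powr p"]) simp
  then show ?thesis unfolding p by (simp only: divide_inverse mult.commute) simp
 qed
 have p2: "(x / 2) powr (1/3) = 3 powr (-1/3) * s"
 proof -
  have "z powr (3/2 * (1/3)) = s" unfolding s' by (rule arg_cong[where f="\<lambda>p. z powr p"]) simp
  then show ?thesis unfolding p by (simp only: mult.commute) simp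
 qed
 have "(A * C + B * z * D) / s = A / s * C + B * s * D" for A B C D :: real
  using s by (simp add: add_divide_distrib)
 then show ?thesis
  unfolding x_def[symmetric] bessel_J_eq_clifford[OF x] x4 p1 p2 airy_def s_def[symmetric] by simp
qed

section \<open>An integral representation and the behaviour on the negative axis\<close>

text \<open>The integral of s^n exp (- s^3 / 3) over s > 0, evaluated by the substitution t = s^3 /
  3.\<close>

definition moment :: "nat \<Rightarrow> real" where
 "moment n = 3 powr ((real n - 2) / 3) * Gamma ((real n + 1) / 3)"

lemma moment_integral: "((\<lambda>s. s ^ n * exp (- (s ^ 3 / 3))) has_integral moment n) {0<..}"
proof -
 define p where "p = (real n - 2) / 3"
 define f where "f t = t powr p / exp t" for t :: real
 define g where "g s = s ^ 3 / 3" for s :: real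
 have a: "(real n + 1) / 3 > 0" "(real n + 1) / 3 - 1 = p" by (auto simp: p_def field_simps)
 have f0: "(f has_integral Gamma ((real n + 1) / 3)) {0..}"
  using Gamma_integral_real[OF a(1)] unfolding a(2) f_def .
 have "(f has_integral Gamma ((real n + 1) / 3)) {0..} \<longleftrightarrow> (f has_integral Gamma ((real n + 1) / 3)) {0<..}"
 proof (rule has_integral_spike_set_eq)
  show "negligible {x \<in> {0..} - {0<..}. f x \<noteq> 0}" by (rule negligible_subset[of "{0}"]) auto
  show "negligible {x \<in> {0<..} - {0..}. f x \<noteq> 0}" by (rule negligible_subset[of "{}"]) auto
 qed
 with f0 have fI: "(f has_integral Gamma ((real n + 1) / 3)) {0<..}" by blast
 have "f absolutely_integrable_on {0<..}"
  by (rule nonnegative_absolutely_integrable_1) (use fI in \<open>auto simp: f_def integrable_on_def\<close>)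
 moreover have "integral {0<..} f = Gamma ((real n + 1) / 3)" using fI by (rule integral_unique)
 moreover have im: "g ` {0<..} = {0<..}"
 proof (intro set_eqI iffI)
  fix t :: real assume t: "t \<in> {0<..}"
  then have "g (root 3 (3 * t)) = t" "0 < root 3 (3 * t)" by (auto simp: g_def)
  then show "t \<in> g ` {0<..}" by (intro image_eqI[of _ _ "root 3 (3 * t)"]) simp_all
 qed (auto simp: g_def)
 moreover have "inj_on g {0<..}"
  by (rule inj_onI) (auto simp: g_def power_eq_iff_eq_base)
 moreover have "(g has_field_derivative s\<^sup>2) (at s within {0<..})" for s
  unfolding g_def by (auto intro!: derivative_eq_intros)
 ultimately have "(\<lambda>s. \<bar>s\<^sup>2\<bar> * f (g s)) absolutely_integrable_on {0<..} \<and>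
   integral {0<..} (\<lambda>s. \<bar>s\<^sup>2\<bar> * f (g s)) = Gamma ((real n + 1) / 3)"
  using has_absolute_integral_change_of_variables_1'[of "{0<..}" g "\<lambda>s. s\<^sup>2" f] by simp
 then have "((\<lambda>s. \<bar>s\<^sup>2\<bar> * f (g s)) has_integral Gamma ((real n + 1) / 3)) {0<..}"
  unfolding has_integral_iff using set_lebesgue_integral_eq_integral(1) by blast
 from has_integral_mult_right[OF this, of "3 powr p"]
 have "((\<lambda>s. 3 powr p * (\<bar>s\<^sup>2\<bar> * f (g s))) has_integral moment n) {0<..}" by (simp add: moment_def p_def)
 then show ?thesis
 proof (rule has_integral_eq[rotated])
  fix s :: real assume "s \<in> {0<..}"
  then have s: "s > 0" by simp
  have "g s powr p = (s powr 3) powr p / 3 powr p" using s powr_realpow[of s 3] by (simp add: g_def powr_divide)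
  also have "(s powr 3) powr p = s powr (real n - 2)"
  proof -
   have "3 * p = real n - 2" by (simp add: p_def)
   then show ?thesis by (simp only: powr_powr)
  qed
  finally have "3 powr p * (\<bar>s\<^sup>2\<bar> * f (g s)) = s\<^sup>2 * s powr (real n - 2) / exp (g s)"
   by (simp add: f_def)
  also have "s\<^sup>2 * s powr (real n - 2) = s ^ n"
  proof -
   have "s powr 2 * s powr (real n - 2) = s powr real n" by (simp flip: powr_add)
   then show ?thesis using s by (simp add: powr_realpow)
  qed
  finally show "3 powr p * (\<bar>s\<^sup>2\<bar> * f (g s)) = s ^ n * exp (- (s ^ 3 / 3))"
   by (simp only: g_def exp_minus divide_inverse)
 qed
qed

lemma moment_Suc3: "moment (n + 3) = (real n + 1) * moment n"
proof -
 define a where "a = (real n + 1) / 3"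
 have a: "a > 0" by (simp add: a_def)
 have "moment (n + 3) = 3 powr ((real n - 2) / 3 + 1) * Gamma (a + 1)"
  by (simp add: moment_def a_def add_divide_distrib diff_divide_distrib)
 also have "\<dots> = 3 powr ((real n - 2) / 3) * 3 * (a * Gamma a)"
 proof -
  have "a \<notin> \<int>\<^sub>\<le>\<^sub>0" using a by (auto elim!: nonpos_Ints_cases)
  then show ?thesis by (simp add: powr_add Gamma_plus1)
 qed
 finally show ?thesis by (simp add: moment_def a_def)
qed

text \<open>The Taylor coefficients, in powers of - x, of the integral of
  \<open>ray_integrand x\<close>; the sine is the imaginary part of exp (i (n + 1) pi / 3).\<close>

definition bcoef :: "nat \<Rightarrow> real" where
 "bcoef n = sin ((real n + 1) * pi / 3) * moment n / fact n"

lemma bcoef_Suc3: "bcoef (n + 3) * ((real n + 2) * (real n + 3)) = - bcoef n"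
proof -
 have "sin ((real (n + 3) + 1) * pi / 3) = - sin ((real n + 1) * pi / 3)"
  using sin_periodic_pi[of "(real n + 1) * pi / 3"] by (simp add: field_simps)
 moreover have "fact (n + 3) = (real n + 3) * (real n + 2) * (real n + 1) * fact n"
  by (simp add: eval_nat_numeral algebra_simps)
 moreover have "(- S * (a * M) / (d * b * a * F)) * (b * d) = - (S * M / F)"
  if "a \<noteq> 0" "b \<noteq> 0" "d \<noteq> 0" "F \<noteq> 0" for S M F a b d :: real using that by simp
 ultimately show ?thesis unfolding bcoef_def moment_Suc3 by (simp del: of_nat_add fact_Suc)
qed

text \<open>The integral of \<open>exp (z^3 / 3 - x z)\<close> along the ray of direction \<open>exp (i \<pi> / 3)\<close>, on which
 \<open>z^3 < 0\<close>; its imaginary part is \<open>\<pi> Ai x\<close>, and it is visibly bounded for \<open>x \<ge> 0\<close>.\<close>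

definition ray_integrand :: "real \<Rightarrow> real \<Rightarrow> real" where
 "ray_integrand x s = Im (cis (pi / 3) * exp (- of_real (x * s) * cis (pi / 3))) * exp (- (s ^ 3 / 3))"

lemma ray_series:
 "(\<lambda>n. (- x) ^ n * sin ((real n + 1) * pi / 3) / fact n * (s ^ n * exp (- (s ^ 3 / 3)))) sums ray_integrand x s"
proof -
 define z where "z = - complex_of_real (x * s) * cis (pi / 3)"
 have "(\<lambda>n. z ^ n /\<^sub>R fact n) sums exp z" by (rule exp_converges)
 then have "(\<lambda>n. Im (cis (pi / 3) * (z ^ n /\<^sub>R fact n))) sums Im (cis (pi / 3) * exp z)"
  by (intro sums_Im sums_mult)
 moreover have "Im (cis (pi / 3) * (z ^ n /\<^sub>R fact n)) = (- x) ^ n * sin ((real n + 1) * pi / 3) / fact n * s ^ n" for n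
 proof -
  have "z = complex_of_real (- (x * s)) * cis (pi / 3)" by (simp add: z_def)
  then have "z ^ n = complex_of_real (- (x * s)) ^ n * cis (pi / 3) ^ n" by (simp only: power_mult_distrib)
  then have "z ^ n = complex_of_real ((- (x * s)) ^ n) * cis (real n * (pi / 3))"
   by (simp only: Complex.DeMoivre of_real_power)
  then have "cis (pi / 3) * (z ^ n /\<^sub>R fact n) = complex_of_real ((- (x * s)) ^ n / fact n) * (cis (pi / 3) * cis (real n * (pi / 3)))"
   by (simp only: scaleR_conv_of_real divide_inverse of_real_mult mult_ac)
  also have "cis (pi / 3) * cis (real n * (pi / 3)) = cis ((real n + 1) * pi / 3)"
   by (simp add: cis_mult field_simps)
  finally have e: "cis (pi / 3) * (z ^ n /\<^sub>R fact n) = complex_of_real ((- (x * s)) ^ n / fact n) * cis ((real n + 1) * pi / 3)" .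
  have "Im (complex_of_real r * cis \<theta>) = r * sin \<theta>" for r \<theta> by simp
  then have "Im (cis (pi / 3) * (z ^ n /\<^sub>R fact n)) = (- (x * s)) ^ n / fact n * sin ((real n + 1) * pi / 3)"
   unfolding e .
  also have "(- (x * s)) ^ n = (- x) ^ n * s ^ n" unfolding mult_minus_left[symmetric] by (rule power_mult_distrib)
  finally show ?thesis by simp
 qed
 ultimately have "(\<lambda>n. (- x) ^ n * sin ((real n + 1) * pi / 3) / fact n * s ^ n) sums Im (cis (pi / 3) * exp z)" by simp
 from sums_mult2[OF this, of "exp (- (s ^ 3 / 3))"] show ?thesis
  by (simp add: ray_integrand_def z_def mult.assoc)
qed

text \<open>Termwise integration by dominated convergence: the partial sums of the series are
  bounded by exp (|x| s - s^3 / 3), and this by a decaying exponential.\<close>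

lemma ray_integral:
 "ray_integrand x integrable_on {0<..}" "(\<lambda>n. (- x) ^ n * bcoef n) sums integral {0<..} (ray_integrand x)"
proof -
 define t where "t n s = (- x) ^ n * sin ((real n + 1) * pi / 3) / fact n * (s ^ n * exp (- (s ^ 3 / 3)))" for n s
 have ti: "(t n has_integral (- x) ^ n * bcoef n) {0<..}" for n
  unfolding t_def using has_integral_mult_right[OF moment_integral[of n], of "(- x) ^ n * sin ((real n + 1) * pi / 3) / fact n"]
  by (simp add: bcoef_def mult.assoc)
 define F where "F N s = (\<Sum>n<N. t n s)" for N s
 have FI: "(F N has_integral (\<Sum>n<N. (- x) ^ n * bcoef n)) {0<..}" for N
  unfolding F_def by (intro has_integral_sum ti) auto
 \<comment> \<open>R s \<le> s^3 / 3 + R^2 holds trivially for s \<le> R, and for s > R because then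
   s^2 \<ge> 3 R. One unit of R pays for the factor exp (- s).\<close>
 define R where "R = \<bar>x\<bar> + 3"
 define h where "h s = exp (R\<^sup>2) * exp (- 1 * s)" for s :: real
 have hI: "h integrable_on {0<..}"
 proof -
  have "(\<lambda>s. exp (R\<^sup>2) * exp (- 1 * s)) integrable_on {0..}"
   by (intro integrable_on_mult_right integrable_on_exp_minus_to_infinity) simp
  then have "h integrable_on {0..}" by (simp add: h_def[abs_def])
  then show ?thesis
  proof (rule integrable_spike_set)
   show "negligible {x \<in> {0..} - {0<..}. h x \<noteq> 0}" by (rule negligible_subset[of "{0}"]) auto
   show "negligible {x \<in> {0<..} - {0..}. h x \<noteq> 0}" by (rule negligible_subset[of "{}"]) auto
  qed
 qed
 have dom: "norm (F N s) \<le> h s" if "s \<in> {0<..}" for N s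
 proof -
  have s: "s > 0" using that by simp
  have "norm (F N s) \<le> (\<Sum>n<N. norm (t n s))" unfolding F_def by (rule norm_sum)
  also have "\<dots> \<le> (\<Sum>n<N. ((\<bar>x\<bar> * s) ^ n /\<^sub>R fact n) * exp (- (s ^ 3 / 3)))"
  proof (rule sum_mono)
   fix n
   have "norm (t n s) = (\<bar>x\<bar> * s) ^ n / fact n * \<bar>sin ((real n + 1) * pi / 3)\<bar> * exp (- (s ^ 3 / 3))"
    using s by (simp add: t_def abs_mult power_abs power_mult_distrib)
   also have "\<dots> \<le> (\<bar>x\<bar> * s) ^ n / fact n * 1 * exp (- (s ^ 3 / 3))"
    using s by (intro mult_right_mono mult_left_mono) auto
   finally show "norm (t n s) \<le> ((\<bar>x\<bar> * s) ^ n /\<^sub>R fact n) * exp (- (s ^ 3 / 3))"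
    by (simp only: real_scaleR_def divide_inverse mult_1_right mult_ac)
  qed
  also have "\<dots> = (\<Sum>n<N. (\<bar>x\<bar> * s) ^ n /\<^sub>R fact n) * exp (- (s ^ 3 / 3))" by (simp add: sum_distrib_right)
  also have "\<dots> \<le> exp (\<bar>x\<bar> * s) * exp (- (s ^ 3 / 3))"
  proof (rule mult_right_mono)
   show "(\<Sum>n<N. (\<bar>x\<bar> * s) ^ n /\<^sub>R fact n) \<le> exp (\<bar>x\<bar> * s)"
    using s exp_converges[of "\<bar>x\<bar> * s"] by (intro sum_le_suminf[where I="{..<N}", THEN order_trans]) (auto simp: sums_iff)
  qed simp
  also have "\<dots> \<le> h s"
  proof -
   have "R * s \<le> s ^ 3 / 3 + R\<^sup>2"
   proof (cases "s \<le> R")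
    case True
    then have "R * s \<le> R\<^sup>2" unfolding power2_eq_square by (intro mult_left_mono) (simp_all add: R_def)
    moreover have "0 \<le> s ^ 3 / 3" using s by simp
    ultimately show ?thesis by linarith
   next
    case False
    then have "3 \<le> s" "R \<le> s" by (auto simp: R_def)
    then have "3 * R \<le> s * s" by (intro mult_mono) (auto simp: R_def)
    then have "3 * R * s \<le> s * s * s" using s by (intro mult_right_mono) auto
    moreover have "0 \<le> R\<^sup>2" by simp
    ultimately show ?thesis unfolding power3_eq_cube by linarith
   qed
   moreover have "\<bar>x\<bar> * s + s \<le> R * s" using s by (simp add: R_def algebra_simps)
   ultimately have "\<bar>x\<bar> * s + - (s ^ 3 / 3) \<le> R\<^sup>2 + - 1 * s" by linarith
   then show ?thesis unfolding h_def by (simp flip: exp_add)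
  qed
  finally show ?thesis .
 qed
 have lim: "(\<lambda>N. F N s) \<longlonglongrightarrow> ray_integrand x s" for s
  using ray_series[of x s] unfolding sums_def F_def t_def .
 note dc = dominated_convergence[of F "{0<..}" h "ray_integrand x", OF _ hI dom lim]
 show "ray_integrand x integrable_on {0<..}"
  by (rule dc(1)) (use FI in \<open>auto simp: integrable_on_def\<close>)
 have "(\<lambda>N. integral {0<..} (F N)) \<longlonglongrightarrow> integral {0<..} (ray_integrand x)"
  by (rule dc(2)) (use FI in \<open>auto simp: integrable_on_def\<close>)
 then show "(\<lambda>n. (- x) ^ n * bcoef n) sums integral {0<..} (ray_integrand x)"
  unfolding sums_def integral_unique[OF FI] .
qed

text \<open>For x \<ge> 0 the factor containing x has modulus exp (- x s / 2) \<le> 1 on the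
  ray.\<close>

lemma ray_integral_bounded: assumes "0 \<le> x" shows "\<bar>integral {0<..} (ray_integrand x)\<bar> \<le> moment 0"
proof -
 have "norm (integral {0<..} (ray_integrand x)) \<le> integral {0<..} (\<lambda>s. s ^ 0 * exp (- (s ^ 3 / 3)))"
 proof (rule integral_norm_bound_integral[OF ray_integral(1)])
  show "(\<lambda>s. s ^ 0 * exp (- (s ^ 3 / 3)) :: real) integrable_on {0<..}"
   using moment_integral[of 0] by (auto simp: integrable_on_def)
  fix s :: real assume "s \<in> {0<..}"
  then have xs: "0 \<le> x * s" using assms by simp
  have "\<bar>Im (cis (pi / 3) * exp (- of_real (x * s) * cis (pi / 3)))\<bar> \<le> norm (cis (pi / 3) * exp (- of_real (x * s) * cis (pi / 3)))"
   by (rule abs_Im_le_cmod)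
  also have "\<dots> = exp (- (x * s) * cos (pi / 3))" by (simp add: norm_mult)
  also have "\<dots> \<le> 1" using xs by (simp add: cos_60)
  finally show "norm (ray_integrand x s) \<le> s ^ 0 * exp (- (s ^ 3 / 3))"
   by (simp add: ray_integrand_def abs_mult mult_left_le_one_le)
 qed
 then show ?thesis using integral_unique[OF moment_integral[of 0]] by simp
qed

text \<open>Equal to pi / 3 by the reflection formula of the Gamma function, so that
  \<open>airy x\<close> is 3 Ai (- x).\<close>

definition ray_factor :: real where
 "ray_factor = sin (pi / 3) * Gamma (1/3) * Gamma (2/3) / 3"

lemma ray_factor_pos: "0 < ray_factor"
 unfolding ray_factor_def by (auto intro!: mult_pos_pos Gamma_real_pos simp: sin_60)

lemma bcoef_0: "bcoef (3 * k) * 9 ^ k = ray_factor * 3 powr (1/3) * clifford_coeff (-1/3) k"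
proof (induction k)
 case 0
 have "3 powr (- (2/3)) * 3 = 3 powr (1/3 :: real)" using powr_add[of "3::real" "-(2/3)" 1] by simp
 moreover have "Gamma (2/3) * rGamma (2/3) = (1::real)"
  using Gamma_real_pos[of "2/3"] unfolding rGamma_inverse_Gamma by (intro right_inverse) linarith
 ultimately show ?case
  by (simp add: bcoef_def moment_def ray_factor_def clifford_coeff_def)
next
 case (Suc k)
 have B: "clifford_coeff (-1/3) (Suc k) * (real k + 2/3) * (real k + 1) = - clifford_coeff (-1/3) k" using clifford_coeff_Suc[of "-1/3" k] by (simp add: add.commute)
 have b: "bcoef (3 * Suc k) * ((3 * real k + 2) * (3 * real k + 3)) = - bcoef (3 * k)"
  using bcoef_Suc3[of "3 * k"] by (simp add: algebra_simps)
 define P where "P = (real k + 2/3) * (real k + 1)"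
 have P: "P > 0" by (simp add: P_def)
 have P9: "(3 * real k + 2) * (3 * real k + 3) = 9 * P" by (simp add: P_def algebra_simps)
 have "bcoef (3 * Suc k) * 9 ^ Suc k * P = (bcoef (3 * Suc k) * (9 * P)) * 9 ^ k" by simp
 also have "\<dots> = - (bcoef (3 * k) * 9 ^ k)" unfolding P9[symmetric] b by simp
 also have "\<dots> = ray_factor * 3 powr (1/3) * (- clifford_coeff (-1/3) k)" unfolding Suc by simp
 also have "\<dots> = ray_factor * 3 powr (1/3) * clifford_coeff (-1/3) (Suc k) * P" unfolding B[symmetric] P_def by simp
 finally show ?case using P by simp
qed

lemma bcoef_1: "bcoef (3 * k + 1) * 9 ^ k = ray_factor * 3 powr (-1/3) * clifford_coeff (1/3) k"
proof (induction k)
 case 0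
 have "sin (pi * 2 / 3) = sin (pi / 3)" using sin_pi_minus[of "pi / 3"] by (simp add: field_simps)
 moreover have "Gamma (1/3) * rGamma (4/3) = (3::real)"
 proof -
  have "(1/3) * rGamma (1/3 + 1) = rGamma (1/3 :: real)" by (rule rGamma_plus1)
  moreover have "Gamma (1/3) * rGamma (1/3) = (1::real)"
   using Gamma_real_pos[of "1/3"] unfolding rGamma_inverse_Gamma by (intro right_inverse) linarith
  ultimately show ?thesis by (simp add: field_simps)
 qed
 ultimately show ?case
  by (simp add: bcoef_def moment_def ray_factor_def clifford_coeff_def mult_ac)
next
 case (Suc k)
 have B: "clifford_coeff (1/3) (Suc k) * (real k + 4/3) * (real k + 1) = - clifford_coeff (1/3) k" using clifford_coeff_Suc[of "1/3" k] by (simp add: add_ac)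
 have b: "bcoef (3 * Suc k + 1) * ((3 * real k + 3) * (3 * real k + 4)) = - bcoef (3 * k + 1)"
  using bcoef_Suc3[of "3 * k + 1"] by (simp add: algebra_simps)
 define P where "P = (real k + 4/3) * (real k + 1)"
 have P: "P > 0" by (simp add: P_def)
 have P9: "(3 * real k + 3) * (3 * real k + 4) = 9 * P" by (simp add: P_def algebra_simps)
 have "bcoef (3 * Suc k + 1) * 9 ^ Suc k * P = (bcoef (3 * Suc k + 1) * (9 * P)) * 9 ^ k" by simp
 also have "\<dots> = - (bcoef (3 * k + 1) * 9 ^ k)" unfolding P9[symmetric] b by simp
 also have "\<dots> = ray_factor * 3 powr (-1/3) * (- clifford_coeff (1/3) k)" unfolding Suc by simp
 also have "\<dots> = ray_factor * 3 powr (-1/3) * clifford_coeff (1/3) (Suc k) * P" unfolding B[symmetric] P_def by simp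
 finally show ?case using P by simp
qed

lemma bcoef_2: "bcoef (3 * k + 2) = 0"
proof -
 have "(real (3 * k + 2) + 1) * pi / 3 = real (k + 1) * pi" by (simp add: field_simps)
 then show ?thesis unfolding bcoef_def by (simp only: sin_npi)
qed

text \<open>The coefficients split by n modulo 3: two classes give the two \<open>clifford\<close>
  series, and in the third the sine vanishes.\<close>

lemma ray_integral_airy: "integral {0<..} (ray_integrand x) = ray_factor * airy (- x)"
proof -
 define y where "y = - x"
 define f where "f n = y ^ n * bcoef n" for n
 define r where "r = ray_factor"
 have "(\<lambda>k. sum f {k * 3..<k * 3 + 3}) sums integral {0<..} (ray_integrand x)"
  by (rule sums_group) (use ray_integral(2)[of x] in \<open>simp_all add: f_def[abs_def] y_def\<close>)
 moreover have "sum f {k * 3..<k * 3 + 3} =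
   r * (3 powr (1/3) * (clifford_coeff (-1/3) k * (y ^ 3 / 9) ^ k) + 3 powr (-1/3) * y * (clifford_coeff (1/3) k * (y ^ 3 / 9) ^ k))" for k
 proof -
  have "{k * 3..<k * 3 + 3} = {3 * k, 3 * k + 1, 3 * k + 2}" by auto
  then have "sum f {k * 3..<k * 3 + 3} = f (3 * k) + f (3 * k + 1) + f (3 * k + 2)" by simp
  also have "\<dots> = (y ^ 3) ^ k * bcoef (3 * k) + y * (y ^ 3) ^ k * bcoef (3 * k + 1)"
   by (simp add: f_def bcoef_2[simplified] power_mult)
  also have "bcoef (3 * k) = r * 3 powr (1/3) * clifford_coeff (-1/3) k / 9 ^ k" using bcoef_0[of k] by (simp add: r_def field_simps)
  also have "bcoef (3 * k + 1) = r * 3 powr (-1/3) * clifford_coeff (1/3) k / 9 ^ k" using bcoef_1[of k] by (simp add: r_def field_simps)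
  finally show ?thesis by (simp add: power_divide algebra_simps)
 qed
 ultimately have "(\<lambda>k. r * (3 powr (1/3) * (clifford_coeff (-1/3) k * (y ^ 3 / 9) ^ k) + 3 powr (-1/3) * y * (clifford_coeff (1/3) k * (y ^ 3 / 9) ^ k)))
  sums integral {0<..} (ray_integrand x)" by simp
 moreover have "(\<lambda>k. r * (3 powr (1/3) * (clifford_coeff (-1/3) k * (y ^ 3 / 9) ^ k) + 3 powr (-1/3) * y * (clifford_coeff (1/3) k * (y ^ 3 / 9) ^ k)))
  sums (r * airy y)" unfolding airy_def by (intro sums_mult sums_add clifford_sums)
 ultimately have "integral {0<..} (ray_integrand x) = r * airy y" by (rule sums_unique2)
 then show ?thesis by (simp add: r_def y_def)
qed

text \<open>Boundedness on this half line singles out Ai among the solutions of Airy's equation up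
  to a factor. The power series does not show it; the integral does.\<close>

lemma airy_bounded: assumes "x \<le> 0" shows "\<bar>airy x\<bar> \<le> moment 0 / ray_factor"
proof -
 have "\<bar>ray_factor * airy x\<bar> \<le> moment 0"
  using ray_integral_bounded[of "-x"] ray_integral_airy[of "-x"] assms by simp
 then show ?thesis using ray_factor_pos by (simp add: abs_mult field_simps)
qed

lemma airy_0: "0 < airy 0"
proof -
 have "clifford (-1/3) 0 = clifford_coeff (-1/3) 0" unfolding clifford_def by (rule powser_zero)
 also have "\<dots> = rGamma (2/3)" by (simp add: clifford_coeff_def)
 also have "\<dots> > 0" using Gamma_real_pos[of "2/3"] by (simp add: rGamma_inverse_Gamma)
 finally show ?thesis by (simp add: airy_def)
qed

lemma airy_cont: "continuous_on S airy" "continuous_on S airy'"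
 by (rule DERIV_continuous_on, rule has_field_derivative_at_within, rule airy_deriv airy'_deriv)+

text \<open>The product is nondecreasing for x \<le> 0. If it were negative somewhere, the square of
  the function would grow at least linearly towards minus infinity, against boundedness.\<close>

lemma airy_slope_sign: assumes "x \<le> 0" shows "0 \<le> airy x * airy' x"
proof (rule ccontr)
 assume neg: "\<not> 0 \<le> airy x * airy' x"
 define r where "r = - 2 * (airy x * airy' x)"
 have r: "0 < r" using neg by (simp add: r_def)
 define C where "C = moment 0 / ray_factor"
 have bound: "(airy s)\<^sup>2 \<le> C\<^sup>2" if "s \<le> 0" for s
  using airy_bounded[OF that] power_mono[of "\<bar>airy s\<bar>" C 2] by (simp add: C_def)
 have mono: "airy s * airy' s \<le> airy x * airy' x" if s: "s \<le> x" for s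
 proof (rule deriv_nonneg_mono[OF s, where f="\<lambda>s. airy s * airy' s"])
  show "DERIV (\<lambda>s. airy s * airy' s) t :> (airy' t)\<^sup>2 + (- t) * (airy t)\<^sup>2" for t
   by (rule DERIV_cong[OF DERIV_mult[OF airy_deriv airy'_deriv]]) (simp add: power2_eq_square)
  show "0 \<le> (airy' t)\<^sup>2 + (- t) * (airy t)\<^sup>2" if "t \<le> x" for t using that assms by (intro add_nonneg_nonneg mult_nonneg_nonneg) auto
 qed
 define s where "s = x - (C\<^sup>2 + 1) / r"
 have s: "s \<le> x" using r by (simp add: s_def)
 have "(airy x)\<^sup>2 + r * x \<le> (airy s)\<^sup>2 + r * s"
 proof (rule deriv_nonpos_mono[OF s, where f="\<lambda>s. (airy s)\<^sup>2 + r * s"])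
  show "DERIV (\<lambda>s. (airy s)\<^sup>2 + r * s) t :> 2 * (airy t * airy' t) + r" for t
   by (rule DERIV_cong[OF DERIV_add[OF DERIV_power[OF airy_deriv] DERIV_cmult_Id]]) simp
  show "2 * (airy t * airy' t) + r \<le> 0" if "t \<le> x" for t using mono[OF that] by (simp add: r_def)
 qed
 moreover have "r * (x - s) = C\<^sup>2 + 1" using r by (simp add: s_def)
 ultimately have "C\<^sup>2 + 1 \<le> (airy s)\<^sup>2" using zero_le_power2[of "airy x"] unfolding right_diff_distrib by linarith
 then show False using bound[of s] s assms by simp
qed

text \<open>The square is nondecreasing, so a zero would make the function vanish on a half line and
  then, by uniqueness for the linear equation, also at 0.\<close>

lemma airy_pos_left: assumes "x \<le> 0" shows "0 < airy x"
proof (rule ccontr)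
 assume "\<not> 0 < airy x"
 then obtain z where z: "x \<le> z" "z < 0" "airy z = 0"
  by (rule_tac last_zero[of x 0 airy, OF airy_cont(1)]) (use airy_0 assms in auto)
 have sq: "(airy s)\<^sup>2 \<le> (airy z)\<^sup>2" if s: "s \<le> z" for s
 proof (rule deriv_nonneg_mono[OF s, where f="\<lambda>s. (airy s)\<^sup>2"])
  show "DERIV (\<lambda>s. (airy s)\<^sup>2) t :> 2 * (airy t * airy' t)" for t
   by (rule DERIV_cong[OF DERIV_power[OF airy_deriv]]) simp
  show "0 \<le> 2 * (airy t * airy' t)" if "t \<le> z" for t using airy_slope_sign[of t] that z by simp
 qed
 then have zero: "airy s = 0" if "s \<le> z" for s using sq[OF that] z by simp
 have z': "airy' (z - 1) = 0"
  by (rule DERIV_local_const[OF airy_deriv zero_less_one]) (use zero in \<open>auto simp: abs_less_iff\<close>)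
 have "(airy 0)\<^sup>2 + (airy' 0)\<^sup>2 \<le> ((airy (z - 1))\<^sup>2 + (airy' (z - 1))\<^sup>2) * exp (2 * (1 - z + 1) * (0 - (z - 1)))"
 proof (rule gronwall_two(1)[where d=airy and e=airy' and d'=airy' and e'="\<lambda>x. - x * airy x"])
  fix t assume t: "z - 1 < t" "t < 0"
  have "airy t * airy' t + airy' t * (- t * airy t) = (1 - t) * (airy t * airy' t)" by (simp add: algebra_simps)
  also have "\<bar>\<dots>\<bar> \<le> (1 - z + 1) * \<bar>airy t * airy' t\<bar>" unfolding abs_mult using t by (intro mult_right_mono) auto
  also have "\<dots> \<le> (1 - z + 1) * ((airy t)\<^sup>2 + (airy' t)\<^sup>2)"
  proof (rule mult_left_mono)
   have "2 * (\<bar>airy t\<bar> * \<bar>airy' t\<bar>) \<le> (airy t)\<^sup>2 + (airy' t)\<^sup>2"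
    using sum_squares_bound[of "\<bar>airy t\<bar>" "\<bar>airy' t\<bar>"] by (simp add: mult.assoc)
   moreover have "0 \<le> \<bar>airy t\<bar> * \<bar>airy' t\<bar>" by simp
   ultimately show "\<bar>airy t * airy' t\<bar> \<le> (airy t)\<^sup>2 + (airy' t)\<^sup>2" unfolding abs_mult by linarith
  qed (use z in simp)
  finally show "\<bar>airy t * airy' t + airy' t * (- t * airy t)\<bar> \<le> (1 - z + 1) * ((airy t)\<^sup>2 + (airy' t)\<^sup>2)" .
 qed (use z airy_cont airy_deriv airy'_deriv in auto)
 then have "(airy 0)\<^sup>2 + (airy' 0)\<^sup>2 \<le> 0" using z' zero[of "z - 1"] by simp
 moreover have "0 < (airy 0)\<^sup>2" using airy_0 by simp
 ultimately show False using zero_le_power2[of "airy' 0"] by linarith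
qed

lemma airy'_nonneg_left: "x \<le> 0 \<Longrightarrow> 0 \<le> airy' x"
 using airy_slope_sign[of x] airy_pos_left[of x] by (simp add: zero_le_mult_iff)

lemma airy_mono_left: assumes "x \<le> y" "y \<le> 0" shows "airy x \<le> airy y"
 by (rule deriv_nonneg_mono[OF assms(1) airy_deriv]) (use airy'_nonneg_left assms in auto)

text \<open>By convexity on the negative axis, the slope at \<open>x\<close> is at most that of the
  chord from \<open>x\<close> to 0.\<close>

lemma airy'_decay: assumes "x < 0" shows "airy' x \<le> airy 0 / - x"
proof -
 have mono: "airy' x \<le> airy' t" if "x \<le> t" "t \<le> 0" for t
 proof (rule deriv_nonneg_mono[OF that(1) airy'_deriv])
  show "0 \<le> - s * airy s" if "x \<le> s" "s \<le> t" for s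
   using airy_pos_left[of s] that \<open>t \<le> 0\<close> by (intro mult_nonneg_nonneg) simp_all
 qed
 have "airy x - airy' x * x \<le> airy 0 - airy' x * 0"
 proof (rule deriv_nonneg_mono[where f="\<lambda>t. airy t - airy' x * t"])
  show "DERIV (\<lambda>t. airy t - airy' x * t) t :> airy' t - airy' x" for t
   by (intro DERIV_diff airy_deriv DERIV_cmult_Id)
 qed (use mono assms in auto)
 then have "airy' x * - x \<le> airy 0" using airy_pos_left[of x] assms by simp
 moreover have "0 < - x" using assms by simp
 ultimately show ?thesis unfolding pos_le_divide_eq[OF \<open>0 < - x\<close>] by simp
qed

text \<open>A positive zero exists because on [2, 2 + pi] the coefficient x exceeds 1 and an arch of
  the sine serves for Sturm comparison. Continuity yields a first one, and positivity before it
  joins with that on the negative axis.\<close>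

lemma Omega_props: "0 < \<Omega>\<^sub>0" "airy \<Omega>\<^sub>0 = 0" "\<And>x. x < \<Omega>\<^sub>0 \<Longrightarrow> 0 < airy x"
proof -
 have "\<exists>t\<in>{2..2 + pi}. airy t \<le> 0"
 proof (rule ccontr)
  assume "\<not> (\<exists>t\<in>{2..2 + pi}. airy t \<le> 0)"
  then have pos: "0 < airy t" if "2 \<le> t" "t \<le> 2 + pi" for t using that by force
  show False
  proof (rule sturm_comparison[of 2 "2 + pi" airy airy' "\<lambda>x. - x * airy x" "\<lambda>t. sin (t - 2)" "\<lambda>t. cos (t - 2)" "\<lambda>t. - sin (t - 2)"])
   show "DERIV (\<lambda>t. sin (t - 2)) t :> cos (t - 2)" "DERIV (\<lambda>t. cos (t - 2)) t :> - sin (t - 2)" for t :: real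
    by (auto intro!: derivative_eq_intros)
   show s: "0 < sin (t - 2)" if "2 < t" "t < 2 + pi" for t using sin_gt_zero[of "t - 2"] that by simp
   show "- t * airy t * sin (t - 2) < airy t * - sin (t - 2)" if t: "2 < t" "t < 2 + pi" for t
   proof -
    have "0 < airy t * sin (t - 2)" using pos[of t] s[OF t] t by simp
    then have "1 * (airy t * sin (t - 2)) < t * (airy t * sin (t - 2))" using t by (intro mult_strict_right_mono) auto
    then show ?thesis by simp
   qed
  qed (use pos airy_deriv airy'_deriv pi_gt_zero in auto)
 qed
 then obtain t where t: "2 \<le> t" "airy t \<le> 0" by auto
 obtain z where z: "0 < z" "airy z = 0" "\<And>x. 0 \<le> x \<Longrightarrow> x < z \<Longrightarrow> 0 < airy x"
  by (rule first_zero[of 0 t airy, OF airy_cont(1) airy_0]) (use t in auto)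
 have iff: "bessel_J (-1/3) (2 * x powr (3/2) / 3) + bessel_J (1/3) (2 * x powr (3/2) / 3) = 0 \<longleftrightarrow> airy x = 0" if "x > 0" for x
  unfolding airy_bessel[OF that] using that by simp
 have "\<Omega>\<^sub>0 = z" unfolding \<Omega>\<^sub>0_def
 proof (rule Least_equality)
  show "0 < z \<and> bessel_J (-1/3) (2 * z powr (3/2) / 3) + bessel_J (1/3) (2 * z powr (3/2) / 3) = 0" using z iff by blast
  fix x assume x: "0 < x \<and> bessel_J (-1/3) (2 * x powr (3/2) / 3) + bessel_J (1/3) (2 * x powr (3/2) / 3) = 0"
  then have "airy x = 0" using iff by blast
  then show "z \<le> x" using z(3)[of x] x by force
 qed
 then show "0 < \<Omega>\<^sub>0" "airy \<Omega>\<^sub>0 = 0" "\<And>x. x < \<Omega>\<^sub>0 \<Longrightarrow> 0 < airy x"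
  using z airy_pos_left by (simp, simp, metis linear)
qed

text \<open>The function is concave between 0 and its first positive zero, since its second
  derivative is - x times a nonnegative value.\<close>

lemma airy_chord: assumes "0 \<le> x" "x \<le> \<Omega>\<^sub>0" shows "airy 0 * (\<Omega>\<^sub>0 - x) / \<Omega>\<^sub>0 \<le> airy x"
proof -
 have nn: "0 \<le> airy t" if "t \<le> \<Omega>\<^sub>0" for t using Omega_props(2) Omega_props(3)[of t] that by (cases "t = \<Omega>\<^sub>0") auto
 have "concave_on {0..\<Omega>\<^sub>0} airy"
  unfolding concave_on_def
 proof (rule f''_ge0_imp_convex)
  show "DERIV (\<lambda>x. - airy x) t :> - airy' t" "DERIV (\<lambda>x. - airy' x) t :> - (- t * airy t)" for t
   by (intro DERIV_minus airy_deriv airy'_deriv)+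
  show "0 \<le> - (- t * airy t)" if "t \<in> {0..\<Omega>\<^sub>0}" for t using nn[of t] that by simp
 qed simp
 define l where "l = x / \<Omega>\<^sub>0"
 have l: "0 \<le> l" "l \<le> 1" using assms Omega_props(1) by (auto simp: l_def)
 have "(1 - l) * airy 0 + l * airy \<Omega>\<^sub>0 \<le> airy ((1 - l) *\<^sub>R 0 + l *\<^sub>R \<Omega>\<^sub>0)"
  using concave_onD[OF \<open>concave_on {0..\<Omega>\<^sub>0} airy\<close> l, of 0 \<Omega>\<^sub>0] Omega_props(1) by simp
 then show ?thesis using Omega_props(1,2) by (simp add: l_def field_simps)
qed

lemma airy_bounded_all: obtains M where "0 < M" "\<And>x. x \<le> \<Omega>\<^sub>0 + 1 \<Longrightarrow> \<bar>airy x\<bar> \<le> M"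
proof -
 obtain b where b: "\<And>x. x \<in> {0..\<Omega>\<^sub>0 + 1} \<Longrightarrow> \<bar>airy x\<bar> \<le> \<bar>airy b\<bar>"
 proof -
  have "\<exists>b\<in>{0..\<Omega>\<^sub>0 + 1}. \<forall>x\<in>{0..\<Omega>\<^sub>0 + 1}. \<bar>airy x\<bar> \<le> \<bar>airy b\<bar>"
   by (rule continuous_attains_sup) (use airy_cont(1) Omega_props(1) in \<open>auto intro!: continuous_on_rabs\<close>)
  then show ?thesis using that by blast
 qed
 show ?thesis
 proof (rule that[of "\<bar>airy b\<bar> + airy 0"])
  show "0 < \<bar>airy b\<bar> + airy 0" using airy_0 by simp
  show "\<bar>airy x\<bar> \<le> \<bar>airy b\<bar> + airy 0" if "x \<le> \<Omega>\<^sub>0 + 1" for x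
   using b[of x] airy_mono_left[of x 0] airy_pos_left[of x] airy_0 that by (cases "0 \<le> x") auto
 qed
qed

section \<open>Location of the front\<close>

lemma tanh_le_self: "0 \<le> x \<Longrightarrow> tanh x \<le> (x::real)"
proof -
 assume x: "0 \<le> x"
 have "tanh x - x \<le> tanh 0 - 0"
 proof (rule deriv_nonpos_mono[OF x, where f="\<lambda>x. tanh x - x" and f'="\<lambda>x. - (tanh x)\<^sup>2"])
  show "DERIV (\<lambda>x. tanh x - x) t :> - (tanh t)\<^sup>2" for t :: real
   by (auto intro!: derivative_eq_intros)
 qed simp
 then show ?thesis by simp
qed

lemma tanh_artanh_real: assumes "\<bar>y\<bar> < 1" shows "tanh (artanh y) = (y::real)"
proof -
 have y: "0 < (1 + y) / (1 - y)" "1 + y > 0" "1 - y > 0" using assms by auto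
 have "exp (- 2 * artanh y) = exp (- ln ((1 + y) / (1 - y)))" by (simp add: artanh_def)
 also have "\<dots> = inverse ((1 + y) / (1 - y))" unfolding exp_minus by (subst exp_ln[OF y(1)]) (rule refl)
 also have "\<dots> = (1 - y) / (1 + y)" by simp
 finally have "tanh (artanh y) = (1 - (1 - y) / (1 + y)) / (1 + (1 - y) / (1 + y))"
  unfolding tanh_real_altdef by (simp only:)
 also have "\<dots> = y" using y by (simp add: field_simps)
 finally show ?thesis .
qed

text \<open>One third of the derivative of (min x 0)^3. That cubic serves as a correction supported
  on the negative axis, and must be twice differentiable at 0.\<close>

definition negpart_sq :: "real \<Rightarrow> real" where "negpart_sq x = (min x 0)\<^sup>2"

lemma negpart_sq_deriv: "DERIV negpart_sq x :> 2 * min x 0"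
proof -
 have q: "DERIV (\<lambda>x. x * \<bar>x\<bar>) x :> 2 * \<bar>x\<bar>" for x :: real
 proof -
  consider "x = 0" | "x > 0" | "x < 0" by linarith
  then show ?thesis
  proof cases
   case 1
   have "((\<lambda>y. (y * \<bar>y\<bar> - 0 * \<bar>0\<bar>) / (y - 0)) \<longlongrightarrow> 2 * \<bar>0\<bar>) (at (0::real))"
   proof (rule Lim_transform_eventually)
    show "((\<lambda>y. \<bar>y\<bar>) \<longlongrightarrow> 2 * \<bar>0\<bar>) (at (0::real))" using tendsto_rabs[OF tendsto_ident_at[of "0::real" UNIV]] by simp
    show "\<forall>\<^sub>F y in at (0::real). \<bar>y\<bar> = (y * \<bar>y\<bar> - 0 * \<bar>0\<bar>) / (y - 0)"
     by (auto simp: eventually_at intro!: exI[of _ 1])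
   qed
   then show ?thesis using 1 by (simp add: has_field_derivative_iff)
  next
   case 2
   have "DERIV (\<lambda>x. x * x) x :> 2 * x" by (auto intro!: derivative_eq_intros)
   then have "DERIV (\<lambda>x. x * \<bar>x\<bar>) x :> 2 * x"
    by (rule has_field_derivative_transform_within_open[where S="{0<..}"]) (use 2 in auto)
   then show ?thesis using 2 by simp
  next
   case 3
   have "DERIV (\<lambda>x. - (x * x)) x :> - (2 * x)" by (auto intro!: derivative_eq_intros)
   then have "DERIV (\<lambda>x. x * \<bar>x\<bar>) x :> - (2 * x)"
    by (rule has_field_derivative_transform_within_open[where S="{..<0}"]) (use 3 in auto)
   then show ?thesis using 3 by simp
  qed
 qed
 have eq: "negpart_sq = (\<lambda>x. (x\<^sup>2 - x * \<bar>x\<bar>) / 2)"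
  by (rule ext) (simp add: negpart_sq_def min_def power2_eq_square)
 have sq: "DERIV (\<lambda>x. x\<^sup>2) x :> 2 * x" by (auto intro!: derivative_eq_intros)
 show ?thesis unfolding eq
  by (rule DERIV_cong[OF DERIV_cdivide[OF DERIV_diff[OF sq q]]]) (simp add: min_def)
qed

locale front_sol = front_eq +
 fixes u v :: "real \<Rightarrow> real"
 assumes uv: "tsol u v" and u_bot: "(u \<longlongrightarrow> 0) at_bot" and v_bot: "(v \<longlongrightarrow> 0) at_bot"
  and u_top: "(u \<longlongrightarrow> 1) at_top" and v_top: "(v \<longlongrightarrow> 0) at_top"
  and u_pos: "\<And>t. 0 < u t" and u_less: "\<And>t. u t < 1" and v_pos: "\<And>t. 0 < v t"
  and v_le: "\<And>t. v t \<le> 200 * u t" and v_ge: "\<And>t. t \<le> 0 \<Longrightarrow> c * u t \<le> v t"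
begin

lemma u_le2: "\<bar>u t\<bar> \<le> 2" using u_pos[of t] u_less[of t] by simp

lemmas du = true_sol(1)[OF uv u_le2] and dv = true_sol(2)[OF uv u_le2]

lemma u_strict: "s < t \<Longrightarrow> u s < u t"
 by (rule DERIV_pos_imp_increasing[where f=u]) (use du v_pos in auto)

definition \<mu>c :: real where "\<mu>c = c\<^sup>2 / 4"
text \<open>The slope of the ramp, divided by \<epsilon>, at the moment when it passes
  \<open>\<mu>c\<close>.\<close>

definition \<kappa> :: real where "\<kappa> = 1 - \<mu>c\<^sup>2"
definition tc :: real where "tc = artanh \<mu>c / \<epsilon>"

lemma \<mu>c_bounds: "0 < \<mu>c" "\<mu>c < 1"
proof -
 have "c\<^sup>2 < 2\<^sup>2" using c_pos c_less by (intro power_strict_mono) auto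
 then show "0 < \<mu>c" "\<mu>c < 1" using c_pos by (auto simp: \<mu>c_def)
qed

lemma \<kappa>_bounds: "0 < \<kappa>" "\<kappa> \<le> 1"
proof -
 have "\<mu>c\<^sup>2 < 1\<^sup>2" using \<mu>c_bounds by (intro power_strict_mono) auto
 then show "0 < \<kappa>" "\<kappa> \<le> 1" by (auto simp: \<kappa>_def)
qed

lemma m_tc: "m tc = \<mu>c"
 using eps \<mu>c_bounds tanh_artanh_real by (simp add: tc_def)

lemma tc_ge: "\<mu>c / \<epsilon> \<le> tc"
proof -
 have "m (\<mu>c / \<epsilon>) \<le> m tc" unfolding m_tc using tanh_le_self[of \<mu>c] \<mu>c_bounds eps by simp
 then have "\<epsilon> * (\<mu>c / \<epsilon>) \<le> \<epsilon> * tc" by (simp only: tanh_real_le_iff)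
 then show ?thesis using eps by (simp add: pos_divide_le_eq mult.commute)
qed

lemma tc_pos: "0 < tc"
proof -
 have "0 < \<mu>c / \<epsilon>" using \<mu>c_bounds eps by simp
 then show ?thesis using tc_ge by linarith
qed

lemma m_less_iff: "m s < m t \<longleftrightarrow> s < t" and m_le_iff: "m s \<le> m t \<longleftrightarrow> s \<le> t"
 using eps by auto

lemma m_deriv: "DERIV m t :> \<epsilon> * (1 - (m t)\<^sup>2)" by (rule tanh_deriv)

lemma m_lipschitz: assumes "s \<le> t" shows "m t - m s \<le> \<epsilon> * (t - s)"
proof -
 have "m t - \<epsilon> * t \<le> m s - \<epsilon> * s"
  by (rule deriv_nonpos_mono[OF assms, where f="\<lambda>t. m t - \<epsilon> * t", OF DERIV_diff[OF m_deriv DERIV_cmult_Id]])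
    (use eps in \<open>simp add: algebra_simps\<close>)
 then show ?thesis by (simp add: algebra_simps)
qed

text \<open>For t \<ge> 0 the ramp is concave and lies below its tangent at
  \<open>tc\<close>.\<close>

lemma m_upper_tangent: assumes "0 \<le> t" shows "m t \<le> \<mu>c + \<epsilon> * \<kappa> * (t - tc)"
proof -
 define h where "h t = \<epsilon> * \<kappa> * t - m t" for t
 have dh: "DERIV h t :> \<epsilon> * \<kappa> - \<epsilon> * (1 - (m t)\<^sup>2)" for t
  unfolding h_def[abs_def] by (intro DERIV_diff DERIV_cmult_Id m_deriv)
 have eq: "\<epsilon> * \<kappa> - \<epsilon> * (1 - (m t)\<^sup>2) = \<epsilon> * ((m t)\<^sup>2 - \<mu>c\<^sup>2)" for t by (simp add: \<kappa>_def algebra_simps)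
 have "h tc \<le> h t"
 proof (cases "tc \<le> t")
  case True
  show ?thesis
  proof (rule deriv_nonneg_mono[OF True dh])
   fix x assume "tc \<le> x"
   then have "\<mu>c \<le> m x" using m_le_iff[of tc x] m_tc by simp
   then have "\<mu>c\<^sup>2 \<le> (m x)\<^sup>2" using \<mu>c_bounds by (intro power_mono) auto
   then show "0 \<le> \<epsilon> * \<kappa> - \<epsilon> * (1 - (m x)\<^sup>2)" unfolding eq using eps by simp
  qed
 next
  case False
  then have tt: "t \<le> tc" by simp
  show ?thesis
  proof (rule deriv_nonpos_mono[OF tt dh])
   fix x assume x: "t \<le> x" "x \<le> tc"
   then have "m x \<le> \<mu>c" "0 \<le> m x" using m_le_iff[of x tc] m_tc m_sgn(2)[of x] assms by simp_all
   then have "(m x)\<^sup>2 \<le> \<mu>c\<^sup>2" by (intro power_mono)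
   then have "\<epsilon> * ((m x)\<^sup>2 - \<mu>c\<^sup>2) \<le> 0" using eps by (intro mult_nonneg_nonpos) auto
   then show "\<epsilon> * \<kappa> - \<epsilon> * (1 - (m x)\<^sup>2) \<le> 0" unfolding eq .
  qed
 qed
 then show ?thesis unfolding h_def m_tc by (simp add: algebra_simps)
qed

text \<open>The second derivative of the ramp is at most 2 \<epsilon>^2 in modulus, whence this
  quadratic error on both sides of \<open>tc\<close>.\<close>

lemma m_lower_parabola: "\<mu>c + \<epsilon> * \<kappa> * (t - tc) - \<epsilon>\<^sup>2 * (t - tc)\<^sup>2 \<le> m t"
proof -
 define h where "h t = m t - \<epsilon> * \<kappa> * t + \<epsilon>\<^sup>2 * (t - tc)\<^sup>2" for t
 have dsq: "DERIV (\<lambda>t. \<epsilon>\<^sup>2 * (t - tc)\<^sup>2) t :> \<epsilon>\<^sup>2 * (2 * (t - tc))" for t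
  by (auto intro!: derivative_eq_intros)
 have dh: "DERIV h t :> \<epsilon> * (1 - (m t)\<^sup>2) - \<epsilon> * \<kappa> + \<epsilon>\<^sup>2 * (2 * (t - tc))" for t
  unfolding h_def[abs_def] by (intro DERIV_add DERIV_diff DERIV_cmult_Id m_deriv dsq)
 have eq: "\<epsilon> * (1 - (m t)\<^sup>2) - \<epsilon> * \<kappa> + \<epsilon>\<^sup>2 * (2 * (t - tc)) = \<epsilon> * (2 * \<epsilon> * (t - tc) - (m t - \<mu>c) * (m t + \<mu>c))" for t
  by (simp add: \<kappa>_def power2_eq_square algebra_simps)
 have "h tc \<le> h t"
 proof (cases "tc \<le> t")
  case True
  show ?thesis
  proof (rule deriv_nonneg_mono[OF True dh])
   fix x assume x: "tc \<le> x"
   then have 1: "\<mu>c \<le> m x" "m x - \<mu>c \<le> \<epsilon> * (x - tc)" using m_le_iff[of tc x] m_lipschitz[OF x] m_tc by simp_all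
   have "(m x - \<mu>c) * (m x + \<mu>c) \<le> (\<epsilon> * (x - tc)) * 2"
    using 1 m_bounds[of x] \<mu>c_bounds by (intro mult_mono) auto
   then have "0 \<le> \<epsilon> * (2 * \<epsilon> * (x - tc) - (m x - \<mu>c) * (m x + \<mu>c))" using eps by (intro mult_nonneg_nonneg) auto
   then show "0 \<le> \<epsilon> * (1 - (m x)\<^sup>2) - \<epsilon> * \<kappa> + \<epsilon>\<^sup>2 * (2 * (x - tc))" unfolding eq .
  qed
 next
  case False
  then have tt: "t \<le> tc" by simp
  show ?thesis
  proof (rule deriv_nonpos_mono[OF tt dh])
   fix x assume x: "x \<le> tc"
   then have 1: "m x \<le> \<mu>c" "\<mu>c - m x \<le> \<epsilon> * (tc - x)" using m_le_iff[of x tc] m_lipschitz[OF x] m_tc by simp_all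
   have "(\<mu>c - m x) * (m x + \<mu>c) \<le> (\<mu>c - m x) * 2"
    using 1 m_bounds[of x] \<mu>c_bounds by (intro mult_left_mono) auto
   also have "\<dots> \<le> (\<epsilon> * (tc - x)) * 2" using 1 by (intro mult_right_mono) auto
   finally have "2 * \<epsilon> * (x - tc) - (m x - \<mu>c) * (m x + \<mu>c) \<le> 0" by (simp add: algebra_simps)
   then have "\<epsilon> * (2 * \<epsilon> * (x - tc) - (m x - \<mu>c) * (m x + \<mu>c)) \<le> 0" using eps by (intro mult_nonneg_nonpos) auto
   then show "\<epsilon> * (1 - (m x)\<^sup>2) - \<epsilon> * \<kappa> + \<epsilon>\<^sup>2 * (2 * (x - tc)) \<le> 0" unfolding eq .
  qed
 qed
 then show ?thesis unfolding h_def m_tc by (simp add: algebra_simps)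
qed

text \<open>At a first zero of v - c u / 2 its derivative is (\<open>\<mu>c\<close> - \<mu>) u + u^3
  > 0, so zero is not reached from above. The line v = c u / 2 is the double eigendirection at \<mu>
  = \<open>\<mu>c\<close>.\<close>

lemma slope_before: assumes "m t \<le> \<mu>c" shows "c / 2 * u t < v t"
proof (rule ccontr)
 define h where "h t = v t - c / 2 * u t" for t
 assume "\<not> c / 2 * u t < v t"
 then have neg: "h t \<le> 0" by (simp add: h_def)
 have h0: "0 < h s" if "s \<le> 0" for s
  using v_ge[OF that] mult_pos_pos[OF c_pos u_pos[of s]] by (simp add: h_def)
 have dh: "DERIV h t :> c * v t + u t ^ 3 - m t * u t - c / 2 * v t" for t
  unfolding h_def[abs_def] by (intro DERIV_diff dv DERIV_cmult du)
 have ch: "continuous_on S h" for S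
  by (rule DERIV_continuous_on, rule has_field_derivative_at_within, rule dh)
 have t0: "0 \<le> t" using neg h0[of t] by linarith
 obtain z where z: "0 < z" "z \<le> t" "h z = 0" "\<And>r. 0 \<le> r \<Longrightarrow> r < z \<Longrightarrow> 0 < h r"
  by (rule first_zero[of 0 t h, OF ch h0 neg t0]) auto
 have "m z \<le> \<mu>c" using assms m_le_iff[of z t] z(2) by linarith
 then have "0 \<le> (\<mu>c - m z) * u z" using u_pos[of z] by simp
 moreover have "c / 2 * v z = \<mu>c * u z" using z(3) by (simp add: h_def \<mu>c_def power2_eq_square)
 moreover have "0 < u z ^ 3" using u_pos[of z] by simp
 ultimately have "0 < c * v z + u z ^ 3 - m z * u z - c / 2 * v z" unfolding left_diff_distrib by linarith
 from DERIV_pos_inc_left[OF dh this] obtain x where x: "x > 0" "\<And>r. 0 < r \<Longrightarrow> r < x \<Longrightarrow> h (z - r) < h z" by blast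
 define r where "r = min (x / 2) (z / 2)"
 have "0 < r" "r < x" "r < z" using x(1) z(1) by (auto simp: r_def min_def)
 then show False using x(2)[of r] z(3) z(4)[of "z - r"] by simp
qed

text \<open>For \<open>\<mu> = c\<^sup>2/4\<close> the layer problem has a front; the parabola below it is a barrier that
 orbits tending to \<open>u = 1\<close> cannot cross.\<close>

lemma barrier: assumes "\<mu>c \<le> m t0" shows "u t0 * (sqrt (m t0) - u t0) / sqrt 2 \<le> v t0"
proof (rule ccontr)
 define M where "M = sqrt (m t0)"
 define h where "h t = v t - u t * (M - u t) / sqrt 2" for t
 assume "\<not> u t0 * (sqrt (m t0) - u t0) / sqrt 2 \<le> v t0"
 then have h0: "h t0 < 0" by (simp add: h_def M_def)
 have M2: "M\<^sup>2 = m t0"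
 proof -
  have "0 \<le> m t0" using assms \<mu>c_bounds by linarith
  then show ?thesis unfolding M_def by (rule real_sqrt_pow2)
 qed
 have "sqrt \<mu>c \<le> M" using assms by (simp add: M_def)
 moreover have "sqrt \<mu>c = c / 2" using c_pos by (simp add: \<mu>c_def real_sqrt_divide)
 ultimately have Mc: "c / 2 \<le> M" by simp
 have dh: "DERIV h t :> c * v t + u t ^ 3 - m t * u t - (v t * (M - u t) + (0 - v t) * u t) / sqrt 2" for t
  unfolding h_def[abs_def]
  by (intro DERIV_diff dv DERIV_cdivide DERIV_mult DERIV_const du)
 have ch: "continuous_on S h" for S
  by (rule DERIV_continuous_on, rule has_field_derivative_at_within, rule dh)
 have uM: "u t < M" if "h t \<le> 0" for t
 proof -
  have "0 < u t * (M - u t) / sqrt 2" using that v_pos[of t] by (simp add: h_def)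
  then show ?thesis using u_pos[of t] by (simp add: zero_less_mult_iff zero_less_divide_iff)
 qed
 have hneg: "h t < 0" if t: "t0 \<le> t" for t
 proof (rule ccontr)
  assume "\<not> h t < 0"
  then have "- h t \<le> 0" "0 < - h t0" using h0 by auto
  then obtain z where z: "t0 < z" "z \<le> t" "- h z = 0" "\<And>r. t0 \<le> r \<Longrightarrow> r < z \<Longrightarrow> 0 < - h r"
   by (rule_tac first_zero[of t0 t "\<lambda>t. - h t"]) (use t ch in \<open>auto intro!: continuous_intros\<close>)
  define U where "U = u z"
  have U: "0 < U" "U < M" using uM[of z] z(3) u_pos by (auto simp: U_def)
  have vz: "v z = U * (M - U) / sqrt 2" using z(3) by (simp add: h_def U_def)
  have mz: "M\<^sup>2 \<le> m z" using m_le_iff[of t0 z] z(1) M2 by simp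
  have "c * v z + u z ^ 3 - m z * u z - (v z * (M - u z) + (0 - v z) * u z) / sqrt 2
    = c * v z - U * (m z - U\<^sup>2) - v z * (M - 2 * U) / sqrt 2"
   by (simp add: U_def power2_eq_square power3_eq_cube algebra_simps add_divide_distrib diff_divide_distrib)
  also have "v z * (M - 2 * U) / sqrt 2 = U * (M - U) * (M - 2 * U) / 2"
   unfolding vz by simp
  also have "c * v z - U * (m z - U\<^sup>2) - U * (M - U) * (M - 2 * U) / 2 =
    U * (M - U) * (c / sqrt 2) - U * (m z - U\<^sup>2) - U * (M - U) * (M - 2 * U) / 2"
   unfolding vz by simp
  also have "U * (M - U) * (c / sqrt 2) - U * (m z - U\<^sup>2) - U * (M - U) * (M - 2 * U) / 2
    \<le> U * (M - U) * (c / sqrt 2) - U * (M\<^sup>2 - U\<^sup>2) - U * (M - U) * (M - 2 * U) / 2"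
   using mz U by (intro diff_mono mult_left_mono) auto
  also have "\<dots> = U * (M - U) * (c / sqrt 2 - 3 / 2 * M)" by (simp add: power2_eq_square field_simps)
  also have "\<dots> < 0"
  proof (rule mult_pos_neg)
   \<comment> \<open>At a contact with the parabola the derivative of h has the sign of c / sqrt 2 -
     3 M / 2 or is smaller; this is negative since M \<ge> c / 2 and 1 / sqrt 2 < 3 / 4.\<close>
   have "(4 / 3)\<^sup>2 < (2::real)" by (simp add: power2_eq_square)
   then have "4 / 3 < sqrt 2" by (rule real_less_rsqrt)
   then have "c / sqrt 2 < c / (4 / 3)" using c_pos by (intro divide_strict_left_mono) auto
   then have "c / sqrt 2 < 3 / 4 * c" by simp
   then show "c / sqrt 2 - 3 / 2 * M < 0" using Mc by linarith
  qed (use U in simp)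
  finally have "c * v z + u z ^ 3 - m z * u z - (v z * (M - u z) + (0 - v z) * u z) / sqrt 2 < 0" .
  from DERIV_neg_dec_left[OF dh this] obtain x where x: "x > 0" "\<And>r. 0 < r \<Longrightarrow> r < x \<Longrightarrow> h z < h (z - r)" by blast
  define r where "r = min (x / 2) ((z - t0) / 2)"
  have "0 < r" "r < x" "t0 \<le> z - r" using x(1) z(1) by (auto simp: r_def min_def field_simps)
  then show False using x(2)[of r] z(3) z(4)[of "z - r"] by simp
 qed
 \<comment> \<open>An orbit below the parabola stays there with u < M, so the limit 1 of u is at
   most M; but M^2 is a value of the ramp.\<close>
 have "1 \<le> M"
  by (rule tendsto_upperbound[OF u_top])
    (use uM hneg in \<open>auto intro!: eventually_at_top_linorderI[of t0] simp: less_imp_le\<close>)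
 then have "1\<^sup>2 \<le> M\<^sup>2" by (intro power_mono) auto
 then show False using M2 m_bounds(2)[of t0] by simp
qed

end

section \<open>Airy scaling and the two bounds for the front location\<close>

lemma min_cube_deriv: "DERIV (\<lambda>x. (min x 0) ^ 3) x :> 3 * negpart_sq x"
proof -
 have eq: "(\<lambda>x::real. (min x 0) ^ 3) = (\<lambda>x. x * negpart_sq x)"
  by (rule ext) (simp add: negpart_sq_def min_def power2_eq_square power3_eq_cube)
 have "x * min x 0 = negpart_sq x" by (simp add: negpart_sq_def min_def power2_eq_square)
 then show ?thesis unfolding eq
  by (intro DERIV_cong[OF DERIV_mult[OF DERIV_ident negpart_sq_deriv]]) (simp add: mult.commute)
qed

text \<open>Here \<theta> is \<epsilon>^(1/6), so the scales \<epsilon>^(1/3) and \<epsilon>^(1/2)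
  are integer powers of it. \<open>a\<close> and \<open>\<kappa>0\<close> bound \<open>c\<close> and
  \<open>\<kappa>\<close> from below and \<open>M\<close> bounds the Airy function. The smallness
  conditions involve \<theta>, \<epsilon> and such constants only, which makes the estimates uniform
  in \<open>c\<close>.\<close>

locale front_scaled = front_sol +
 fixes a \<kappa>0 \<theta> M :: real
 assumes a: "0 < a" "a \<le> c" and \<kappa>0: "0 < \<kappa>0" "\<kappa>0 \<le> \<kappa>" and \<theta>: "0 < \<theta>" "\<theta> ^ 6 = \<epsilon>" "\<theta> \<le> 1"
  and ln1: "1 \<le> - ln \<epsilon>"
  and M: "\<And>x. x \<le> \<Omega>\<^sub>0 + 1 \<Longrightarrow> \<bar>airy x\<bar> \<le> M"
  and small1: "2 * \<theta>\<^sup>2 \<le> \<Omega>\<^sub>0" and small2: "8 * \<theta> ^ 6 \<le> \<kappa>0 * a\<^sup>2"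
  and small3: "16 * \<Omega>\<^sub>0\<^sup>2 * \<theta>\<^sup>2 \<le> a ^ 3" and small4: "(M * \<Omega>\<^sub>0\<^sup>2 / airy 0 + 1) * \<theta>\<^sup>2 \<le> a / 4"
  and small5: "8 * \<epsilon> * (- ln \<epsilon>) \<le> a ^ 3"
  and small6: "6 * \<theta>\<^sup>2 \<le> \<kappa>0 ^ 4" and small7: "(\<Omega>\<^sub>0 + 1) * \<theta> \<le> 1"
  and small8: "airy 0 * 40 * \<kappa>0 ^ 4 * \<theta> \<le> 3 * airy (-3)"
begin

text \<open>The Airy scale: \<rho>^3 is the slope of the ramp at \<open>tc\<close>, and \<rho> (t -
  tc) is the Airy variable.\<close>

definition \<rho> :: real where "\<rho> = root 3 (\<epsilon> * \<kappa>)"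

lemma \<rho>_pos: "0 < \<rho>" using eps \<kappa>_bounds by (simp add: \<rho>_def)

lemma \<rho>_cube: "\<rho> ^ 3 = \<epsilon> * \<kappa>" using eps \<kappa>_bounds by (simp add: \<rho>_def)

lemma \<rho>_bounds: "\<rho> \<le> \<theta>\<^sup>2" "\<kappa>0 * \<theta>\<^sup>2 \<le> \<rho>"
proof -
 have \<theta>6: "(\<theta>\<^sup>2) ^ 3 = \<epsilon>" using \<theta>(2) by (simp flip: power_mult)
 have "\<epsilon> * \<kappa> \<le> \<epsilon> * 1" using eps \<kappa>_bounds by (intro mult_left_mono) simp_all
 then have "\<rho> ^ 3 \<le> (\<theta>\<^sup>2) ^ 3" unfolding \<rho>_cube \<theta>6 by simp
 then show "\<rho> \<le> \<theta>\<^sup>2" by (subst (asm) power_mono_iff) (use \<rho>_pos in simp_all)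
 have "\<kappa>0 ^ 3 \<le> \<kappa>0 ^ 1" using \<kappa>0 \<kappa>_bounds by (intro power_decreasing) simp_all
 then have "\<kappa>0 ^ 3 \<le> \<kappa>" using \<kappa>0 by simp
 then have "\<kappa>0 ^ 3 * \<epsilon> \<le> \<kappa> * \<epsilon>" using eps by (intro mult_right_mono) simp_all
 then have "(\<kappa>0 * \<theta>\<^sup>2) ^ 3 \<le> \<rho> ^ 3" unfolding \<rho>_cube power_mult_distrib \<theta>6 by (simp add: mult.commute)
 then show "\<kappa>0 * \<theta>\<^sup>2 \<le> \<rho>" by (subst (asm) power_mono_iff) (use \<rho>_pos \<kappa>0 in simp_all)
qed

lemma airy_line_deriv:
 "DERIV (\<lambda>t. airy (\<rho> * (t - tc) + h)) t :> \<rho> * airy' (\<rho> * (t - tc) + h)"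
 "DERIV (\<lambda>t. \<rho> * airy' (\<rho> * (t - tc) + h)) t :> \<rho>\<^sup>2 * (- (\<rho> * (t - tc) + h) * airy (\<rho> * (t - tc) + h))"
proof -
 have l: "DERIV (\<lambda>t. \<rho> * (t - tc) + h) t :> \<rho>" by (auto intro!: derivative_eq_intros)
 show "DERIV (\<lambda>t. airy (\<rho> * (t - tc) + h)) t :> \<rho> * airy' (\<rho> * (t - tc) + h)"
  using DERIV_chain2[OF airy_deriv l] by (simp add: mult.commute)
 show "DERIV (\<lambda>t. \<rho> * airy' (\<rho> * (t - tc) + h)) t :> \<rho>\<^sup>2 * (- (\<rho> * (t - tc) + h) * airy (\<rho> * (t - tc) + h))"
  by (rule DERIV_cong[OF DERIV_cmult[OF DERIV_chain2[OF airy'_deriv l]]]) (simp add: power2_eq_square)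
qed

text \<open>The constant \<open>\<tau>\<close> added to the shifted Airy function absorbs the error of the tangent
 approximation of the ramp near the zero.\<close>

lemma u_le_before_zero:
 defines "h \<equiv> \<theta>\<^sup>2" defines "t1 \<equiv> tc + (\<Omega>\<^sub>0 - 2 * h) / \<rho>" and "\<tau> \<equiv> airy 0 * h\<^sup>2 / \<Omega>\<^sub>0\<^sup>2"
 assumes "0 \<le> t" "t \<le> t1"
 shows "u t \<le> exp (- (c / 2 * (t1 - t))) * ((M + \<tau>) / \<tau>)"
proof -
 have h: "0 < h" "2 * h \<le> \<Omega>\<^sub>0" "h \<le> 1" using \<theta> small1 by (simp_all add: h_def power_le_one)
 have \<Omega>: "0 < \<Omega>\<^sub>0" by (rule Omega_props)
 have \<tau>: "0 < \<tau>" using h airy_0 \<Omega> by (simp add: \<tau>_def)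
 have \<tau>\<Omega>: "\<tau> * \<Omega>\<^sub>0 = h * (airy 0 * h / \<Omega>\<^sub>0)" using \<Omega> by (simp add: \<tau>_def power2_eq_square)
 define x where "x t = \<rho> * (t - tc)" for t
 have xt1: "x t1 = \<Omega>\<^sub>0 - 2 * h" using \<rho>_pos by (simp add: x_def t1_def)
 have xle: "x t \<le> \<Omega>\<^sub>0 - 2 * h" if "t \<le> t1" for t
  unfolding xt1[symmetric] using that \<rho>_pos by (simp add: x_def)
 define w where "w t = airy (x t + h) + \<tau>" for t
 define w' where "w' t = \<rho> * airy' (x t + h)" for t
 define f where "f t = exp (- c / 2 * t) * u t" for t
 define f' where "f' t = exp (- c / 2 * t) * (v t - c / 2 * u t)" for t
 have df: "DERIV f t :> f' t" for t
  unfolding f_def[abs_def] f'_def by (rule liouville(1)[OF uv])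
 have df': "DERIV f' t :> f t * (c\<^sup>2 / 4 - m t + (u t)\<^sup>2)" for t
  unfolding f_def f'_def[abs_def] by (rule liouville(2)[OF uv u_le2])
 have dw: "DERIV w t :> w' t" for t
  unfolding w_def[abs_def] w'_def x_def by (rule DERIV_cong[OF DERIV_add[OF airy_line_deriv(1) DERIV_const]]) simp
 have dw': "DERIV w' t :> \<rho>\<^sup>2 * (- (x t + h) * airy (x t + h))" for t
  unfolding w'_def[abs_def] x_def by (rule airy_line_deriv(2))
 have f: "0 < f t" for t using u_pos by (simp add: f_def)
 have ai: "0 < airy (x t + h)" if "t \<le> t1" for t using xle[OF that] h by (intro Omega_props(3)) simp
 have w: "0 < w t" if "t \<le> t1" for t using ai[OF that] \<tau> by (simp add: w_def)
 \<comment> \<open>If R \<ge> 0 up to \<open>t1\<close>, then f / w is nondecreasing there and f is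
   bounded through its value at \<open>t1\<close>, where w \<ge> \<tau>.\<close>
 define R where "R t = f' t * w t - f t * w' t" for t
 have dR: "DERIV R t :> f t * (c\<^sup>2 / 4 - m t + (u t)\<^sup>2) * w t - f t * (\<rho>\<^sup>2 * (- (x t + h) * airy (x t + h)))" for t
  unfolding R_def[abs_def]
  by (rule DERIV_cong[OF DERIV_diff[OF DERIV_mult[OF df' dw] DERIV_mult[OF df dw']]]) simp
 \<comment> \<open>At time 0 the front has f' \<ge> (c / 2) f, whereas the slope of the Airy
   function, far to the left of its zero, has decayed below (c / 2) \<tau>.\<close>
 have R0: "0 \<le> R 0"
 proof -
  have "\<mu>c / \<epsilon> \<ge> a\<^sup>2 / 4 / \<epsilon>" using eps a power_mono[of a c 2] unfolding \<mu>c_def by (intro divide_right_mono) simp_all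
  then have tca: "a\<^sup>2 / (4 * \<epsilon>) \<le> tc" using tc_ge by simp
  have "\<epsilon> * tc \<ge> \<epsilon> * (a\<^sup>2 / (4 * \<epsilon>))" using tca eps by (intro mult_left_mono) simp_all
  then have etc: "a\<^sup>2 \<le> 4 * (\<epsilon> * tc)" using eps by simp
  have "2 * h \<le> \<rho> * tc"
  proof -
   have "8 * \<epsilon> \<le> \<kappa>0 * a\<^sup>2" using small2 \<theta> by simp
   also have "\<dots> \<le> \<kappa>0 * (4 * (\<epsilon> * tc))" using etc \<kappa>0 by (intro mult_left_mono) simp_all
   finally have "2 * \<epsilon> \<le> \<epsilon> * (\<kappa>0 * tc)" by (simp add: mult_ac)
   then have "2 \<le> \<kappa>0 * tc" using eps by (simp add: mult.commute)
   then have "h * 2 \<le> h * (\<kappa>0 * tc)" using h by (intro mult_left_mono) simp_all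
   also have "\<dots> = (\<kappa>0 * \<theta>\<^sup>2) * tc" by (simp add: h_def)
   also have "\<dots> \<le> \<rho> * tc" using \<rho>_bounds tc_pos by (intro mult_right_mono) simp_all
   finally have "h * 2 \<le> \<rho> * tc" .
   then show ?thesis by linarith
  qed
  then have y: "\<rho> * tc / 2 \<le> \<rho> * tc - h" by linarith
  have rtc: "0 < \<rho> * tc" using \<rho>_pos tc_pos by simp
  have x0: "x 0 + h = - (\<rho> * tc - h)" by (simp add: x_def)
  have "airy' (x 0 + h) \<le> airy 0 / - (x 0 + h)" by (rule airy'_decay) (use y rtc x0 in linarith)
  also have "\<dots> = airy 0 / (\<rho> * tc - h)" unfolding x0 by simp
  also have "\<dots> \<le> airy 0 / (\<rho> * tc / 2)" using y rtc airy_0 by (intro divide_left_mono mult_pos_pos) linarith+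
  finally have "w' 0 \<le> \<rho> * (airy 0 / (\<rho> * tc / 2))" unfolding w'_def using \<rho>_pos by (intro mult_left_mono) simp_all
  also have "\<dots> = 2 * airy 0 / tc" using \<rho>_pos tc_pos by simp
  also have "\<dots> \<le> 2 * airy 0 / (a\<^sup>2 / (4 * \<epsilon>))" using tca a eps tc_pos airy_0 by (intro divide_left_mono mult_pos_pos) simp_all
  also have "\<dots> = airy 0 * (8 * \<epsilon>) / a\<^sup>2" by simp
  also have "\<dots> \<le> c / 2 * \<tau>"
  proof -
   have "16 * \<Omega>\<^sub>0\<^sup>2 * h * h\<^sup>2 \<le> a ^ 3 * h\<^sup>2" using small3 unfolding h_def[symmetric] by (intro mult_right_mono) simp_all
   moreover have "h * h\<^sup>2 = \<epsilon>" unfolding \<theta>(2)[symmetric] by (simp add: h_def flip: power_add power_mult)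
   ultimately have "16 * \<Omega>\<^sub>0\<^sup>2 * \<epsilon> \<le> a ^ 3 * h\<^sup>2" by (simp add: mult.assoc)
   then have "(16 * \<epsilon>) * \<Omega>\<^sub>0\<^sup>2 \<le> (a * h\<^sup>2) * a\<^sup>2" by (simp add: power2_eq_square power3_eq_cube mult_ac)
   then have "(16 * \<epsilon>) / a\<^sup>2 \<le> (a * h\<^sup>2) / \<Omega>\<^sub>0\<^sup>2" using a \<Omega> by (simp add: divide_le_eq pos_le_divide_eq)
   also have "\<dots> \<le> (c * h\<^sup>2) / \<Omega>\<^sub>0\<^sup>2" using a by (intro divide_right_mono mult_right_mono) simp_all
   finally have "airy 0 / 2 * (16 * \<epsilon> / a\<^sup>2) \<le> airy 0 / 2 * (c * h\<^sup>2 / \<Omega>\<^sub>0\<^sup>2)" using airy_0 by (intro mult_left_mono) simp_all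
   then show ?thesis by (simp add: \<tau>_def mult_ac)
  qed
  finally have 1: "w' 0 \<le> c / 2 * \<tau>" .
  have t1p: "0 \<le> t1" using tc_pos h \<rho>_pos by (simp add: t1_def)
  have "c / 2 * \<tau> \<le> c / 2 * w 0" using ai[OF t1p] c_pos by (intro mult_left_mono) (simp_all add: w_def)
  then have 2: "w' 0 \<le> c / 2 * w 0" using 1 by linarith
  have "f 0 * w' 0 \<le> f 0 * (c / 2 * w 0)" using 2 f[of 0] by (intro mult_left_mono) simp_all
  also have "\<dots> = (c / 2 * u 0) * w 0" by (simp add: f_def)
  also have "\<dots> \<le> f' 0 * w 0" using w[OF t1p] v_ge[of 0] by (intro mult_right_mono) (simp_all add: f'_def)
  finally show ?thesis by (simp add: R_def)
 qed
 have R: "0 \<le> R s" if s: "0 \<le> s" "s \<le> t1" for s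
 proof -
  have "R 0 \<le> R s"
  proof (rule deriv_nonneg_mono[OF s(1) dR])
   fix r assume r: "0 \<le> r" "r \<le> s"
   have rt: "r \<le> t1" using r s by simp
   have "m r \<le> \<mu>c + \<rho> ^ 3 * (r - tc)" unfolding \<rho>_cube using m_upper_tangent[OF r(1)] .
   moreover have "\<rho> ^ 3 * (r - tc) = \<rho>\<^sup>2 * x r" by (simp add: x_def power2_eq_square power3_eq_cube)
   moreover have "0 \<le> (u r)\<^sup>2" by simp
   ultimately have 1: "- (\<rho>\<^sup>2 * x r) \<le> c\<^sup>2 / 4 - m r + (u r)\<^sup>2" unfolding \<mu>c_def by linarith
   \<comment> \<open>The shift by h gains h times the Airy function, and the constant costs \<tau>
     x. Stopping 2 h before \<open>\<Omega>\<^sub>0\<close> leaves x + h \<le>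
     \<open>\<Omega>\<^sub>0 - h\<close>, where the chord bound makes the gain at least \<tau>
     \<open>\<Omega>\<^sub>0\<close>; this fixes the size of \<tau>.\<close>
   have 2: "0 \<le> - x r * \<tau> + h * airy (x r + h)"
   proof (cases "x r \<le> 0")
    case True
    then have "0 \<le> - x r * \<tau>" using \<tau> by (intro mult_nonneg_nonneg) simp_all
    moreover have "0 < h * airy (x r + h)" using ai[OF rt] h by simp
    ultimately show ?thesis by linarith
   next
    case False
    have "airy 0 * (\<Omega>\<^sub>0 - (x r + h)) / \<Omega>\<^sub>0 \<le> airy (x r + h)"
     by (rule airy_chord) (use False h xle[OF rt] in auto)
    moreover have "airy 0 * h / \<Omega>\<^sub>0 \<le> airy 0 * (\<Omega>\<^sub>0 - (x r + h)) / \<Omega>\<^sub>0"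
     using xle[OF rt] airy_0 \<Omega> by (intro divide_right_mono mult_left_mono) simp_all
    ultimately have "airy 0 * h / \<Omega>\<^sub>0 \<le> airy (x r + h)" by linarith
    then have "h * (airy 0 * h / \<Omega>\<^sub>0) \<le> h * airy (x r + h)" using h by (intro mult_left_mono) simp_all
    moreover have "\<tau> * x r \<le> \<tau> * \<Omega>\<^sub>0" using xle[OF rt] h \<tau> by (intro mult_left_mono) simp_all
    ultimately show ?thesis using \<tau>\<Omega> by (simp add: mult.commute)
   qed
   have "0 \<le> f r * (\<rho>\<^sup>2 * (- x r * \<tau> + h * airy (x r + h)))" using 2 f[of r] by (intro mult_nonneg_nonneg) simp_all
   also have "\<dots> = f r * (- (\<rho>\<^sup>2 * x r)) * w r - f r * (\<rho>\<^sup>2 * (- (x r + h) * airy (x r + h)))"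
    by (simp add: w_def algebra_simps)
   also have "\<dots> \<le> f r * (c\<^sup>2 / 4 - m r + (u r)\<^sup>2) * w r - f r * (\<rho>\<^sup>2 * (- (x r + h) * airy (x r + h)))"
    using 1 f[of r] w[OF rt] by (intro diff_right_mono mult_right_mono mult_left_mono) simp_all
   finally show "0 \<le> f r * (c\<^sup>2 / 4 - m r + (u r)\<^sup>2) * w r - f r * (\<rho>\<^sup>2 * (- (x r + h) * airy (x r + h)))" .
  qed
  then show ?thesis using R0 by linarith
 qed
 have "f t / w t \<le> f t1 / w t1"
 proof (rule deriv_nonneg_mono[OF assms(5), where f="\<lambda>t. f t / w t"])
  fix r assume r: "t \<le> r" "r \<le> t1"
  show "DERIV (\<lambda>t. f t / w t) r :> (f' r * w r - f r * w' r) / (w r * w r)"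
   by (rule DERIV_divide[OF df dw]) (use w[OF r(2)] in simp)
  show "0 \<le> (f' r * w r - f r * w' r) / (w r * w r)"
   using R[of r] r assms(4) unfolding R_def by (intro divide_nonneg_nonneg) simp_all
 qed
 also have "\<dots> \<le> exp (- c / 2 * t1) / \<tau>"
 proof (rule frac_le)
  show "f t1 \<le> exp (- c / 2 * t1)" unfolding f_def using u_less[of t1] by (intro mult_left_le) simp_all
  show "\<tau> \<le> w t1" using ai[of t1] by (simp add: w_def)
 qed (use \<tau> in simp_all)
 finally have "f t \<le> exp (- c / 2 * t1) / \<tau> * w t" using w[OF assms(5)] by (simp add: pos_divide_le_eq)
 also have "\<dots> \<le> exp (- c / 2 * t1) / \<tau> * (M + \<tau>)"
  using M[of "x t + h"] xle[OF assms(5)] h \<tau> unfolding w_def by (intro mult_left_mono) simp_all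
 finally have "exp (c / 2 * t) * f t \<le> exp (c / 2 * t) * (exp (- c / 2 * t1) / \<tau> * (M + \<tau>))" by (intro mult_left_mono) simp_all
 moreover have "exp (c / 2 * t) * f t = u t"
 proof -
  have "exp (c / 2 * t) * exp (- c / 2 * t) = 1" unfolding exp_add[symmetric] by simp
  then show ?thesis unfolding f_def mult.assoc[symmetric] by simp
 qed
 moreover have "exp (- (c / 2 * (t1 - t))) = exp (c / 2 * t) * exp (- c / 2 * t1)"
  unfolding exp_add[symmetric] by (simp add: field_simps)
 ultimately show ?thesis by simp
qed

text \<open>Shortly before the Airy zero u is at most a constant times exp (- c (t1 - t) / 2) /
  \<tau>. Going back from \<open>t1\<close> by the time (2 / a) ln (1 / \<epsilon>) gains a factor
  \<epsilon>, which beats 1 / \<tau> of order \<theta>^(-4). There u is still at most c / 4, and the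
  ramp has lost only O (\<epsilon> ln \<epsilon>).\<close>

lemma front_lower:
 assumes "c / 4 < u t"
 shows "\<mu>c + \<rho>\<^sup>2 * \<Omega>\<^sub>0 - (2 + 2 * \<Omega>\<^sub>0\<^sup>2 / \<kappa>0\<^sup>2 + 6 / a) * (\<epsilon> * (- ln \<epsilon>)) \<le> m t"
proof -
 define h where "h = \<theta>\<^sup>2"
 define t1 where "t1 = tc + (\<Omega>\<^sub>0 - 2 * h) / \<rho>"
 define \<tau> where "\<tau> = airy 0 * h\<^sup>2 / \<Omega>\<^sub>0\<^sup>2"
 define l where "l = - ln \<epsilon>"
 define L where "L = 2 / a * l"
 have \<Omega>: "0 < \<Omega>\<^sub>0" by (rule Omega_props)
 have h: "0 < h" "2 * h \<le> \<Omega>\<^sub>0" "h \<le> 1" using \<theta> small1 by (simp_all add: h_def power_le_one)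
 have h3: "h * h\<^sup>2 = \<epsilon>" unfolding \<theta>(2)[symmetric] by (simp add: h_def flip: power_add power_mult)
 have "0 < l" using ln1 by (simp add: l_def)
 then have L: "0 < L" using a by (simp add: L_def)
 have eL: "\<epsilon> * L \<le> a\<^sup>2 / 4"
 proof -
  have "8 * (\<epsilon> * l) \<le> a ^ 3" using small5 by (simp add: l_def)
  then have "\<epsilon> * l * 2 / a \<le> a ^ 3 / 4 / a" using a by (intro divide_right_mono) simp_all
  then show ?thesis using a by (simp add: L_def power2_eq_square power3_eq_cube mult_ac)
 qed
 have a2: "a\<^sup>2 / 4 \<le> \<mu>c" using a power_mono[of a c 2] by (simp add: \<mu>c_def)
 have "\<epsilon> * L \<le> \<epsilon> * tc"
 proof -
  have "\<epsilon> * (\<mu>c / \<epsilon>) \<le> \<epsilon> * tc" using tc_ge eps by (intro mult_left_mono) simp_all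
  moreover have "\<epsilon> * (\<mu>c / \<epsilon>) = \<mu>c" using eps by simp
  ultimately show ?thesis using eL a2 by linarith
 qed
 then have Ltc: "L \<le> tc" using eps by simp
 have t1: "tc \<le> t1" using h \<rho>_pos by (simp add: t1_def)
 define s where "s = t1 - L"
 have s: "0 \<le> s" "s \<le> t1" using Ltc t1 L by (simp_all add: s_def)
 have "u s \<le> c / 4"
 proof -
  have "u s \<le> exp (- (c / 2 * (t1 - s))) * ((M + \<tau>) / \<tau>)"
   using s unfolding t1_def \<tau>_def h_def by (intro u_le_before_zero)
  also have "\<dots> \<le> \<epsilon> * ((M + \<tau>) / \<tau>)"
  proof (rule mult_right_mono)
   have "a / 2 * L \<le> c / 2 * L" using a L by (intro mult_right_mono) simp_all
   moreover have "a / 2 * L = l" using a by (simp add: L_def)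
   ultimately have "- (c / 2 * (t1 - s)) \<le> ln \<epsilon>" by (simp add: s_def l_def)
   then show "exp (- (c / 2 * (t1 - s))) \<le> \<epsilon>" using eps by (simp add: ln_ge_iff[symmetric])
   have "0 < \<tau>" "0 \<le> M" using airy_0 h \<Omega> M[of 0] by (simp_all add: \<tau>_def)
   then show "0 \<le> (M + \<tau>) / \<tau>" by simp
  qed
  \<comment> \<open>As \<tau> is of order h^2 and h^3 = \<epsilon>, the quotient \<epsilon> / \<tau>
    is of order h.\<close>
  also have "(M + \<tau>) / \<tau> = M * \<Omega>\<^sub>0\<^sup>2 / airy 0 / h\<^sup>2 + 1" using airy_0 h \<Omega> by (simp add: \<tau>_def field_simps)
  also have "\<epsilon> * (M * \<Omega>\<^sub>0\<^sup>2 / airy 0 / h\<^sup>2 + 1) = M * \<Omega>\<^sub>0\<^sup>2 / airy 0 * h + \<epsilon>"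
   unfolding h3[symmetric] distrib_left using h by simp
  also have "\<epsilon> \<le> h"
  proof -
   have "h * h\<^sup>2 \<le> h * 1" using h by (intro mult_left_mono power_le_one) simp_all
   then show ?thesis unfolding h3 by simp
  qed
  also have "M * \<Omega>\<^sub>0\<^sup>2 / airy 0 * h + h \<le> a / 4" using small4 by (simp add: h_def distrib_right)
  finally show ?thesis using a by simp
 qed
 then have st: "s < t" using assms u_strict[of t s] by (cases t s rule: linorder_cases) simp_all
 have D: "s - tc = (\<Omega>\<^sub>0 - 2 * h) / \<rho> - L" by (simp add: s_def t1_def)
 have "\<mu>c + \<epsilon> * \<kappa> * (s - tc) - \<epsilon>\<^sup>2 * (s - tc)\<^sup>2 \<le> m s" by (rule m_lower_parabola)
 also have "m s \<le> m t" using st m_le_iff[of s t] by linarith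
 finally have low: "\<mu>c + \<epsilon> * \<kappa> * (s - tc) - \<epsilon>\<^sup>2 * (s - tc)\<^sup>2 \<le> m t" .
 have el: "\<epsilon> * 1 \<le> \<epsilon> * l" using ln1 eps unfolding l_def by (intro mult_left_mono) simp_all
 have 1: "\<epsilon> * \<kappa> * (s - tc) \<ge> \<rho>\<^sup>2 * \<Omega>\<^sub>0 - 2 * (\<epsilon> * l) - \<epsilon> * L"
 proof -
  have "\<epsilon> * \<kappa> * (s - tc) = \<rho>\<^sup>2 * \<Omega>\<^sub>0 - 2 * (\<rho>\<^sup>2 * h) - \<kappa> * (\<epsilon> * L)"
  proof -
   have "\<rho> ^ 3 * ((\<Omega>\<^sub>0 - 2 * h) / \<rho>) = \<rho>\<^sup>2 * (\<Omega>\<^sub>0 - 2 * h)"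
    using \<rho>_pos by (simp add: power2_eq_square power3_eq_cube)
   moreover have "\<rho>\<^sup>2 * (\<Omega>\<^sub>0 - 2 * h) = \<rho>\<^sup>2 * \<Omega>\<^sub>0 - 2 * (\<rho>\<^sup>2 * h)" by (simp add: right_diff_distrib)
   moreover have "\<epsilon> * \<kappa> * L = \<kappa> * (\<epsilon> * L)" by (simp only: mult_ac)
   moreover have "\<epsilon> * \<kappa> * (s - tc) = \<rho> ^ 3 * ((\<Omega>\<^sub>0 - 2 * h) / \<rho>) - \<epsilon> * \<kappa> * L"
    unfolding D \<rho>_cube by (simp only: right_diff_distrib)
   ultimately show ?thesis by linarith
  qed
  moreover have "\<rho>\<^sup>2 * h \<le> h\<^sup>2 * h" using \<rho>_bounds \<rho>_pos h unfolding h_def by (intro mult_right_mono power_mono) simp_all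
  moreover have "h\<^sup>2 * h = \<epsilon>" using h3 by (simp add: mult.commute)
  moreover have "\<kappa> * (\<epsilon> * L) \<le> 1 * (\<epsilon> * L)" using \<kappa>_bounds eps L by (intro mult_right_mono) simp_all
  ultimately show ?thesis using el by linarith
 qed
 have 2: "\<epsilon>\<^sup>2 * (s - tc)\<^sup>2 \<le> 2 * (\<Omega>\<^sub>0\<^sup>2 / \<kappa>0\<^sup>2) * (\<epsilon> * l) + 2 * (\<epsilon> * L)"
 proof -
  define A where "A = (\<Omega>\<^sub>0 - 2 * h) / \<rho>"
  have A: "0 \<le> A" using h \<rho>_pos by (simp add: A_def)
  have "(A - L)\<^sup>2 \<le> 2 * A\<^sup>2 + 2 * L\<^sup>2"
   using zero_le_power2[of "A + L"] by (simp add: power2_eq_square algebra_simps)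
  then have "\<epsilon>\<^sup>2 * (A - L)\<^sup>2 \<le> \<epsilon>\<^sup>2 * (2 * A\<^sup>2 + 2 * L\<^sup>2)" by (intro mult_left_mono) simp_all
  moreover have "(\<epsilon> * A)\<^sup>2 \<le> \<Omega>\<^sub>0\<^sup>2 / \<kappa>0\<^sup>2 * (\<epsilon> * l)"
  proof -
   have "A \<le> \<Omega>\<^sub>0 / (\<kappa>0 * h)" unfolding A_def
    using \<rho>_bounds(2) h \<kappa>0 \<Omega> by (intro frac_le) (simp_all add: h_def)
   then have "(\<epsilon> * A)\<^sup>2 \<le> (\<epsilon> * (\<Omega>\<^sub>0 / (\<kappa>0 * h)))\<^sup>2" using A eps by (intro power_mono mult_left_mono) simp_all
   also have "\<dots> = \<Omega>\<^sub>0\<^sup>2 / \<kappa>0\<^sup>2 * (\<epsilon> * (\<epsilon> / h\<^sup>2))" by (simp add: power2_eq_square mult_ac)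
   also have "\<epsilon> / h\<^sup>2 = h" using h h3 by (simp add: field_simps)
   also have "\<Omega>\<^sub>0\<^sup>2 / \<kappa>0\<^sup>2 * (\<epsilon> * h) \<le> \<Omega>\<^sub>0\<^sup>2 / \<kappa>0\<^sup>2 * (\<epsilon> * l)"
    using h ln1 eps unfolding l_def by (intro mult_left_mono) simp_all
   finally show ?thesis .
  qed
  moreover have "(\<epsilon> * L)\<^sup>2 \<le> \<epsilon> * L"
  proof -
   have "\<epsilon> * L \<le> 1" using eL a2 \<mu>c_bounds by linarith
   then have "(\<epsilon> * L) * (\<epsilon> * L) \<le> (\<epsilon> * L) * 1" using eps L by (intro mult_left_mono) simp_all
   then show ?thesis by (simp add: power2_eq_square)
  qed
  ultimately show ?thesis unfolding D A_def[symmetric] by (simp add: power_mult_distrib distrib_left)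
 qed
 have "3 * (\<epsilon> * L) = 6 / a * (\<epsilon> * l)" by (simp add: L_def)
 then show ?thesis using low 1 2 unfolding l_def[symmetric] by (simp add: algebra_simps)
qed

text \<open>The cubic correction makes the perturbed Airy function vanish on the left, as Sturm's
 comparison theorem requires.\<close>

lemma u_ge_after_zero:
 defines "h \<equiv> 6 * \<theta>\<^sup>2 / \<kappa>0 ^ 4" shows "\<epsilon> \<le> (u (tc + (\<Omega>\<^sub>0 + h) / \<rho>))\<^sup>2"
proof (rule ccontr)
 define tb where "tb = tc + (\<Omega>\<^sub>0 + h) / \<rho>"
 \<comment> \<open>One half of the shift h absorbs the errors of the ramp and of u^2, the other half
   the cubic correction.\<close>
 define h' where "h' = h / 2"
 \<comment> \<open>A lower bound of the shifted Airy function for -2 < x < 0, as h \<le> 1. There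
   the correction costs at most 12 \<tau>, which the factor 1/40 makes 3/10 of the gain h'
   \<beta>.\<close>
 define \<beta> where "\<beta> = airy (-3)"
 define \<tau> where "\<tau> = \<beta> / 40 * h'"
 \<comment> \<open>At the distance 1 / \<theta> the cubic outweighs the Airy function, so W has a
   zero no further out; within this distance the quadratic error of the ramp is still of order
   \<epsilon>.\<close>
 define X where "X = 1 / \<theta>"
 assume "\<not> \<epsilon> \<le> (u (tc + (\<Omega>\<^sub>0 + h) / \<rho>))\<^sup>2"
 then have small: "(u tb)\<^sup>2 < \<epsilon>" by (simp add: tb_def)
 have h: "0 < h" "h \<le> 1" "h = 2 * h'" "0 < h'"
  using \<theta> \<kappa>0 small6 by (simp_all add: h_def h'_def divide_le_eq)
 have \<Omega>: "0 < \<Omega>\<^sub>0" by (rule Omega_props)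
 have \<beta>: "0 < \<beta>" by (simp add: \<beta>_def airy_pos_left)
 have \<tau>: "0 < \<tau>" using \<beta> h by (simp add: \<tau>_def)
 have X: "0 < X" "\<Omega>\<^sub>0 + 1 \<le> X" using \<theta> small7 by (simp_all add: X_def pos_le_divide_eq)
 define W where "W x = airy (x - h) + \<tau> * (min x 0) ^ 3" for x
 define W' where "W' x = airy' (x - h) + \<tau> * (3 * negpart_sq x)" for x
 define W'' where "W'' x = - (x - h) * airy (x - h) + \<tau> * (6 * min x 0)" for x
 have sh: "DERIV (\<lambda>x. x - h) x :> 1" for x by (auto intro!: derivative_eq_intros)
 have dW: "DERIV W x :> W' x" for x
  unfolding W_def[abs_def] W'_def
  by (rule DERIV_cong[OF DERIV_add[OF DERIV_chain2[OF airy_deriv sh] DERIV_cmult[OF min_cube_deriv]]]) simp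
 have dW': "DERIV W' x :> W'' x" for x
  unfolding W'_def[abs_def] W''_def
  by (rule DERIV_cong[OF DERIV_add[OF DERIV_chain2[OF airy'_deriv sh] DERIV_cmult[OF DERIV_cmult[OF negpart_sq_deriv]]]]) simp
 \<comment> \<open>The corrected function, shifted by h, satisfies as an inequality the Airy
   equation shifted by h' alone. For y \<ge> 2 the quartic term beats 6 y; for smaller y the deficit
   is at most 12 \<tau>.\<close>
 have key: "0 \<le> W'' x + (x - h') * W x" if x: "x \<le> \<Omega>\<^sub>0 + h" for x
 proof (cases "0 \<le> x")
  case True
  have "0 \<le> airy (x - h)" using Omega_props(3)[of "x - h"] Omega_props(2) x by (cases "x - h = \<Omega>\<^sub>0") auto
  then have "0 \<le> h' * airy (x - h)" using h by (intro mult_nonneg_nonneg) simp_all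
  also have "\<dots> = W'' x + (x - h') * W x" using True by (simp add: W''_def W_def h(3) algebra_simps)
  finally show ?thesis .
 next
  case False
  define y where "y = - x"
  have y: "0 < y" using False by (simp add: y_def)
  have eq: "W'' x + (x - h') * W x = h' * airy (x - h) + \<tau> * ((y + h') * y ^ 3 - 6 * y)"
   using False by (simp add: W''_def W_def h(3) y_def min_def algebra_simps)
  have ai: "0 < airy (x - h)" using False h by (intro airy_pos_left) simp
  have y3: "y * y ^ 3 \<le> (y + h') * y ^ 3" using y h by (intro mult_right_mono) simp_all
  show ?thesis
  proof (cases "2 \<le> y")
   case True
   then have "2 ^ 3 \<le> y ^ 3" by (intro power_mono) simp_all
   then have "y * 6 \<le> y * y ^ 3" using y by (intro mult_left_mono) simp_all
   then have "0 \<le> \<tau> * ((y + h') * y ^ 3 - 6 * y)" using y3 \<tau> by (intro mult_nonneg_nonneg) simp_all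
   moreover have "0 < h' * airy (x - h)" using h ai by simp
   ultimately show ?thesis unfolding eq by linarith
  next
   case False
   have "0 \<le> y * y ^ 3" using y by simp
   then have "- 12 \<le> (y + h') * y ^ 3 - 6 * y" using y3 False by simp
   then have 1: "\<tau> * (- 12) \<le> \<tau> * ((y + h') * y ^ 3 - 6 * y)" using \<tau> by (intro mult_left_mono) simp_all
   have "\<beta> \<le> airy (x - h)" unfolding \<beta>_def
    by (rule airy_mono_left) (use False h y in \<open>simp_all add: y_def\<close>)
   then have 2: "h' * \<beta> \<le> h' * airy (x - h)" using h by (intro mult_left_mono) simp_all
   have "0 < h' * \<beta>" using h \<beta> by simp
   moreover have "\<tau> * (- 12) = - (3 / 10 * (h' * \<beta>))" by (simp add: \<tau>_def)
   ultimately show ?thesis unfolding eq using 1 2 by linarith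
  qed
 qed
 have gap: "\<rho>\<^sup>2 * (\<rho> * (t - tc) - h') < m t - \<mu>c - \<epsilon>" if t: "\<bar>\<rho> * (t - tc)\<bar> \<le> X" for t
 proof -
  define x where "x = \<rho> * (t - tc)"
  have tx: "t - tc = x / \<rho>" using \<rho>_pos by (simp add: x_def)
  have "\<mu>c + \<rho> ^ 3 * (x / \<rho>) - \<epsilon>\<^sup>2 * (x / \<rho>)\<^sup>2 \<le> m t" using m_lower_parabola[of t] unfolding tx \<rho>_cube .
  moreover have "\<rho> ^ 3 * (x / \<rho>) = \<rho>\<^sup>2 * x" using \<rho>_pos by (simp add: power2_eq_square power3_eq_cube)
  moreover have "\<epsilon>\<^sup>2 * (x / \<rho>)\<^sup>2 + \<epsilon> < \<rho>\<^sup>2 * h'"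
  proof -
   have "\<bar>x / \<rho>\<bar> \<le> X / (\<kappa>0 * \<theta>\<^sup>2)"
    unfolding abs_divide using t \<rho>_bounds(2) \<rho>_pos \<kappa>0 \<theta> by (intro frac_le) (simp_all add: x_def)
   then have "\<bar>x / \<rho>\<bar>\<^sup>2 \<le> (X / (\<kappa>0 * \<theta>\<^sup>2))\<^sup>2" by (intro power_mono) simp_all
   then have "\<epsilon>\<^sup>2 * (x / \<rho>)\<^sup>2 \<le> \<epsilon>\<^sup>2 * (X / (\<kappa>0 * \<theta>\<^sup>2))\<^sup>2" unfolding power2_abs by (intro mult_left_mono) simp_all
   also have "\<dots> = \<epsilon> / \<kappa>0\<^sup>2"
    proof -
    have "X / (\<kappa>0 * \<theta>\<^sup>2) = 1 / (\<kappa>0 * \<theta> ^ 3)" by (simp add: X_def power2_eq_square power3_eq_cube mult_ac)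
    moreover have "(1 / (\<kappa>0 * \<theta> ^ 3))\<^sup>2 = 1 / (\<kappa>0\<^sup>2 * \<epsilon>)"
     by (simp add: power_divide power_mult_distrib \<theta>(2)[symmetric] flip: power_mult)
    ultimately have e: "(X / (\<kappa>0 * \<theta>\<^sup>2))\<^sup>2 = 1 / (\<kappa>0\<^sup>2 * \<epsilon>)" by (simp only:)
    show ?thesis unfolding e using eps by (simp add: power2_eq_square)
   qed
   also have "\<dots> \<le> \<epsilon> / \<kappa>0\<^sup>2 * 1" by simp
   finally have 1: "\<epsilon>\<^sup>2 * (x / \<rho>)\<^sup>2 \<le> \<epsilon> / \<kappa>0\<^sup>2" by simp
   have k: "\<kappa>0\<^sup>2 \<le> 1" using \<kappa>0 \<kappa>_bounds by (intro power_le_one) simp_all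
   have 2: "\<epsilon> \<le> \<epsilon> / \<kappa>0\<^sup>2" using k \<kappa>0 eps by (simp add: pos_le_divide_eq mult_left_le)
   have "(\<kappa>0 * \<theta>\<^sup>2)\<^sup>2 * h' \<le> \<rho>\<^sup>2 * h'" using \<rho>_bounds(2) \<kappa>0 h by (intro mult_right_mono power_mono) simp_all
   \<comment> \<open>The factor 6 in h makes this 3 \<epsilon> / \<open>\<kappa>0\<close>^2, against
     errors of at most 2 \<epsilon> / \<open>\<kappa>0\<close>^2.\<close>
   moreover have "(\<kappa>0 * \<theta>\<^sup>2)\<^sup>2 * h' = 3 * (\<epsilon> / \<kappa>0\<^sup>2)"
   proof -
    have A: "(\<kappa>0 * \<theta>\<^sup>2)\<^sup>2 = \<kappa>0\<^sup>2 * \<theta> ^ 4" by (simp add: power_mult_distrib flip: power_mult)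
    have k4: "\<kappa>0 ^ 4 = \<kappa>0\<^sup>2 * \<kappa>0\<^sup>2" by (simp flip: power_add)
    have "6 * q / k / 2 = 3 * q / k" for q k :: real by simp
    then have B: "h' = 3 * \<theta>\<^sup>2 / (\<kappa>0\<^sup>2 * \<kappa>0\<^sup>2)" unfolding h'_def h_def k4 .
    have C: "\<theta> ^ 4 * \<theta>\<^sup>2 = \<epsilon>" unfolding \<theta>(2)[symmetric] by (simp flip: power_add)
    have D: "k * p * (3 * q / (k * k)) = 3 * (p * q / k)" if "k \<noteq> 0" for k p q :: real using that by simp
    show ?thesis unfolding A B C[symmetric] by (rule D) (use \<kappa>0 in simp)
   qed
   moreover have "0 < \<epsilon> / \<kappa>0\<^sup>2" using eps \<kappa>0 by simp
   ultimately show ?thesis using 1 2 by linarith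
  qed
  ultimately have "\<rho>\<^sup>2 * (x - h') < m t - \<mu>c - \<epsilon>" unfolding right_diff_distrib by linarith
  then show ?thesis by (simp only: x_def)
 qed
 have Wc: "continuous_on S W" for S
  by (rule DERIV_continuous_on, rule has_field_derivative_at_within, rule dW)
 have WX: "W (- X) \<le> 0"
 proof -
  have "airy (- X - h) \<le> airy 0" using X h by (intro airy_mono_left) simp_all
  moreover have "airy 0 \<le> \<tau> * X ^ 3"
  proof -
   have "airy 0 * 40 * \<kappa>0 ^ 4 * \<theta> * \<theta>\<^sup>2 \<le> 3 * \<beta> * \<theta>\<^sup>2" using small8 unfolding \<beta>_def by (intro mult_right_mono) simp_all
   moreover have "\<tau> * (40 * \<kappa>0 ^ 4) = 3 * \<beta> * \<theta>\<^sup>2" using \<kappa>0 by (simp add: \<tau>_def h'_def h_def)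
   ultimately have "airy 0 * \<theta> ^ 3 * (40 * \<kappa>0 ^ 4) \<le> \<tau> * (40 * \<kappa>0 ^ 4)" by (simp add: power2_eq_square power3_eq_cube mult_ac)
   then have "airy 0 * \<theta> ^ 3 \<le> \<tau>" by (rule mult_right_le_imp_le) (use \<kappa>0 in simp)
   then show ?thesis using \<theta> by (simp add: X_def power_divide pos_le_divide_eq)
  qed
  ultimately show ?thesis using X by (simp add: W_def)
 qed
 have W0: "0 < W 0" using h by (simp add: W_def airy_pos_left)
 obtain z where z: "- X \<le> z" "z < 0" "W z = 0" "\<And>x. z < x \<Longrightarrow> x \<le> 0 \<Longrightarrow> 0 < W x"
  using last_zero[OF Wc WX W0] X by (metis less_eq_real_def neg_le_0_iff_le)
 have Wpos: "0 < W x" if "z < x" "x < \<Omega>\<^sub>0 + h" for x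
 proof (cases "x \<le> 0")
  case True
  then show ?thesis using z(4) that by simp
 next
  case False
  then show ?thesis using Omega_props(3)[of "x - h"] that by (simp add: W_def)
 qed
 have We: "W (\<Omega>\<^sub>0 + h) = 0" using Omega_props \<Omega> h by (simp add: W_def)
 define x where "x t = \<rho> * (t - tc)" for t
 define ta where "ta = tc + z / \<rho>"
 have xa: "x ta = z" and xb: "x tb = \<Omega>\<^sub>0 + h" using \<rho>_pos by (simp_all add: x_def ta_def tb_def)
 have xm: "s < t \<longleftrightarrow> x s < x t" for s t using \<rho>_pos by (simp add: x_def)
 have dx: "DERIV x t :> \<rho>" for t
 proof -
  have "DERIV (\<lambda>s. \<rho> * (s - tc)) t :> \<rho>"
   by (rule DERIV_cong[OF DERIV_cmult[OF DERIV_diff[OF DERIV_ident DERIV_const]]]) simp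
  moreover have "x = (\<lambda>s. \<rho> * (s - tc))" by (rule ext) (rule x_def)
  ultimately show ?thesis by (simp only:)
 qed
 show False
 proof (rule sturm_comparison[of ta tb "\<lambda>t. exp (- c / 2 * t) * u t" "\<lambda>t. exp (- c / 2 * t) * (v t - c / 2 * u t)"
    "\<lambda>t. exp (- c / 2 * t) * u t * (c\<^sup>2 / 4 - m t + (u t)\<^sup>2)" "\<lambda>t. W (x t)" "\<lambda>t. \<rho> * W' (x t)" "\<lambda>t. \<rho>\<^sup>2 * W'' (x t)"])
  show "ta < tb" using z \<Omega> h xm[of ta tb] xa xb by simp
  show "DERIV (\<lambda>t. exp (- c / 2 * t) * u t) t :> exp (- c / 2 * t) * (v t - c / 2 * u t)" for t
   by (rule liouville(1)[OF uv])
  show "((\<lambda>t. exp (- c / 2 * t) * (v t - c / 2 * u t)) has_real_derivative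
   exp (- c / 2 * t) * u t * (c\<^sup>2 / 4 - m t + (u t)\<^sup>2)) (at t)" for t
   by (rule liouville(2)[OF uv u_le2])
  show "DERIV (\<lambda>t. W (x t)) t :> \<rho> * W' (x t)" for t
   by (rule DERIV_cong[OF DERIV_chain2[OF dW dx]]) simp
  show "DERIV (\<lambda>t. \<rho> * W' (x t)) t :> \<rho>\<^sup>2 * W'' (x t)" for t
   by (rule DERIV_cong[OF DERIV_cmult[OF DERIV_chain2[OF dW' dx]]]) (simp add: power2_eq_square)
  show "0 < exp (- c / 2 * t) * u t" for t using u_pos by simp
  show "W (x ta) = 0" "W (x tb) = 0" unfolding xa xb by (rule z(3) We)+
  show "0 < W (x t)" if "ta < t" "t < tb" for t
   using Wpos[of "x t"] xm[of ta t] xm[of t tb] that xa xb by simp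
  show "exp (- c / 2 * t) * u t * (c\<^sup>2 / 4 - m t + (u t)\<^sup>2) * W (x t) < exp (- c / 2 * t) * u t * (\<rho>\<^sup>2 * W'' (x t))"
   if t: "ta < t" "t < tb" for t
  proof -
   have xt: "z < x t" "x t < \<Omega>\<^sub>0 + h" using xm[of ta t] xm[of t tb] t xa xb by simp_all
   have Wp: "0 < W (x t)" by (rule Wpos[OF xt])
   have "(u t)\<^sup>2 \<le> (u tb)\<^sup>2" using u_strict[OF t(2)] u_pos[of t] by (intro power_mono) simp_all
   moreover have "\<rho>\<^sup>2 * (x t - h') < m t - \<mu>c - \<epsilon>" unfolding x_def
    by (rule gap) (use xt z X h in \<open>simp add: x_def\<close>)
   ultimately have "c\<^sup>2 / 4 - m t + (u t)\<^sup>2 < \<rho>\<^sup>2 * (h' - x t)" using small unfolding \<mu>c_def right_diff_distrib by linarith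
   then have "(c\<^sup>2 / 4 - m t + (u t)\<^sup>2) * W (x t) < \<rho>\<^sup>2 * (h' - x t) * W (x t)" using Wp by (rule mult_strict_right_mono)
   also have "\<dots> \<le> \<rho>\<^sup>2 * W'' (x t)"
   proof -
    have "(h' - x t) * W (x t) \<le> W'' (x t)" using key[of "x t"] xt by (simp add: left_diff_distrib)
    then have "\<rho>\<^sup>2 * ((h' - x t) * W (x t)) \<le> \<rho>\<^sup>2 * W'' (x t)" by (rule mult_left_mono) simp
    then show ?thesis by (simp only: mult.assoc)
   qed
   finally have "exp (- c / 2 * t) * u t * ((c\<^sup>2 / 4 - m t + (u t)\<^sup>2) * W (x t)) < exp (- c / 2 * t) * u t * (\<rho>\<^sup>2 * W'' (x t))"
    using u_pos[of t] by (intro mult_strict_left_mono) simp_all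
   then show ?thesis by (simp only: mult.assoc)
  qed
 qed
qed

text \<open>While u \<le> c / 4 the barrier gives v \<ge> (a / 8) u, so u grows by the factor 1 /
  \<epsilon> in the time (8 / a) ln (1 / \<epsilon>). Starting from at least sqrt \<epsilon> it
  would exceed 1, hence c / 4 is passed before.\<close>

lemma front_upper:
 "\<exists>t. c / 4 < u t \<and> m t \<le> \<mu>c + \<rho>\<^sup>2 * \<Omega>\<^sub>0 + (6 / \<kappa>0 ^ 4 + 8 / a) * (\<epsilon> * (- ln \<epsilon>))"
proof -
 define h where "h = 6 * \<theta>\<^sup>2 / \<kappa>0 ^ 4"
 define tb where "tb = tc + (\<Omega>\<^sub>0 + h) / \<rho>"
 define l where "l = - ln \<epsilon>"
 define t where "t = tb + 8 / a * l"
 have \<Omega>: "0 < \<Omega>\<^sub>0" by (rule Omega_props)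
 have h: "0 < h" using \<theta> \<kappa>0 by (simp add: h_def)
 have l: "1 \<le> l" using ln1 by (simp add: l_def)
 then have tbt: "tb \<le> t" using a by (simp add: t_def)
 have tcb: "tc \<le> tb" using h \<Omega> \<rho>_pos by (simp add: tb_def)
 have ub: "\<epsilon> \<le> (u tb)\<^sup>2" unfolding tb_def h_def by (rule u_ge_after_zero)
 have big: "c / 4 < u t"
 proof (rule ccontr)
  assume "\<not> c / 4 < u t"
  then have le: "u s \<le> c / 4" if "s \<le> t" for s
   using u_strict[of s t] that by (cases "s = t") simp_all
  have grow: "a / 8 * u s \<le> v s" if s: "tb \<le> s" "s \<le> t" for s
  proof -
   have ms: "\<mu>c \<le> m s" using m_le_iff[of tc s] m_tc tcb s by simp
   have "sqrt \<mu>c \<le> sqrt (m s)" using ms by simp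
   moreover have "sqrt \<mu>c = c / 2" using c_pos by (simp add: \<mu>c_def real_sqrt_divide)
   ultimately have "c / 4 \<le> sqrt (m s) - u s" using le[OF s(2)] by linarith
   then have "u s * (c / 4) / sqrt 2 \<le> u s * (sqrt (m s) - u s) / sqrt 2" using u_pos[of s] by (intro divide_right_mono mult_left_mono) simp_all
   also have "\<dots> \<le> v s" by (rule barrier[OF ms])
   finally have 1: "u s * (c / 4) / sqrt 2 \<le> v s" .
   have "sqrt 2 \<le> sqrt (2\<^sup>2)" by (rule real_sqrt_le_mono) simp
   then have "sqrt 2 \<le> 2" by simp
   then have 2: "u s * (c / 4) / 2 \<le> u s * (c / 4) / sqrt 2" using u_pos[of s] c_pos by (intro divide_left_mono) simp_all
   have "u s * a \<le> u s * c" using a u_pos[of s] by (intro mult_left_mono) simp_all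
   then have "a / 8 * u s \<le> u s * (c / 4) / 2" by (simp add: mult.commute)
   then show ?thesis using 1 2 by linarith
  qed
  have "exp (- (a / 8) * tb) * u tb \<le> exp (- (a / 8) * t) * u t"
  proof (rule deriv_nonneg_mono[OF tbt, where f="\<lambda>s. exp (- (a / 8) * s) * u s"])
   fix s assume s: "tb \<le> s" "s \<le> t"
   have e: "DERIV (\<lambda>s. exp (- (a / 8) * s)) s :> exp (- (a / 8) * s) * (- (a / 8))"
    by (auto intro!: derivative_eq_intros)
   show "DERIV (\<lambda>s. exp (- (a / 8) * s) * u s) s :> exp (- (a / 8) * s) * (v s - a / 8 * u s)"
    by (rule DERIV_cong[OF DERIV_mult[OF e du]]) (simp add: right_diff_distrib)
   show "0 \<le> exp (- (a / 8) * s) * (v s - a / 8 * u s)" using grow[OF s] by simp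
  qed
  also have "\<dots> < exp (- (a / 8) * t) * 1" using u_less by (intro mult_strict_left_mono) simp_all
  also have "\<dots> = exp (- (a / 8) * tb) * \<epsilon>"
  proof -
   have "- (a / 8) * t = - (a / 8) * tb + ln \<epsilon>" using a by (simp add: t_def l_def algebra_simps)
   then show ?thesis by (simp only: exp_add exp_ln[OF eps] mult_1_right)
  qed
  finally have "u tb < \<epsilon>" by simp
  then have "(u tb)\<^sup>2 < u tb * 1" using u_pos[of tb] u_less[of tb] unfolding power2_eq_square by (intro mult_strict_left_mono)
  then show False using ub \<open>u tb < \<epsilon>\<close> by simp
 qed
 have 1: "m t \<le> \<mu>c + \<epsilon> * \<kappa> * (t - tc)" using tbt tcb tc_pos by (intro m_upper_tangent) simp
 have 2: "\<epsilon> * \<kappa> * (t - tc) = \<rho>\<^sup>2 * \<Omega>\<^sub>0 + \<rho>\<^sup>2 * h + \<kappa> * (8 / a * (\<epsilon> * l))"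
 proof -
  have "\<epsilon> * \<kappa> * ((\<Omega>\<^sub>0 + h) / \<rho>) = \<rho>\<^sup>2 * (\<Omega>\<^sub>0 + h)"
   unfolding \<rho>_cube[symmetric] using \<rho>_pos by (simp add: power2_eq_square power3_eq_cube)
  moreover have "t - tc = (\<Omega>\<^sub>0 + h) / \<rho> + 8 / a * l" by (simp add: t_def tb_def)
  then have "\<epsilon> * \<kappa> * (t - tc) = \<epsilon> * \<kappa> * ((\<Omega>\<^sub>0 + h) / \<rho>) + \<epsilon> * \<kappa> * (8 / a * l)"
   by (simp only: distrib_left)
  ultimately show ?thesis unfolding distrib_left by (simp only: mult_ac)
 qed
 have 3: "\<rho>\<^sup>2 * h \<le> 6 / \<kappa>0 ^ 4 * (\<epsilon> * l)"
 proof -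
  have "\<rho>\<^sup>2 * h \<le> (\<theta>\<^sup>2)\<^sup>2 * h" using \<rho>_bounds \<rho>_pos h by (intro mult_right_mono power_mono) simp_all
  moreover have "(\<theta>\<^sup>2)\<^sup>2 * h = 6 / \<kappa>0 ^ 4 * (\<epsilon> * 1)"
   unfolding h_def \<theta>(2)[symmetric] by (simp flip: power_add power_mult)
  moreover have "6 / \<kappa>0 ^ 4 * (\<epsilon> * 1) \<le> 6 / \<kappa>0 ^ 4 * (\<epsilon> * l)" using l eps \<kappa>0 by (intro mult_left_mono) simp_all
  ultimately show ?thesis by linarith
 qed
 have 4: "\<kappa> * (8 / a * (\<epsilon> * l)) \<le> 1 * (8 / a * (\<epsilon> * l))" using \<kappa>_bounds a eps l by (intro mult_right_mono) simp_all
 have "m t \<le> \<mu>c + \<rho>\<^sup>2 * \<Omega>\<^sub>0 + (6 / \<kappa>0 ^ 4 + 8 / a) * (\<epsilon> * l)"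
  unfolding distrib_right using 1 2 3 4 by linarith
 then show ?thesis using big unfolding l_def by blast
qed

end

section \<open>Closeness to the states before and after the front\<close>

context front_sol
begin

lemma u_mono: "s \<le> t \<Longrightarrow> u s \<le> u t" using u_strict[of s t] by (cases "s = t") simp_all

text \<open>By \<open>slope_before\<close> the function exp (- c t / 2) u is nondecreasing up to
  \<open>tc\<close>, and the ramp takes at least the time \<delta> / \<epsilon> to climb to
  \<open>\<mu>c\<close>. The factor is 1 + 200, from u and v.\<close>

lemma close_left:
 assumes a: "0 < a" "a \<le> c" and \<delta>: "0 < \<delta>" and t: "m t < \<mu>c - \<delta>"
 shows "u t + v t \<le> 201 * exp (- (a * \<delta> / 2) / \<epsilon>)"
proof -
 have tt: "t \<le> tc" using t \<delta> m_less_iff[of t tc] m_tc by simp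
 have gap: "\<delta> \<le> \<epsilon> * (tc - t)" using m_lipschitz[OF tt] m_tc t by simp
 have "exp (- c / 2 * t) * u t \<le> exp (- c / 2 * tc) * u tc"
 proof (rule deriv_nonneg_mono[OF tt, where f="\<lambda>t. exp (- c / 2 * t) * u t"])
  show "DERIV (\<lambda>t. exp (- c / 2 * t) * u t) s :> exp (- c / 2 * s) * (v s - c / 2 * u s)" for s
   by (rule liouville(1)[OF uv])
  show "0 \<le> exp (- c / 2 * s) * (v s - c / 2 * u s)" if "s \<le> tc" for s
   using slope_before[of s] m_le_iff[of s tc] m_tc that by simp
 qed
 also have "\<dots> \<le> exp (- c / 2 * tc)" using u_less[of tc] by (intro mult_left_le) simp_all
 finally have "exp (c / 2 * t) * (exp (- c / 2 * t) * u t) \<le> exp (c / 2 * t) * exp (- c / 2 * tc)" by (rule mult_left_mono) simp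
 moreover have "exp (c / 2 * t) * (exp (- c / 2 * t) * u t) = u t"
  unfolding mult.assoc[symmetric] exp_add[symmetric] by simp
 ultimately have 1: "u t \<le> exp (c / 2 * t + - c / 2 * tc)" by (simp only: exp_add)
 have "a * \<delta> / 2 \<le> c * (\<epsilon> * (tc - t)) / 2" using a gap \<delta> by (intro divide_right_mono mult_mono) simp_all
 then have "a * \<delta> / 2 \<le> (c / 2 * (tc - t)) * \<epsilon>" by (simp add: mult_ac)
 then have "a * \<delta> / 2 / \<epsilon> \<le> c / 2 * (tc - t)" using eps by (simp only: pos_divide_le_eq)
 then have "c / 2 * t + - c / 2 * tc \<le> - (a * \<delta> / 2) / \<epsilon>" unfolding right_diff_distrib by linarith
 then have "u t \<le> exp (- (a * \<delta> / 2) / \<epsilon>)" using 1 order_trans exp_le_cancel_iff by blast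
 then show ?thesis using v_le[of t] by linarith
qed

text \<open>During the time S = 8 / (a e) the ramp barely moves. If u lagged behind sqrt \<mu> by
  more than e for so long, the barrier would raise it by 1; if it were ahead by more than e, the
  repulsion from sqrt \<mu> would drive it past 1. A large v would likewise never come down again,
  although v tends to 0.\<close>

lemma close_right:
 assumes a: "0 < a" "a \<le> c" and \<delta>: "0 < \<delta>" and e: "0 < e" and ts: "c / 4 < u ts" "m ts \<le> \<mu>c + \<delta> / 2"
  and small: "\<epsilon> * (8 / (a * e)) \<le> \<delta> / 2" "\<epsilon> * (8 / (a * e)) \<le> a * e" and t: "\<mu>c + \<delta> < m t"
 shows "\<bar>u t - sqrt (m t)\<bar> \<le> 2 * e" "v t \<le> 4 * e / a"
proof -
 define S where "S = 8 / (a * e)"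
 have S: "0 < S" using a e by (simp add: S_def)
 have aeS: "a * e * S = 8" using a e by (simp add: S_def)
 have sc: "sqrt \<mu>c = c / 2" using c_pos by (simp add: \<mu>c_def real_sqrt_divide)
 have lower: "sqrt (m t) - 2 * e \<le> u t" if t: "\<mu>c + \<delta> < m t" for t
 proof -
  define s0 where "s0 = t - S"
  have s0t: "s0 \<le> t" using S by (simp add: s0_def)
  have ml: "m t - m s0 \<le> \<epsilon> * S" using m_lipschitz[OF s0t] by (simp add: s0_def)
  have ms0: "\<mu>c + \<delta> / 2 \<le> m s0" using ml small(1) t unfolding S_def by linarith
  then have tss: "ts \<le> s0" using ts(2) m_le_iff[of ts s0] by linarith
  have \<mu>s: "\<mu>c \<le> m s0" using ms0 \<delta> by linarith
  define M where "M = sqrt (m s0)"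
  have Mc: "c / 2 \<le> M" using \<mu>s unfolding M_def sc[symmetric] by simp
  have 1: "M - e \<le> u t"
  proof (rule ccontr)
   assume neg: "\<not> M - e \<le> u t"
   have "u s0 - a * e / 8 * s0 \<le> u t - a * e / 8 * t"
   proof (rule deriv_nonneg_mono[OF s0t, where f="\<lambda>s. u s - a * e / 8 * s"])
    show "DERIV (\<lambda>s. u s - a * e / 8 * s) s :> v s - a * e / 8" for s
     by (intro DERIV_diff du DERIV_cmult_Id)
    fix s assume s: "s0 \<le> s" "s \<le> t"
    have mss: "m s0 \<le> m s" using s m_le_iff by blast
    then have Ms: "M \<le> sqrt (m s)" by (simp add: M_def)
    have us: "a / 4 \<le> u s" using u_mono[of ts s] ts(1) tss s a by simp
    have gs: "e \<le> sqrt (m s) - u s" using u_mono[OF s(2)] neg Ms by linarith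
    have "a / 4 * e / 2 \<le> u s * (sqrt (m s) - u s) / sqrt 2"
    proof (rule frac_le)
     show "a / 4 * e \<le> u s * (sqrt (m s) - u s)" using us gs a e by (intro mult_mono) simp_all
     show "sqrt 2 \<le> 2" by (rule real_le_lsqrt) simp_all
    qed (use us gs a e in simp_all)
    also have "\<dots> \<le> v s" by (rule barrier) (use \<mu>s mss in linarith)
    finally show "0 \<le> v s - a * e / 8" by simp
   qed
   then have "a * e / 8 * S \<le> u t - u s0" by (simp add: s0_def right_diff_distrib)
   then show False using aeS u_less[of t] u_pos[of s0] by simp
  qed
  have "sqrt (m t) - M \<le> e"
  proof -
   have "m s0 \<le> m t" using s0t m_le_iff by blast
   then have nn: "0 \<le> m s0" "0 \<le> m t" "M \<le> sqrt (m t)"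
    unfolding M_def real_sqrt_le_iff using \<mu>s \<mu>c_bounds by linarith+
   have "(sqrt (m t) - M) * a \<le> (sqrt (m t) - M) * (sqrt (m t) + M)"
    using nn Mc a by (intro mult_left_mono) linarith+
   also have "\<dots> = (sqrt (m t))\<^sup>2 - M\<^sup>2" by (simp add: power2_eq_square algebra_simps)
   also have "\<dots> = m t - m s0" unfolding M_def real_sqrt_pow2[OF nn(1)] real_sqrt_pow2[OF nn(2)] ..
   also have "\<dots> \<le> e * a" using ml small(2) unfolding S_def by (simp add: mult.commute)
   finally show ?thesis using a by simp
  qed
  then show ?thesis using 1 by linarith
 qed
 have st: "\<mu>c + \<delta> < m s" if "t \<le> s" for s using t m_le_iff[of t s] that by linarith
 have mt0: "\<mu>c \<le> m t" using t \<delta> by linarith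
 then have sm: "c / 2 \<le> sqrt (m t)" unfolding sc[symmetric] by simp
 have mt: "0 \<le> m t" using mt0 \<mu>c_bounds by linarith
 have upper: "u t \<le> sqrt (m t) + e" if t: "c / 2 \<le> sqrt (m t)" "0 \<le> m t" for t
 proof (rule ccontr)
  assume neg: "\<not> u t \<le> sqrt (m t) + e"
  define p where "p = a / 2 * e\<^sup>2"
  have p: "0 < p" using a e by (simp add: p_def)
  have dv': "p \<le> c * v s + u s ^ 3 - m s * u s" if s: "t \<le> s" "s \<le> t + S" for s
  proof -
   have us: "sqrt (m t) + e \<le> u s" using neg u_mono[OF s(1)] by linarith
   have "m s - m t \<le> \<epsilon> * (s - t)" by (rule m_lipschitz[OF s(1)])
   also have "\<dots> \<le> \<epsilon> * S" using s eps by (intro mult_left_mono) simp_all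
   also have "\<dots> \<le> a * e" using small(2) by (simp add: S_def)
   also have "\<dots> \<le> 2 * (e * sqrt (m t))"
   proof -
    have "e * (a / 2) \<le> e * sqrt (m t)" using e a t by (intro mult_left_mono) linarith+
    then show ?thesis by (simp add: mult.commute)
   qed
   finally have 1: "m s - m t \<le> 2 * (e * sqrt (m t))" .
   have "(sqrt (m t) + e)\<^sup>2 \<le> (u s)\<^sup>2" using us t e a by (intro power_mono) simp_all
   moreover have "(sqrt (m t) + e)\<^sup>2 = m t + 2 * (e * sqrt (m t)) + e\<^sup>2" using t by (simp add: power2_sum)
   ultimately have 2: "e\<^sup>2 \<le> (u s)\<^sup>2 - m s" using 1 by linarith
   have "a / 2 * e\<^sup>2 \<le> u s * ((u s)\<^sup>2 - m s)" using 2 us t a e by (intro mult_mono) simp_all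
   moreover have "0 < c * v s" using c_pos v_pos by simp
   moreover have "u s * ((u s)\<^sup>2 - m s) = u s ^ 3 - m s * u s" by (simp add: power2_eq_square power3_eq_cube algebra_simps)
   ultimately show ?thesis unfolding p_def by linarith
  qed
  have vl: "p * (s - t) \<le> v s" if s: "t \<le> s" "s \<le> t + S" for s
  proof -
   have "v t - p * t \<le> v s - p * s"
   proof (rule deriv_nonneg_mono[OF s(1), where f="\<lambda>s. v s - p * s"])
    show "DERIV (\<lambda>s. v s - p * s) r :> c * v r + u r ^ 3 - m r * u r - p" for r
     by (intro DERIV_diff dv DERIV_cmult_Id)
    show "0 \<le> c * v r + u r ^ 3 - m r * u r - p" if "t \<le> r" "r \<le> s" for r using dv'[of r] that s by simp
   qed
   then show ?thesis using v_pos[of t] unfolding right_diff_distrib by linarith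
  qed
  have tS: "t \<le> t + S" using S by simp
  have "u t - p / 2 * (t - t)\<^sup>2 \<le> u (t + S) - p / 2 * (t + S - t)\<^sup>2"
  proof (rule deriv_nonneg_mono[OF tS, where f="\<lambda>s. u s - p / 2 * (s - t)\<^sup>2"])
   fix r assume r: "t \<le> r" "r \<le> t + S"
   have "DERIV (\<lambda>s. p / 2 * (s - t)\<^sup>2) r :> p * (r - t)"
    by (auto intro!: derivative_eq_intros)
   then show "DERIV (\<lambda>s. u s - p / 2 * (s - t)\<^sup>2) r :> v r - p * (r - t)"
    by (intro DERIV_diff du)
   show "0 \<le> v r - p * (r - t)" using vl[OF r] by simp
  qed
  then have 3: "p / 2 * S\<^sup>2 \<le> u (t + S) - u t" by simp
  have "a * (p / 2 * S\<^sup>2) = (a * e * S)\<^sup>2 / 4" by (simp add: p_def power2_eq_square)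
  then have "a * (p / 2 * S\<^sup>2) = 16" unfolding aeS by simp
  moreover have "a * (p / 2 * S\<^sup>2) \<le> 2 * (p / 2 * S\<^sup>2)" using a c_less p by (intro mult_right_mono) simp_all
  ultimately show False using 3 u_less[of "t + S"] u_pos[of t] by linarith
 qed
 show "\<bar>u t - sqrt (m t)\<bar> \<le> 2 * e" using lower[OF t] upper[OF sm mt] e by linarith
 show "v t \<le> 4 * e / a"
 proof (rule ccontr)
  assume "\<not> v t \<le> 4 * e / a"
  then have neg: "4 * e < a * v t" using a by (simp add: pos_divide_less_eq not_le mult.commute)
  have up: "4 * e < a * v s" if s: "t \<le> s" for s
  proof (rule ccontr)
   define h where "h s = a * v s - 4 * e" for s
   assume "\<not> 4 * e < a * v s"
   then have hs: "h s \<le> 0" "0 < h t" using neg by (simp_all add: h_def)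
   have dh: "DERIV h r :> a * (c * v r + u r ^ 3 - m r * u r)" for r
    unfolding h_def by (rule DERIV_cong[OF DERIV_diff[OF DERIV_cmult[OF dv] DERIV_const]]) simp
   have ch: "continuous_on A h" for A
    by (rule DERIV_continuous_on, rule has_field_derivative_at_within, rule dh)
   obtain z where z: "t < z" "z \<le> s" "h z = 0" "\<And>r. t \<le> r \<Longrightarrow> r < z \<Longrightarrow> 0 < h r"
    by (rule first_zero[of t s h, OF ch hs(2) hs(1) s]) auto
   have tz: "t \<le> z" using z by simp
   have mz: "0 \<le> m z" using st[OF tz] \<mu>c_bounds \<delta> by linarith
   have l: "sqrt (m z) - 2 * e \<le> u z" by (rule lower[OF st[OF tz]])
   \<comment> \<open>This is (sqrt \<mu> - u) (sqrt \<mu> + u) u, where the first factor is at most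
     2 e by \<open>lower\<close> and the others are together below 2. Since c v \<ge> 4 e at the
     supposed return, v' > 0 there.\<close>
   have "m z * u z - u z ^ 3 < 4 * e"
   proof (cases "sqrt (m z) \<le> u z")
    case True
    then have "(sqrt (m z))\<^sup>2 \<le> (u z)\<^sup>2" by (rule power_mono) (rule real_sqrt_ge_zero[OF mz])
    then have "m z \<le> (u z)\<^sup>2" unfolding real_sqrt_pow2[OF mz] .
    then have "m z * u z \<le> (u z)\<^sup>2 * u z" using u_pos[of z] by (intro mult_right_mono) simp_all
    then show ?thesis using e by (simp add: power2_eq_square power3_eq_cube)
   next
    case False
    have s1: "sqrt (m z) < 1" using m_bounds(2)[of z] by simp
    have s0: "0 \<le> sqrt (m z)" by (rule real_sqrt_ge_zero[OF mz])
    have "m z * u z - u z ^ 3 = (sqrt (m z) - u z) * ((sqrt (m z) + u z) * u z)"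
    proof -
     have "(sqrt (m z) - u z) * ((sqrt (m z) + u z) * u z) = (sqrt (m z))\<^sup>2 * u z - u z ^ 3"
      by (simp add: power2_eq_square power3_eq_cube algebra_simps)
     then show ?thesis unfolding real_sqrt_pow2[OF mz] ..
    qed
    also have "\<dots> \<le> (2 * e) * ((sqrt (m z) + u z) * u z)" using l u_pos[of z] s0 by (intro mult_right_mono mult_nonneg_nonneg) linarith+
    also have "\<dots> < (2 * e) * 2"
    proof (rule mult_strict_left_mono)
     have "(sqrt (m z) + u z) * u z \<le> sqrt (m z) + u z" using u_pos[of z] u_less[of z] s0 by (intro mult_left_le) linarith+
     then show "(sqrt (m z) + u z) * u z < 2" by (rule le_less_trans) (use s1 u_less[of z] in linarith)
    qed (use e in simp)
    finally show ?thesis by simp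
   qed
   moreover have "4 * e \<le> c * v z"
   proof -
    have "a * v z \<le> c * v z" using a v_pos[of z] by (intro mult_right_mono) simp_all
    then show ?thesis using z(3) by (simp add: h_def)
   qed
   ultimately have "0 < a * (c * v z + u z ^ 3 - m z * u z)" using a by (intro mult_pos_pos) simp_all
   from DERIV_pos_inc_left[OF dh this] obtain x where x: "x > 0" "\<And>r. 0 < r \<Longrightarrow> r < x \<Longrightarrow> h (z - r) < h z" by blast
   define r where "r = min (x / 2) (z - t)"
   have "0 < r" "r < x" "t \<le> z - r" using x(1) z(1) by (auto simp: r_def min_def)
   then show False using x(2)[of r] z(3) z(4)[of "z - r"] by simp
  qed
  have "4 * e \<le> a * 0"
   by (rule tendsto_lowerbound[OF tendsto_mult_left[OF v_top]])
     (use up in \<open>auto intro!: eventually_at_top_linorderI[of t] simp: less_imp_le\<close>)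
  then show False using e by simp
 qed
qed

end

section \<open>Tangent planes of the invariant manifolds\<close>

lemma at_within_atMost: "s < t \<Longrightarrow> at s within {..t} = at (s::real)"
 by (rule at_within_nhd[of s "{..<t}"]) auto

text \<open>A value in (-1, 1) fixes a time shift of tanh, and backwards uniqueness follows from
  Gronwall on compact intervals, where the solution is bounded. Both signs of \<kappa> occur, for
  the two directions of time.\<close>

lemma half_ramp_eq_tanh:
 fixes z :: "real \<Rightarrow> real"
 assumes "\<kappa> \<noteq> 0" and dz: "\<And>s. s \<le> 0 \<Longrightarrow> (z has_real_derivative \<kappa> * (1 - (z s)\<^sup>2)) (at s within {..0})" and z0: "\<bar>z 0\<bar> < 1"
 shows "\<exists>t. \<forall>s\<le>0. z s = tanh (\<kappa> * (s + t))"
proof (intro exI allI impI)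
 define t where "t = artanh (z 0) / \<kappa>"
 define w where "w s = tanh (\<kappa> * (s + t))" for s
 fix r :: real assume r: "r \<le> 0"
 have w0: "w 0 = z 0" using \<open>\<kappa> \<noteq> 0\<close> tanh_artanh_real[OF z0] by (simp add: w_def t_def)
 have dw: "DERIV w s :> \<kappa> * (1 - (w s)\<^sup>2)" for s
 proof -
  have "DERIV (\<lambda>s. s + t) s :> 1" by (auto intro!: derivative_eq_intros)
  from DERIV_chain2[OF tanh_deriv[of \<kappa> "s + t"] this] show ?thesis by (simp add: w_def[abs_def])
 qed
 have zc: "continuous_on {r..0} z"
  by (rule DERIV_continuous_on[where D="\<lambda>s. \<kappa> * (1 - (z s)\<^sup>2)"], rule has_field_derivative_subset[OF dz]) auto
 have wc: "continuous_on {r..0} w"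
  by (rule DERIV_continuous_on, rule has_field_derivative_at_within, rule dw)
 have "bounded (z ` {r..0})" by (rule compact_imp_bounded, rule compact_continuous_image[OF zc]) simp
 then obtain B where "\<forall>x\<in>{r..0}. \<bar>z x\<bar> \<le> B" unfolding bounded_iff by auto
 then have B: "\<bar>z s\<bar> \<le> B" if "r \<le> s" "s \<le> 0" for s using that by simp
 define K where "K = \<bar>\<kappa>\<bar> * (B + 1)"
 have "(z r - w r)\<^sup>2 + 0\<^sup>2 \<le> ((z 0 - w 0)\<^sup>2 + 0\<^sup>2) * exp (2 * K * (0 - r))"
 proof (rule gronwall_two(2)[OF r, where d="\<lambda>s. z s - w s" and e="\<lambda>s. 0" and e'="\<lambda>s. 0"])
  fix s assume s: "r < s" "s < 0"
  show "DERIV (\<lambda>s. z s - w s) s :> \<kappa> * (1 - (z s)\<^sup>2) - \<kappa> * (1 - (w s)\<^sup>2)"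
   using dz[of s] s dw by (intro DERIV_diff) (simp_all add: at_within_atMost)
  have "(z s - w s) * (\<kappa> * (1 - (z s)\<^sup>2) - \<kappa> * (1 - (w s)\<^sup>2)) + 0 * 0 = - (\<kappa> * (z s + w s)) * (z s - w s)\<^sup>2"
   by (simp add: power2_eq_square algebra_simps)
  moreover have "\<bar>- (\<kappa> * (z s + w s)) * (z s - w s)\<^sup>2\<bar> \<le> K * (z s - w s)\<^sup>2"
  proof -
   have "\<bar>w s\<bar> < 1" using tanh_real_bounds[of "\<kappa> * (s + t)"] by (auto simp: w_def abs_less_iff)
   then have "\<bar>z s + w s\<bar> \<le> B + 1" using B[of s] s by linarith
   then have "\<bar>\<kappa>\<bar> * \<bar>z s + w s\<bar> \<le> K" unfolding K_def by (intro mult_left_mono) simp_all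
   then have "\<bar>\<kappa>\<bar> * \<bar>z s + w s\<bar> * (z s - w s)\<^sup>2 \<le> K * (z s - w s)\<^sup>2" by (rule mult_right_mono) simp
   then show ?thesis by (simp add: abs_mult)
  qed
  ultimately show "\<bar>(z s - w s) * (\<kappa> * (1 - (z s)\<^sup>2) - \<kappa> * (1 - (w s)\<^sup>2)) + 0 * 0\<bar> \<le> K * ((z s - w s)\<^sup>2 + 0\<^sup>2)" by simp
 qed (use zc wc in \<open>simp_all add: continuous_on_diff\<close>)
 then have "(z r - w r)\<^sup>2 \<le> 0" using w0 by simp
 then have "z r = w r" by simp
 then show "z r = tanh (\<kappa> * (r + t))" by (simp add: w_def)
qed

text \<open>\<open>k\<close>, \<open>\<kappa>\<close>, \<open>\<sigma>\<close> are c, \<epsilon>, 1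
  for the unstable manifold and - c, - \<epsilon>, -1 for the stable one, where \<sigma> undoes the
  change of sign of v under reversal of time.\<close>

locale tanh_branch = branch k "\<lambda>t. tanh (\<kappa> * t)" U V T \<delta> q for k \<kappa> U V T \<delta> q +
 fixes \<sigma> :: real
 assumes \<kappa>: "\<kappa> \<noteq> 0" and \<sigma>: "\<bar>\<sigma>\<bar> = 1"
begin

abbreviation mt :: "real \<Rightarrow> real" where "mt t \<equiv> tanh (\<kappa> * t)"

text \<open>The half orbits that make up the manifolds, shifted in time so that the third component
  is \<open>mt\<close>. They obey the cubic equation without the cut, and only up to
  \<open>t\<close>, since they may blow up later.\<close>

definition half :: "(real \<Rightarrow> real) \<Rightarrow> (real \<Rightarrow> real) \<Rightarrow> real \<Rightarrow> bool" where
 "half u v t \<longleftrightarrow> (\<forall>s\<le>t. (u has_real_derivative v s) (at s within {..t}) \<and>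
   (v has_real_derivative k * v s + u s ^ 3 - mt s * u s) (at s within {..t})) \<and>
   ((\<lambda>s. u s - U s) \<longlongrightarrow> 0) at_bot \<and> (v \<longlongrightarrow> 0) at_bot"

lemma half_interior:
 assumes "half u v t" "s < t"
 shows "DERIV u s :> v s" "DERIV v s :> k * v s + u s ^ 3 - mt s * u s"
 using assms at_within_atMost[OF assms(2)] unfolding half_def by (metis less_imp_le)+

lemma half_cont: assumes "half u v t" shows "continuous_on {r..t} u" "continuous_on {r..t} v"
proof -
 have 1: "(u has_real_derivative v s) (at s within {..t})"
  and 2: "(v has_real_derivative k * v s + u s ^ 3 - mt s * u s) (at s within {..t})" if "s \<le> t" for s
  using assms that unfolding half_def by simp_all
 show "continuous_on {r..t} u" by (rule DERIV_continuous_on[where D=v], rule has_field_derivative_subset[OF 1]) auto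
 show "continuous_on {r..t} v"
  by (rule DERIV_continuous_on[where D="\<lambda>s. k * v s + u s ^ 3 - mt s * u s"], rule has_field_derivative_subset[OF 2]) auto
qed

lemma half_eq_tsol:
 assumes h: "half u v t" and ts: "tsol u' v'" and eq: "u' t = u t" "v' t = v t" and rt: "r \<le> t"
  and le2: "\<And>s. r \<le> s \<Longrightarrow> s \<le> t \<Longrightarrow> \<bar>u s\<bar> \<le> 2"
 shows "u r = u' r" "v r = v' r"
proof -
 have "(u r - u' r)\<^sup>2 + (v r - v' r)\<^sup>2 \<le> ((u t - u' t)\<^sup>2 + (v t - v' t)\<^sup>2) * exp (2 * 9 * (t - r))"
 proof (rule gronwall_two(2)[OF rt, where d="\<lambda>s. u s - u' s" and e="\<lambda>s. v s - v' s"])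
  show "continuous_on {r..t} (\<lambda>s. u s - u' s)" "continuous_on {r..t} (\<lambda>s. v s - v' s)"
   using continuous_on_subset[OF tsol_cont(1)[OF ts]] continuous_on_subset[OF tsol_cont(2)[OF ts]]
   by (auto intro!: continuous_on_diff half_cont[OF h] tsol_cont[OF ts])
  fix s assume s: "r < s" "s < t"
  show "DERIV (\<lambda>s. u s - u' s) s :> v s - v' s"
   by (intro DERIV_diff half_interior(1)[OF h s(2)] tsolD(1)[OF ts])
  have cu: "u s ^ 3 = cub (u s)" using le2[of s] s by (simp add: cub_eq)
  have "k * v s + u s ^ 3 - mt s * u s - (k * v' s + cub (u' s) - mt s * u' s) =
    k * (v s - v' s) + (cub (u s) - cub (u' s)) - mt s * (u s - u' s)"
   unfolding cu by (simp add: algebra_simps)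
  with DERIV_diff[OF half_interior(2)[OF h s(2)] tsolD(2)[OF ts]]
  show "DERIV (\<lambda>s. v s - v' s) s :> k * (v s - v' s) + (cub (u s) - cub (u' s)) - mt s * (u s - u' s)"
   by simp
  show "\<bar>(u s - u' s) * (v s - v' s) + (v s - v' s) * (k * (v s - v' s) + (cub (u s) - cub (u' s)) - mt s * (u s - u' s))\<bar>
    \<le> 9 * ((u s - u' s)\<^sup>2 + (v s - v' s)\<^sup>2)"
   by (rule growth_bound[OF cub_lipschitz])
 qed
 then have "(u r - u' r)\<^sup>2 + (v r - v' r)\<^sup>2 \<le> 0" using eq by simp
 then show "u r = u' r" "v r = v' r" by (simp_all add: sum_power2_le_zero_iff)
qed

text \<open>A bound on the truncated solution carries over: at the last time before \<open>t\<close>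
  with |u| = 2 the two solutions would already agree, although |u'| < 2 there.\<close>

lemma half_eq_tsol':
 assumes h: "half u v t" and ts: "tsol u' v'" and eq: "u' t = u t" "v' t = v t" and rt: "r \<le> t"
  and less: "\<And>s. r \<le> s \<Longrightarrow> s \<le> t \<Longrightarrow> \<bar>u' s\<bar> < 2"
 shows "u r = u' r" "v r = v' r"
proof -
 have bound: "\<bar>u s\<bar> \<le> 2" if s: "r \<le> s" "s \<le> t" for s
 proof (rule ccontr)
  assume "\<not> \<bar>u s\<bar> \<le> 2"
  then have 1: "2 - \<bar>u s\<bar> \<le> 0" by simp
  have 2: "0 < 2 - \<bar>u t\<bar>" using less[of t] rt eq by simp
  have c: "continuous_on {s..t} (\<lambda>s. 2 - \<bar>u s\<bar>)" by (intro continuous_intros half_cont[OF h])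
  obtain z where z: "s \<le> z" "z < t" "2 - \<bar>u z\<bar> = 0" "\<And>r. z < r \<Longrightarrow> r \<le> t \<Longrightarrow> 0 < 2 - \<bar>u r\<bar>"
   by (rule last_zero[OF c 1 2 s(2)]) auto
  have "\<bar>u r\<bar> \<le> 2" if "z \<le> r" "r \<le> t" for r using z(3) z(4)[of r] that by (cases "r = z") simp_all
  then have "u z = u' z" using half_eq_tsol(1)[OF h ts eq, of z] z(2) by simp
  then show False using z(1,2,3) less[of z] s by simp
 qed
 show "u r = u' r" "v r = v' r" using half_eq_tsol[OF h ts eq rt bound] by simp_all
qed

lemma mt_between:
 assumes "0 < \<rho>" "min (mt (t0 - \<rho>)) (mt (t0 + \<rho>)) < mt t" "mt t < max (mt (t0 - \<rho>)) (mt (t0 + \<rho>))"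
 shows "\<bar>t - t0\<bar> < \<rho>"
proof -
 consider "0 < \<kappa>" | "\<kappa> < 0" using \<kappa> by linarith
 then show ?thesis
 proof cases
  case 1
  then show ?thesis using assms by (auto simp: min_def max_def split: if_splits)
 next
  case 2
  then show ?thesis using assms by (auto simp: min_def max_def split: if_splits)
 qed
qed

text \<open>Excludes other sheets of the global manifold. A point of \<open>S\<close> near the orbit
  has its time near \<open>t0\<close> because the ramp is monotone, so its orbit is close to
  \<open>U\<close> back to \<open>T\<close> by finite-time dependence. \<open>stay\<close> confines
  it to the tube of radius \<delta> on the rest of the half line, which makes it a member of the
  family.\<close>

lemma neighbourhood_in_family:
 assumes T0: "T \<le> t0 - 1" and \<rho>: "0 < \<rho>"
  and stay: "\<exists>r>0. \<forall>u v t. half u v t \<longrightarrow> T < t \<longrightarrow> \<bar>u T - U T\<bar> < r \<longrightarrow> \<bar>v T - V T\<bar> < r \<longrightarrow> (\<forall>s\<le>T. \<bar>u s - U s\<bar> \<le> \<delta>)"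
  and out: "\<And>x y z. (x, y, z) \<in> S \<Longrightarrow> \<bar>z\<bar> < 1 \<Longrightarrow> \<exists>u v t. half u v t \<and> (x, y, z) = (u t, \<sigma> * v t, mt t)"
 shows "\<exists>N. open N \<and> (U t0, \<sigma> * V t0, mt t0) \<in> N \<and>
   (\<forall>p\<in>S \<inter> N. \<exists>u v t. cls u v \<and> \<bar>t - t0\<bar> < \<rho> \<and> \<bar>u T - U T\<bar> < \<rho> \<and> p = (u t, \<sigma> * v t, mt t))"
proof -
 obtain r where r: "r > 0" and stay: "\<And>u v t s. half u v t \<Longrightarrow> T < t \<Longrightarrow> \<bar>u T - U T\<bar> < r \<Longrightarrow> \<bar>v T - V T\<bar> < r \<Longrightarrow> s \<le> T \<Longrightarrow> \<bar>u s - U s\<bar> \<le> \<delta>"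
  using stay by blast
 define R where "R = t0 + 1 - T"
 define e where "e = min (min \<rho> r) 1"
 have e: "0 < e" "e \<le> \<rho>" "e \<le> r" "e \<le> 1" using \<rho> r by (simp_all add: e_def)
 define \<rho>0 where "\<rho>0 = e / (4 * exp (9 * R))"
 have \<rho>0: "0 < \<rho>0" "2 * \<rho>0 * exp (9 * R) = e / 2" using e by (simp_all add: \<rho>0_def)
 have "\<forall>\<^sub>F t in nhds t0. \<bar>U t - U t0\<bar> < \<rho>0 / 2 \<and> \<bar>V t - V t0\<bar> < \<rho>0 / 2"
 proof (rule eventually_conj)
  have "(U \<longlongrightarrow> U t0) (nhds t0)" "(V \<longlongrightarrow> V t0) (nhds t0)"
   using tsol_isCont[OF UV, of t0] unfolding isCont_def tendsto_at_iff_tendsto_nhds .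
  from tendstoD[OF this(1), of "\<rho>0 / 2"] tendstoD[OF this(2), of "\<rho>0 / 2"] \<rho>0
  have "\<forall>\<^sub>F t in nhds t0. dist (U t) (U t0) < \<rho>0 / 2" "\<forall>\<^sub>F t in nhds t0. dist (V t) (V t0) < \<rho>0 / 2"
   by (metis half_gt_zero)+
  then show "\<forall>\<^sub>F t in nhds t0. \<bar>U t - U t0\<bar> < \<rho>0 / 2" "\<forall>\<^sub>F t in nhds t0. \<bar>V t - V t0\<bar> < \<rho>0 / 2"
   by (simp_all add: dist_real_def)
 qed
 then obtain d where d: "d > 0" "\<And>t. \<bar>t - t0\<bar> < d \<Longrightarrow> \<bar>U t - U t0\<bar> < \<rho>0 / 2 \<and> \<bar>V t - V t0\<bar> < \<rho>0 / 2"
  unfolding eventually_nhds_metric dist_real_def by blast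
 define b where "b = min d e"
 have b: "0 < b" "b \<le> d" "b \<le> e" using d e by (simp_all add: b_def)
 define lo hi where "lo = min (mt (t0 - b)) (mt (t0 + b))" and "hi = max (mt (t0 - b)) (mt (t0 + b))"
 define N where "N = {U t0 - \<rho>0 / 2<..<U t0 + \<rho>0 / 2} \<times> {\<sigma> * V t0 - \<rho>0 / 2<..<\<sigma> * V t0 + \<rho>0 / 2} \<times> {lo<..<hi}"
 show ?thesis
 proof (intro exI[of _ N] conjI ballI)
  show "open N" unfolding N_def by (intro open_Times) simp_all
  have "lo < mt t0 \<and> mt t0 < hi"
  proof -
   consider "0 < \<kappa>" | "\<kappa> < 0" using \<kappa> by linarith
   then show ?thesis
   proof cases
    case 1
    then have "mt (t0 - b) < mt t0" "mt t0 < mt (t0 + b)" using b by simp_all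
    then show ?thesis by (simp add: lo_def hi_def)
   next
    case 2
    then have "mt (t0 + b) < mt t0" "mt t0 < mt (t0 - b)" using b by simp_all
    then show ?thesis by (simp add: lo_def hi_def)
   qed
  qed
  then show "(U t0, \<sigma> * V t0, mt t0) \<in> N" using \<rho>0 by (simp add: N_def)
  fix p assume p: "p \<in> S \<inter> N"
  obtain x y z where xyz: "p = (x, y, z)" by (cases p)
  have pN: "lo < z" "z < hi" "U t0 - \<rho>0 / 2 < x" "x < U t0 + \<rho>0 / 2" "\<sigma> * V t0 - \<rho>0 / 2 < y" "y < \<sigma> * V t0 + \<rho>0 / 2"
   using p unfolding xyz N_def by auto
  then have pz: "lo < z" "z < hi" and px: "\<bar>x - U t0\<bar> < \<rho>0 / 2" and py: "\<bar>y - \<sigma> * V t0\<bar> < \<rho>0 / 2"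
   by linarith+
  have "- 1 < lo" "hi < 1" unfolding lo_def hi_def by (simp_all add: tanh_real_gt_neg1 tanh_real_lt_1)
  then have "\<bar>z\<bar> < 1" using pz by linarith
  moreover have "(x, y, z) \<in> S" using p xyz by simp
  ultimately obtain u v t where h: "half u v t" and pt: "(x, y, z) = (u t, \<sigma> * v t, mt t)" using out by blast
  have tt: "\<bar>t - t0\<bar> < b" using mt_between[of b t0 t] b pz pt unfolding lo_def hi_def by simp
  have Tt: "T < t" using tt b e T0 by linarith
  obtain u' v' where ts: "tsol u' v'" and eq: "u' t = u t" "v' t = v t" using tsol_exists by blast
  have "x = u t" using pt by simp
  moreover have "\<bar>U t - U t0\<bar> < \<rho>0 / 2" using d(2)[of t] tt b by linarith
  ultimately have 1: "\<bar>u' t - U t\<bar> \<le> \<rho>0" unfolding eq using px by linarith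
  have "\<bar>\<sigma> * (v t - V t0)\<bar> < \<rho>0 / 2" using py pt by (simp add: right_diff_distrib)
  then have "\<bar>v t - V t0\<bar> < \<rho>0 / 2" unfolding abs_mult \<sigma> by simp
  moreover have "\<bar>V t - V t0\<bar> < \<rho>0 / 2" using d(2)[of t] tt b by linarith
  ultimately have 2: "\<bar>v' t - V t\<bar> \<le> \<rho>0" unfolding eq by linarith
  have close: "\<bar>u' s - U s\<bar> \<le> e / 2" "\<bar>v' s - V s\<bar> \<le> e / 2" if s: "T \<le> s" "s \<le> t" for s
  proof -
   have "\<bar>s - t\<bar> \<le> R" using s tt b e unfolding R_def by linarith
   from tsol_dependence_abs[OF ts UV 1 2 this] show "\<bar>u' s - U s\<bar> \<le> e / 2" "\<bar>v' s - V s\<bar> \<le> e / 2"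
    unfolding \<rho>0(2) by simp_all
  qed
  have "\<bar>u' s\<bar> < 2" if "T \<le> s" "s \<le> t" for s using close(1)[OF that] U_pos[of s] U_less[of s] e by linarith
  then have onT: "u s = u' s" "v s = v' s" if "T \<le> s" "s \<le> t" for s
   using half_eq_tsol'[OF h ts eq, of s] that by simp_all
  have cT: "\<bar>u T - U T\<bar> < e" "\<bar>v T - V T\<bar> < e" using close[of T] onT[of T] Tt e by simp_all
  have left: "\<bar>u s - U s\<bar> \<le> \<delta>" if "s \<le> T" for s
   by (rule stay[OF h Tt _ _ that]) (use cT e in linarith)+
  have le2: "\<bar>u s\<bar> \<le> 2" if "s \<le> t" for s
  proof (cases "s \<le> T")
   case True
   then show ?thesis using left[of s] U_pos[of s] U_less[of s] \<delta> by linarith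
  next
   case False
   then show ?thesis using onT[of s] close[of s] U_pos[of s] U_less[of s] e that by linarith
  qed
  have all: "u s = u' s" "v s = v' s" if "s \<le> t" for s
   using half_eq_tsol[OF h ts eq that] le2 by simp_all
  have "cls u' v'" unfolding cls_def
  proof (intro conjI allI impI ts)
   show "\<bar>u' s - U s\<bar> \<le> \<delta>" if "s \<le> T" for s using left[OF that] all[of s] that Tt by simp
   have ev: "\<forall>\<^sub>F s in at_bot. s \<le> t" by (rule eventually_le_at_bot)
   have l: "((\<lambda>s. u s - U s) \<longlongrightarrow> 0) at_bot" "(v \<longlongrightarrow> 0) at_bot" using h by (simp_all add: half_def)
   show "((\<lambda>s. u' s - U s) \<longlongrightarrow> 0) at_bot"
    by (rule Lim_transform_eventually[OF l(1)]) (rule eventually_mono[OF ev], simp add: all)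
   have "((\<lambda>s. v s - V s) \<longlongrightarrow> 0 - 0) at_bot" by (intro tendsto_diff l V_lim)
   then have l2: "((\<lambda>s. v s - V s) \<longlongrightarrow> 0) at_bot" by simp
   show "((\<lambda>s. v' s - V s) \<longlongrightarrow> 0) at_bot"
    by (rule Lim_transform_eventually[OF l2]) (rule eventually_mono[OF ev], simp add: all)
  qed
  moreover have "\<bar>u' T - U T\<bar> < \<rho>" using cT onT[of T] Tt e by simp
  moreover have "\<bar>t - t0\<bar> < \<rho>" using tt b e by simp
  moreover have "p = (u' t, \<sigma> * v' t, mt t)" using xyz pt eq by simp
  ultimately show "\<exists>u v t. cls u v \<and> \<bar>t - t0\<bar> < \<rho> \<and> \<bar>u T - U T\<bar> < \<rho> \<and> p = (u t, \<sigma> * v t, mt t)" by blast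
 qed
qed

lemma half_of_cls:
 assumes cl: "cls u v" and le2: "\<And>r. r \<le> t \<Longrightarrow> 0 < u r \<and> u r < 2" shows "half u v t"
 unfolding half_def
proof (intro conjI allI impI)
 fix s assume s: "s \<le> t"
 show "(u has_real_derivative v s) (at s within {..t})"
  by (rule has_field_derivative_at_within, rule tsolD(1)[OF cls_tsol[OF cl]])
 have "cub (u s) = u s ^ 3" using le2[OF s] by (simp add: cub_eq)
 then show "(v has_real_derivative k * v s + u s ^ 3 - mt s * u s) (at s within {..t})"
  using has_field_derivative_at_within[OF tsolD(2)[OF cls_tsol[OF cl], of s]] by simp
next
 show "((\<lambda>s. u s - U s) \<longlongrightarrow> 0) at_bot" "(v \<longlongrightarrow> 0) at_bot"
  using cl cls_v_lim[OF cl] by (simp_all add: cls_def)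
qed

lemma tangent_plane:
 assumes T0: "T \<le> t0 - 1"
  and stay: "\<exists>r>0. \<forall>u v t. half u v t \<longrightarrow> T < t \<longrightarrow> \<bar>u T - U T\<bar> < r \<longrightarrow> \<bar>v T - V T\<bar> < r \<longrightarrow> (\<forall>s\<le>T. \<bar>u s - U s\<bar> \<le> \<delta>)"
  and out: "\<And>x y z. (x, y, z) \<in> S \<Longrightarrow> \<bar>z\<bar> < 1 \<Longrightarrow> \<exists>u v t. half u v t \<and> (x, y, z) = (u t, \<sigma> * v t, mt t)"
  and into: "\<And>u v t. half u v t \<Longrightarrow> (u t, \<sigma> * v t, mt t) \<in> S"
 shows "\<exists>z w. 0 < z \<and> z * V t0 < w * U t0 \<and>
  surface_with_tangent_plane S (U t0, \<sigma> * V t0, mt t0)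
   {(\<alpha> * z + \<beta> * V t0, \<sigma> * (\<alpha> * w + \<beta> * (k * V t0 + U t0 ^ 3 - mt t0 * U t0)), \<beta> * (\<kappa> * (1 - (mt t0)\<^sup>2))) |\<alpha> \<beta>. True}"
proof -
 have Tt: "T \<le> t0 + 1" using T0 by simp
 show ?thesis
 proof (rule us_bounds[OF Tt])
 fix \<eta> K assume b: "0 < \<eta>" "\<eta> \<le> \<delta>" "0 \<le> K"
  "\<And>s t. \<bar>s\<bar> \<le> \<eta> \<Longrightarrow> t \<le> t0 + 1 \<Longrightarrow> 0 < us s t \<and> us s t < 2"
  "\<And>s t. \<bar>s\<bar> \<le> \<eta> \<Longrightarrow> T \<le> t \<Longrightarrow> t \<le> t0 + 1 \<Longrightarrow> - K * us s t \<le> vs s t"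
 interpret bb: branch_box k "\<lambda>t. tanh (\<kappa> * t)" U V T \<delta> q "t0 + 1" \<eta> K
  by unfold_locales (use b Tt in simp_all)
 show ?thesis
 proof (rule bb.surface_at[where m'="\<lambda>t. \<kappa> * (1 - (mt t)\<^sup>2)"])
  show "T \<le> t0 - 1" "t0 + 1 \<le> t0 + 1" "\<sigma> \<noteq> 0" using T0 \<sigma> by auto
  show "DERIV (\<lambda>t. mt t) t :> \<kappa> * (1 - (mt t)\<^sup>2)" for t by (rule tanh_deriv)
  show "continuous_on UNIV (\<lambda>t. \<kappa> * (1 - (mt t)\<^sup>2))"
   by (intro continuous_intros) (simp_all add: cosh_real_nonzero)
  show "\<kappa> * (1 - (mt t)\<^sup>2) \<noteq> 0" for t
  proof -
   have "\<bar>mt t\<bar> < 1" using tanh_real_bounds[of "\<kappa> * t"] by (auto simp: abs_less_iff)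
   then have "(mt t)\<^sup>2 < 1" by (simp add: abs_square_less_1)
   then show ?thesis using \<kappa> by simp
  qed
  show "inj (\<lambda>t. mt t)" using \<kappa> by (intro injI) simp
  show "(u t, \<sigma> * v t, mt t) \<in> S" if "cls u v" "\<And>r. r \<le> t \<Longrightarrow> 0 < u r \<and> u r < 2" for u v t
   by (rule into, rule half_of_cls[OF that])
  show "\<exists>N. open N \<and> (U t0, \<sigma> * V t0, mt t0) \<in> N \<and>
   (\<forall>p\<in>S \<inter> N. \<exists>u v t. cls u v \<and> \<bar>t - t0\<bar> < \<rho> \<and> \<bar>u T - U T\<bar> < \<rho> \<and> p = (u t, \<sigma> * v t, mt t))" if "\<rho> > 0" for \<rho>
   by (rule neighbourhood_in_family[OF T0 that stay out])
 qed
 qed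
qed

end

section \<open>The manifolds in coordinates, and transversality\<close>

lemma has_vector_derivative_triple:
 fixes x y z :: "real \<Rightarrow> real"
 shows "((\<lambda>t. (x t, y t, z t)) has_vector_derivative (a, b, d)) (at t within S) \<longleftrightarrow>
  (x has_real_derivative a) (at t within S) \<and> (y has_real_derivative b) (at t within S) \<and> (z has_real_derivative d) (at t within S)"
proof
 assume h: "((\<lambda>t. (x t, y t, z t)) has_vector_derivative (a, b, d)) (at t within S)"
 have 1: "((\<lambda>t. fst (x t, y t, z t)) has_vector_derivative fst (a, b, d)) (at t within S)"
  by (rule bounded_linear.has_vector_derivative[OF bounded_linear_fst h])
 have 2: "((\<lambda>t. snd (x t, y t, z t)) has_vector_derivative snd (a, b, d)) (at t within S)"
  by (rule bounded_linear.has_vector_derivative[OF bounded_linear_snd h])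
 have 3: "((\<lambda>t. fst (snd (x t, y t, z t))) has_vector_derivative fst (snd (a, b, d))) (at t within S)"
  by (rule bounded_linear.has_vector_derivative[OF bounded_linear_fst 2])
 have 4: "((\<lambda>t. snd (snd (x t, y t, z t))) has_vector_derivative snd (snd (a, b, d))) (at t within S)"
  by (rule bounded_linear.has_vector_derivative[OF bounded_linear_snd 2])
 show "(x has_real_derivative a) (at t within S) \<and> (y has_real_derivative b) (at t within S) \<and> (z has_real_derivative d) (at t within S)"
  using 1 3 4 by (simp add: has_real_derivative_iff_has_vector_derivative)
next
 assume h: "(x has_real_derivative a) (at t within S) \<and> (y has_real_derivative b) (at t within S) \<and> (z has_real_derivative d) (at t within S)"
 have "((\<lambda>t. (x t, y t, z t)) has_derivative (\<lambda>h. (a * h, b * h, d * h))) (at t within S)"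
  using h unfolding has_field_derivative_def by (intro has_derivative_Pair) simp_all
 moreover have "(\<lambda>h. (a * h, b * h, d * h)) = (\<lambda>h. h *\<^sub>R (a, b, d))" by (rule ext) (simp add: mult.commute)
 ultimately show "((\<lambda>t. (x t, y t, z t)) has_vector_derivative (a, b, d)) (at t within S)"
  unfolding has_vector_derivative_def by simp
qed

lemma ramp_orbit_iff:
 "((\<lambda>t. (x t, y t, z t)) has_vector_derivative ramp_field \<epsilon> c (x t, y t, z t)) (at t within S) \<longleftrightarrow>
  (x has_real_derivative y t) (at t within S) \<and>
  (y has_real_derivative c * y t - z t * x t + x t ^ 3) (at t within S) \<and>
  (z has_real_derivative \<epsilon> * (1 - (z t)\<^sup>2)) (at t within S)"
 unfolding ramp_field_def by (simp add: has_vector_derivative_triple)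

lemma tendsto_triple_iff:
 fixes x y z :: "real \<Rightarrow> real"
 shows "((\<lambda>t. (x t, y t, z t)) \<longlongrightarrow> (a, b, d)) F \<longleftrightarrow> (x \<longlongrightarrow> a) F \<and> (y \<longlongrightarrow> b) F \<and> (z \<longlongrightarrow> d) F"
proof
 assume h: "((\<lambda>t. (x t, y t, z t)) \<longlongrightarrow> (a, b, d)) F"
 show "(x \<longlongrightarrow> a) F \<and> (y \<longlongrightarrow> b) F \<and> (z \<longlongrightarrow> d) F"
  using tendsto_fst[OF h] tendsto_fst[OF tendsto_snd[OF h]] tendsto_snd[OF tendsto_snd[OF h]] by simp
qed (simp add: tendsto_Pair)

lemma mem_unstable_manifold_ramp:
 "(x0, y0, z0) \<in> unstable_manifold (ramp_field \<epsilon> c) (p1, p2, p3) \<longleftrightarrow> (\<exists>x y z. x 0 = x0 \<and> y 0 = y0 \<and> z 0 = z0 \<and>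
  (\<forall>t\<le>0. (x has_real_derivative y t) (at t within {..0}) \<and>
   (y has_real_derivative c * y t - z t * x t + x t ^ 3) (at t within {..0}) \<and>
   (z has_real_derivative \<epsilon> * (1 - (z t)\<^sup>2)) (at t within {..0})) \<and>
  (x \<longlongrightarrow> p1) at_bot \<and> (y \<longlongrightarrow> p2) at_bot \<and> (z \<longlongrightarrow> p3) at_bot)" (is "_ \<longleftrightarrow> ?R")
proof
 assume "(x0, y0, z0) \<in> unstable_manifold (ramp_field \<epsilon> c) (p1, p2, p3)"
 then obtain \<gamma> where g: "\<gamma> 0 = (x0, y0, z0)"
  "\<forall>t\<le>0. (\<gamma> has_vector_derivative ramp_field \<epsilon> c (\<gamma> t)) (at t within {..0})" "(\<gamma> \<longlongrightarrow> (p1, p2, p3)) at_bot"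
  unfolding unstable_manifold_def by blast
 define x y z where "x t = fst (\<gamma> t)" and "y t = fst (snd (\<gamma> t))" and "z t = snd (snd (\<gamma> t))" for t
 have e: "\<gamma> = (\<lambda>t. (x t, y t, z t))" by (rule ext) (simp add: x_def y_def z_def)
 show ?R using g unfolding e ramp_orbit_iff tendsto_triple_iff prod.inject
  by (intro exI[of _ x] exI[of _ y] exI[of _ z]) simp
next
 assume ?R
 then obtain x y z where h: "x 0 = x0" "y 0 = y0" "z 0 = z0"
  "\<forall>t\<le>0. (x has_real_derivative y t) (at t within {..0}) \<and>
   (y has_real_derivative c * y t - z t * x t + x t ^ 3) (at t within {..0}) \<and>
   (z has_real_derivative \<epsilon> * (1 - (z t)\<^sup>2)) (at t within {..0})"
  "(x \<longlongrightarrow> p1) at_bot" "(y \<longlongrightarrow> p2) at_bot" "(z \<longlongrightarrow> p3) at_bot" by (elim exE conjE) (rule that)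
 show "(x0, y0, z0) \<in> unstable_manifold (ramp_field \<epsilon> c) (p1, p2, p3)"
  unfolding unstable_manifold_def mem_Collect_eq
  by (rule exI[of _ "\<lambda>t. (x t, y t, z t)"]) (use h in \<open>simp add: ramp_orbit_iff tendsto_triple_iff\<close>)
qed

lemma mem_stable_manifold_ramp:
 "(x0, y0, z0) \<in> stable_manifold (ramp_field \<epsilon> c) (p1, p2, p3) \<longleftrightarrow> (\<exists>x y z. x 0 = x0 \<and> y 0 = y0 \<and> z 0 = z0 \<and>
  (\<forall>t\<ge>0. (x has_real_derivative y t) (at t within {0..}) \<and>
   (y has_real_derivative c * y t - z t * x t + x t ^ 3) (at t within {0..}) \<and>
   (z has_real_derivative \<epsilon> * (1 - (z t)\<^sup>2)) (at t within {0..})) \<and>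
  (x \<longlongrightarrow> p1) at_top \<and> (y \<longlongrightarrow> p2) at_top \<and> (z \<longlongrightarrow> p3) at_top)" (is "_ \<longleftrightarrow> ?R")
proof
 assume "(x0, y0, z0) \<in> stable_manifold (ramp_field \<epsilon> c) (p1, p2, p3)"
 then obtain \<gamma> where g: "\<gamma> 0 = (x0, y0, z0)"
  "\<forall>t\<ge>0. (\<gamma> has_vector_derivative ramp_field \<epsilon> c (\<gamma> t)) (at t within {0..})" "(\<gamma> \<longlongrightarrow> (p1, p2, p3)) at_top"
  unfolding stable_manifold_def by blast
 define x y z where "x t = fst (\<gamma> t)" and "y t = fst (snd (\<gamma> t))" and "z t = snd (snd (\<gamma> t))" for t
 have e: "\<gamma> = (\<lambda>t. (x t, y t, z t))" by (rule ext) (simp add: x_def y_def z_def)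
 show ?R using g unfolding e ramp_orbit_iff tendsto_triple_iff prod.inject
  by (intro exI[of _ x] exI[of _ y] exI[of _ z]) simp
next
 assume ?R
 then obtain x y z where h: "x 0 = x0" "y 0 = y0" "z 0 = z0"
  "\<forall>t\<ge>0. (x has_real_derivative y t) (at t within {0..}) \<and>
   (y has_real_derivative c * y t - z t * x t + x t ^ 3) (at t within {0..}) \<and>
   (z has_real_derivative \<epsilon> * (1 - (z t)\<^sup>2)) (at t within {0..})"
  "(x \<longlongrightarrow> p1) at_top" "(y \<longlongrightarrow> p2) at_top" "(z \<longlongrightarrow> p3) at_top" by (elim exE conjE) (rule that)
 show "(x0, y0, z0) \<in> stable_manifold (ramp_field \<epsilon> c) (p1, p2, p3)"
  unfolding stable_manifold_def mem_Collect_eq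
  by (rule exI[of _ "\<lambda>t. (x t, y t, z t)"]) (use h in \<open>simp add: ramp_orbit_iff tendsto_triple_iff\<close>)
qed

lemma deriv_within_chain:
 fixes f g :: "real \<Rightarrow> real"
 assumes "(f has_real_derivative D) (at (g s) within A)" "(g has_real_derivative \<tau>) (at s within S)" "g ` S \<subseteq> A"
 shows "((\<lambda>s. f (g s)) has_real_derivative D * \<tau>) (at s within S)"
 using DERIV_image_chain[OF has_field_derivative_subset[OF assms(1,3)] assms(2)] by (simp add: o_def)

lemma deriv_shift: "((\<lambda>s. s + b) has_real_derivative 1) (at s within S)" "((\<lambda>s. b - s) has_real_derivative - 1) (at s within S)" for b :: real
 by (auto intro!: derivative_eq_intros)

lemma filterlim_shift:
 "filterlim (\<lambda>s. s + b) at_bot at_bot" "filterlim (\<lambda>s. b - s) at_top at_bot" "filterlim (\<lambda>s. b - s) at_bot at_top" for b :: real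
proof -
 show "filterlim (\<lambda>s. s + b) at_bot at_bot"
  unfolding filterlim_at_bot eventually_at_bot_linorder by (metis add.commute le_diff_eq)
 show "filterlim (\<lambda>s. b - s) at_top at_bot"
  unfolding filterlim_at_top eventually_at_bot_linorder by (metis add.commute le_diff_eq diff_le_eq)
 show "filterlim (\<lambda>s. b - s) at_bot at_top"
  unfolding filterlim_at_bot eventually_at_top_linorder by (metis add.commute le_diff_eq diff_le_eq)
qed

text \<open>An orbit that leaves a neighbourhood of \<open>u = 1\<close> backwards in time dissipates too much energy
 to be able to return.\<close>

lemma energy_stay:
 fixes x y M \<mu> :: "real \<Rightarrow> real"
 assumes c: "0 < c" "c < 2"
  and dx: "\<And>s. s \<le> T \<Longrightarrow> DERIV x s :> y s"
  and dy: "\<And>s. s \<le> T \<Longrightarrow> DERIV y s :> - c * y s + x s ^ 3 - M s * x s"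
  and dM: "\<And>s. DERIV M s :> \<mu> s" "\<And>s. \<mu> s \<le> 0" "\<And>s. M s \<le> 1"
  and lim: "(x \<longlongrightarrow> 1) at_bot" "(y \<longlongrightarrow> 0) at_bot" "(M \<longlongrightarrow> 1) at_bot"
  and ET: "1/4 - c / 4000 < (y T)\<^sup>2 / 2 + M T * (x T)\<^sup>2 / 2 - x T ^ 4 / 4" and xT: "\<bar>x T - 1\<bar> < 1/20" and s: "s \<le> T"
 shows "\<bar>x s - 1\<bar> \<le> 1/10"
proof (rule ccontr)
 assume out: "\<not> \<bar>x s - 1\<bar> \<le> 1/10"
 define E where "E s = (y s)\<^sup>2 / 2 + M s * (x s)\<^sup>2 / 2 - x s ^ 4 / 4" for s
 have dE: "DERIV E r :> - c * (y r)\<^sup>2 + \<mu> r * (x r)\<^sup>2 / 2" if "r \<le> T" for r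
 proof -
  have 1: "DERIV (\<lambda>s. (y s)\<^sup>2 / 2) r :> y r * (- c * y r + x r ^ 3 - M r * x r)"
   by (rule DERIV_cong[OF DERIV_cdivide[OF DERIV_power[OF dy[OF that]]]]) simp
  have 2: "DERIV (\<lambda>s. M s * (x s)\<^sup>2 / 2) r :> (\<mu> r * (x r)\<^sup>2 + (2 * (x r * y r)) * M r) / 2"
   by (rule DERIV_cdivide[OF DERIV_mult[OF dM(1) DERIV_cong[OF DERIV_power[OF dx[OF that]]]]]) simp
  have 3: "DERIV (\<lambda>s. x s ^ 4 / 4) r :> x r ^ 3 * y r"
   by (rule DERIV_cong[OF DERIV_cdivide[OF DERIV_power[OF dx[OF that]]]]) (simp add: mult.commute)
  show ?thesis unfolding E_def
   by (rule DERIV_cong[OF DERIV_diff[OF DERIV_add[OF 1 2] 3]]) (simp add: field_simps power2_eq_square)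
 qed
 have neg: "- c * (y r)\<^sup>2 + \<mu> r * (x r)\<^sup>2 / 2 \<le> - c * (y r)\<^sup>2" for r
  using mult_nonpos_nonneg[OF dM(2)[of r] zero_le_power2[of "x r"]] by simp
 have neg0: "- c * (y r)\<^sup>2 \<le> 0" for r using c by simp
 have mono: "E r' \<le> E r" if "r \<le> r'" "r' \<le> T" for r r'
 proof (rule deriv_nonpos_mono[OF that(1), where f=E])
  fix q assume q: "r \<le> q" "q \<le> r'"
  show "DERIV E q :> - c * (y q)\<^sup>2 + \<mu> q * (x q)\<^sup>2 / 2" by (rule dE) (use q that in linarith)
  show "- c * (y q)\<^sup>2 + \<mu> q * (x q)\<^sup>2 / 2 \<le> 0" using neg[of q] neg0[of q] by linarith
 qed
 have "(E \<longlongrightarrow> 0\<^sup>2 / 2 + 1 * 1\<^sup>2 / 2 - 1 ^ 4 / 4) at_bot"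
  unfolding E_def by (intro tendsto_intros lim) simp_all
 then have El: "(E \<longlongrightarrow> 1/4) at_bot" by simp
 have Ele: "E r \<le> 1/4" if "r \<le> T" for r
  by (rule tendsto_lowerbound[OF El])
    (use mono[of _ r] that in \<open>auto intro!: eventually_mono[OF eventually_le_at_bot[of r]]\<close>)
 have Ege: "1/4 - c / 4000 < E r" if "r \<le> T" for r using mono[OF that order_refl] ET by (simp add: E_def)
 have xc: "continuous_on {p..T} x" for p
  by (rule DERIV_continuous_on[where D=y]) (rule has_field_derivative_at_within, rule dx, simp)
 obtain t1 where t1: "s \<le> t1" "t1 < T" "1/10 - \<bar>x t1 - 1\<bar> = 0" "\<And>r. t1 < r \<Longrightarrow> r \<le> T \<Longrightarrow> 0 < 1/10 - \<bar>x r - 1\<bar>"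
 proof (rule last_zero[of s T "\<lambda>r. 1/10 - \<bar>x r - 1\<bar>"])
  show "continuous_on {s..T} (\<lambda>r. 1/10 - \<bar>x r - 1\<bar>)" by (intro continuous_intros xc)
 qed (use out xT s in simp_all)
 obtain s1 where s1: "t1 < s1" "s1 \<le> T" "\<bar>x s1 - 1\<bar> - 1/20 = 0" "\<And>r. t1 \<le> r \<Longrightarrow> r < s1 \<Longrightarrow> 0 < \<bar>x r - 1\<bar> - 1/20"
 proof (rule first_zero[of t1 T "\<lambda>r. \<bar>x r - 1\<bar> - 1/20"])
  show "continuous_on {t1..T} (\<lambda>r. \<bar>x r - 1\<bar> - 1/20)" by (intro continuous_intros xc)
 qed (use t1 xT in simp_all)
 \<comment> \<open>With energy above 1/4 - c / 4000, the kinetic part y^2 / 2 exceeds (1 - x^2)^2 /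
   4 - c / 4000, so the ring between the distances 1/20 and 1/10 from 1 is crossed with speed at
   least 1/20.\<close>
 have yl: "1/20 \<le> \<bar>y r\<bar>" if r: "t1 \<le> r" "r \<le> s1" for r
 proof -
  have b1: "1/20 \<le> \<bar>x r - 1\<bar>" using s1(3) s1(4)[of r] r by (cases "r = s1") simp_all
  have b2: "\<bar>x r - 1\<bar> \<le> 1/10" using t1(3) t1(4)[of r] r s1(2) by (cases "r = t1") simp_all
  have rT: "r \<le> T" using r s1 by simp
  have "1/20 * (19/10) \<le> \<bar>x r - 1\<bar> * \<bar>x r + 1\<bar>" using b1 b2 by (intro mult_mono) linarith+
  then have "(19/200)\<^sup>2 \<le> (\<bar>x r - 1\<bar> * \<bar>x r + 1\<bar>)\<^sup>2" by (intro power_mono) simp_all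
  also have "\<dots> = 1 - 2 * (x r)\<^sup>2 + x r ^ 4"
   unfolding power_mult_distrib power2_abs by (simp add: power2_eq_square power4_eq_xxxx algebra_simps)
  finally have 1: "361 / 40000 \<le> 1 - 2 * (x r)\<^sup>2 + x r ^ 4" by (simp add: power2_eq_square)
  have "M r * (x r)\<^sup>2 \<le> 1 * (x r)\<^sup>2" by (rule mult_right_mono[OF dM(3)]) simp
  then have "1/400 \<le> (y r)\<^sup>2" using 1 Ege[OF rT] c(2) unfolding E_def by linarith
  then have "(1/20)\<^sup>2 \<le> \<bar>y r\<bar>\<^sup>2" by (simp add: power2_eq_square)
  then show ?thesis by (rule power2_le_imp_le) simp
 qed
 \<comment> \<open>From |y| \<ge> 1/20, c y^2 \<ge> (c / 20) |y| turns distance travelled into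
   energy lost: the crossing costs at least c / 400, and only c / 4000 is available. The two signs
   \<tau> cover the two directions.\<close>
 have drop: "E s1 + \<tau> * (c / 20) * x s1 \<le> E t1 + \<tau> * (c / 20) * x t1" if \<tau>: "\<bar>\<tau>\<bar> = 1" for \<tau>
 proof (rule deriv_nonpos_mono[where f="\<lambda>r. E r + \<tau> * (c / 20) * x r"])
  show "t1 \<le> s1" using s1 by simp
  fix r assume r: "t1 \<le> r" "r \<le> s1"
  have rT: "r \<le> T" using r s1 by simp
  show "DERIV (\<lambda>r. E r + \<tau> * (c / 20) * x r) r :> - c * (y r)\<^sup>2 + \<mu> r * (x r)\<^sup>2 / 2 + \<tau> * (c / 20) * y r"
   by (intro DERIV_add dE[OF rT] DERIV_cmult dx[OF rT])
  have "\<tau> * (c / 20) * y r \<le> \<bar>\<tau> * (c / 20) * y r\<bar>" by simp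
  also have "\<dots> = c * (1/20 * \<bar>y r\<bar>)" using c \<tau> by (simp add: abs_mult)
  also have "\<dots> \<le> c * (\<bar>y r\<bar> * \<bar>y r\<bar>)" using yl[OF r] c by (intro mult_left_mono mult_right_mono) simp_all
  also have "\<dots> = c * (y r)\<^sup>2" by (simp add: power2_eq_square)
  finally show "- c * (y r)\<^sup>2 + \<mu> r * (x r)\<^sup>2 / 2 + \<tau> * (c / 20) * y r \<le> 0" using neg[of r] by linarith
 qed
 have E1: "E t1 - E s1 \<le> c / 4000" using Ele[of t1] Ege[of s1] t1 s1 by simp
 have "c / 20 * (1/20) \<le> c / 20 * \<bar>x s1 - x t1\<bar>" using t1(3) s1(3) c by (intro mult_left_mono) linarith+
 moreover have "c / 20 * \<bar>x s1 - x t1\<bar> \<le> E t1 - E s1"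
 proof -
  have d1: "c / 20 * (x s1 - x t1) \<le> E t1 - E s1" using drop[of 1] unfolding right_diff_distrib by simp
  have d2: "c / 20 * - (x s1 - x t1) \<le> E t1 - E s1" using drop[of "-1"] unfolding minus_diff_eq right_diff_distrib by simp
  show ?thesis using d1 d2 unfolding abs_if by (simp split: if_split)
 qed
 ultimately show False using E1 c by linarith
qed

text \<open>Multiplying the slope inequalities crosswise and adding gives z w' + z' w > 0, so (z, w)
  and (z', - w') are independent in the (u, v) plane. The flow direction, with B \<noteq> 0,
  supplies the third dimension.\<close>

lemma planes_span:
 fixes z w z' w' U V A A' B B' :: real
 assumes "0 < z" "z * V < w * U" "0 < z'" "z' * (- V) < w' * U" "0 < U" "B \<noteq> 0"
 shows "{x + y |x y. x \<in> {(\<alpha> * z + \<beta> * V, 1 * (\<alpha> * w + \<beta> * A), \<beta> * B) |\<alpha> \<beta>. True} \<and>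
   y \<in> {(\<alpha> * z' + \<beta> * (- V), - 1 * (\<alpha> * w' + \<beta> * A'), \<beta> * B') |\<alpha> \<beta>. True}} = (UNIV :: (real \<times> real \<times> real) set)"
proof -
 define D where "D = z * w' + z' * w"
 have "z' * (z * V) < z' * (w * U)" "z * (z' * (- V)) < z * (w' * U)"
  using mult_strict_left_mono[OF assms(2,3)] mult_strict_left_mono[OF assms(4,1)] by simp_all
 then have "0 < D * U" by (simp add: D_def algebra_simps)
 then have D: "D \<noteq> 0" by auto
 have "(p1, p2, p3) \<in> {x + y |x y. x \<in> {(\<alpha> * z + \<beta> * V, 1 * (\<alpha> * w + \<beta> * A), \<beta> * B) |\<alpha> \<beta>. True} \<and>
   y \<in> {(\<alpha> * z' + \<beta> * (- V), - 1 * (\<alpha> * w' + \<beta> * A'), \<beta> * B') |\<alpha> \<beta>. True}}" for p1 p2 p3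
 proof -
  have frac: "A / D * z + B / D * z' = (A * z + B * z') / D" "A / D * z - B / D * z' = (A * z - B * z') / D" for A B z z' :: real
   by (simp_all add: add_divide_distrib diff_divide_distrib)
  define \<beta> where "\<beta> = p3 / B"
  define q1 q2 where "q1 = p1 - \<beta> * V" and "q2 = p2 - \<beta> * A"
  define \<alpha> \<alpha>' where "\<alpha> = (q1 * w' + q2 * z') / D" and "\<alpha>' = (q1 * w - q2 * z) / D"
  have "\<alpha> * z + \<alpha>' * z' = ((q1 * w' + q2 * z') * z + (q1 * w - q2 * z) * z') / D"
   unfolding \<alpha>_def \<alpha>'_def by (rule frac)
  also have "(q1 * w' + q2 * z') * z + (q1 * w - q2 * z) * z' = q1 * D" by (simp add: D_def algebra_simps)
  finally have 1: "\<alpha> * z + \<alpha>' * z' = q1" using D by simp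
  have "\<alpha> * w - \<alpha>' * w' = ((q1 * w' + q2 * z') * w - (q1 * w - q2 * z) * w') / D"
   unfolding \<alpha>_def \<alpha>'_def by (rule frac)
  also have "(q1 * w' + q2 * z') * w - (q1 * w - q2 * z) * w' = q2 * D" by (simp add: D_def algebra_simps)
  finally have 2: "\<alpha> * w - \<alpha>' * w' = q2" using D by simp
  have 3: "\<beta> * B = p3" using assms by (simp add: \<beta>_def)
  have eq: "(p1, p2, p3) = (\<alpha> * z + \<beta> * V, 1 * (\<alpha> * w + \<beta> * A), \<beta> * B) + (\<alpha>' * z' + 0 * (- V), - 1 * (\<alpha>' * w' + 0 * A'), 0 * B')"
   using 1 2 3 by (simp add: q1_def q2_def)
  show ?thesis
   by (rule CollectI, rule exI, rule exI, rule conjI[OF eq]) blast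
 qed
 then show ?thesis by auto
qed

context front_sol
begin

lemma orbit_in_unstable: "(u t, v t, m t) \<in> unstable_manifold (ramp_field \<epsilon> c) (0, 0, -1)"
 unfolding mem_unstable_manifold_ramp
proof (rule exI[of _ "\<lambda>s. u (s + t)"], rule exI[of _ "\<lambda>s. v (s + t)"], rule exI[of _ "\<lambda>s. m (s + t)"], intro conjI allI impI)
 fix s :: real
 show "((\<lambda>s. u (s + t)) has_real_derivative v (s + t)) (at s within {..0})"
  using deriv_within_chain[OF du[of "s + t"] deriv_shift(1)] by simp
 show "((\<lambda>s. v (s + t)) has_real_derivative c * v (s + t) - m (s + t) * u (s + t) + u (s + t) ^ 3) (at s within {..0})"
  using deriv_within_chain[OF dv[of "s + t"] deriv_shift(1)] by (simp add: algebra_simps)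
 show "((\<lambda>s. m (s + t)) has_real_derivative \<epsilon> * (1 - (m (s + t))\<^sup>2)) (at s within {..0})"
  using deriv_within_chain[OF m_deriv[of "s + t"] deriv_shift(1)] by simp
qed (use filterlim_compose[OF u_bot filterlim_shift(1)] filterlim_compose[OF v_bot filterlim_shift(1)]
  filterlim_compose[OF m_lim(2) filterlim_shift(1)] in simp_all)

lemma orbit_in_stable: "(u t, v t, m t) \<in> stable_manifold (ramp_field \<epsilon> c) (1, 0, 1)"
 unfolding mem_stable_manifold_ramp
proof (rule exI[of _ "\<lambda>s. u (s + t)"], rule exI[of _ "\<lambda>s. v (s + t)"], rule exI[of _ "\<lambda>s. m (s + t)"], intro conjI allI impI)
 fix s :: real
 show "((\<lambda>s. u (s + t)) has_real_derivative v (s + t)) (at s within {0..})"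
  using deriv_within_chain[OF du[of "s + t"] deriv_shift(1)] by simp
 show "((\<lambda>s. v (s + t)) has_real_derivative c * v (s + t) - m (s + t) * u (s + t) + u (s + t) ^ 3) (at s within {0..})"
  using deriv_within_chain[OF dv[of "s + t"] deriv_shift(1)] by (simp add: algebra_simps)
 show "((\<lambda>s. m (s + t)) has_real_derivative \<epsilon> * (1 - (m (s + t))\<^sup>2)) (at s within {0..})"
  using deriv_within_chain[OF m_deriv[of "s + t"] deriv_shift(1)] by simp
next
 have f: "filterlim (\<lambda>s. s + t) at_top at_top" using filterlim_tendsto_add_at_top[OF tendsto_const[of t] filterlim_ident] by (simp add: add.commute)
 show "((\<lambda>s. u (s + t)) \<longlongrightarrow> 1) at_top" "((\<lambda>s. v (s + t)) \<longlongrightarrow> 0) at_top" "((\<lambda>s. m (s + t)) \<longlongrightarrow> 1) at_top"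
  using filterlim_compose[OF u_top f] filterlim_compose[OF v_top f] filterlim_compose[OF m_lim(1) f] by simp_all
qed simp_all

lemma heteroclinic_orbit: "heteroclinic (ramp_field \<epsilon> c) (0, 0, -1) (1, 0, 1) (\<lambda>t. (u t, v t, m t))"
 unfolding heteroclinic_def
proof (intro conjI allI)
 show "ramp_field \<epsilon> c (0, 0, -1) = 0" "ramp_field \<epsilon> c (1, 0, 1) = 0" by (simp_all add: ramp_field_def zero_prod_def)
 show "((\<lambda>t. (u t, v t, m t)) has_vector_derivative ramp_field \<epsilon> c (u t, v t, m t)) (at t)" for t
  by (rule ramp_orbit_iff[of u v m, THEN iffD2], intro conjI du m_deriv, rule DERIV_cong[OF dv]) simp
 show "((\<lambda>t. (u t, v t, m t)) \<longlongrightarrow> (0, 0, -1)) at_bot" "((\<lambda>t. (u t, v t, m t)) \<longlongrightarrow> (1, 0, 1)) at_top"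
  unfolding tendsto_triple_iff using u_bot v_bot u_top v_top m_lim by simp_all
qed

text \<open>Where the ramp is negative, a^2 + a b + b^2 - \<mu> is bounded below by a positive
  constant for all a and b. The maximum principle therefore holds for arbitrary half orbits, their
  distance to u is largest at \<open>T\<close>, and the confinement to the tube is
  immediate.\<close>

lemma unstable_plane:
 "\<exists>z w. 0 < z \<and> z * v t0 < w * u t0 \<and>
  surface_with_tangent_plane (unstable_manifold (ramp_field \<epsilon> c) (0, 0, -1)) (u t0, 1 * v t0, m t0)
   {(\<alpha> * z + \<beta> * v t0, 1 * (\<alpha> * w + \<beta> * (c * v t0 + u t0 ^ 3 - m t0 * u t0)), \<beta> * (\<epsilon> * (1 - (m t0)\<^sup>2))) |\<alpha> \<beta>. True}"
proof -
 have "\<forall>\<^sub>F t in at_bot. u t < 1/2" using order_tendstoD(2)[OF u_bot, of "1/2"] by simp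
 then obtain T0 where T0: "\<And>t. t \<le> T0 \<Longrightarrow> u t < 1/2" unfolding eventually_at_bot_linorder by blast
 define T where "T = min T0 (min (-1) (t0 - 1))"
 have T: "T \<le> T0" "T \<le> -1" "T \<le> t0 - 1" by (simp_all add: T_def)
 have mT: "m T < 0" using T eps by (simp add: mult_pos_neg)
 have mle: "m t \<le> m T" if "t \<le> T" for t using m_le_iff that by blast
 interpret B: tanh_branch c \<epsilon> u v T "1/2" "- m T" 1
 proof unfold_locales
  show "\<exists>B. \<forall>t\<le>T. exp (- c * t) * u t \<le> B"
  proof (intro exI allI impI)
   fix t assume t: "t \<le> T"
   show "exp (- c * t) * u t \<le> exp (- c * T) * u T"
   proof (rule deriv_nonneg_mono[OF t, where f="\<lambda>t. exp (- c * t) * u t"])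
    fix s assume s: "t \<le> s" "s \<le> T"
    have e: "DERIV (\<lambda>t. exp (- c * t)) s :> exp (- c * s) * (- c)" by (auto intro!: derivative_eq_intros)
    show "DERIV (\<lambda>t. exp (- c * t) * u t) s :> exp (- c * s) * (v s - c * u s)"
     by (rule DERIV_cong[OF DERIV_mult[OF e du]]) (simp add: algebra_simps)
    show "0 \<le> exp (- c * s) * (v s - c * u s)" using v_ge[of s] s T by simp
   qed
  qed
  show "- m T \<le> a\<^sup>2 + a * b + b\<^sup>2 - m t" if "t \<le> T" for t a b
  proof -
   have "0 \<le> (a + b)\<^sup>2 + a\<^sup>2 + b\<^sup>2" by simp
   then have "0 \<le> a\<^sup>2 + a * b + b\<^sup>2" by (simp add: power2_sum)
   then show ?thesis using mle[OF that] by linarith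
  qed
  show "(\<forall>t\<le>T. 1/2 < u t) \<or> (\<forall>t\<le>T. u t \<le> 1/2) \<and> (u \<longlongrightarrow> 0) at_bot"
   using T0 T u_bot by (auto intro: less_imp_le)
 qed (use uv u_pos u_less v_bot c_pos mT eps in simp_all)
 show ?thesis
 proof (rule B.tangent_plane[OF T(3)])
  show "\<exists>r>0. \<forall>x y t. B.half x y t \<longrightarrow> T < t \<longrightarrow> \<bar>x T - u T\<bar> < r \<longrightarrow> \<bar>y T - v T\<bar> < r \<longrightarrow> (\<forall>s\<le>T. \<bar>x s - u s\<bar> \<le> 1/2)"
  proof (intro exI[of _ "1/2"] conjI allI impI)
   fix x y t s assume h: "B.half x y t" and Tt: "T < t" and xT: "\<bar>x T - u T\<bar> < 1/2" and s: "s \<le> T"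
   have "\<bar>x s - u s\<bar> \<le> \<bar>x T - u T\<bar>"
   proof (rule vanishing_abs_mono[where d="\<lambda>s. x s - u s" and e="\<lambda>s. y s - v s" and k=c and T=T and
      Q="\<lambda>s. (x s)\<^sup>2 + x s * u s + (u s)\<^sup>2 - m s"])
    show "((\<lambda>s. x s - u s) \<longlongrightarrow> 0) at_bot" using h by (simp add: B.half_def)
    fix r assume r: "r \<le> T"
    then have rt: "r < t" using Tt by simp
    show "DERIV (\<lambda>s. x s - u s) r :> y r - v r"
     by (intro DERIV_diff B.half_interior(1)[OF h rt] du)
    show "DERIV (\<lambda>s. y s - v s) r :> c * (y r - v r) + ((x r)\<^sup>2 + x r * u r + (u r)\<^sup>2 - m r) * (x r - u r)"
     by (rule DERIV_cong[OF DERIV_diff[OF B.half_interior(2)[OF h rt] dv]])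
       (simp add: power2_eq_square power3_eq_cube algebra_simps)
    have "0 \<le> (x r + u r)\<^sup>2 + (x r)\<^sup>2 + (u r)\<^sup>2" by simp
    then have "0 \<le> (x r)\<^sup>2 + x r * u r + (u r)\<^sup>2" by (simp add: power2_sum)
    then show "0 \<le> (x r)\<^sup>2 + x r * u r + (u r)\<^sup>2 - m r" using mle[OF r] mT by linarith
   qed (use s in simp_all)
   then show "\<bar>x s - u s\<bar> \<le> 1/2" using xT by linarith
  qed simp
  show "\<exists>u' v' t. B.half u' v' t \<and> (x, y, z) = (u' t, 1 * v' t, m t)"
   if S: "(x, y, z) \<in> unstable_manifold (ramp_field \<epsilon> c) (0, 0, -1)" and z1: "\<bar>z\<bar> < 1" for x y z
  proof -
   obtain X Y Z where h: "X 0 = x" "Y 0 = y" "Z 0 = z"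
    and d: "\<And>s. s \<le> 0 \<Longrightarrow> (X has_real_derivative Y s) (at s within {..0})"
     "\<And>s. s \<le> 0 \<Longrightarrow> (Y has_real_derivative c * Y s - Z s * X s + X s ^ 3) (at s within {..0})"
     "\<And>s. s \<le> 0 \<Longrightarrow> (Z has_real_derivative \<epsilon> * (1 - (Z s)\<^sup>2)) (at s within {..0})"
    and l: "(X \<longlongrightarrow> 0) at_bot" "(Y \<longlongrightarrow> 0) at_bot"
    using S unfolding mem_unstable_manifold_ramp by blast
   have "\<epsilon> \<noteq> 0" using eps by simp
   from half_ramp_eq_tanh[OF this d(3)] obtain t where t: "\<And>s. s \<le> 0 \<Longrightarrow> Z s = m (s + t)" using z1 h by blast
   have "B.half (\<lambda>s. X (s + - t)) (\<lambda>s. Y (s + - t)) t"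
    unfolding B.half_def
   proof (intro conjI allI impI)
    fix s assume s: "s \<le> t"
    then have s0: "s + - t \<le> 0" by simp
    have im: "(\<lambda>s. s + - t) ` {..t} \<subseteq> {..0}" by auto
    show "((\<lambda>s. X (s + - t)) has_real_derivative Y (s + - t)) (at s within {..t})"
     using deriv_within_chain[OF d(1)[OF s0] deriv_shift(1) im] by simp
    show "((\<lambda>s. Y (s + - t)) has_real_derivative c * Y (s + - t) + X (s + - t) ^ 3 - m s * X (s + - t)) (at s within {..t})"
     using deriv_within_chain[OF d(2)[OF s0] deriv_shift(1) im] t[OF s0] by (simp add: algebra_simps)
   next
    have "((\<lambda>s. X (s + - t) - u s) \<longlongrightarrow> 0 - 0) at_bot"
     by (intro tendsto_diff u_bot filterlim_compose[OF l(1) filterlim_shift(1)])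
    then show "((\<lambda>s. X (s + - t) - u s) \<longlongrightarrow> 0) at_bot" by simp
    show "((\<lambda>s. Y (s + - t)) \<longlongrightarrow> 0) at_bot" by (rule filterlim_compose[OF l(2) filterlim_shift(1)])
   qed
   moreover have "(x, y, z) = (X (t + - t), 1 * Y (t + - t), m t)" using h t[of 0] by simp
   ultimately show ?thesis by blast
  qed
  show "(u' t, 1 * v' t, m t) \<in> unstable_manifold (ramp_field \<epsilon> c) (0, 0, -1)" if h: "B.half u' v' t" for u' v' t
   unfolding mem_unstable_manifold_ramp
  proof (rule exI[of _ "\<lambda>s. u' (s + t)"], rule exI[of _ "\<lambda>s. v' (s + t)"], rule exI[of _ "\<lambda>s. m (s + t)"], intro conjI allI impI)
   fix s :: real assume s: "s \<le> 0"
   then have st: "s + t \<le> t" by simp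
   have im: "(\<lambda>s. s + t) ` {..0} \<subseteq> {..t}" by auto
   have d: "(u' has_real_derivative v' (s + t)) (at (s + t) within {..t})"
    "(v' has_real_derivative c * v' (s + t) + u' (s + t) ^ 3 - m (s + t) * u' (s + t)) (at (s + t) within {..t})"
    using h st unfolding B.half_def by simp_all
   show "((\<lambda>s. u' (s + t)) has_real_derivative v' (s + t)) (at s within {..0})"
    using deriv_within_chain[OF d(1) deriv_shift(1) im] by simp
   show "((\<lambda>s. v' (s + t)) has_real_derivative c * v' (s + t) - m (s + t) * u' (s + t) + u' (s + t) ^ 3) (at s within {..0})"
    using deriv_within_chain[OF d(2) deriv_shift(1) im] by (simp add: algebra_simps)
   show "((\<lambda>s. m (s + t)) has_real_derivative \<epsilon> * (1 - (m (s + t))\<^sup>2)) (at s within {..0})"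
    using deriv_within_chain[OF m_deriv[of "s + t"] deriv_shift(1)] by simp
  next
   have l: "((\<lambda>s. u' s - u s) \<longlongrightarrow> 0) at_bot" "(v' \<longlongrightarrow> 0) at_bot" using h by (simp_all add: B.half_def)
   have "((\<lambda>s. (u' s - u s) + u s) \<longlongrightarrow> 0 + 0) at_bot" by (intro tendsto_add l u_bot)
   then have l1: "(u' \<longlongrightarrow> 0) at_bot" by simp
   show "((\<lambda>s. u' (s + t)) \<longlongrightarrow> 0) at_bot" by (rule filterlim_compose[OF l1 filterlim_shift(1)])
   show "((\<lambda>s. v' (s + t)) \<longlongrightarrow> 0) at_bot" by (rule filterlim_compose[OF l(2) filterlim_shift(1)])
   show "((\<lambda>s. m (s + t)) \<longlongrightarrow> -1) at_bot" by (rule filterlim_compose[OF m_lim(2) filterlim_shift(1)])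
  qed simp_all
 qed
qed

end

context front_sol
begin

text \<open>In reversed time, with u > 19/20 on the half line, values within 1/5 of u are at least
  3/4; then a^2 + a b + b^2 is at least 27/16 and \<open>1/2\<close> is an admissible lower bound
  after subtracting \<mu>. Away from u = 1 this hyperbolicity fails, so the confinement to the tube
  comes from \<open>energy_stay\<close>.\<close>

lemma stable_plane:
 "\<exists>z w. 0 < z \<and> z * - v t0 < w * u t0 \<and>
  surface_with_tangent_plane (stable_manifold (ramp_field \<epsilon> c) (1, 0, 1)) (u t0, 1 * v t0, m t0)
   {(\<alpha> * z + \<beta> * - v t0, - 1 * (\<alpha> * w + \<beta> * (c * v t0 + u t0 ^ 3 - m t0 * u t0)), \<beta> * (- \<epsilon> * (1 - (m t0)\<^sup>2))) |\<alpha> \<beta>. True}"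
proof -
 have "((\<lambda>t. (v t)\<^sup>2 / 2 + m t * (u t)\<^sup>2 / 2 - u t ^ 4 / 4) \<longlongrightarrow> 0\<^sup>2 / 2 + 1 * 1\<^sup>2 / 2 - 1 ^ 4 / 4) at_top"
  by (intro tendsto_intros u_top v_top m_lim) simp_all
 then have El: "((\<lambda>t. (v t)\<^sup>2 / 2 + m t * (u t)\<^sup>2 / 2 - u t ^ 4 / 4) \<longlongrightarrow> 1/4) at_top" by simp
 have "\<forall>\<^sub>F t in at_top. 19/20 < u t \<and> 1/4 - c / 4000 < (v t)\<^sup>2 / 2 + m t * (u t)\<^sup>2 / 2 - u t ^ 4 / 4"
  using order_tendstoD(1)[OF u_top, of "19/20"] order_tendstoD(1)[OF El, of "1/4 - c / 4000"] c_pos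
  by (intro eventually_conj) simp_all
 then obtain N where N: "\<And>t. N \<le> t \<Longrightarrow> 19/20 < u t"
  "\<And>t. N \<le> t \<Longrightarrow> 1/4 - c / 4000 < (v t)\<^sup>2 / 2 + m t * (u t)\<^sup>2 / 2 - u t ^ 4 / 4"
  unfolding eventually_at_top_linorder by blast
 define t1 where "t1 = max N (max 1 (t0 + 1))"
 have t1: "N \<le> t1" "1 \<le> t1" "t0 + 1 \<le> t1" by (simp_all add: t1_def)
 define T where "T = - t1"
 have T: "T \<le> 0" "T \<le> - t0 - 1" "- T = t1" using t1 by (simp_all add: T_def)
 have U1: "19/20 < u (- s)" if "s \<le> T" for s using N(1)[of "- s"] that t1 T by simp
 have mm: "tanh (- \<epsilon> * s) = m (- s)" for s by simp
 interpret R: ramp_eq "- c" "\<lambda>t. tanh (- \<epsilon> * t)"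
 proof
  show "continuous_on UNIV (\<lambda>t. tanh (- \<epsilon> * t))" by (intro continuous_intros) (simp_all add: cosh_real_nonzero)
  show "\<bar>tanh (- \<epsilon> * t)\<bar> \<le> 1" for t unfolding mm using m_bounds[of "- t"] by linarith
 qed (use c_pos c_less in simp)
 have mi: "DERIV (\<lambda>t. - t) t :> - 1" for t :: real by (auto intro!: derivative_eq_intros)
 have RUV: "R.tsol (\<lambda>s. u (- s)) (\<lambda>s. - v (- s))"
  unfolding R.tsol_def
 proof (intro allI conjI)
  fix t
  show "DERIV (\<lambda>s. u (- s)) t :> - v (- t)"
   by (rule DERIV_cong[OF DERIV_chain2[OF du mi]]) simp
  have cu: "cub (u (- t)) = u (- t) ^ 3" by (rule cub_eq[OF u_le2])
  show "DERIV (\<lambda>s. - v (- s)) t :> - c * - v (- t) + cub (u (- t)) - tanh (- \<epsilon> * t) * u (- t)"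
   unfolding cu by (rule DERIV_cong[OF DERIV_minus[OF DERIV_chain2[OF dv mi]]]) simp
 qed
 have bt: "filterlim (\<lambda>s::real. - s) at_top at_bot" using filterlim_uminus_at_top_at_bot .
 have Vl: "((\<lambda>s. - v (- s)) \<longlongrightarrow> 0) at_bot"
  using tendsto_minus[OF filterlim_compose[OF v_top bt]] by simp
 have Ul: "((\<lambda>s. u (- s)) \<longlongrightarrow> 1) at_bot" by (rule filterlim_compose[OF u_top bt])
 have Ml: "((\<lambda>s. tanh (- \<epsilon> * s)) \<longlongrightarrow> 1) at_bot" unfolding mm by (rule filterlim_compose[OF m_lim(1) bt])
 interpret B: tanh_branch "- c" "- \<epsilon>" "\<lambda>s. u (- s)" "\<lambda>s. - v (- s)" T "1/5" "1/2" "- 1"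
 proof unfold_locales
  show "R.tsol (\<lambda>s. u (- s)) (\<lambda>s. - v (- s))" by (rule RUV)
  show "((\<lambda>s. - v (- s)) \<longlongrightarrow> 0) at_bot" by (rule Vl)
  show "\<exists>B. \<forall>t\<le>T. exp (- (- c) * t) * u (- t) \<le> B"
  proof (intro exI[of _ 1] allI impI)
   fix t assume "t \<le> T"
   then have "c * t \<le> 0" using T c_pos by (simp add: mult_nonneg_nonpos)
   then have "exp (c * t) * u (- t) \<le> 1 * 1" using u_less[of "- t"] u_pos[of "- t"] by (intro mult_mono) simp_all
   then show "exp (- (- c) * t) * u (- t) \<le> 1" by simp
  qed
  show "1/2 \<le> a\<^sup>2 + a * b + b\<^sup>2 - tanh (- \<epsilon> * t)" if "t \<le> T" "\<bar>a - u (- t)\<bar> \<le> 1/5" "\<bar>b - u (- t)\<bar> \<le> 1/5" for t a b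
  proof -
   have ab: "3/4 \<le> a" "3/4 \<le> b" using U1[OF that(1)] that(2,3) by linarith+
   have "3/4 * (3/4) \<le> a * a" "3/4 * (3/4) \<le> a * b" "3/4 * (3/4) \<le> b * b" using ab by (intro mult_mono; simp)+
   then show ?thesis unfolding mm power2_eq_square using m_bounds(2)[of "- t"] by linarith
  qed
  show "(\<forall>t\<le>T. 1/5 < u (- t)) \<or> (\<forall>t\<le>T. u (- t) \<le> 1/5) \<and> ((\<lambda>s. u (- s)) \<longlongrightarrow> 0) at_bot"
   using U1 by (intro disjI1 allI impI) (meson less_trans divide_strict_right_mono less_numeral_extra | fastforce)
 qed (use u_pos u_less c_pos eps in simp_all)
 have "\<exists>z w. 0 < z \<and> z * - v (- (- t0)) < w * u (- (- t0)) \<and>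
  surface_with_tangent_plane (stable_manifold (ramp_field \<epsilon> c) (1, 0, 1)) (u (- (- t0)), - 1 * - v (- (- t0)), tanh (- \<epsilon> * - t0))
   {(\<alpha> * z + \<beta> * - v (- (- t0)), - 1 * (\<alpha> * w + \<beta> * (- c * - v (- (- t0)) + u (- (- t0)) ^ 3 - tanh (- \<epsilon> * - t0) * u (- (- t0)))),
    \<beta> * (- \<epsilon> * (1 - (tanh (- \<epsilon> * - t0))\<^sup>2))) |\<alpha> \<beta>. True}"
 proof (rule B.tangent_plane[OF T(2)])
  show "\<exists>r>0. \<forall>x y t. B.half x y t \<longrightarrow> T < t \<longrightarrow> \<bar>x T - u (- T)\<bar> < r \<longrightarrow> \<bar>y T - - v (- T)\<bar> < r \<longrightarrow> (\<forall>s\<le>T. \<bar>x s - u (- s)\<bar> \<le> 1/5)"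
  proof -
   define F where "F p = (snd p)\<^sup>2 / 2 + tanh (- \<epsilon> * T) * (fst p)\<^sup>2 / 2 - fst p ^ 4 / 4" for p :: "real \<times> real"
   have "open {p. 1/4 - c / 4000 < F p}" unfolding F_def by (intro open_Collect_less continuous_intros) simp_all
   moreover have "(u t1, - v t1) \<in> {p. 1/4 - c / 4000 < F p}"
    unfolding F_def mm T(3) mem_Collect_eq using N(2)[OF t1(1)] by simp
   ultimately obtain e where e: "e > 0" "ball (u t1, - v t1) e \<subseteq> {p. 1/4 - c / 4000 < F p}"
    unfolding open_contains_ball by blast
   \<comment> \<open>Half of \<open>e\<close> for each coordinate keeps the energy above the
     threshold. The other bound puts x (T) within 1/20 of 1, because u lies between 19/20 and
     1.\<close>
   define r where "r = min (e / 2) (u t1 - 19/20)"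
   have r: "r \<le> e / 2" "r \<le> u t1 - 19/20" unfolding r_def by (rule min.cobounded1, rule min.cobounded2)
   have r0: "0 < r" using e(1) N(1)[OF t1(1)] by (simp add: r_def)
   show ?thesis
   proof (intro exI[of _ r] conjI r0 allI impI)
    fix x y t s assume h: "B.half x y t" and Tt: "T < t" and xT: "\<bar>x T - u (- T)\<bar> < r" and yT: "\<bar>y T - - v (- T)\<bar> < r" and s: "s \<le> T"
    have "dist (u t1, - v t1) (x T, y T) \<le> \<bar>u t1 - x T\<bar> + \<bar>- v t1 - y T\<bar>"
     unfolding dist_Pair_Pair dist_real_def by (rule order_trans[OF sqrt_sum_squares_le_sum_abs]) simp
    then have "dist (u t1, - v t1) (x T, y T) < e" using xT yT r(1) unfolding T(3) by linarith
    then have "1/4 - c / 4000 < F (x T, y T)" using e(2) by (auto simp: mem_ball)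
    then have ET: "1/4 - c / 4000 < (y T)\<^sup>2 / 2 + tanh (- \<epsilon> * T) * (x T)\<^sup>2 / 2 - x T ^ 4 / 4" by (simp only: F_def fst_conv snd_conv)
    have x1: "\<bar>x T - 1\<bar> < 1/20" using xT r(2) u_less[of t1] unfolding T(3) by linarith
    have l: "((\<lambda>s. x s - u (- s)) \<longlongrightarrow> 0) at_bot" "(y \<longlongrightarrow> 0) at_bot" using h by (simp_all add: B.half_def)
    have "((\<lambda>s. (x s - u (- s)) + u (- s)) \<longlongrightarrow> 0 + 1) at_bot" by (intro tendsto_add l Ul)
    then have lx: "(x \<longlongrightarrow> 1) at_bot" by simp
    have "\<bar>x s - 1\<bar> \<le> 1/10"
    proof (rule energy_stay[where M="\<lambda>s. tanh (- \<epsilon> * s)" and \<mu>="\<lambda>s. - \<epsilon> * (1 - (tanh (- \<epsilon> * s))\<^sup>2)" and x=x and y=y and T=T and c=c])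
     fix r assume "r \<le> T"
     then have rt: "r < t" using Tt by simp
     show "DERIV x r :> y r" by (rule B.half_interior(1)[OF h rt])
     show "DERIV y r :> - c * y r + x r ^ 3 - tanh (- \<epsilon> * r) * x r" by (rule B.half_interior(2)[OF h rt])
    next
     show "- \<epsilon> * (1 - (tanh (- \<epsilon> * r))\<^sup>2) \<le> 0" for r
     proof -
      have "\<bar>m (- r)\<bar> < 1" using m_bounds[of "- r"] by linarith
      then have "(m (- r))\<^sup>2 < 1" by (simp add: abs_square_less_1)
      then show ?thesis unfolding mm using eps by (simp add: mult_nonneg_nonneg)
     qed
     show "tanh (- \<epsilon> * r) \<le> 1" for r unfolding mm using m_bounds(2)[of "- r"] by linarith
    qed (rule c_pos c_less tanh_deriv lx l(2) Ml ET x1 s)+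
    then show "\<bar>x s - u (- s)\<bar> \<le> 1/5" using U1[OF s] u_less[of "- s"] by linarith
   qed
  qed
  show "\<exists>x' y' t. B.half x' y' t \<and> (x, y, z) = (x' t, - 1 * y' t, tanh (- \<epsilon> * t))"
   if S: "(x, y, z) \<in> stable_manifold (ramp_field \<epsilon> c) (1, 0, 1)" and z1: "\<bar>z\<bar> < 1" for x y z
  proof -
   obtain X Y Z where h: "X 0 = x" "Y 0 = y" "Z 0 = z"
    and d: "\<And>s. 0 \<le> s \<Longrightarrow> (X has_real_derivative Y s) (at s within {0..})"
     "\<And>s. 0 \<le> s \<Longrightarrow> (Y has_real_derivative c * Y s - Z s * X s + X s ^ 3) (at s within {0..})"
     "\<And>s. 0 \<le> s \<Longrightarrow> (Z has_real_derivative \<epsilon> * (1 - (Z s)\<^sup>2)) (at s within {0..})"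
    and l: "(X \<longlongrightarrow> 1) at_top" "(Y \<longlongrightarrow> 0) at_top"
    using S unfolding mem_stable_manifold_ramp by blast
   have e0: "- \<epsilon> \<noteq> 0" using eps by simp
   have dZ: "((\<lambda>s. Z (0 - s)) has_real_derivative - \<epsilon> * (1 - (Z (0 - s))\<^sup>2)) (at s within {..0})" if s: "s \<le> 0" for s
   proof -
    have s0: "0 \<le> 0 - s" using s by simp
    have im: "(\<lambda>s. 0 - s) ` {..0::real} \<subseteq> {0..}" by auto
    show ?thesis by (rule DERIV_cong[OF deriv_within_chain[OF d(3)[OF s0] deriv_shift(2) im]]) simp
   qed
   have "\<bar>Z (0 - 0)\<bar> < 1" using z1 h by simp
   from half_ramp_eq_tanh[OF e0 dZ this] obtain t where t: "\<And>s. s \<le> 0 \<Longrightarrow> Z (0 - s) = tanh (- \<epsilon> * (s + t))" by blast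
   have "B.half (\<lambda>s. X (t - s)) (\<lambda>s. - Y (t - s)) t"
    unfolding B.half_def
   proof (intro conjI allI impI)
    fix s assume s: "s \<le> t"
    then have s0: "0 \<le> t - s" by simp
    have im: "(\<lambda>s. t - s) ` {..t} \<subseteq> {0..}" by auto
    show "((\<lambda>s. X (t - s)) has_real_derivative - Y (t - s)) (at s within {..t})"
     by (rule DERIV_cong[OF deriv_within_chain[OF d(1)[OF s0] deriv_shift(2) im]]) simp
    have "Z (t - s) = tanh (- \<epsilon> * s)" using t[of "s - t"] s by simp
    then show "((\<lambda>s. - Y (t - s)) has_real_derivative - c * - Y (t - s) + X (t - s) ^ 3 - tanh (- \<epsilon> * s) * X (t - s)) (at s within {..t})"
     by (intro DERIV_cong[OF DERIV_minus[OF deriv_within_chain[OF d(2)[OF s0] deriv_shift(2) im]]]) simp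
   next
    have "((\<lambda>s. X (t - s) - u (- s)) \<longlongrightarrow> 1 - 1) at_bot"
     by (intro tendsto_diff Ul filterlim_compose[OF l(1) filterlim_shift(2)])
    then show "((\<lambda>s. X (t - s) - u (- s)) \<longlongrightarrow> 0) at_bot" by simp
    show "((\<lambda>s. - Y (t - s)) \<longlongrightarrow> 0) at_bot" using tendsto_minus[OF filterlim_compose[OF l(2) filterlim_shift(2)]] by simp
   qed
   moreover have "(x, y, z) = (X (t - t), - 1 * - Y (t - t), tanh (- \<epsilon> * t))" using h t[of 0] by simp
   ultimately show ?thesis by blast
  qed
  show "(x t, - 1 * y t, tanh (- \<epsilon> * t)) \<in> stable_manifold (ramp_field \<epsilon> c) (1, 0, 1)" if h: "B.half x y t" for x y t
   unfolding mem_stable_manifold_ramp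
  proof (rule exI[of _ "\<lambda>s. x (t - s)"], rule exI[of _ "\<lambda>s. - y (t - s)"], rule exI[of _ "\<lambda>s. tanh (- \<epsilon> * (t - s))"], intro conjI allI impI)
   fix s :: real assume s: "0 \<le> s"
   then have st: "t - s \<le> t" by simp
   have im: "(\<lambda>s. t - s) ` {0..} \<subseteq> {..t}" by auto
   have d: "(x has_real_derivative y (t - s)) (at (t - s) within {..t})"
    "(y has_real_derivative - c * y (t - s) + x (t - s) ^ 3 - tanh (- \<epsilon> * (t - s)) * x (t - s)) (at (t - s) within {..t})"
    using h st unfolding B.half_def by blast+
   show "((\<lambda>s. x (t - s)) has_real_derivative - y (t - s)) (at s within {0..})"
    by (rule DERIV_cong[OF deriv_within_chain[OF d(1) deriv_shift(2) im]]) simp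
   show "((\<lambda>s. - y (t - s)) has_real_derivative c * - y (t - s) - tanh (- \<epsilon> * (t - s)) * x (t - s) + x (t - s) ^ 3) (at s within {0..})"
    by (rule DERIV_cong[OF DERIV_minus[OF deriv_within_chain[OF d(2) deriv_shift(2) im]]]) simp
   show "((\<lambda>s. tanh (- \<epsilon> * (t - s))) has_real_derivative \<epsilon> * (1 - (tanh (- \<epsilon> * (t - s)))\<^sup>2)) (at s within {0..})"
    by (rule DERIV_cong[OF deriv_within_chain[OF tanh_deriv[of "- \<epsilon>" "t - s"] deriv_shift(2)]]) simp_all
  next
   have l: "((\<lambda>s. x s - u (- s)) \<longlongrightarrow> 0) at_bot" "(y \<longlongrightarrow> 0) at_bot" using h by (simp_all add: B.half_def)
   have "((\<lambda>s. (x s - u (- s)) + u (- s)) \<longlongrightarrow> 0 + 1) at_bot" by (intro tendsto_add l Ul)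
   then have l1: "(x \<longlongrightarrow> 1) at_bot" by simp
   show "((\<lambda>s. x (t - s)) \<longlongrightarrow> 1) at_top" by (rule filterlim_compose[OF l1 filterlim_shift(3)])
   show "((\<lambda>s. - y (t - s)) \<longlongrightarrow> 0) at_top" using tendsto_minus[OF filterlim_compose[OF l(2) filterlim_shift(3)]] by simp
   show "((\<lambda>s. tanh (- \<epsilon> * (t - s))) \<longlongrightarrow> 1) at_top" by (rule filterlim_compose[OF Ml filterlim_shift(3)])
  qed simp_all
 qed
 then show ?thesis unfolding minus_minus minus_mult_minus .
qed

lemma transverse_orbit:
 "transverse_at (unstable_manifold (ramp_field \<epsilon> c) (0, 0, -1)) (stable_manifold (ramp_field \<epsilon> c) (1, 0, 1)) (u t, v t, m t)"
proof -
 obtain z w where 1: "0 < z" "z * v t < w * u t" "surface_with_tangent_plane (unstable_manifold (ramp_field \<epsilon> c) (0, 0, -1)) (u t, 1 * v t, m t)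
   {(\<alpha> * z + \<beta> * v t, 1 * (\<alpha> * w + \<beta> * (c * v t + u t ^ 3 - m t * u t)), \<beta> * (\<epsilon> * (1 - (m t)\<^sup>2))) |\<alpha> \<beta>. True}"
  using unstable_plane[of t] by (elim exE conjE) (rule that)
 obtain z' w' where 2: "0 < z'" "z' * - v t < w' * u t" "surface_with_tangent_plane (stable_manifold (ramp_field \<epsilon> c) (1, 0, 1)) (u t, 1 * v t, m t)
   {(\<alpha> * z' + \<beta> * - v t, - 1 * (\<alpha> * w' + \<beta> * (c * v t + u t ^ 3 - m t * u t)), \<beta> * (- \<epsilon> * (1 - (m t)\<^sup>2))) |\<alpha> \<beta>. True}"
  using stable_plane[of t] by (elim exE conjE) (rule that)
 have "\<bar>m t\<bar> < 1" using m_bounds[of t] by linarith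
 then have "(m t)\<^sup>2 < 1" by (simp add: abs_square_less_1)
 then have B: "\<epsilon> * (1 - (m t)\<^sup>2) \<noteq> 0" using eps by simp
 have e: "(u t, v t, m t) = (u t, 1 * v t, m t)" by simp
 show ?thesis unfolding transverse_at_def e
  by (intro exI conjI, rule 1(3), rule 2(3), rule planes_span[OF 1(1,2) 2(1,2) u_pos B])
qed

lemma front_location_orbit: "front_location c (range (\<lambda>t. (u t, v t, m t))) = Inf (m ` {t. c / 4 < u t})"
proof -
 have "sqrt (c\<^sup>2 / 4) / 2 = c / 4" using c_pos by (simp add: real_sqrt_divide)
 then have e: "front_location c (range (\<lambda>t. (u t, v t, m t))) = Inf {\<mu>. \<exists>x y. (x, y, \<mu>) \<in> range (\<lambda>t. (u t, v t, m t)) \<and> x > c / 4}"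
  by (simp only: front_location_def)
 have "{\<mu>. \<exists>x y. (x, y, \<mu>) \<in> range (\<lambda>t. (u t, v t, m t)) \<and> x > c / 4} = m ` {t. c / 4 < u t}"
 proof (intro set_eqI iffI)
  fix \<mu> assume "\<mu> \<in> m ` {t. c / 4 < u t}"
  then obtain t where t: "\<mu> = m t" "c / 4 < u t" by blast
  have "(u t, v t, m t) \<in> range (\<lambda>t. (u t, v t, m t))" by (rule rangeI)
  then show "\<mu> \<in> {\<mu>. \<exists>x y. (x, y, \<mu>) \<in> range (\<lambda>t. (u t, v t, m t)) \<and> x > c / 4}" using t by blast
 qed auto
 then show ?thesis unfolding e by (rule arg_cong)
qed

end

section \<open>Uniformity in the speed, and conclusion\<close>

text \<open>From ln y \<le> y - 1 at y = 1 / \<theta>. It reduces terms with \<epsilon> ln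
  \<epsilon> to powers of \<theta>.\<close>

lemma root_log_bound: assumes "0 < (\<theta> :: real)" shows "\<theta> ^ 6 * (- ln (\<theta> ^ 6)) \<le> 6 * \<theta> ^ 5"
proof -
 have "ln (inverse \<theta>) \<le> inverse \<theta> - 1" using assms by (intro ln_le_minus_one) simp
 moreover have "ln (inverse \<theta>) = - ln \<theta>" using assms by (simp add: ln_inverse)
 moreover have "ln (\<theta> ^ 6) = 6 * ln \<theta>" using assms ln_realpow[of \<theta> 6] by simp
 ultimately have "- ln (\<theta> ^ 6) \<le> 6 * inverse \<theta>" by linarith
 then have "\<theta> ^ 6 * (- ln (\<theta> ^ 6)) \<le> \<theta> ^ 6 * (6 * inverse \<theta>)" using assms by (intro mult_left_mono) simp_all
 also have "\<theta> ^ 6 * (6 * inverse \<theta>) = 6 * \<theta> ^ 5" using assms by (simp add: eval_nat_numeral)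
 finally show ?thesis .
qed

context front_scaled
begin

text \<open>Every \<mu> at which u exceeds the threshold obeys \<open>front_lower\<close>, and
  \<open>front_upper\<close> exhibits one such \<mu>, so the infimum is enclosed.\<close>

lemma front_location_bounds:
 "\<bar>front_location c (range (\<lambda>t. (u t, v t, m t))) - (\<mu>c + \<rho>\<^sup>2 * \<Omega>\<^sub>0)\<bar>
  \<le> ((2 + 2 * \<Omega>\<^sub>0\<^sup>2 / \<kappa>0\<^sup>2 + 6 / a) + (6 / \<kappa>0 ^ 4 + 8 / a)) * (\<epsilon> * (- ln \<epsilon>))"
proof -
 define A where "A = m ` {t. c / 4 < u t}"
 define l where "l = \<epsilon> * (- ln \<epsilon>)"
 define C1 where "C1 = 2 + 2 * \<Omega>\<^sub>0\<^sup>2 / \<kappa>0\<^sup>2 + 6 / a"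
 define C2 where "C2 = 6 / \<kappa>0 ^ 4 + 8 / a"
 have l: "0 \<le> l" unfolding l_def by (intro mult_nonneg_nonneg) (use eps ln1 in linarith)+
 have C: "0 \<le> C1 * l" "0 \<le> C2 * l" using a \<kappa>0 l by (simp_all add: C1_def C2_def)
 obtain t where t: "c / 4 < u t" "m t \<le> \<mu>c + \<rho>\<^sup>2 * \<Omega>\<^sub>0 + C2 * l" using front_upper unfolding C2_def l_def by blast
 have low: "\<mu>c + \<rho>\<^sup>2 * \<Omega>\<^sub>0 - C1 * l \<le> x" if "x \<in> A" for x
  using that front_lower unfolding A_def C1_def l_def by auto
 have mA: "m t \<in> A" unfolding A_def using t(1) by (intro imageI CollectI)
 have "\<mu>c + \<rho>\<^sup>2 * \<Omega>\<^sub>0 - C1 * l \<le> Inf A" by (rule cInf_greatest) (use mA low in auto)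
 moreover have "Inf A \<le> m t" by (rule cInf_lower[OF mA]) (use low in \<open>auto intro!: bdd_belowI\<close>)
 ultimately have "\<bar>Inf A - (\<mu>c + \<rho>\<^sup>2 * \<Omega>\<^sub>0)\<bar> \<le> C1 * l + C2 * l" using t(2) C by linarith
 then show ?thesis unfolding front_location_orbit A_def[symmetric] C1_def[symmetric] C2_def[symmetric] l_def[symmetric] distrib_right .
qed

lemma \<rho>_sq: "\<rho>\<^sup>2 = (1 - c ^ 4 / 16) powr (2/3) * \<epsilon> powr (2/3)"
proof -
 have "\<kappa> = 1 - c ^ 4 / 16" by (simp add: \<kappa>_def \<mu>c_def power_divide flip: power_mult)
 moreover have "\<rho> = (\<epsilon> * \<kappa>) powr (1/3)" unfolding \<rho>_def using eps \<kappa>_bounds by (simp add: root_powr_inverse)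
 moreover have "((\<epsilon> * \<kappa>) powr (1/3))\<^sup>2 = (\<epsilon> * \<kappa>) powr (2/3)" unfolding power2_eq_square by (simp flip: powr_add)
 moreover have "(\<epsilon> * \<kappa>) powr (2/3) = \<epsilon> powr (2/3) * \<kappa> powr (2/3)" by (rule powr_mult)
 ultimately show ?thesis by (simp only: mult.commute)
qed

end

lemma eventually_root_le:
 assumes "0 < B" "0 < n" shows "\<forall>\<^sub>F \<epsilon> in at_right 0. A * root 6 \<epsilon> ^ n \<le> B"
proof -
 have "((\<lambda>\<epsilon>. A * root 6 \<epsilon> ^ n) \<longlongrightarrow> A * root 6 0 ^ n) (at_right 0)" by (intro tendsto_intros)
 then have "((\<lambda>\<epsilon>. A * root 6 \<epsilon> ^ n) \<longlongrightarrow> 0) (at_right 0)" using zero_power[OF assms(2), where 'a=real] by simp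
 from order_tendstoD(2)[OF this assms(1)] show ?thesis by (rule eventually_mono) simp
qed

lemma front_sol_exists:
 assumes "0 < c" "c < 2" "0 < \<epsilon>" shows "\<exists>u v. front_sol c \<epsilon> u v"
proof -
 interpret front_eq c \<epsilon> by unfold_locales (use assms in simp_all)
 obtain u v where *: "tsol u v" "(u \<longlongrightarrow> 0) at_bot" "(v \<longlongrightarrow> 0) at_bot" "(u \<longlongrightarrow> 1) at_top" "(v \<longlongrightarrow> 0) at_top"
  "\<forall>t. 0 < u t \<and> u t < 1 \<and> 0 < v t \<and> v t \<le> 200 * u t" "\<forall>t\<le>0. c * u t \<le> v t"
  using heteroclinic_solution_exists by (elim exE conjE) (rule that)
 have "front_sol c \<epsilon> u v" by unfold_locales (use * in simp_all)
 then show ?thesis by blast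
qed

text \<open>The constants depend on \<open>a\<close> and \<open>b\<close> alone:
  \<open>\<kappa>0\<close> is the value of \<open>\<kappa>\<close> at the largest speed, where it is
  smallest. Each smallness condition bounds a positive power of \<theta> by a positive
  constant.\<close>

lemma eventually_front_scaled:
 assumes "0 < a" "b < 2"
 shows "\<exists>\<kappa>0 M. 0 < \<kappa>0 \<and> (\<forall>\<^sub>F \<epsilon> in at_right 0. \<forall>c\<in>{a..b}. \<forall>u v. front_sol c \<epsilon> u v \<longrightarrow> front_scaled c \<epsilon> u v a \<kappa>0 (root 6 \<epsilon>) M)"
proof (cases "a \<le> b")
 case False
 then have "{a..b} = {}" by simp
 then show ?thesis by (intro exI[of _ 1]) simp
next
 case True
 obtain M where M: "0 < M" "\<And>x. x \<le> \<Omega>\<^sub>0 + 1 \<Longrightarrow> \<bar>airy x\<bar> \<le> M" by (rule airy_bounded_all) (rule that)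
 define \<kappa>0 where "\<kappa>0 = 1 - (b\<^sup>2 / 4)\<^sup>2"
 have "b\<^sup>2 < 2\<^sup>2" using assms True by (intro power_strict_mono) simp_all
 then have "(b\<^sup>2 / 4)\<^sup>2 < 1\<^sup>2" by (intro power_strict_mono) simp_all
 then have \<kappa>0: "0 < \<kappa>0" by (simp add: \<kappa>0_def)
 have \<Omega>: "0 < \<Omega>\<^sub>0" by (rule Omega_props)
 have ai: "0 < airy (-3)" by (rule airy_pos_left) simp
 have pos: "0 < \<kappa>0 * a\<^sup>2" "0 < a ^ 3" "0 < a / 4" "0 < \<kappa>0 ^ 4" "0 < 3 * airy (-3)" using \<kappa>0 assms ai by simp_all
 have "\<forall>\<^sub>F \<epsilon> in at_right 0. \<forall>c\<in>{a..b}. \<forall>u v. front_sol c \<epsilon> u v \<longrightarrow> front_scaled c \<epsilon> u v a \<kappa>0 (root 6 \<epsilon>) M"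
  using eventually_at_right_less[of "0::real"]
   eventually_root_le[where n=1 and A="1", OF zero_less_one zero_less_one]
   eventually_root_le[where n=6 and A="1" and B="exp (-1)", OF exp_gt_zero zero_less_numeral]
   eventually_root_le[where n=2 and A="2", OF \<Omega> zero_less_numeral]
   eventually_root_le[where n=6 and A="8", OF pos(1) zero_less_numeral]
   eventually_root_le[where n=2 and A="16 * \<Omega>\<^sub>0\<^sup>2", OF pos(2) zero_less_numeral]
   eventually_root_le[where n=2 and A="M * \<Omega>\<^sub>0\<^sup>2 / airy 0 + 1", OF pos(3) zero_less_numeral]
   eventually_root_le[where n=5 and A="48", OF pos(2) zero_less_numeral]
   eventually_root_le[where n=2 and A="6", OF pos(4) zero_less_numeral]
   eventually_root_le[where n=1 and A="\<Omega>\<^sub>0 + 1", OF zero_less_one zero_less_one]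
   eventually_root_le[where n=1 and A="airy 0 * 40 * \<kappa>0 ^ 4", OF pos(5) zero_less_one]
 proof eventually_elim
  case (elim \<epsilon>)
  define \<theta> where "\<theta> = root 6 \<epsilon>"
  have \<epsilon>: "0 < \<epsilon>" by fact
  have \<theta>: "0 < \<theta>" "\<theta> ^ 6 = \<epsilon>" using \<epsilon> by (simp_all add: \<theta>_def)
  note e = elim[folded \<theta>_def]
  have "\<epsilon> \<le> exp (- 1)" using e(3) \<theta> by simp
  then have "ln \<epsilon> \<le> ln (exp (- 1))" using \<epsilon> by (simp only: ln_le_cancel_iff exp_gt_zero)
  then have ln1: "1 \<le> - ln \<epsilon>" by simp
  have "\<epsilon> * (- ln \<epsilon>) \<le> 6 * \<theta> ^ 5" using root_log_bound[OF \<theta>(1)] unfolding \<theta>(2) .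
  then have small5: "8 * \<epsilon> * (- ln \<epsilon>) \<le> a ^ 3" using e(8) by simp
  show ?case unfolding \<theta>_def[symmetric]
  proof (intro ballI allI impI)
   fix c u v assume c: "c \<in> {a..b}" and sol: "front_sol c \<epsilon> u v"
   interpret F: front_sol c \<epsilon> u v by (rule sol)
   have "c\<^sup>2 / 4 \<le> b\<^sup>2 / 4" using c assms by (intro divide_right_mono power_mono) simp_all
   then have "(c\<^sup>2 / 4)\<^sup>2 \<le> (b\<^sup>2 / 4)\<^sup>2" by (intro power_mono) simp_all
   then have k: "\<kappa>0 \<le> F.\<kappa>" by (simp add: \<kappa>0_def F.\<kappa>_def F.\<mu>c_def)
   show "front_scaled c \<epsilon> u v a \<kappa>0 \<theta> M"
    by unfold_locales (use c assms \<kappa>0 k \<theta> ln1 M e small5 in simp_all)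
  qed
 qed
 then show ?thesis using \<kappa>0 by blast
qed

text \<open>An orbit omits \<mu> = -1 and \<mu> = 1, and its closure adds the equilibria there. Each
  condition, as an alternative to a closed condition on \<mu>, describes a closed set and so passes
  to the closure.\<close>

lemma closure_subset_close:
 fixes \<Gamma> :: "(real \<times> real \<times> real) set"
 assumes "\<And>x y z. (x, y, z) \<in> \<Gamma> \<Longrightarrow> z < l \<Longrightarrow> \<bar>x\<bar> + \<bar>y\<bar> \<le> r"
  and "\<And>x y z. (x, y, z) \<in> \<Gamma> \<Longrightarrow> h < z \<Longrightarrow> \<bar>x - sqrt z\<bar> + \<bar>y\<bar> \<le> r"
  and p: "(x, y, z) \<in> closure \<Gamma>"
 shows "z < l \<Longrightarrow> dist (x, y) (0, 0) \<le> r" "h < z \<Longrightarrow> dist (x, y) (sqrt z, 0) \<le> r"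
proof -
 have d: "dist (x, y) (s, 0) \<le> \<bar>x - s\<bar> + \<bar>y\<bar>" for x y s :: real
  unfolding dist_Pair_Pair dist_real_def by (rule order_trans[OF sqrt_sum_squares_le_sum_abs]) simp
 define S1 where "S1 = {p. l \<le> snd (snd p)} \<union> {p :: real \<times> real \<times> real. dist (fst p, fst (snd p)) (0, 0) \<le> r}"
 define S2 where "S2 = {p. snd (snd p) \<le> h} \<union> {p :: real \<times> real \<times> real. dist (fst p, fst (snd p)) (sqrt (snd (snd p)), 0) \<le> r}"
 have cl: "closed S1" "closed S2" unfolding S1_def S2_def
  by (intro closed_Un closed_Collect_le continuous_intros)+
 have "\<Gamma> \<subseteq> S1"
 proof
  fix p assume "p \<in> \<Gamma>"
  then show "p \<in> S1" using assms(1)[of "fst p" "fst (snd p)" "snd (snd p)"] d[of "fst p" "fst (snd p)" 0]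
   by (cases "snd (snd p) < l") (auto simp: S1_def)
 qed
 then have 1: "closure \<Gamma> \<subseteq> S1" using cl by (intro closure_minimal)
 have "\<Gamma> \<subseteq> S2"
 proof
  fix p assume "p \<in> \<Gamma>"
  then show "p \<in> S2" using assms(2)[of "fst p" "fst (snd p)" "snd (snd p)"] d[of "fst p" "fst (snd p)" "sqrt (snd (snd p))"]
   by (cases "h < snd (snd p)") (auto simp: S2_def)
 qed
 then have 2: "closure \<Gamma> \<subseteq> S2" using cl by (intro closure_minimal)
 show "z < l \<Longrightarrow> dist (x, y) (0, 0) \<le> r" using 1 p by (auto simp: S1_def)
 show "h < z \<Longrightarrow> dist (x, y) (sqrt z, 0) \<le> r" using 2 p by (auto simp: S2_def)
qed

text \<open>Closeness after the front presupposes a time at which u exceeds c / 4 while \<mu> is at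
  most c^2/4 + \<delta>/2; \<open>front_upper\<close> supplies it, uniformly in
  \<open>c\<close>.\<close>

lemma eventually_close:
 assumes ab: "0 < a" "b < 2" and \<delta>: "0 < \<delta>" and \<eta>: "0 < \<eta>"
 shows "\<forall>\<^sub>F \<epsilon> in at_right 0. \<forall>c\<in>{a..b}. \<forall>u v. front_sol c \<epsilon> u v \<longrightarrow> (\<forall>t.
  (tanh (\<epsilon> * t) < c\<^sup>2 / 4 - \<delta> \<longrightarrow> \<bar>u t\<bar> + \<bar>v t\<bar> \<le> \<eta>) \<and>
  (c\<^sup>2 / 4 + \<delta> < tanh (\<epsilon> * t) \<longrightarrow> \<bar>u t - sqrt (tanh (\<epsilon> * t))\<bar> + \<bar>v t\<bar> \<le> \<eta>))"
proof -
 obtain \<kappa>0 M where \<kappa>0: "0 < \<kappa>0" and ev: "\<forall>\<^sub>F \<epsilon> in at_right 0. \<forall>c\<in>{a..b}. \<forall>u v. front_sol c \<epsilon> u v \<longrightarrow> front_scaled c \<epsilon> u v a \<kappa>0 (root 6 \<epsilon>) M"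
  using eventually_front_scaled[OF ab] by blast
 \<comment> \<open>Chosen so that the two errors in \<open>close_right\<close>, 2 e and 4 e / a, add
   up to \<eta>.\<close>
 define e where "e = \<eta> / (2 + 4 / a)"
 have e: "0 < e" "2 * e + 4 * e / a = \<eta>"
 proof -
  have p: "0 < 2 + 4 / a" using ab by (simp add: add_pos_pos)
  then show "0 < e" using \<eta> by (simp add: e_def)
  have "e * (2 + 4 / a) = \<eta>" using p by (simp add: e_def)
  then show "2 * e + 4 * e / a = \<eta>" by (simp add: distrib_left mult.commute)
 qed
 define C2 where "C2 = 6 / \<kappa>0 ^ 4 + 8 / a"
 have C2: "0 \<le> C2" using \<kappa>0 ab by (simp add: C2_def)
 define s where "s = a * \<delta> / 2"
 have s: "0 < s" using ab \<delta> by (simp add: s_def)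
 have ae: "0 < a * e" using ab e by simp
 have d: "0 < \<delta> / 4" "0 < \<delta> / 2" using \<delta> by simp_all
 show ?thesis
  using ev eventually_at_right_less[of "0::real"]
   eventually_root_le[where n=6 and A="201 / s", OF \<eta> zero_less_numeral]
   eventually_root_le[where n=4 and A="\<Omega>\<^sub>0", OF d(1) zero_less_numeral]
   eventually_root_le[where n=5 and A="C2 * 6", OF d(1) zero_less_numeral]
   eventually_root_le[where n=6 and A="8 / (a * e)", OF d(2) zero_less_numeral]
   eventually_root_le[where n=6 and A="8 / (a * e)", OF ae zero_less_numeral]
 proof eventually_elim
  case (elim \<epsilon>)
  define \<theta> where "\<theta> = root 6 \<epsilon>"
  have \<epsilon>: "0 < \<epsilon>" by fact
  have \<theta>: "0 < \<theta>" "\<theta> ^ 6 = \<epsilon>" using \<epsilon> by (simp_all add: \<theta>_def)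
  note E = elim(3-7)[folded \<theta>_def, simplified \<theta>(2)]
  have sc: "front_scaled c \<epsilon> u v a \<kappa>0 \<theta> M" if "c \<in> {a..b}" "front_sol c \<epsilon> u v" for c u v
   using elim(1) that unfolding \<theta>_def by blast
  show ?case
  proof (intro ballI allI impI)
   fix c u v t assume c: "c \<in> {a..b}" and sol: "front_sol c \<epsilon> u v"
   interpret F: front_scaled c \<epsilon> u v a \<kappa>0 \<theta> M by (rule sc[OF c sol])
   have av: "\<bar>v t\<bar> = v t" "\<bar>u t\<bar> = u t" using F.v_pos[of t] F.u_pos[of t] by simp_all
   have left: "\<bar>u t\<bar> + \<bar>v t\<bar> \<le> \<eta>" if "tanh (\<epsilon> * t) < c\<^sup>2 / 4 - \<delta>"
   proof -
    have 1: "u t + v t \<le> 201 * exp (- (a * \<delta> / 2) / \<epsilon>)"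
     by (rule F.close_left[OF F.a \<delta>]) (use that in \<open>simp only: F.\<mu>c_def\<close>)
    have "s / \<epsilon> \<le> exp (s / \<epsilon>)" using exp_ge_add_one_self[of "s / \<epsilon>"] by linarith
    moreover have sp: "0 < s / \<epsilon>" using s \<epsilon> by simp
    ultimately have "inverse (exp (s / \<epsilon>)) \<le> inverse (s / \<epsilon>)" by (intro le_imp_inverse_le)
    then have "exp (- (a * \<delta> / 2) / \<epsilon>) \<le> \<epsilon> / s" by (simp add: s_def exp_minus mult.commute)
    then have "201 * exp (- (a * \<delta> / 2) / \<epsilon>) \<le> 201 / s * \<epsilon>" by simp
    then show ?thesis using 1 E(1) unfolding av by linarith
   qed
   have right: "\<bar>u t - sqrt (tanh (\<epsilon> * t))\<bar> + \<bar>v t\<bar> \<le> \<eta>" if t: "c\<^sup>2 / 4 + \<delta> < tanh (\<epsilon> * t)"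
   proof -
    obtain ts where ts: "c / 4 < u ts" "tanh (\<epsilon> * ts) \<le> F.\<mu>c + F.\<rho>\<^sup>2 * \<Omega>\<^sub>0 + C2 * (\<epsilon> * (- ln \<epsilon>))"
     using F.front_upper unfolding C2_def by blast
    have "F.\<rho>\<^sup>2 \<le> (\<theta>\<^sup>2)\<^sup>2" using F.\<rho>_bounds F.\<rho>_pos by (intro power_mono) simp_all
    then have "F.\<rho>\<^sup>2 * \<Omega>\<^sub>0 \<le> (\<theta>\<^sup>2)\<^sup>2 * \<Omega>\<^sub>0" using Omega_props(1) by (intro mult_right_mono) simp_all
    also have "(\<theta>\<^sup>2)\<^sup>2 * \<Omega>\<^sub>0 = \<Omega>\<^sub>0 * \<theta> ^ 4" by (simp flip: power_mult)
    finally have 1: "F.\<rho>\<^sup>2 * \<Omega>\<^sub>0 \<le> \<delta> / 4" using E(2) by linarith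
    have "\<epsilon> * (- ln \<epsilon>) \<le> 6 * \<theta> ^ 5" using root_log_bound[OF \<theta>(1)] unfolding \<theta>(2) .
    then have "C2 * (\<epsilon> * (- ln \<epsilon>)) \<le> C2 * (6 * \<theta> ^ 5)" using C2 by (rule mult_left_mono)
    then have 2: "C2 * (\<epsilon> * (- ln \<epsilon>)) \<le> \<delta> / 4" using E(3) by (simp only: mult.assoc)
    have tsm: "tanh (\<epsilon> * ts) \<le> F.\<mu>c + \<delta> / 2" using ts(2) 1 2 by linarith
    have sm: "\<epsilon> * (8 / (a * e)) \<le> \<delta> / 2" "\<epsilon> * (8 / (a * e)) \<le> a * e" using E(4,5) by (simp_all add: mult.commute)
    have "F.\<mu>c + \<delta> < tanh (\<epsilon> * t)" using t by (simp only: F.\<mu>c_def)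
    from F.close_right[OF F.a \<delta> e(1) ts(1) tsm sm this] show ?thesis unfolding av using e(2) by linarith
   qed
   show "(tanh (\<epsilon> * t) < c\<^sup>2 / 4 - \<delta> \<longrightarrow> \<bar>u t\<bar> + \<bar>v t\<bar> \<le> \<eta>) \<and>
    (c\<^sup>2 / 4 + \<delta> < tanh (\<epsilon> * t) \<longrightarrow> \<bar>u t - sqrt (tanh (\<epsilon> * t))\<bar> + \<bar>v t\<bar> \<le> \<eta>)"
    using left right by blast
  qed
 qed
qed

text \<open>An O(1) value of c is rendered as a compact interval [a, b] inside (0, 2), over which
  closeness and the error term are uniform. One family \<gamma>, fixed before \<delta> and \<eta>,
  carries all the properties.\<close>

theorem theorem1:
  fixes a b :: real
  assumes "0 < a" and "a \<le> b" and "b < 2"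
  shows "\<exists>\<epsilon>\<^sub>0>0. \<exists>\<gamma> :: real \<Rightarrow> real \<Rightarrow> real \<Rightarrow> real \<times> real \<times> real.
    (\<forall>\<epsilon>\<in>{0<..\<epsilon>\<^sub>0}. \<forall>c\<in>{a..b}.
       heteroclinic (ramp_field \<epsilon> c) (0, 0, -1) (1, 0, 1) (\<gamma> \<epsilon> c) \<and>
       range (\<gamma> \<epsilon> c) \<subseteq> unstable_manifold (ramp_field \<epsilon> c) (0, 0, -1)
                      \<inter> stable_manifold (ramp_field \<epsilon> c) (1, 0, 1) \<and>
       (\<forall>q\<in>range (\<gamma> \<epsilon> c).
          transverse_at (unstable_manifold (ramp_field \<epsilon> c) (0, 0, -1))
                        (stable_manifold (ramp_field \<epsilon> c) (1, 0, 1)) q) \<and>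
       strict_mono (\<lambda>\<zeta>. fst (\<gamma> \<epsilon> c \<zeta>))) \<and>
    (\<forall>d>0. \<exists>\<delta>>0. \<delta> < d \<and>
       (\<forall>\<eta>>0. \<forall>\<^sub>F \<epsilon> in at_right 0. \<forall>c\<in>{a..b}.
          \<forall>(u, v, \<mu>) \<in> closure (range (\<gamma> \<epsilon> c)).
            (\<mu> \<in> {-1..<c\<^sup>2 / 4 - \<delta>} \<longrightarrow> dist (u, v) (0, 0) < \<eta>) \<and>
            (\<mu> \<in> {c\<^sup>2 / 4 + \<delta><..1} \<longrightarrow> dist (u, v) (sqrt \<mu>, 0) < \<eta>))) \<and>
    (\<lambda>(\<epsilon>, c). front_location c (range (\<gamma> \<epsilon> c))
               - (c\<^sup>2 / 4 + \<Omega>\<^sub>0 * (1 - c ^ 4 / 16) powr (2/3) * \<epsilon> powr (2/3)))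
      \<in> O[at_right 0 \<times>\<^sub>F principal {a..b}](\<lambda>(\<epsilon>, c). \<epsilon> * ln \<epsilon>)"
proof -
 define p where "p \<epsilon> c = (SOME p. front_sol c \<epsilon> (fst p) (snd p))" for \<epsilon> c
 define u where "u \<epsilon> c = fst (p \<epsilon> c)" for \<epsilon> c
 define v where "v \<epsilon> c = snd (p \<epsilon> c)" for \<epsilon> c
 define \<gamma> where "\<gamma> \<epsilon> c = (\<lambda>t. (u \<epsilon> c t, v \<epsilon> c t, tanh (\<epsilon> * t)))" for \<epsilon> c
 have sol: "front_sol c \<epsilon> (u \<epsilon> c) (v \<epsilon> c)" if "0 < \<epsilon>" "c \<in> {a..b}" for \<epsilon> c
 proof -
  have "0 < c" "c < 2" using that(2) assms by simp_all
  from front_sol_exists[OF this that(1)] obtain x y where "front_sol c \<epsilon> x y" by blast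
  then have "front_sol c \<epsilon> (fst (x, y)) (snd (x, y))" by simp
  then show ?thesis unfolding u_def v_def p_def by (rule someI)
 qed
 obtain \<kappa>0 M where ev: "\<forall>\<^sub>F \<epsilon> in at_right 0. \<forall>c\<in>{a..b}. \<forall>u v. front_sol c \<epsilon> u v \<longrightarrow> front_scaled c \<epsilon> u v a \<kappa>0 (root 6 \<epsilon>) M"
  using eventually_front_scaled[OF assms(1,3)] by blast
 define C where "C = (2 + 2 * \<Omega>\<^sub>0\<^sup>2 / \<kappa>0\<^sup>2 + 6 / a) + (6 / \<kappa>0 ^ 4 + 8 / a)"
 show ?thesis
 \<comment> \<open>The value 1 serves as bound for \<epsilon> because the first group of properties
   holds for every positive \<epsilon>; the other two concern the limit.\<close>
 proof (rule exI[of _ 1], intro conjI, simp, rule exI[of _ \<gamma>], intro conjI)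
  show "\<forall>\<epsilon>\<in>{0<..1}. \<forall>c\<in>{a..b}.
    heteroclinic (ramp_field \<epsilon> c) (0, 0, -1) (1, 0, 1) (\<gamma> \<epsilon> c) \<and>
    range (\<gamma> \<epsilon> c) \<subseteq> unstable_manifold (ramp_field \<epsilon> c) (0, 0, -1) \<inter> stable_manifold (ramp_field \<epsilon> c) (1, 0, 1) \<and>
    (\<forall>q\<in>range (\<gamma> \<epsilon> c). transverse_at (unstable_manifold (ramp_field \<epsilon> c) (0, 0, -1)) (stable_manifold (ramp_field \<epsilon> c) (1, 0, 1)) q) \<and>
    strict_mono (\<lambda>\<zeta>. fst (\<gamma> \<epsilon> c \<zeta>))" (is "\<forall>\<epsilon>\<in>_. \<forall>c\<in>_. ?P \<epsilon> c")
  proof (intro ballI)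
   fix \<epsilon> c :: real assume "\<epsilon> \<in> {0<..1}" and c: "c \<in> {a..b}"
   then have \<epsilon>: "0 < \<epsilon>" by simp
   interpret F: front_sol c \<epsilon> "u \<epsilon> c" "v \<epsilon> c" by (rule sol[OF \<epsilon> c])
   show "?P \<epsilon> c"
   proof (intro conjI ballI)
    show "heteroclinic (ramp_field \<epsilon> c) (0, 0, -1) (1, 0, 1) (\<gamma> \<epsilon> c)" unfolding \<gamma>_def by (rule F.heteroclinic_orbit)
    show "range (\<gamma> \<epsilon> c) \<subseteq> unstable_manifold (ramp_field \<epsilon> c) (0, 0, -1) \<inter> stable_manifold (ramp_field \<epsilon> c) (1, 0, 1)"
     unfolding \<gamma>_def using F.orbit_in_unstable F.orbit_in_stable by blast
    show "transverse_at (unstable_manifold (ramp_field \<epsilon> c) (0, 0, -1)) (stable_manifold (ramp_field \<epsilon> c) (1, 0, 1)) q"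
     if q: "q \<in> range (\<gamma> \<epsilon> c)" for q
    proof -
     obtain t where "q = \<gamma> \<epsilon> c t" using q by blast
     then show ?thesis using F.transverse_orbit[of t] by (simp only: \<gamma>_def)
    qed
    show "strict_mono (\<lambda>\<zeta>. fst (\<gamma> \<epsilon> c \<zeta>))" unfolding \<gamma>_def fst_conv by (rule strict_monoI) (rule F.u_strict)
   qed
  qed
  show "\<forall>d>0. \<exists>\<delta>>0. \<delta> < d \<and>
    (\<forall>\<eta>>0. \<forall>\<^sub>F \<epsilon> in at_right 0. \<forall>c\<in>{a..b}.
     \<forall>(u, v, \<mu>) \<in> closure (range (\<gamma> \<epsilon> c)).
      (\<mu> \<in> {-1..<c\<^sup>2 / 4 - \<delta>} \<longrightarrow> dist (u, v) (0, 0) < \<eta>) \<and>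
      (\<mu> \<in> {c\<^sup>2 / 4 + \<delta><..1} \<longrightarrow> dist (u, v) (sqrt \<mu>, 0) < \<eta>))" (is "\<forall>d>0. ?P d")
  proof (intro allI impI)
   fix d :: real assume d: "0 < d"
   show "?P d"
   \<comment> \<open>Closeness is available for every positive \<delta>, so any value below d will
     do.\<close>
   proof (intro exI[of _ "d / 2"] conjI allI impI)
    show "0 < d / 2" "d / 2 < d" using d by simp_all
    fix \<eta> :: real assume \<eta>: "0 < \<eta>"
    have h: "0 < d / 2" "0 < \<eta> / 2" using d \<eta> by simp_all
    show "\<forall>\<^sub>F \<epsilon> in at_right 0. \<forall>c\<in>{a..b}. \<forall>(u, v, \<mu>) \<in> closure (range (\<gamma> \<epsilon> c)).
      (\<mu> \<in> {-1..<c\<^sup>2 / 4 - d / 2} \<longrightarrow> dist (u, v) (0, 0) < \<eta>) \<and>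
      (\<mu> \<in> {c\<^sup>2 / 4 + d / 2<..1} \<longrightarrow> dist (u, v) (sqrt \<mu>, 0) < \<eta>)"
     using eventually_close[OF assms(1,3) h] eventually_at_right_less[of "0::real"]
    proof eventually_elim
     case (elim \<epsilon>)
     have \<epsilon>: "0 < \<epsilon>" by fact
     show ?case
     proof (intro ballI, clarify)
      fix c x y z assume c: "c \<in> {a..b}" and p: "(x, y, z) \<in> closure (range (\<gamma> \<epsilon> c))"
      have cl: "(tanh (\<epsilon> * t) < c\<^sup>2 / 4 - d / 2 \<longrightarrow> \<bar>u \<epsilon> c t\<bar> + \<bar>v \<epsilon> c t\<bar> \<le> \<eta> / 2) \<and>
       (c\<^sup>2 / 4 + d / 2 < tanh (\<epsilon> * t) \<longrightarrow> \<bar>u \<epsilon> c t - sqrt (tanh (\<epsilon> * t))\<bar> + \<bar>v \<epsilon> c t\<bar> \<le> \<eta> / 2)" for t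
       using elim(1) c sol[OF \<epsilon> c] by blast
      have 1: "\<bar>x\<bar> + \<bar>y\<bar> \<le> \<eta> / 2" if "(x, y, z) \<in> range (\<gamma> \<epsilon> c)" "z < c\<^sup>2 / 4 - d / 2" for x y z
       using that cl by (auto simp: \<gamma>_def)
      have 2: "\<bar>x - sqrt z\<bar> + \<bar>y\<bar> \<le> \<eta> / 2" if "(x, y, z) \<in> range (\<gamma> \<epsilon> c)" "c\<^sup>2 / 4 + d / 2 < z" for x y z
       using that cl by (auto simp: \<gamma>_def)
      have c1: "dist (x, y) (0, 0) \<le> \<eta> / 2" if "z < c\<^sup>2 / 4 - d / 2"
       by (rule closure_subset_close(1)[where h="c\<^sup>2 / 4 + d / 2", OF _ _ p that]) (erule (1) 1, erule (1) 2)
      have c2: "dist (x, y) (sqrt z, 0) \<le> \<eta> / 2" if "c\<^sup>2 / 4 + d / 2 < z"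
       by (rule closure_subset_close(2)[where l="c\<^sup>2 / 4 - d / 2", OF _ _ p that]) (erule (1) 1, erule (1) 2)
      have "\<eta> / 2 < \<eta>" using \<eta> by simp
      note c1 = le_less_trans[OF c1 this] and c2 = le_less_trans[OF c2 this]
      show "(z \<in> {-1..<c\<^sup>2 / 4 - d / 2} \<longrightarrow> dist (x, y) (0, 0) < \<eta>) \<and>
       (z \<in> {c\<^sup>2 / 4 + d / 2<..1} \<longrightarrow> dist (x, y) (sqrt z, 0) < \<eta>)"
       using c1 c2 by simp
     qed
    qed
   qed
  qed
  show "(\<lambda>(\<epsilon>, c). front_location c (range (\<gamma> \<epsilon> c)) - (c\<^sup>2 / 4 + \<Omega>\<^sub>0 * (1 - c ^ 4 / 16) powr (2/3) * \<epsilon> powr (2/3)))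
   \<in> O[at_right 0 \<times>\<^sub>F principal {a..b}](\<lambda>(\<epsilon>, c). \<epsilon> * ln \<epsilon>)"
  proof (rule bigoI[where c=C])
   have main: "norm (front_location c (range (\<gamma> \<epsilon> c)) - (c\<^sup>2 / 4 + \<Omega>\<^sub>0 * (1 - c ^ 4 / 16) powr (2/3) * \<epsilon> powr (2/3))) \<le> C * norm (\<epsilon> * ln \<epsilon>)"
    if h: "0 < \<epsilon>" "\<forall>c\<in>{a..b}. \<forall>u v. front_sol c \<epsilon> u v \<longrightarrow> front_scaled c \<epsilon> u v a \<kappa>0 (root 6 \<epsilon>) M" and c: "c \<in> {a..b}" for \<epsilon> c
   proof -
    interpret F: front_scaled c \<epsilon> "u \<epsilon> c" "v \<epsilon> c" a \<kappa>0 "root 6 \<epsilon>" M using h(2) c sol[OF h(1) c] by blast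
    have n: "norm (\<epsilon> * ln \<epsilon>) = \<epsilon> * (- ln \<epsilon>)" using h(1) F.ln1 by (simp add: abs_mult)
    have e: "c\<^sup>2 / 4 + \<Omega>\<^sub>0 * (1 - c ^ 4 / 16) powr (2/3) * \<epsilon> powr (2/3) = F.\<mu>c + F.\<rho>\<^sup>2 * \<Omega>\<^sub>0"
     unfolding F.\<rho>_sq F.\<mu>c_def by (simp only: mult_ac)
    show ?thesis unfolding n e unfolding real_norm_def \<gamma>_def C_def by (rule F.front_location_bounds)
   qed
   show "\<forall>\<^sub>F x in at_right 0 \<times>\<^sub>F principal {a..b}.
    norm (case x of (\<epsilon>, c) \<Rightarrow> front_location c (range (\<gamma> \<epsilon> c)) - (c\<^sup>2 / 4 + \<Omega>\<^sub>0 * (1 - c ^ 4 / 16) powr (2/3) * \<epsilon> powr (2/3)))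
     \<le> C * norm (case x of (\<epsilon>, c) \<Rightarrow> \<epsilon> * ln \<epsilon>)"
    unfolding eventually_prod_filter
   proof (intro exI conjI)
    show "\<forall>\<^sub>F \<epsilon> in at_right 0. 0 < \<epsilon> \<and> (\<forall>c\<in>{a..b}. \<forall>u v. front_sol c \<epsilon> u v \<longrightarrow> front_scaled c \<epsilon> u v a \<kappa>0 (root 6 \<epsilon>) M)"
     by (intro eventually_conj eventually_at_right_less ev)
    show "\<forall>\<^sub>F c in principal {a..b}. c \<in> {a..b}" by (simp only: eventually_principal) blast
   qed (use main in simp)
  qed
 qed
qed

end
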